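(* Let $K$ be a field of characteristic $0$, let ${\bf X}=(X,\operatorname{rk})$ be a polymatroid with $|X|=d$, and let $V$ (with $n=\dim V$) together with subspaces $V_x\subseteq V$, $x\in X$, be a realization of ${\bf X}$ over $K$. Let $W$ be a finite-dimensional $K$-vector space. Then $$\big(\sigma^{\,n-\operatorname{rk}(X)}\,\mathcal{P}[{\bf X}]\big)\star W=\sum_{A\subseteq X}(-1)^{|A|}\langle J_A(W)\rangle$$ and $$\big(\sigma^{n}\,\mathcal{H}[{\bf X}](\sigma^{-1},-1)\big)\star W=\langle J(W)\rangle .$$
   Context: A (discrete) polymatroid is a pair ${\bf X}=(X,\operatorname{rk})$ with $X$ a finite set and $\operatorname{rk}$ a function from subsets of $X$ to $\{0,1,2,\dots\}$ with $\operatorname{rk}(\emptyset)=0$, $\operatorname{rk}(A)\le\operatorname{rk}(B)$ for $A\subseteq B$, and $\operatorname{rk}(A\cup B)+\operatorname{rk}(A\cap B)\le\operatorname{rk}(A)+\operatorname{rk}(B)$. For $A\subseteq X$, ${\bf X}|_A=(A,\operatorname{rk}|_A)$. Let $\mathrm{Sym}=\mathbb{Z}[e_1,e_2,\dots]$ be the graded ring of symmetric functions with Schur basis $s_\lambda$, and $\overline{\mathrm{Sym}}=\mathbb{Z}[[e_1,e_2,\dots]]$. Put $\sigma=1+s_1+s_2+s_3+\cdots\in\overline{\mathrm{Sym}}$ (so $\sigma^{-1}=1-e_1+e_2-\cdots$). Define $\mathcal{P}[{\bf X}]\in\mathrm{Sym}$ recursively: $\mathcal{P}[{\bf X}]=1$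 if $X=\emptyset$; otherwise $\mathcal{P}[{\bf X}]$ is the sum of the homogeneous components of degrees $0,1,\dots,|X|-1$ of $-\sum_{A\subsetneq X}\mathcal{P}[{\bf X}|_A]\,\sigma^{\operatorname{rk}(X)-\operatorname{rk}(A)}(-1)^{|X|-|A|}$. Define $\mathcal{H}[{\bf X}](q,t)=\sum_{A\subseteq X}\mathcal{P}[{\bf X}|_A]q^{\operatorname{rk}(A)}t^{|A|}$; $\mathcal{H}[{\bf X}](\sigma^{-1},-1)\in\overline{\mathrm{Sym}}$ is obtained by substituting $q=\sigma^{-1}$, $t=-1$. A realization of ${\bf X}$ over $K$ is a finite-dimensional $K$-vector space $V$ with subspaces $V_x$, $x\in X$, such that $\operatorname{rk}(A)=\dim V-\dim V_A$ for all $A\subseteq X$, where $V_A=\bigcap_{x\in A}V_x$ ($V_\emptyset=V$). For a $K$-vector space $W$ with dual $W^\star$, let $R(W)=K[V\otimes W^\star]$ (polynomial functions), let $J_x(W)\subseteq R(W)$ be the vanishing ideal of $V_x\otimes W^\star$, $J_A(W)=\prod_{x\in A}J_x(W)$ (with $J_\emptyset(W)=R(W)$), and $J(W)=J_X(W)$. These are $\mathrm{GL}(W)$-modules. For a $\mathrm{GL}(W)$-module $M$ in which each irreducible rational representation occurs with finite multiplicity, $\langle M\rangle$ is the function assigning to each isomorphism class of irreducible representation its multiplicity in $M$; these functions form an abelian group. For $f=\sum_\lambda a_\lambda s_\lambda\in\overline{\mathrm{Sym}}$ define $f\star W=\sum_\lambda a_\lambda\langle S_\lambda(W)\rangle$,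 where $S_\lambda$ is the Schur functor (so $S_\lambda(W)=0$ if $\lambda$ has more than $\dim W$ parts). *)

theory Defs
  imports
    Complex_Main
    "HOL-Library.Multiset"
    "HOL-Library.FuncSet"
    "HOL-Library.Function_Algebras"
    "HOL-Combinatorics.Permutations"
begin

section \<open>Symmetric functions\<close>

text \<open>
  Formal power series over the integers in variables indexed by the natural numbers. A monomial
  is the multiset of the indices of its variables, so that its degree is the size of the multiset.
\<close>

typedef xps = "UNIV :: (nat multiset \<Rightarrow> int) set"
  morphisms xcoeff Abs_xps ..

setup_lifting type_definition_xps

lemma xps_eqI: "(\<And>M. xcoeff f M = xcoeff g M) \<Longrightarrow> f = g"
  by transfer auto

lemma finite_mset_splits: "finite {(A, B). A + B = (M :: 'a multiset)}"
proof (induction M)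
  case empty
  have "{(A, B). A + B = ({#} :: 'a multiset)} = {({#}, {#})}" by auto
  then show ?case by simp
next
  case (add x M)
  let ?S = "{(A, B). A + B = M}"
  have "{(A, B). A + B = add_mset x M}
      \<subseteq> (\<lambda>(A, B). (add_mset x A, B)) ` ?S \<union> (\<lambda>(A, B). (A, add_mset x B)) ` ?S"
  proof clarify
    fix A B
    assume eq: "A + B = add_mset x M"
      and n: "(A, B) \<notin> (\<lambda>(A, B). (A, add_mset x B)) ` ?S"
    then have "x \<in># A + B" by simp
    then consider "x \<in># A" | "x \<in># B" by auto
    then show "(A, B) \<in> (\<lambda>(A, B). (add_mset x A, B)) ` ?S"
    proof cases
      case 1
      then obtain A' where A': "A = add_mset x A'" by (metis multi_member_split)
      with eq have "A' + B = M" by simp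
      then show ?thesis using A' by (intro image_eqI[of _ _ "(A', B)"]) auto
    next
      case 2
      then obtain B' where B': "B = add_mset x B'" by (metis multi_member_split)
      with eq have "A + B' = M" by simp
      then have "(A, B) \<in> (\<lambda>(A, B). (A, add_mset x B)) ` ?S"
        using B' by (intro image_eqI[of _ _ "(A, B')"]) auto
      with n show ?thesis by contradiction
    qed
  qed
  then show ?case using add by (meson finite_UnI finite_imageI finite_subset)
qed

lemma finite_mset_splits': "finite {p. fst p + snd p = (M :: 'a multiset)}"
  using finite_mset_splits[of M] by (simp add: case_prod_unfold)

instantiation xps :: comm_ring_1
begin

lift_definition zero_xps :: xps is "\<lambda>_. 0" .
lift_definition one_xps :: xps is "\<lambda>M. if M = {#} then 1 else 0" .
lift_definition plus_xps :: "xps \<Rightarrow> xps \<Rightarrow> xps" is "\<lambda>f g M. f M + g M" .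
lift_definition minus_xps :: "xps \<Rightarrow> xps \<Rightarrow> xps" is "\<lambda>f g M. f M - g M" .
lift_definition uminus_xps :: "xps \<Rightarrow> xps" is "\<lambda>f M. - f M" .
lift_definition times_xps :: "xps \<Rightarrow> xps \<Rightarrow> xps"
  is "\<lambda>f g M. \<Sum>(A, B) \<in> {(A, B). A + B = M}. f A * g B" .

instance
proof
  fix a b c :: xps
  show "a * b * c = a * (b * c)"
  proof (rule xps_eqI)
    fix M
    let ?D = "\<lambda>M. {(A, B). A + B = (M :: nat multiset)}"
    let ?f = "xcoeff a" and ?g = "xcoeff b" and ?h = "xcoeff c"
    have "xcoeff (a * b * c) M = (\<Sum>(Q, C)\<in>?D M. \<Sum>(A, B)\<in>?D Q. ?f A * ?g B * ?h C)"
      by (simp add: times_xps.rep_eq sum_distrib_right case_prod_unfold)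
    also have "\<dots> = (\<Sum>((Q, C), (A, B))\<in>(SIGMA p:?D M. ?D (fst p)). ?f A * ?g B * ?h C)"
      by (subst sum.Sigma[symmetric])
         (auto simp: finite_mset_splits' case_prod_unfold)
    also have "\<dots> = (\<Sum>((A, Q), (B, C))\<in>(SIGMA p:?D M. ?D (snd p)). ?f A * ?g B * ?h C)"
      by (rule sum.reindex_bij_witness[of _
            "\<lambda>((A, Q), (B, C)). ((A + B, C), (A, B))"
            "\<lambda>((Q, C), (A, B)). ((A, B + C), (B, C))"])
         (auto simp: ac_simps)
    also have "\<dots> = (\<Sum>(A, Q)\<in>?D M. \<Sum>(B, C)\<in>?D Q. ?f A * ?g B * ?h C)"
      by (subst sum.Sigma[symmetric])
         (auto simp: finite_mset_splits' case_prod_unfold)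
    also have "\<dots> = xcoeff (a * (b * c)) M"
      by (simp add: times_xps.rep_eq sum_distrib_left case_prod_unfold ac_simps)
    finally show "xcoeff (a * b * c) M = xcoeff (a * (b * c)) M" .
  qed
  show "a * b = b * a"
    by (rule xps_eqI, unfold times_xps.rep_eq)
       (rule sum.reindex_bij_witness[of _ prod.swap prod.swap]; auto simp: ac_simps)
  show "1 * a = a"
  proof (rule xps_eqI)
    fix M
    have "xcoeff (1 * a) M = (\<Sum>(A, B)\<in>{({#}, M)}. xcoeff 1 A * xcoeff a B)"
      unfolding times_xps.rep_eq
      by (rule sum.mono_neutral_right)
         (auto simp: finite_mset_splits one_xps.rep_eq split: if_splits)
    then show "xcoeff (1 * a) M = xcoeff a M" by (simp add: one_xps.rep_eq)
  qed
  show "(a + b) * c = a * c + b * c"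
    by (rule xps_eqI)
       (simp add: times_xps.rep_eq plus_xps.rep_eq case_prod_unfold distrib_right sum.distrib)
  show "a + b + c = a + (b + c)" by transfer auto
  show "a + b = b + a" by transfer auto
  show "0 + a = a" by transfer auto
  show "- a + a = 0" by transfer auto
  show "a - b = a + - b" by transfer auto
  show "(0 :: xps) \<noteq> 1"
    by transfer (metis zero_neq_one)
qed

end

text \<open>
  \<open>Sym_bar\<close> is the completed ring of symmetric functions: by the fundamental theorem on symmetric
  functions the symmetric power series in the variables are exactly the power series in the
  elementary symmetric functions. \<open>Sym\<close> consists of the symmetric series of bounded degree.
\<close>

definition Sym_bar :: "xps set" where
  "Sym_bar = {f. \<forall>\<pi>. bij \<pi> \<longrightarrow> (\<forall>M. xcoeff f (image_mset \<pi> M) = xcoeff f M)}"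

definition Sym :: "xps set" where
  "Sym = {f \<in> Sym_bar. \<exists>n. \<forall>M. n < size M \<longrightarrow> xcoeff f M = 0}"

definition is_partition :: "nat list \<Rightarrow> bool" where
  "is_partition lam \<longleftrightarrow> sorted_wrt (\<ge>) lam \<and> 0 \<notin> set lam"

definition cells :: "nat list \<Rightarrow> (nat \<times> nat) set" where
  "cells lam = {(i, j). i < length lam \<and> j < lam ! i}"

definition ssyt :: "nat list \<Rightarrow> (nat \<times> nat \<Rightarrow> nat) set" where
  "ssyt lam = {T \<in> extensional (cells lam).
     (\<forall>i j j'. (i, j) \<in> cells lam \<and> (i, j') \<in> cells lam \<and> j < j' \<longrightarrow> T (i, j) \<le> T (i, j')) \<and>
     (\<forall>i i' j. (i, j) \<in> cells lam \<and> (i', j) \<in> cells lam \<and> i < i' \<longrightarrow> T (i, j) < T (i', j))}"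

text \<open>The Schur function, as the generating function of semistandard tableaux by content.\<close>

definition schur :: "nat list \<Rightarrow> xps" where
  "schur lam = Abs_xps (\<lambda>M. int (card {T \<in> ssyt lam. image_mset T (mset_set (cells lam)) = M}))"

text \<open>
  The infinite linear combination of all Schur functions with given coefficients; in each degree
  it is a finite sum.
\<close>

definition schur_sum :: "(nat list \<Rightarrow> int) \<Rightarrow> xps" where
  "schur_sum a = Abs_xps (\<lambda>M. \<Sum>lam | is_partition lam \<and> sum_list lam = size M.
     a lam * xcoeff (schur lam) M)"

definition schur_coeff :: "xps \<Rightarrow> nat list \<Rightarrow> int" where
  "schur_coeff f = (THE a. f = schur_sum a \<and> (\<forall>lam. \<not> is_partition lam \<longrightarrow> a lam = 0))"

definition sigma :: xps where
  "sigma = schur_sum (\<lambda>lam. if length lam \<le> 1 then 1 else 0)"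

definition sigma_inv :: xps where
  "sigma_inv = (THE u. sigma * u = 1)"

lemma xcoeff_sigma: "xcoeff sigma M = 1"
proof -
  define lam where "lam = (if M = {#} then [] else [size M])"
  define k where "k = size M"
  have part: "{mu. is_partition mu \<and> sum_list mu = size M \<and> length mu \<le> 1} = {lam}"
  proof -
    have "mu = lam" if "is_partition mu" "sum_list mu = size M" "length mu \<le> 1" for mu
      using that by (cases mu) (auto simp: lam_def is_partition_def)
    moreover have "is_partition lam \<and> sum_list lam = size M \<and> length lam \<le> 1"
      by (auto simp: lam_def is_partition_def)
    ultimately show ?thesis by auto
  qed
  have finpart: "finite {mu. is_partition mu \<and> sum_list mu = size M}"
  proof (rule finite_subset)
    have "length mu \<le> sum_list mu" if "0 \<notin> set mu" for mu :: "nat list"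
      using that by (induction mu) auto
    moreover have "set mu \<subseteq> {..sum_list mu}" for mu :: "nat list"
      by (auto intro: member_le_sum_list)
    ultimately show "{mu. is_partition mu \<and> sum_list mu = size M}
        \<subseteq> {mu. set mu \<subseteq> {..size M} \<and> length mu \<le> size M}"
      unfolding is_partition_def by (metis (mono_tags, lifting) Collect_mono)
    show "finite {mu. set mu \<subseteq> {..size M} \<and> length mu \<le> size M}"
      by (rule finite_lists_length_le) simp
  qed
  have cells: "cells lam = Pair 0 ` {..<k}"
    by (auto simp: cells_def lam_def k_def)
  have content: "image_mset T (mset_set (cells lam)) = mset (map (\<lambda>j. T (0, j)) [0..<k])"
    for T :: "nat \<times> nat \<Rightarrow> nat"
  proof -
    have "mset_set (cells lam) = image_mset (Pair 0) (mset_set {..<k})"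
      unfolding cells by (rule image_mset_mset_set[symmetric]) (auto simp: inj_on_def)
    then show ?thesis
      by (simp add: multiset.map_comp comp_def lessThan_atLeast0)
  qed
  let ?L = "sorted_list_of_multiset M"
  let ?T = "\<lambda>c. if c \<in> cells lam then ?L ! snd c else undefined"
  have lenL: "length ?L = k"
    unfolding k_def by (metis mset_sorted_list_of_multiset size_mset)
  have mapT: "map (\<lambda>j. ?T (0, j)) [0..<k] = ?L"
    by (rule nth_equalityI) (auto simp: lenL cells)
  have "{T \<in> ssyt lam. image_mset T (mset_set (cells lam)) = M} = {?T}"
  proof (intro equalityI subsetI)
    fix T assume "T \<in> {T \<in> ssyt lam. image_mset T (mset_set (cells lam)) = M}"
    then have T: "T \<in> ssyt lam" and c: "mset (map (\<lambda>j. T (0, j)) [0..<k]) = M"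
      by (auto simp: content)
    have "sorted (map (\<lambda>j. T (0, j)) [0..<k])"
      using T by (auto simp: ssyt_def cells sorted_wrt_iff_nth_less)
    then have eq: "map (\<lambda>j. T (0, j)) [0..<k] = ?L"
      using c by (metis sorted_list_of_multiset_mset sorted_sort_id)
    have "T c = ?T c" for c
    proof (cases "c \<in> cells lam")
      case True
      then obtain j where "c = (0, j)" "j < k" by (auto simp: cells)
      then show ?thesis using True arg_cong[OF eq, of "\<lambda>l. l ! j"] by simp
    next
      case False
      then show ?thesis using T unfolding ssyt_def extensional_def by (cases c) simp
    qed
    then show "T \<in> {?T}" by auto
  next
    fix T assume "T \<in> {?T}"
    then have T: "T = ?T" by simp
    have "?T \<in> ssyt lam"
      using sorted_sorted_list_of_multiset[of M] lenL
      by (auto simp: ssyt_def extensional_def cells sorted_iff_nth_mono)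
    moreover have "image_mset ?T (mset_set (cells lam)) = M"
      unfolding content mapT by simp
    ultimately show "T \<in> {T \<in> ssyt lam. image_mset T (mset_set (cells lam)) = M}"
      using T by simp
  qed
  then have "xcoeff (schur lam) M = 1"
    by (simp add: schur_def Abs_xps_inverse)
  moreover have "xcoeff sigma M
      = (\<Sum>mu | is_partition mu \<and> sum_list mu = size M \<and> length mu \<le> 1. xcoeff (schur mu) M)"
    using finpart
    by (auto simp: sigma_def schur_sum_def Abs_xps_inverse split: if_splits
        intro!: sum.mono_neutral_cong_right)
  ultimately show ?thesis by (simp only: part) simp
qed

lemma sigma_times_alternating_elementary:
  "sigma * Abs_xps (\<lambda>M. if \<forall>x. count M x \<le> 1 then (-1) ^ size M else 0) = 1"
    (is "sigma * ?u = 1")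
proof (rule xps_eqI)
  fix M :: "nat multiset"
  have "xcoeff (sigma * ?u) M
      = (\<Sum>(A, B)\<in>{(A, B). A + B = M}. if \<forall>x. count B x \<le> 1 then (-1) ^ size B else 0)"
    by (simp add: times_xps.rep_eq xcoeff_sigma Abs_xps_inverse case_prod_unfold)
  also have "\<dots> = (\<Sum>(A, B)\<in>{(A, B). A + B = M \<and> (\<forall>x. count B x \<le> 1)}. (-1) ^ size B)"
    by (rule sum.mono_neutral_cong_right) (auto simp: finite_mset_splits split: if_splits)
  also have "\<dots> = (\<Sum>S\<in>Pow (set_mset M). (-1) ^ card S)"
  proof (rule sum.reindex_bij_witness[of _
        "\<lambda>S. (M - mset_set S, mset_set S)" "\<lambda>(A, B). set_mset B"])
    fix p assume "p \<in> {(A, B). A + B = M \<and> (\<forall>x. count B x \<le> 1)}"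
    then obtain A B where p: "p = (A, B)" "A + B = M" "\<forall>x. count B x \<le> 1" by auto
    have B: "mset_set (set_mset B) = B"
    proof (rule multiset_eqI)
      fix x show "count (mset_set (set_mset B)) x = count B x"
        using p(3)[rule_format, of x] count_greater_zero_iff[of B x]
        by (cases "x \<in># B") (simp_all add: count_mset_set' not_in_iff del: count_greater_zero_iff)
    qed
    then show "(\<lambda>S. (M - mset_set S, mset_set S)) ((\<lambda>(A, B). set_mset B) p) = p"
      using p by auto
    show "(\<lambda>(A, B). set_mset B) p \<in> Pow (set_mset M)" using p by auto
    show "(-1) ^ card ((\<lambda>(A, B). set_mset B) p) = (case p of (A, B) \<Rightarrow> (-1 :: int) ^ size B)"
      using p(1) arg_cong[OF B, of size] by simp
  next
    fix S assume "S \<in> Pow (set_mset M)"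
    then have S: "S \<subseteq> set_mset M" "finite S" by (auto intro: finite_subset)
    then show "(\<lambda>(A, B). set_mset B) ((\<lambda>S. (M - mset_set S, mset_set S)) S) = S" by simp
    have "mset_set S \<subseteq># M"
      using S by (auto simp: subseteq_mset_def count_mset_set' Suc_le_eq)
    then show "(\<lambda>S. (M - mset_set S, mset_set S)) S \<in> {(A, B). A + B = M \<and> (\<forall>x. count B x \<le> 1)}"
      by (auto simp: count_mset_set')
  qed
  also have "\<dots> = (if M = {#} then 1 else 0)"
    using prod_add[of "set_mset M" "\<lambda>_. -1 :: int" "\<lambda>_. 1"] by (cases "M = {#}") (simp_all add: zero_power card_gt_0_iff)
  finally show "xcoeff (sigma * ?u) M = xcoeff 1 M"
    by (simp add: one_xps.rep_eq)
qed

lemma sigma_sigma_inv: "sigma * sigma_inv = 1"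
proof -
  obtain v where v: "sigma * v = 1"
    using sigma_times_alternating_elementary by blast
  show ?thesis
    unfolding sigma_inv_def
  proof (rule theI)
    show "sigma * v = 1" by (fact v)
    fix u assume "sigma * u = 1"
    then have "v * (sigma * u) = v" by simp
    moreover have "v * (sigma * u) = sigma * v * u" by (simp only: ac_simps)
    ultimately show "u = v" using v by simp
  qed
qed

text \<open>The sum of the homogeneous components of degree less than \<open>n\<close>.\<close>

definition trunc :: "nat \<Rightarrow> xps \<Rightarrow> xps" where
  "trunc n f = Abs_xps (\<lambda>M. if size M < n then xcoeff f M else 0)"


section \<open>Polymatroids and their symmetric functions\<close>

definition polymatroid :: "'x set \<Rightarrow> ('x set \<Rightarrow> nat) \<Rightarrow> bool" where
  "polymatroid X rk \<longleftrightarrow> finite X \<and> rk {} = 0 \<and>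
     (\<forall>A B. A \<subseteq> B \<and> B \<subseteq> X \<longrightarrow> rk A \<le> rk B) \<and>
     (\<forall>A B. A \<subseteq> X \<and> B \<subseteq> X \<longrightarrow> rk (A \<union> B) + rk (A \<inter> B) \<le> rk A + rk B)"

text \<open>
  The restriction of \<open>(X, rk)\<close> to \<open>A\<close> is \<open>(A, rk)\<close>: only the values of \<open>rk\<close> on subsets of the
  ground set matter. Infinite ground sets are not polymatroids and get a dummy value.
\<close>

function polyP :: "'x set \<Rightarrow> ('x set \<Rightarrow> nat) \<Rightarrow> xps" where
  "polyP X rk = (if finite X \<and> X \<noteq> {}
     then trunc (card X)
       (- (\<Sum>A | A \<subset> X. polyP A rk * sigma ^ (rk X - rk A) * (-1) ^ (card X - card A)))
     else 1)"
  by auto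
termination
  by (relation "measure (\<lambda>(X, rk). card X)") (auto intro: psubset_card_mono)

declare polyP.simps [simp del]

lemma Sym_bar_minus: "f \<in> Sym_bar \<Longrightarrow> - f \<in> Sym_bar"
  by (auto simp: Sym_bar_def uminus_xps.rep_eq)

lemma Sym_bar_one: "1 \<in> Sym_bar"
  by (auto simp: Sym_bar_def one_xps.rep_eq)

lemma Sym_bar_sum: "(\<And>i. i \<in> I \<Longrightarrow> f i \<in> Sym_bar) \<Longrightarrow> sum f I \<in> Sym_bar"
  by (induction I rule: infinite_finite_induct)
     (auto simp: Sym_bar_def zero_xps.rep_eq plus_xps.rep_eq)

lemma Sym_bar_mult:
  assumes "f \<in> Sym_bar" "g \<in> Sym_bar"
  shows "f * g \<in> Sym_bar"
  unfolding Sym_bar_def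
proof (clarify)
  fix \<pi> :: "nat \<Rightarrow> nat" and M
  assume \<pi>: "bij \<pi>"
  then have [simp]: "image_mset (inv \<pi>) (image_mset \<pi> A) = A"
      "image_mset \<pi> (image_mset (inv \<pi>) A) = A" for A
    by (simp_all add: multiset.map_comp comp_def bij_is_inj bij_is_surj surj_f_inv_f)
  have "(\<Sum>(A, B)\<in>{(A, B). A + B = image_mset \<pi> M}. xcoeff f A * xcoeff g B)
      = (\<Sum>(A, B)\<in>{(A, B). A + B = M}. xcoeff f A * xcoeff g B)"
  proof (rule sum.reindex_bij_witness[of _
        "\<lambda>(A, B). (image_mset \<pi> A, image_mset \<pi> B)"
        "\<lambda>(A, B). (image_mset (inv \<pi>) A, image_mset (inv \<pi>) B)"])
    fix p assume "p \<in> {(A, B). A + B = image_mset \<pi> M}"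
    then obtain A B where p: "p = (A, B)" "A + B = image_mset \<pi> M" by auto
    have "image_mset (inv \<pi>) (A + B) = M" unfolding p(2) by simp
    then show "(\<lambda>(A, B). (image_mset (inv \<pi>) A, image_mset (inv \<pi>) B)) p \<in> {(A, B). A + B = M}"
      unfolding p(1) by simp
    show "(case (\<lambda>(A, B). (image_mset (inv \<pi>) A, image_mset (inv \<pi>) B)) p of
        (A, B) \<Rightarrow> xcoeff f A * xcoeff g B) = (case p of (A, B) \<Rightarrow> xcoeff f A * xcoeff g B)"
      using p assms bij_imp_bij_inv[OF \<pi>] by (simp add: Sym_bar_def)
  qed auto
  then show "xcoeff (f * g) (image_mset \<pi> M) = xcoeff (f * g) M"
    by (simp add: times_xps.rep_eq)
qed

lemma Sym_bar_power: "f \<in> Sym_bar \<Longrightarrow> f ^ n \<in> Sym_bar"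
  by (induction n) (auto simp: Sym_bar_one Sym_bar_mult)

lemma polyP_in_Sym: "polyP X rk \<in> Sym"
proof (induction X rk rule: polyP.induct)
  case (1 X rk)
  show ?case
  proof (cases "finite X \<and> X \<noteq> {}")
    case True
    let ?f = "- (\<Sum>A | A \<subset> X. polyP A rk * sigma ^ (rk X - rk A) * (-1) ^ (card X - card A))"
    have "sigma \<in> Sym_bar" by (simp add: Sym_bar_def xcoeff_sigma)
    moreover have "polyP A rk \<in> Sym_bar" if "A \<subset> X" for A
      using 1 True that by (auto simp: Sym_def)
    ultimately have "?f \<in> Sym_bar"
      by (intro Sym_bar_minus Sym_bar_sum Sym_bar_mult Sym_bar_power Sym_bar_one) auto
    then have "trunc (card X) ?f \<in> Sym"
      by (auto simp: Sym_def Sym_bar_def trunc_def Abs_xps_inverse intro!: exI[of _ "card X"])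
    then show ?thesis using True by (simp add: polyP.simps[of X])
  next
    case False
    then show ?thesis
      by (auto simp: polyP.simps[of X] Sym_def Sym_bar_one one_xps.rep_eq)
  qed
qed

definition polyH :: "'x set \<Rightarrow> ('x set \<Rightarrow> nat) \<Rightarrow> xps \<Rightarrow> xps \<Rightarrow> xps" where
  "polyH X rk q t = (\<Sum>A\<in>Pow X. polyP A rk * q ^ rk A * t ^ card A)"

definition realization ::
    "('k::field \<Rightarrow> 'v::ab_group_add \<Rightarrow> 'v) \<Rightarrow> ('x \<Rightarrow> 'v set) \<Rightarrow> 'x set \<Rightarrow> ('x set \<Rightarrow> nat) \<Rightarrow> bool"
  where
  "realization sV V X rk \<longleftrightarrow> (\<forall>x\<in>X. module.subspace sV (V x)) \<and>
     (\<forall>A\<subseteq>X. int (rk A) = int (vector_space.dim sV UNIV) - int (vector_space.dim sV (\<Inter>x\<in>A. V x)))"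


section \<open>Representations of the general linear group\<close>

definition dual_space :: "('k::field \<Rightarrow> 'v::ab_group_add \<Rightarrow> 'v) \<Rightarrow> ('v \<Rightarrow> 'k) set" where
  "dual_space s = {\<xi>. Vector_Spaces.linear s (*) \<xi>}"

definition GL :: "('k::field \<Rightarrow> 'w::ab_group_add \<Rightarrow> 'w) \<Rightarrow> ('w \<Rightarrow> 'w) set" where
  "GL sW = {g. Vector_Spaces.linear sW sW g \<and> bij g}"

text \<open>
  Regular functions on \<open>GL sW\<close> (values off \<open>GL sW\<close> are irrelevant): the algebra generated by the
  matrix entries of \<open>g\<close> and of its inverse, which contains the inverse of the determinant.
\<close>

inductive_set regular_fun ::
    "('k::field \<Rightarrow> 'w::ab_group_add \<Rightarrow> 'w) \<Rightarrow> (('w \<Rightarrow> 'w) \<Rightarrow> 'k) set" for sW where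
  const: "(\<lambda>g. c) \<in> regular_fun sW"
| entry: "\<eta> \<in> dual_space sW \<Longrightarrow> (\<lambda>g. \<eta> (g w)) \<in> regular_fun sW"
| inv_entry: "\<eta> \<in> dual_space sW \<Longrightarrow> (\<lambda>g. \<eta> (inv g w)) \<in> regular_fun sW"
| add: "r \<in> regular_fun sW \<Longrightarrow> r' \<in> regular_fun sW \<Longrightarrow> r + r' \<in> regular_fun sW"
| mult: "r \<in> regular_fun sW \<Longrightarrow> r' \<in> regular_fun sW \<Longrightarrow> r * r' \<in> regular_fun sW"

record ('k, 'w, 'm) glmod =
  gl_space :: "'m set"
  gl_scale :: "'k \<Rightarrow> 'm \<Rightarrow> 'm"
  gl_act :: "('w \<Rightarrow> 'w) \<Rightarrow> 'm \<Rightarrow> 'm"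

definition gl_module ::
    "('k::field \<Rightarrow> 'w::ab_group_add \<Rightarrow> 'w) \<Rightarrow> ('k, 'w, 'm::ab_group_add) glmod \<Rightarrow> bool" where
  "gl_module sW M \<longleftrightarrow> vector_space (gl_scale M) \<and> module.subspace (gl_scale M) (gl_space M) \<and>
     (\<forall>g\<in>GL sW. \<forall>u\<in>gl_space M. gl_act M g u \<in> gl_space M) \<and>
     (\<forall>g\<in>GL sW. \<forall>u\<in>gl_space M. \<forall>v\<in>gl_space M. gl_act M g (u + v) = gl_act M g u + gl_act M g v) \<and>
     (\<forall>g\<in>GL sW. \<forall>c. \<forall>u\<in>gl_space M. gl_act M g (gl_scale M c u) = gl_scale M c (gl_act M g u)) \<and>
     (\<forall>u\<in>gl_space M. gl_act M id u = u) \<and>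
     (\<forall>g\<in>GL sW. \<forall>h\<in>GL sW. \<forall>u\<in>gl_space M. gl_act M (g \<circ> h) u = gl_act M g (gl_act M h u))"

definition gl_submodule ::
    "('k::field \<Rightarrow> 'w::ab_group_add \<Rightarrow> 'w) \<Rightarrow> ('k, 'w, 'm::ab_group_add) glmod \<Rightarrow> 'm set \<Rightarrow> bool"
  where
  "gl_submodule sW M N \<longleftrightarrow> N \<subseteq> gl_space M \<and> module.subspace (gl_scale M) N \<and>
     (\<forall>g\<in>GL sW. \<forall>u\<in>N. gl_act M g u \<in> N)"

definition irreducible_module ::
    "('k::field \<Rightarrow> 'w::ab_group_add \<Rightarrow> 'w) \<Rightarrow> ('k, 'w, 'm::ab_group_add) glmod \<Rightarrow> bool" where
  "irreducible_module sW M \<longleftrightarrow> gl_module sW M \<and> gl_space M \<noteq> {0} \<and>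
     (\<forall>N. gl_submodule sW M N \<longrightarrow> N = {0} \<or> N = gl_space M)"

definition rational_module ::
    "('k::field \<Rightarrow> 'w::ab_group_add \<Rightarrow> 'w) \<Rightarrow> ('k, 'w, 'm::ab_group_add) glmod \<Rightarrow> bool" where
  "rational_module sW M \<longleftrightarrow> gl_module sW M \<and>
     (\<exists>B. finite B \<and> gl_space M = module.span (gl_scale M) B) \<and>
     (\<forall>\<xi>\<in>dual_space (gl_scale M). \<forall>u\<in>gl_space M. \<exists>r\<in>regular_fun sW. \<forall>g\<in>GL sW. \<xi> (gl_act M g u) = r g)"

definition isomorphic_modules ::
    "('k::field \<Rightarrow> 'w::ab_group_add \<Rightarrow> 'w) \<Rightarrow> ('k, 'w, 'm::ab_group_add) glmod
      \<Rightarrow> ('k, 'w, 'u::ab_group_add) glmod \<Rightarrow> bool" where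
  "isomorphic_modules sW M U \<longleftrightarrow> (\<exists>h. bij_betw h (gl_space M) (gl_space U) \<and>
     (\<forall>u\<in>gl_space M. \<forall>v\<in>gl_space M. h (u + v) = h u + h v) \<and>
     (\<forall>c. \<forall>u\<in>gl_space M. h (gl_scale M c u) = gl_scale U c (h u)) \<and>
     (\<forall>g\<in>GL sW. \<forall>u\<in>gl_space M. h (gl_act M g u) = gl_act U g (h u)))"

text \<open>\<open>M\<close> is the internal direct sum of the set \<open>D\<close> of irreducible submodules.\<close>

definition irreducible_decomposition ::
    "('k::field \<Rightarrow> 'w::ab_group_add \<Rightarrow> 'w) \<Rightarrow> ('k, 'w, 'm::ab_group_add) glmod
      \<Rightarrow> 'm set set \<Rightarrow> bool" where
  "irreducible_decomposition sW M D \<longleftrightarrow>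
     (\<forall>N\<in>D. gl_submodule sW M N \<and> irreducible_module sW (M\<lparr>gl_space := N\<rparr>)) \<and>
     gl_space M = module.span (gl_scale M) (\<Union>D) \<and>
     (\<forall>N\<in>D. N \<inter> module.span (gl_scale M) (\<Union>(D - {N})) = {0})"

text \<open>The (finite) number of summands isomorphic to \<open>U\<close> in a decomposition into irreducibles.\<close>

definition gl_mult ::
    "('k::field \<Rightarrow> 'w::ab_group_add \<Rightarrow> 'w) \<Rightarrow> ('k, 'w, 'm::ab_group_add) glmod
      \<Rightarrow> ('k, 'w, 'u::ab_group_add) glmod \<Rightarrow> nat" where
  "gl_mult sW M U = (THE m. \<exists>D. irreducible_decomposition sW M D \<and>
     finite {N \<in> D. isomorphic_modules sW (M\<lparr>gl_space := N\<rparr>) U} \<and>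
     m = card {N \<in> D. isomorphic_modules sW (M\<lparr>gl_space := N\<rparr>) U})"


section \<open>Schur functors\<close>

definition fscale :: "'k::field \<Rightarrow> ('a \<Rightarrow> 'k) \<Rightarrow> 'a \<Rightarrow> 'k" where
  "fscale c f = (\<lambda>a. c * f a)"

text \<open>
  The tensor power of \<open>W\<close> indexed by a finite set \<open>I\<close>, inside the multilinear forms on \<open>I\<close>-indexed
  families of linear forms on \<open>W\<close>: the pure tensor of \<open>(w c)\<close> sends \<open>(\<xi> c)\<close> to the product of all
  \<open>\<xi> c (w c)\<close>.
\<close>

definition pure_tensor ::
    "('k::field \<Rightarrow> 'w::ab_group_add \<Rightarrow> 'w) \<Rightarrow> 'i set \<Rightarrow> ('i \<Rightarrow> 'w) \<Rightarrow> ('i \<Rightarrow> 'w \<Rightarrow> 'k) \<Rightarrow> 'k" where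
  "pure_tensor sW I w = (\<lambda>\<xi>. if \<forall>c\<in>I. \<xi> c \<in> dual_space sW then \<Prod>c\<in>I. \<xi> c (w c) else 0)"

definition tensor_power ::
    "('k::field \<Rightarrow> 'w::ab_group_add \<Rightarrow> 'w) \<Rightarrow> 'i set \<Rightarrow> (('i \<Rightarrow> 'w \<Rightarrow> 'k) \<Rightarrow> 'k) set" where
  "tensor_power sW I = module.span fscale (range (pure_tensor sW I))"

definition row_group :: "nat list \<Rightarrow> (nat \<times> nat \<Rightarrow> nat \<times> nat) set" where
  "row_group lam = {p. p permutes cells lam \<and> (\<forall>c. fst (p c) = fst c)}"

definition column_group :: "nat list \<Rightarrow> (nat \<times> nat \<Rightarrow> nat \<times> nat) set" where
  "column_group lam = {q. q permutes cells lam \<and> (\<forall>c. snd (q c) = snd c)}"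

text \<open>
  A permutation \<open>p\<close> of the cells acts on tensors from the left by \<open>t \<mapsto> (\<lambda>\<xi>. t (\<xi> \<circ> p))\<close>, which
  moves the vector in position \<open>c\<close> to position \<open>p c\<close>.
\<close>

definition young_symmetrizer ::
    "nat list \<Rightarrow> ((nat \<times> nat \<Rightarrow> 'w \<Rightarrow> 'k::field) \<Rightarrow> 'k) \<Rightarrow> (nat \<times> nat \<Rightarrow> 'w \<Rightarrow> 'k) \<Rightarrow> 'k" where
  "young_symmetrizer lam t = (\<lambda>\<xi>. \<Sum>p\<in>row_group lam. \<Sum>q\<in>column_group lam.
     of_int (sign q) * t (\<xi> \<circ> p \<circ> q))"

definition schur_functor ::
    "('k::field \<Rightarrow> 'w::ab_group_add \<Rightarrow> 'w) \<Rightarrow> nat list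
      \<Rightarrow> ('k, 'w, (nat \<times> nat \<Rightarrow> 'w \<Rightarrow> 'k) \<Rightarrow> 'k) glmod" where
  "schur_functor sW lam =
     \<lparr>gl_space = young_symmetrizer lam ` tensor_power sW (cells lam),
      gl_scale = fscale,
      gl_act = (\<lambda>g t \<xi>. t (\<lambda>c. \<xi> c \<circ> g))\<rparr>"

text \<open>
  The value of \<open>f \<star> W\<close> at the irreducible representation \<open>U\<close>. Only finitely many \<open>S\<^sub>\<lambda>(W)\<close>
  contain \<open>U\<close>.
\<close>

definition sym_star ::
    "('k::field \<Rightarrow> 'w::ab_group_add \<Rightarrow> 'w) \<Rightarrow> xps \<Rightarrow> ('k, 'w, 'u::ab_group_add) glmod \<Rightarrow> int" where
  "sym_star sW f U = (\<Sum>lam | is_partition lam \<and> gl_mult sW (schur_functor sW lam) U \<noteq> 0.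
     schur_coeff f lam * int (gl_mult sW (schur_functor sW lam) U))"


section \<open>Products of ideals of subspaces\<close>

text \<open>
  The tensor product of a subspace \<open>S\<close> of \<open>V\<close> with the dual of \<open>W\<close>, inside \<open>Hom(W, V)\<close>:
  \<open>v \<otimes> \<eta>\<close> is the linear map sending \<open>w\<close> to \<open>\<eta> w\<close> times \<open>v\<close>.
\<close>

definition tensor_dual ::
    "('k::field \<Rightarrow> 'v::ab_group_add \<Rightarrow> 'v) \<Rightarrow> ('k \<Rightarrow> 'w::ab_group_add \<Rightarrow> 'w) \<Rightarrow> 'v set
      \<Rightarrow> ('w \<Rightarrow> 'v) set" where
  "tensor_dual sV sW S = module.span (\<lambda>c \<phi> w. sV c (\<phi> w))
     {(\<lambda>w. sV (\<eta> w) v) | v \<eta>. v \<in> S \<and> \<eta> \<in> dual_space sW}"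

text \<open>
  Polynomial functions on the tensor product of \<open>V\<close> with the dual of \<open>W\<close>, extended by zero to the
  whole type. The linear forms on this space are spanned by the functions \<open>\<phi> \<mapsto> \<xi> (\<phi> w)\<close>.
\<close>

inductive_set poly_fun ::
    "('k::field \<Rightarrow> 'v::ab_group_add \<Rightarrow> 'v) \<Rightarrow> ('k \<Rightarrow> 'w::ab_group_add \<Rightarrow> 'w)
      \<Rightarrow> (('w \<Rightarrow> 'v) \<Rightarrow> 'k) set" for sV sW where
  const: "(\<lambda>\<phi>. if \<phi> \<in> tensor_dual sV sW UNIV then c else 0) \<in> poly_fun sV sW"
| coord: "\<xi> \<in> dual_space sV \<Longrightarrow>
    (\<lambda>\<phi>. if \<phi> \<in> tensor_dual sV sW UNIV then \<xi> (\<phi> w) else 0) \<in> poly_fun sV sW"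
| add: "f \<in> poly_fun sV sW \<Longrightarrow> f' \<in> poly_fun sV sW \<Longrightarrow> f + f' \<in> poly_fun sV sW"
| mult: "f \<in> poly_fun sV sW \<Longrightarrow> f' \<in> poly_fun sV sW \<Longrightarrow> f * f' \<in> poly_fun sV sW"

definition vanishing_ideal ::
    "('k::field \<Rightarrow> 'v::ab_group_add \<Rightarrow> 'v) \<Rightarrow> ('k \<Rightarrow> 'w::ab_group_add \<Rightarrow> 'w) \<Rightarrow> 'v set
      \<Rightarrow> (('w \<Rightarrow> 'v) \<Rightarrow> 'k) set" where
  "vanishing_ideal sV sW S = {f \<in> poly_fun sV sW. \<forall>\<phi>\<in>tensor_dual sV sW S. f \<phi> = 0}"

text \<open>
  The product of the vanishing ideals, i.e. the ideal generated by the products of their elements.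
  The factor \<open>r\<close> makes the empty product the whole ring.
\<close>

definition prod_ideal ::
    "('k::field \<Rightarrow> 'v::ab_group_add \<Rightarrow> 'v) \<Rightarrow> ('k \<Rightarrow> 'w::ab_group_add \<Rightarrow> 'w) \<Rightarrow> ('x \<Rightarrow> 'v set)
      \<Rightarrow> 'x set \<Rightarrow> (('w \<Rightarrow> 'v) \<Rightarrow> 'k) set" where
  "prod_ideal sV sW V A = module.span fscale
     {r * (\<Prod>x\<in>A. f x) | r f. r \<in> poly_fun sV sW \<and> (\<forall>x\<in>A. f x \<in> vanishing_ideal sV sW (V x))}"

text \<open>
  An element \<open>g\<close> of \<open>GL(W)\<close> acts on \<open>v \<otimes> \<eta>\<close> by composing \<open>\<eta>\<close> with the inverse of \<open>g\<close>, hence on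
  functions by \<open>f \<mapsto> (\<lambda>\<phi>. f (\<phi> \<circ> g))\<close>.
\<close>

definition J_module ::
    "('k::field \<Rightarrow> 'v::ab_group_add \<Rightarrow> 'v) \<Rightarrow> ('k \<Rightarrow> 'w::ab_group_add \<Rightarrow> 'w) \<Rightarrow> ('x \<Rightarrow> 'v set)
      \<Rightarrow> 'x set \<Rightarrow> ('k, 'w, ('w \<Rightarrow> 'v) \<Rightarrow> 'k) glmod" where
  "J_module sV sW V A =
     \<lparr>gl_space = prod_ideal sV sW V A, gl_scale = fscale, gl_act = (\<lambda>g f \<phi>. f (\<phi> \<circ> g))\<rparr>"

end

theory Submission
  imports Defs "HOL-Computational_Algebra.Polynomial" "HOL-Computational_Algebra.Primes" "HOL-Library.Infinite_Set"
begin

text \<open>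
  A polynomial representation of \<open>GL(W)\<close> is determined by its weight multiplicities, and the Schur functor
  of \<open>\<lambda>\<close> has the Schur polynomial of \<open>\<lambda>\<close> as its character. So everything reduces to the characters of the
  ideals \<open>J_A(W)\<close>. Write \<open>V_B\<close> for the intersection of the subspaces indexed by \<open>B\<close>. Coordinate functions
  along \<open>V_B\<close> are nonzerodivisors for all \<open>J_A\<close>, \<open>A \<subseteq> B\<close>, and cutting down by all of them divides the
  characters by \<open>\<sigma>\<close> to the power \<open>dim V_B\<close> and leads to an arrangement with zero intersection. There the
  complex formed by the \<open>J_A\<close> is exact in degrees at least \<open>|B|\<close>: modulo a generic linear form this holds
  by induction on the dimension, and such a form is a sum of linear forms from the single ideals, which
  yields a contracting homotopy. Hence the alternating sum of the \<open>J_A\<close>, \<open>A \<subseteq> B\<close>, becomes after division by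
  that power of \<open>\<sigma>\<close> a polynomial of degree less than \<open>|B|\<close>, and this is the recursion defining \<open>P\<close>.
\<close>

section \<open>Linear algebra in function spaces\<close>

text \<open>Multiplicities are read from an arbitrary decomposition into simple modules, so complete
  reducibility has to be established before characters can be used. Averaging over the infinite
  group GL(W) is impossible. Instead the symmetric group is averaged over, and its simple submodules
  of a tensor power are transferred to GL(W): every operator on a tensor power that commutes with
  the permutations preserves each GL(W)-stable subspace. The field need not be algebraically closed,
  so simple modules are told apart by highest weights alone, and these also make their characters
  independent. Quotients are avoided. All modules are spaces of scalar functions, and dividing by
  linear forms becomes restriction to the subspace where the forms vanish. A space W of dimension m
  sees only m variables, so series are compared after setting the others to 0. There \<sigma> is
  inverse to the product of the m factors 1 - x_j. One coordinate of V gives m coordinates on the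
  tensor product, one for each basis vector of W, and these account for the m factors.\<close>

lemma sum_fun_apply: "(\<Sum>i\<in>A. f i) x = (\<Sum>i\<in>A. f i x)"
 by (induction A rule: infinite_finite_induct) auto

interpretation fs: vector_space "fscale :: 'k::field => ('a => 'k) => 'a => 'k"
 by unfold_locales (auto simp: fscale_def algebra_simps fun_eq_iff)

interpretation fsp: vector_space_pair "fscale :: 'k::field => ('a => 'k) => 'a => 'k"
 "fscale :: 'k::field => ('b => 'k) => 'b => 'k" ..

abbreviation flinear :: "(('a => 'k::field) => 'b => 'k) => bool" where
 "flinear \<equiv> Vector_Spaces.linear fscale fscale"

lemma flinearI:
 "(!!u v. f (u + v) = f u + f v) ==> (!!c u. f (fscale c u) = fscale c (f u)) ==> flinear f"
 by (simp add: Vector_Spaces.linear_iff fs.vector_space_axioms)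

lemma fscale_apply: "fscale c f x = c * f x"
 by (simp add: fscale_def)

lemmas fs_simps = fun_eq_iff fscale_apply sum_fun_apply

text \<open>\<open>fs.dim\<close> does not tell an infinite-dimensional space from 0, and the
  ambient function spaces are in general infinite-dimensional. Finite dimension is therefore carried
  as a separate hypothesis.\<close>

definition findim :: "('a => 'k::field) set => bool" where
 "findim S \<longleftrightarrow> (\<exists>B. finite B & S \<subseteq> fs.span B)"

lemma findim_mono: "findim T ==> S \<subseteq> T ==> findim S"
 unfolding findim_def by blast

lemma findim_span: "finite B ==> findim (fs.span B)"
 unfolding findim_def by blast

lemma findim_basis:
 assumes "fs.subspace S" "findim S"
 obtains B where "finite B" "B \<subseteq> S" "fs.independent B" "fs.span B = S" "card B = fs.dim S"
proof -
 obtain C where C: "finite C" "S \<subseteq> fs.span C" using assms findim_def by blast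
 obtain B where B: "B \<subseteq> S" "fs.independent B" "S \<subseteq> fs.span B" "card B = fs.dim S"
  using fs.basis_exists by blast
 have "finite B" using fs.independent_span_bound[OF C(1) B(2)] B C by auto
 moreover have "fs.span B = S" using B assms fs.span_minimal by blast
 ultimately show ?thesis using that B by blast
qed

lemma findim_image:
 assumes "flinear f" "findim S" shows "findim (f ` S)"
proof -
 obtain B where B: "finite B" "S \<subseteq> fs.span B" using assms findim_def by blast
 have "f ` S \<subseteq> fs.span (f ` B)" using B fsp.linear_span_image[OF assms(1), of B] by auto
 then show ?thesis using B findim_def by blast
qed

lemma fs_dim_mono:
 assumes "S \<subseteq> T" "findim T" shows "fs.dim S \<le> fs.dim T"
proof -
 have "findim (fs.span T)" using assms unfolding findim_def
  by (metis fs.span_minimal fs.subspace_span)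
 then obtain B where B: "finite B" "fs.span B = fs.span T" "card B = fs.dim (fs.span T)"
  using findim_basis fs.subspace_span by metis
 have "fs.dim S \<le> card B" using B assms fs.dim_le_card[of S B] fs.span_superset by blast
 then show ?thesis using B by simp
qed

lemma span_disjoint_Int:
 assumes B: "fs.independent B" "finite B" "B0 \<subseteq> B" and x: "x \<in> fs.span B0" "x \<in> fs.span (B - B0)"
 shows "x = 0"
proof -
 have fin: "finite B0" "finite (B - B0)" using B finite_subset by auto
 obtain u where u: "x = (\<Sum>v\<in>B0. fscale (u v) v)" using x fs.span_finite[OF fin(1)] by auto
 obtain w where w: "x = (\<Sum>v\<in>B-B0. fscale (w v) v)" using x fs.span_finite[OF fin(2)] by auto
 have "(\<Sum>v\<in>B. fscale (if v \<in> B0 then u v else - w v) v)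
   = (\<Sum>v\<in>B0. fscale (if v \<in> B0 then u v else - w v) v) + (\<Sum>v\<in>B-B0. fscale (if v \<in> B0 then u v else - w v) v)"
  by (rule trans[OF sum.subset_diff[OF B(3,2)] add.commute])
 also have "... = (\<Sum>v\<in>B0. fscale (u v) v) + (\<Sum>v\<in>B-B0. fscale (- w v) v)"
  by (intro arg_cong2[where f="(+)"] sum.cong) auto
 also have "... = 0" using u w by (simp add: fs.scale_minus_left sum_negf)
 finally have z: "(\<Sum>v\<in>B. fscale (if v \<in> B0 then u v else - w v) v) = 0" .
 have uw: "\<forall>v\<in>B. (if v \<in> B0 then u v else - w v) = 0"
  by (intro ballI fs.independentD[where u="%v. if v \<in> B0 then u v else - w v", OF B(1,2) subset_refl z])
 have "u v = 0" if "v \<in> B0" for v using bspec[OF uw, of v] B(3) that by auto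
 then show ?thesis using u by simp
qed

lemma rank_nullity:
 assumes f: "flinear f" and S: "fs.subspace S" "findim S"
 shows "fs.dim S = fs.dim {s\<in>S. f s = 0} + fs.dim (f ` S)"
proof -
 let ?K = "{s\<in>S. f s = 0}"
 have K: "fs.subspace ?K"
  using S(1) unfolding fs.subspace_def
  by (auto simp: fsp.linear_0[OF f] fsp.linear_add[OF f] fsp.linear_scale[OF f] fs.scale_zero_right)
 have finK: "findim ?K" using S(2) by (rule findim_mono) auto
 obtain B0 where B0: "finite B0" "B0 \<subseteq> ?K" "fs.independent B0" "fs.span B0 = ?K" "card B0 = fs.dim ?K"
  by (rule findim_basis[OF K finK])
 obtain B where B: "B0 \<subseteq> B" "B \<subseteq> S" "fs.independent B" "S \<subseteq> fs.span B"
  using fs.maximal_independent_subset_extend[of B0 S] B0 by auto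
 have finB: "finite B" using S(2) fs.independent_span_bound[OF _ B(3)] B(2) unfolding findim_def by blast
 let ?C = "B - B0"
 have inj: "inj_on f (fs.span ?C)"
 proof (rule inj_onI)
  fix x y assume xy: "x \<in> fs.span ?C" "y \<in> fs.span ?C" "f x = f y"
  have "x - y \<in> fs.span ?C" using xy fs.span_diff by blast
  moreover have "x - y \<in> ?K"
  proof -
   have "fs.span ?C \<subseteq> S" using B S(1) fs.span_minimal by blast
   then show ?thesis using xy S(1) by (auto simp: fsp.linear_diff[OF f] intro!: fs.subspace_diff)
  qed
  ultimately have "x - y = 0" using span_disjoint_Int[OF B(3) finB B(1)] B0(4) by blast
  then show "x = y" by simp
 qed
 have ind: "fs.independent (f ` ?C)"
  using fsp.linear_independent_injective_image[OF f] fs.independent_mono[OF B(3)] inj by blast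
 have "f ` S \<subseteq> fs.span (f ` ?C)"
 proof clarify
  fix s assume "s \<in> S"
  then have "s \<in> fs.span (B0 Un ?C)" using B by (metis Un_Diff_cancel Un_absorb1 subsetD)
  then obtain a c where s: "s = a + c" "a \<in> fs.span B0" "c \<in> fs.span ?C"
   unfolding fs.span_Un by auto
  then have "f s = f c" using B0(4) by (auto simp: fsp.linear_add[OF f])
  then show "f s \<in> fs.span (f ` ?C)" using s fsp.linear_span_image[OF f] by auto
 qed
 then have "card (f ` ?C) = fs.dim (f ` S)"
  using ind B(2) fs.basis_card_eq_dim[of "f ` ?C" "f ` S"] by blast
 moreover have "card (f ` ?C) = card ?C"
  using inj card_image inj_on_subset fs.span_superset by metis
 moreover have "card B = fs.dim S" using fs.basis_card_eq_dim B by blast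
 moreover have "card B = card B0 + card ?C" using finB B(1)
  by (metis card_Diff_subset card_mono le_add_diff_inverse B0(1))
 ultimately show ?thesis using B0(5) by simp
qed

text \<open>Module isomorphisms and similar maps below are linear only on a submodule. A basis of it
  carries them to maps that are linear everywhere, to which rank-nullity and the rules for images of
  spans apply.\<close>

lemma partial_linear_extend:
 fixes f :: "('a => 'k::field) => 'b => 'k"
 assumes S: "fs.subspace S" and add: "!!u v. u \<in> S ==> v \<in> S ==> f (u + v) = f u + f v"
  and scale: "!!c u. u \<in> S ==> f (fscale c u) = fscale c (f u)"
 obtains f' where "flinear f'" "!!u. u \<in> S ==> f' u = f u"
proof -
 obtain B where B: "B \<subseteq> S" "fs.independent B" "S \<subseteq> fs.span B"
  by (rule fs.basis_exists[of S])
 let ?f = "fsp.construct B f"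
 have lin: "flinear ?f" by (rule fsp.linear_construct[OF B(2)])
 have "?f u = f u" if "u \<in> S" for u
 proof -
  have "f (fscale 0 0) = fscale 0 (f 0)" by (rule scale[OF fs.subspace_0[OF S]])
  then have "fs.subspace {u \<in> S. ?f u = f u}"
   using fs.subspace_0[OF S] fs.subspace_add[OF S] fs.subspace_scale[OF S]
   unfolding fs.subspace_def
   by (auto simp: fsp.linear_0[OF lin] fsp.linear_add[OF lin] fsp.linear_scale[OF lin] add scale)
  moreover have "B \<subseteq> {u \<in> S. ?f u = f u}" using B fsp.construct_basis[OF B(2)] by blast
  ultimately have "fs.span B \<subseteq> {u \<in> S. ?f u = f u}" by (rule fs.span_minimal[rotated])
  then show ?thesis using that B by blast
 qed
 then show ?thesis using that lin by blast
qed

lemma fs_dim_zero [simp]: "fs.dim {0 :: 'a => 'k::field} = 0"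
proof -
 have "fs.dim ({} :: ('a => 'k) set) = 0"
  using fs.dim_eq_card_independent[OF fs.independent_empty] by simp
 then show ?thesis using fs.dim_span[of "{} :: ('a => 'k) set"] by simp
qed

lemma fs_dim_eq_partial_iso:
 fixes f :: "('a => 'k::field) => 'b => 'k"
 assumes S: "fs.subspace S" "findim S" and add: "!!u v. u \<in> S ==> v \<in> S ==> f (u + v) = f u + f v"
  and scale: "!!c u. u \<in> S ==> f (fscale c u) = fscale c (f u)" and inj: "inj_on f S"
 shows "fs.dim (f ` S) = fs.dim S"
proof -
 obtain f' where f': "flinear f'" "!!u. u \<in> S ==> f' u = f u"
  using partial_linear_extend[OF S(1) add scale] by blast
 have "{s\<in>S. f' s = 0} = {0}"
 proof -
  have "f 0 = 0" using f'(2)[OF fs.subspace_0[OF S(1)]] fsp.linear_0[OF f'(1)] by simp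
  then show ?thesis using f'(2) fs.subspace_0[OF S(1)] inj_onD[OF inj, of _ 0] by auto
 qed
 moreover have "f' ` S = f ` S" using f'(2) by auto
 ultimately show ?thesis using rank_nullity[OF f'(1) S] fs_dim_zero by simp
qed

text \<open>An exact complex, folded into its even and odd part, is such a pair. Rank-nullity for
  the two maps produces the same two summands, with kernel and image exchanged.\<close>

lemma dim_eq_of_exact_pair:
 fixes f :: "('a => 'k::field) => 'b => 'k"
 assumes f: "flinear f" and g: "flinear g" and S: "fs.subspace S" "findim S" and T: "fs.subspace T" "findim T"
  and "g ` T = {s\<in>S. f s = 0}" "f ` S = {t\<in>T. g t = 0}"
 shows "fs.dim S = fs.dim T"
 using rank_nullity[OF f S] rank_nullity[OF g T] assms(7,8) by simp

section \<open>Finite direct sums inside function spaces\<close>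

definition slice :: "'i => ('i \<times> 'a => 'k) => 'a => 'k" where
 "slice i c = (%y. c (i, y))"

text \<open>The external direct sum, realized by functions of an index and a point so that it is
  again a subspace of a function space. It serves for internal direct sums and for the two halves of
  the complex of ideals.\<close>

definition fprod :: "'i set => ('i => ('a => 'k::field) set) => ('i \<times> 'a => 'k) set" where
 "fprod F N = {c. (\<forall>i\<in>F. slice i c \<in> N i) & (\<forall>i. i \<notin> F --> slice i c = 0)}"

lemma flinear_slice: "flinear (slice i)"
 by (rule flinearI) (auto simp: slice_def fs_simps)

lemma subspace_fprod: "(!!i. i \<in> F ==> fs.subspace (N i)) ==> fs.subspace (fprod F N)"
 unfolding fs.subspace_def fprod_def
 by (auto simp: fsp.linear_0[OF flinear_slice] fsp.linear_add[OF flinear_slice] fsp.linear_scale[OF flinear_slice] fs.scale_zero_right)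

lemma findim_fprod:
 fixes N :: "'i => ('a => 'k::field) set"
 assumes "finite F" "!!i. i \<in> F ==> findim (N i)" shows "findim (fprod F N)"
proof -
 define J :: "'i => ('a => 'k) => 'i \<times> 'a => 'k" where "J = (%i f (j, y). if j = i then f y else 0)"
 have J: "flinear (J i)" for i by (rule flinearI) (auto simp: J_def fs_simps)
 obtain B where B: "!!i. i \<in> F ==> finite (B i) & N i \<subseteq> fs.span (B i)"
  using assms(2) unfolding findim_def by metis
 have "fprod F N \<subseteq> fs.span (\<Union>i\<in>F. J i ` B i)"
 proof
  fix c assume c: "c \<in> fprod F N"
  have "c = (\<Sum>i\<in>F. J i (slice i c))"
  proof
   fix p :: "'i \<times> 'a" obtain i y where p: "p = (i, y)" by fastforce
   have "c (i, y) = 0" if "i \<notin> F" using c that unfolding fprod_def slice_def by (auto simp: fun_eq_iff)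
   then show "c p = (\<Sum>i\<in>F. J i (slice i c)) p"
    using assms(1) by (auto simp: p sum_fun_apply J_def slice_def)
  qed
  also have "... \<in> fs.span (\<Union>i\<in>F. J i ` B i)"
  proof (rule fs.span_sum)
   fix i assume i: "i \<in> F"
   then have "slice i c \<in> fs.span (B i)" using c B by (auto simp: fprod_def)
   then have "J i (slice i c) \<in> fs.span (J i ` B i)" using fsp.linear_span_image[OF J] by blast
   moreover have "J i ` B i \<subseteq> (\<Union>i\<in>F. J i ` B i)" using i by blast
   ultimately show "J i (slice i c) \<in> fs.span (\<Union>i\<in>F. J i ` B i)" using fs.span_mono[THEN subsetD] by blast
  qed
  finally show "c \<in> fs.span (\<Union>i\<in>F. J i ` B i)" .
 qed
 moreover have "finite (\<Union>i\<in>F. J i ` B i)" using assms(1) B by auto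
 ultimately show ?thesis unfolding findim_def by blast
qed

lemma dim_fprod:
 fixes N :: "'i => ('a => 'k::field) set"
 assumes "finite F" "!!i. i \<in> F ==> fs.subspace (N i)" "!!i. i \<in> F ==> findim (N i)"
 shows "fs.dim (fprod F N) = (\<Sum>i\<in>F. fs.dim (N i))"
 using assms
proof (induction F)
 case empty
 have "fprod {} N = {0}" by (auto simp: fprod_def slice_def fun_eq_iff)
 then show ?case by simp
next
 case (insert i F)
 have "{c\<in>fprod (insert i F) N. slice i c = 0} = fprod F N"
 proof -
  have "0 \<in> N i" using insert(4)[of i] fs.subspace_0[of "N i"] by simp
  then show ?thesis using insert(2) unfolding fprod_def by auto
 qed
 moreover have "slice i ` fprod (insert i F) N = N i"
 proof
  show "N i \<subseteq> slice i ` fprod (insert i F) N"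
  proof
   fix f assume f: "f \<in> N i"
   let ?c = "(%(j, y). if j = i then f y else 0) :: 'i \<times> 'a => 'k"
   have s: "slice j ?c = (if j = i then f else 0)" for j by (auto simp: slice_def)
   have "?c \<in> fprod (insert i F) N" unfolding fprod_def
   proof (intro CollectI conjI ballI allI impI)
    show "slice j ?c \<in> N j" if "j \<in> insert i F" for j
     unfolding s[of j] using f fs.subspace_0[OF insert(4)[OF that]] by auto
    show "slice j ?c = 0" if "j \<notin> insert i F" for j unfolding s[of j] using that by auto
   qed
   then show "f \<in> slice i ` fprod (insert i F) N" using s[of i] by (intro image_eqI[of _ _ ?c]) simp_all
  qed
 qed (auto simp: fprod_def)
 ultimately show ?case
  using rank_nullity[OF flinear_slice subspace_fprod findim_fprod, of "insert i F" N i] insert by simp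
qed

lemma subspace_sums_of_family:
 assumes "!!i. i \<in> F ==> fs.subspace (N i)"
 shows "fs.subspace {\<Sum>i\<in>F. v i |v. \<forall>i\<in>F. v i \<in> N i}"
 unfolding fs.subspace_def
proof (intro conjI ballI allI)
 show "0 \<in> {\<Sum>i\<in>F. v i |v. \<forall>i\<in>F. v i \<in> N i}" using assms fs.subspace_0
  by (intro CollectI exI[of _ "%_. 0"]) auto
 fix x y assume "x \<in> {\<Sum>i\<in>F. v i |v. \<forall>i\<in>F. v i \<in> N i}" "y \<in> {\<Sum>i\<in>F. v i |v. \<forall>i\<in>F. v i \<in> N i}"
 then obtain v w where "x = (\<Sum>i\<in>F. v i)" "\<forall>i\<in>F. v i \<in> N i" "y = (\<Sum>i\<in>F. w i)" "\<forall>i\<in>F. w i \<in> N i" by blast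
 then show "x + y \<in> {\<Sum>i\<in>F. v i |v. \<forall>i\<in>F. v i \<in> N i}" using assms
  by (intro CollectI exI[of _ "%i. v i + w i"]) (auto simp: sum.distrib intro: fs.subspace_add)
next
 fix c x assume "x \<in> {\<Sum>i\<in>F. v i |v. \<forall>i\<in>F. v i \<in> N i}"
 then obtain v where "x = (\<Sum>i\<in>F. v i)" "\<forall>i\<in>F. v i \<in> N i" by blast
 then show "fscale c x \<in> {\<Sum>i\<in>F. v i |v. \<forall>i\<in>F. v i \<in> N i}" using assms
  by (intro CollectI exI[of _ "%i. fscale c (v i)"]) (auto simp: fs.scale_sum_right intro: fs.subspace_scale)
qed

lemma span_UN_eq_sums:
 assumes F: "finite F" and sub: "!!i. i \<in> F ==> fs.subspace (N i)"
 shows "fs.span (\<Union>i\<in>F. N i) = {\<Sum>i\<in>F. v i |v. \<forall>i\<in>F. v i \<in> N i}"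
proof
 have "(\<Union>i\<in>F. N i) \<subseteq> {\<Sum>i\<in>F. v i |v. \<forall>i\<in>F. v i \<in> N i}"
 proof clarify
  fix x i assume "i \<in> F" "x \<in> N i"
  then show "\<exists>v. x = (\<Sum>i\<in>F. v i) & (\<forall>i\<in>F. v i \<in> N i)" using F sub fs.subspace_0
   by (intro exI[of _ "%j. if j = i then x else 0"]) auto
 qed
 then show "fs.span (\<Union>i\<in>F. N i) \<subseteq> {\<Sum>i\<in>F. v i |v. \<forall>i\<in>F. v i \<in> N i}"
  using fs.span_minimal subspace_sums_of_family[of F N] sub by blast
 show "{\<Sum>i\<in>F. v i |v. \<forall>i\<in>F. v i \<in> N i} \<subseteq> fs.span (\<Union>i\<in>F. N i)"
  by clarify (rule fs.span_sum, rule fs.span_base, blast)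
qed

lemma dim_direct_sum:
 fixes N :: "'i => ('a => 'k::field) set"
 assumes F: "finite F" and sub: "!!i. i \<in> F ==> fs.subspace (N i)" and fin: "!!i. i \<in> F ==> findim (N i)"
  and ind: "!!v. (!!i. i \<in> F ==> v i \<in> N i) ==> (\<Sum>i\<in>F. v i) = 0 ==> (!!i. i \<in> F ==> v i = 0)"
 shows "fs.dim (fs.span (\<Union>i\<in>F. N i)) = (\<Sum>i\<in>F. fs.dim (N i))"
proof -
 define f where "f = (%c :: 'i \<times> 'a => 'k. \<Sum>i\<in>F. slice i c)"
 have f: "flinear f" by (rule flinearI) (auto simp: f_def slice_def fs_simps sum.distrib sum_distrib_left)
 have "inj_on f (fprod F N)"
 proof (subst fsp.linear_inj_on_iff_eq_0[OF f subspace_fprod[OF sub]], assumption, clarify)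
  fix c assume c: "c \<in> fprod F N" "f c = 0"
  then have "slice i c = 0" for i using ind[of "%i. slice i c" i] by (auto simp: f_def fprod_def)
  then show "c = 0" by (auto simp: slice_def fun_eq_iff)
 qed
 then have "fs.dim (f ` fprod F N) = fs.dim (fprod F N)"
  by (intro fs_dim_eq_partial_iso subspace_fprod findim_fprod F sub fin)
    (auto simp: fsp.linear_add[OF f] fsp.linear_scale[OF f])
 moreover have "f ` fprod F N = {\<Sum>i\<in>F. v i |v. \<forall>i\<in>F. v i \<in> N i}"
 proof
  show "f ` fprod F N \<subseteq> {\<Sum>i\<in>F. v i |v. \<forall>i\<in>F. v i \<in> N i}" by (auto simp: f_def fprod_def)
  show "{\<Sum>i\<in>F. v i |v. \<forall>i\<in>F. v i \<in> N i} \<subseteq> f ` fprod F N"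
  proof clarify
   fix v assume v: "\<forall>i\<in>F. v i \<in> N i"
   let ?c = "%(i, y). if i \<in> F then v i y else 0"
   have s: "slice i ?c = (if i \<in> F then v i else 0)" for i by (auto simp: slice_def)
   have "?c \<in> fprod F N" using v by (simp add: fprod_def s)
   moreover have "f ?c = (\<Sum>i\<in>F. v i)" unfolding f_def s by simp
   ultimately show "(\<Sum>i\<in>F. v i) \<in> f ` fprod F N" by (intro image_eqI[of _ f ?c]) simp_all
  qed
 qed
 ultimately show ?thesis using span_UN_eq_sums[OF F sub] dim_fprod[OF F sub fin] by simp
qed

text \<open>Lagrange interpolation at n + 1 points of \<open>A\<close> recovers every coefficient as
  a linear combination of values. In this way closure under infinitely many members of a
  one-parameter family of operators yields closure under its coefficients.\<close>

lemma poly_coeffs_in_subspace: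
 fixes A :: "'k::field set" and v :: "nat => 'a => 'k"
 assumes A: "infinite A" and S: "fs.subspace S" and inS: "!!t. t \<in> A ==> (\<Sum>r\<le>n. fscale (t ^ r) (v r)) \<in> S"
  and r: "r \<le> n"
 shows "v r \<in> S"
proof -
 obtain F where F: "F \<subseteq> A" "card F = Suc n" "finite F"
  using infinite_arbitrarily_large[OF A] by blast
 \<comment> \<open>The Lagrange basis polynomial of the node \<open>t\<close>.\<close>
 define L where "L = (%t. \<Prod>s\<in>F-{t}. [:- s / (t - s), 1 / (t - s):])"
 have deg: "degree (L t) \<le> n" if "t \<in> F" for t
 proof -
  have d1: "degree [:a, b:] \<le> 1" for a b :: 'k by simp
  have "degree (L t) \<le> (\<Sum>s\<in>F-{t}. degree [:- s / (t - s), 1 / (t - s):])" unfolding L_def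
   using degree_prod_sum_le[of "F - {t}"] F(3) unfolding comp_def by blast
  also have "... \<le> (\<Sum>s\<in>F-{t}. 1)" by (intro sum_mono d1)
  finally have "degree (L t) \<le> (\<Sum>s\<in>F-{t}. 1)" .
  then show ?thesis using F that by simp
 qed
 have ev: "poly (L t) s = (if s = t then 1 else 0)" if "t \<in> F" "s \<in> F" for s t
 proof (cases "s = t")
  case True
  then have "poly (L t) s = (\<Prod>u\<in>F-{t}. - u / (t - u) + t / (t - u))"
   unfolding L_def poly_prod by (intro prod.cong) auto
  also have "... = 1"
  proof (rule prod.neutral, rule ballI)
   fix u assume "u \<in> F - {t}"
   then have "t - u ~= 0" by auto
   then show "- u / (t - u) + t / (t - u) = 1" by (simp add: divide_simps)
  qed
  finally show ?thesis using True by simp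
 next
  case False
  then have "s \<in> F - {t}" using that by auto
  then show ?thesis using False F(3) unfolding L_def poly_prod
   by (auto intro!: bexI[of _ s] simp: field_simps)
 qed
 \<comment> \<open>The combination of Lagrange polynomials with weights \<open>t ^ j\<close> and the
   monomial of degree \<open>j\<close> agree at n + 1 points and have degree at most n; their
   coefficients at \<open>r\<close> are compared.\<close>
 have key: "(\<Sum>t\<in>F. t ^ j * coeff (L t) r) = (if j = r then 1 else 0)" if j: "j \<le> n" for j
 proof -
  let ?p = "(\<Sum>t\<in>F. smult (t ^ j) (L t)) - monom 1 j"
  have dp: "degree ?p \<le> n"
   by (intro degree_diff_le degree_sum_le F) (use deg j in \<open>auto intro!: order_trans[OF degree_smult_le] simp: degree_monom_eq\<close>)
  have Fp: "F \<subseteq> {x. poly ?p x = 0}"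
  proof
   fix x assume x: "x \<in> F"
   have "(\<Sum>t\<in>F. t ^ j * poly (L t) x) = (\<Sum>t\<in>F. if t = x then x ^ j else 0)"
    using x ev by (intro sum.cong) auto
   then show "x \<in> {x. poly ?p x = 0}" using x F(3) by (simp add: poly_sum poly_monom)
  qed
  have "?p = 0"
  proof (rule ccontr)
   assume nz: "?p ~= 0"
   have "card F \<le> card {x. poly ?p x = 0}" by (rule card_mono[OF poly_roots_finite[OF nz] Fp])
   also have "... \<le> degree ?p" by (rule card_poly_roots_bound[OF nz])
   finally show False using F(2) dp by simp
  qed
  then have "coeff ?p r = 0" by simp
  then show ?thesis by (simp add: coeff_sum)
 qed
 have "(\<Sum>t\<in>F. fscale (coeff (L t) r) (\<Sum>j\<le>n. fscale (t ^ j) (v j)))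
   = (\<Sum>t\<in>F. \<Sum>j\<le>n. fscale (t ^ j * coeff (L t) r) (v j))"
  by (simp only: fs.scale_sum_right fs.scale_scale mult.commute)
 also have "... = (\<Sum>j\<le>n. \<Sum>t\<in>F. fscale (t ^ j * coeff (L t) r) (v j))" by (rule sum.swap)
 also have "... = (\<Sum>j\<le>n. fscale (\<Sum>t\<in>F. t ^ j * coeff (L t) r) (v j))"
  by (simp only: fs.scale_sum_left)
 also have "... = (\<Sum>j\<le>n. if j = r then v r else 0)"
  using key by (intro sum.cong) auto
 also have "... = v r" using r by simp
 finally have "v r = (\<Sum>t\<in>F. fscale (coeff (L t) r) (\<Sum>j\<le>n. fscale (t ^ j) (v j)))" by simp
 also have "... \<in> S"
  by (rule fs.subspace_sum[OF S], rule fs.subspace_scale[OF S], rule inS) (use F in blast)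
 finally show ?thesis .
qed

text \<open>Subtracting \<open>\<theta> j\<close> times the vector from its image under
  \<open>H\<close> kills the component \<open>j\<close> and multiplies the others by nonzero
  differences, which allows induction on the number of components.\<close>

lemma (in vector_space) eigen_components_in_subspace:
 assumes H: "Vector_Spaces.linear scale scale H" and S: "subspace S" "!!u. u \<in> S ==> H u \<in> S"
  and F: "finite F" "inj_on \<theta> F" "!!i. i \<in> F ==> H (u i) = scale (\<theta> i) (u i)"
  and "(\<Sum>i\<in>F. u i) \<in> S" "i \<in> F"
 shows "u i \<in> S"
proof -
 interpret H: Vector_Spaces.linear scale scale H by (fact H)
 show ?thesis using F assms(7,8)
 proof (induction F arbitrary: u i)
  case (insert j F)
  let ?x = "\<Sum>i\<in>insert j F. u i"
  have "H ?x - scale (\<theta> j) ?x = (\<Sum>i\<in>insert j F. H (u i) - scale (\<theta> j) (u i))"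
   by (simp only: H.sum scale_sum_right sum_subtractf)
  also have "... = (\<Sum>i\<in>insert j F. scale (\<theta> i - \<theta> j) (u i))"
   using insert.prems(2) by (intro sum.cong) (auto simp: scale_left_diff_distrib)
  also have "... = (\<Sum>i\<in>F. scale (\<theta> i - \<theta> j) (u i))" using insert.hyps by (simp add: scale_zero_left)
  finally have eq: "(\<Sum>i\<in>F. scale (\<theta> i - \<theta> j) (u i)) \<in> S"
   using insert.prems(3) S subspace_diff subspace_scale by metis
  have *: "u i \<in> S" if "i \<in> F" for i
  proof -
   have "scale (\<theta> i - \<theta> j) (u i) \<in> S"
   proof (rule insert.IH[OF _ _ eq that])
    show "inj_on \<theta> F" using insert.prems(1) by auto
    show "H (scale (\<theta> i - \<theta> j) (u i)) = scale (\<theta> i) (scale (\<theta> i - \<theta> j) (u i))" if "i \<in> F" for i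
     using insert.prems(2)[of i] that by (simp add: H.scale mult.commute)
   qed
   moreover have "\<theta> i - \<theta> j ~= 0" using insert.prems(1) insert.hyps that by (auto simp: inj_on_def)
   ultimately show ?thesis
    using subspace_scale[OF S(1), of "scale (\<theta> i - \<theta> j) (u i)" "inverse (\<theta> i - \<theta> j)"] by simp
  qed
  show ?case
  proof (cases "i = j")
   case True
   have "u j = ?x - (\<Sum>i\<in>F. u i)" using insert.hyps by simp
   also have "... \<in> S" using insert.prems(3) * S(1) subspace_diff subspace_sum by metis
   finally show ?thesis using True by simp
  qed (use insert.prems * in auto)
 qed auto
qed

section \<open>Semisimplicity\<close>

text \<open>The group is only a set of indices for operators, so that the same notions serve GL(W)
  and the permutations of tensor positions.\<close>

definition stable :: "'g set => ('g => ('a => 'k::field) => 'a => 'k) => ('a => 'k) set => bool" where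
 "stable G act N \<longleftrightarrow> fs.subspace N & (\<forall>g\<in>G. \<forall>u\<in>N. act g u \<in> N)"

definition simple_sub :: "'g set => ('g => ('a => 'k::field) => 'a => 'k) => ('a => 'k) set => bool" where
 "simple_sub G act N \<longleftrightarrow> stable G act N & N ~= {0} &
   (\<forall>N'. N' \<subseteq> N --> stable G act N' --> N' = {0} \<or> N' = N)"

definition equivariant_on ::
 "'g set => ('g => ('a => 'k::field) => 'a => 'k) => ('g => ('b => 'k) => 'b => 'k)
  => ('a => 'k) set => (('a => 'k) => 'b => 'k) => bool" where
 "equivariant_on G act act' N h \<longleftrightarrow> (\<forall>u\<in>N. \<forall>v\<in>N. h (u + v) = h u + h v) &
   (\<forall>c. \<forall>u\<in>N. h (fscale c u) = fscale c (h u)) & (\<forall>g\<in>G. \<forall>u\<in>N. h (act g u) = act' g (h u))"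

definition fmod :: "(('w => 'w) => ('a => 'k::field) => 'a => 'k) => ('a => 'k) set => ('k, 'w, 'a => 'k) glmod" where
 "fmod act N = \<lparr>gl_space = N, gl_scale = fscale, gl_act = act\<rparr>"

lemma fmod_simps [simp]: "gl_space (fmod act N) = N" "gl_scale (fmod act N) = fscale"
 "gl_act (fmod act N) = act" "(fmod act N)\<lparr>gl_space := N'\<rparr> = fmod act N'"
 by (simp_all add: fmod_def)

lemma stableD: "stable G act N ==> fs.subspace N" "stable G act N ==> g \<in> G ==> u \<in> N ==> act g u \<in> N"
 by (auto simp: stable_def)

lemma simple_subD: "simple_sub G act N ==> stable G act N" "simple_sub G act N ==> N ~= {0}"
 "simple_sub G act N ==> stable G act N' ==> N' \<subseteq> N ==> N' = {0} \<or> N' = N"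
 by (auto simp: simple_sub_def)

lemma stable_Int: "stable G act N ==> stable G act N' ==> stable G act (N Int N')"
 by (auto simp: stable_def fs.subspace_inter)

lemma stable_span:
 assumes lin: "!!g. g \<in> G ==> flinear (act g)" and S: "!!g u. g \<in> G ==> u \<in> S ==> act g u \<in> fs.span S"
 shows "stable G act (fs.span S)"
 unfolding stable_def
proof (intro conjI ballI)
 fix g u assume g: "g \<in> G" and u: "u \<in> fs.span S"
 have "act g u \<in> fs.span (act g ` S)" using u fsp.linear_span_image[OF lin[OF g], of S] by blast
 moreover have "fs.span (act g ` S) \<subseteq> fs.span S"
  by (rule fs.span_minimal) (use S g in auto)
 ultimately show "act g u \<in> fs.span S" by blast
qed simp

lemma stable_span_Union:
 assumes lin: "!!g. g \<in> G ==> flinear (act g)" and T: "!!T. T \<in> \<T> ==> stable G act T"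
 shows "stable G act (fs.span (\<Union>\<T>))"
 by (rule stable_span[OF lin]) (auto intro!: fs.span_base dest: stableD(2)[OF T])

lemma stable_sums:
 assumes lin: "!!g. g \<in> G ==> flinear (act g)" and "stable G act N" "stable G act C"
 shows "stable G act {n + c |n c. n \<in> N & c \<in> C}"
 unfolding stable_def
proof (intro conjI ballI)
 show "fs.subspace {n + c |n c. n \<in> N & c \<in> C}"
  using assms(2,3) by (intro fs.subspace_sums) (auto simp: stable_def)
 fix g u assume g: "g \<in> G" and "u \<in> {n + c |n c. n \<in> N & c \<in> C}"
 then obtain n c where u: "u = n + c" "n \<in> N" "c \<in> C" by blast
 then have "act g u = act g n + act g c" using fsp.linear_add[OF lin[OF g]] by simp
 then show "act g u \<in> {n + c |n c. n \<in> N & c \<in> C}"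
  using stableD(2)[OF assms(2) g u(2)] stableD(2)[OF assms(3) g u(3)] by blast
qed

text \<open>Schur's lemma: preimages of stable subspaces are stable, so for a simple source the
  kernel, and the preimage of any stable part of the image, can only be 0 or everything.\<close>

lemma simple_image:
 assumes lin: "!!g. g \<in> G ==> flinear (act' g)"
  and T: "simple_sub G act T" and p: "equivariant_on G act act' T p" and nz: "p ` T ~= {0}"
 shows "simple_sub G act' (p ` T)" "inj_on p T"
proof -
 have sT: "fs.subspace T" using T simple_subD stableD by blast
 have add: "!!u v. u \<in> T ==> v \<in> T ==> p (u + v) = p u + p v"
  and scale: "!!c u. u \<in> T ==> p (fscale c u) = fscale c (p u)"
  and eq: "!!g u. g \<in> G ==> u \<in> T ==> p (act g u) = act' g (p u)"
  using p by (auto simp: equivariant_on_def)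
 have actT: "!!g u. g \<in> G ==> u \<in> T ==> act g u \<in> T"
  using stableD(2)[OF simple_subD(1)[OF T]] by blast
 have p0: "p 0 = 0" using scale[OF fs.subspace_0[OF sT], of 0] by simp
 have pre: "stable G act {u \<in> T. p u \<in> N}" if "stable G act' N" for N
  using that sT actT unfolding stable_def fs.subspace_def by (auto simp: add scale eq p0)
 have im: "stable G act' (p ` T)"
  unfolding stable_def fs.subspace_def
 proof (intro conjI ballI allI)
  show "0 \<in> p ` T" using p0 fs.subspace_0[OF sT] by force
  show "x + y \<in> p ` T" if xy: "x \<in> p ` T" "y \<in> p ` T" for x y
  proof -
   obtain a b where ab: "a \<in> T" "b \<in> T" "x = p a" "y = p b" using xy by blast
   show ?thesis unfolding ab(3,4) add[OF ab(1,2), symmetric] using fs.subspace_add[OF sT ab(1,2)] by blast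
  qed
  show "fscale c x \<in> p ` T" if x: "x \<in> p ` T" for c x
  proof -
   obtain a where ab: "a \<in> T" "x = p a" using x by blast
   show ?thesis unfolding ab(2) scale[OF ab(1), symmetric] using fs.subspace_scale[OF sT ab(1)] by blast
  qed
  show "act' g u \<in> p ` T" if gu: "g \<in> G" "u \<in> p ` T" for g u
  proof -
   obtain v where "v \<in> T" "u = p v" using gu by blast
   then have "act' g u = p (act g v)" "act g v \<in> T" using eq actT gu by auto
   then show ?thesis by blast
  qed
 qed
 have z: "stable G act' {0}"
  unfolding stable_def using fsp.linear_0[OF lin] by auto
 have "{u \<in> T. p u \<in> {0}} = {0} \<or> {u \<in> T. p u \<in> {0}} = T"
  by (rule simple_subD(3)[OF T pre[OF z]]) auto
 then have ker: "{u \<in> T. p u = 0} = {0}"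
 proof
  assume "{u \<in> T. p u \<in> {0}} = T"
  then have "p ` T \<subseteq> {0}" by auto
  then have "p ` T = {0}" using fs.subspace_0[OF sT] by auto
  then show ?thesis using nz by simp
 qed simp
 show "inj_on p T"
 proof (rule inj_onI)
  fix x y assume xy: "x \<in> T" "y \<in> T" "p x = p y"
  have d: "x - y \<in> T" using fs.subspace_diff[OF sT xy(1,2)] .
  have "p (x - y) + p y = p x" using add[OF d xy(2)] by simp
  then have "x - y \<in> {u \<in> T. p u = 0}" using xy d by simp
  then show "x = y" unfolding ker by simp
 qed
 show "simple_sub G act' (p ` T)"
  unfolding simple_sub_def
 proof (intro conjI im nz allI impI)
  fix N assume N: "N \<subseteq> p ` T" "stable G act' N"
  have "{u \<in> T. p u \<in> N} = {0} \<or> {u \<in> T. p u \<in> N} = T"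
   by (rule simple_subD(3)[OF T pre[OF N(2)]]) auto
  then show "N = {0} \<or> N = p ` T"
  proof
   assume a: "{u \<in> T. p u \<in> N} = {0}"
   have "x = 0" if x: "x \<in> N" for x
   proof -
    obtain u where "u \<in> T" "x = p u" using N x by blast
    then have "u \<in> {u \<in> T. p u \<in> N}" using x by simp
    then show ?thesis using a p0 \<open>x = p u\<close> by simp
   qed
   moreover have "0 \<in> N" using fs.subspace_0[OF stableD(1)[OF N(2)]] .
   ultimately show ?thesis by blast
  qed (use N(1) in auto)
 qed
qed

lemma equivariant_onD:
 assumes "equivariant_on G act act' N h"
 shows "!!u v. u \<in> N ==> v \<in> N ==> h (u + v) = h u + h v"
  "!!c u. u \<in> N ==> h (fscale c u) = fscale c (h u)"
  "!!g u. g \<in> G ==> u \<in> N ==> h (act g u) = act' g (h u)"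
 using assms by (auto simp: equivariant_on_def)

lemma equivariant_on_subset: "equivariant_on G act act' N h ==> N' \<subseteq> N ==> equivariant_on G act act' N' h"
 unfolding equivariant_on_def by blast

lemma isomorphic_fmodI:
 "bij_betw h N N' ==> equivariant_on (GL sW) act act' N h ==> isomorphic_modules sW (fmod act N) (fmod act' N')"
 unfolding isomorphic_modules_def equivariant_on_def fmod_simps by blast

lemma isomorphic_fmodE:
 assumes "isomorphic_modules sW (fmod act N) (fmod act' N')"
 obtains h where "bij_betw h N N'" "equivariant_on (GL sW) act act' N h"
 using assms unfolding isomorphic_modules_def equivariant_on_def fmod_simps by blast

lemma isomorphic_modules_trans:
 assumes "isomorphic_modules sW A B" "isomorphic_modules sW B C"
 shows "isomorphic_modules sW A C"
proof -
 obtain h where h: "bij_betw h (gl_space A) (gl_space B)"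
  "!!u v. u\<in>gl_space A ==> v\<in>gl_space A ==> h (u + v) = h u + h v"
  "!!c u. u\<in>gl_space A ==> h (gl_scale A c u) = gl_scale B c (h u)"
  "!!g u. g\<in>GL sW ==> u\<in>gl_space A ==> h (gl_act A g u) = gl_act B g (h u)"
  using assms(1) unfolding isomorphic_modules_def by blast
 obtain k where k: "bij_betw k (gl_space B) (gl_space C)"
  "!!u v. u\<in>gl_space B ==> v\<in>gl_space B ==> k (u + v) = k u + k v"
  "!!c u. u\<in>gl_space B ==> k (gl_scale B c u) = gl_scale C c (k u)"
  "!!g u. g\<in>GL sW ==> u\<in>gl_space B ==> k (gl_act B g u) = gl_act C g (k u)"
  using assms(2) unfolding isomorphic_modules_def by blast
 have hB: "h u \<in> gl_space B" if "u \<in> gl_space A" for u using h(1) that by (auto simp: bij_betw_def)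
 show ?thesis unfolding isomorphic_modules_def
  by (rule exI[of _ "k o h"]) (auto simp: h k hB intro: bij_betw_trans[OF h(1) k(1)])
qed

lemma isomorphic_fmod_sym:
 assumes "isomorphic_modules sW (fmod act N) U" "stable (GL sW) act N"
 shows "isomorphic_modules sW U (fmod act N)"
proof -
 obtain h where h: "bij_betw h N (gl_space U)"
  "!!u v. u\<in>N ==> v\<in>N ==> h (u + v) = h u + h v"
  "!!c u. u\<in>N ==> h (fscale c u) = gl_scale U c (h u)"
  "!!g u. g\<in>GL sW ==> u\<in>N ==> h (act g u) = gl_act U g (h u)"
  using assms(1) unfolding isomorphic_modules_def fmod_simps by blast
 let ?k = "inv_into N h"
 have kh: "?k (h u) = u" if "u \<in> N" for u using h(1) that by (auto simp: bij_betw_def)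
 have ex: "\<exists>u'\<in>N. u = h u'" if "u \<in> gl_space U" for u using h(1) that by (auto simp: bij_betw_def)
 have cl: "u + v \<in> N" "fscale c u \<in> N" "g \<in> GL sW ==> act g u \<in> N" if "u \<in> N" "v \<in> N" for u v c g
  using assms(2) that fs.subspace_add fs.subspace_scale by (auto simp: stable_def)
 have a1: "?k (u + v) = ?k u + ?k v" if U: "u \<in> gl_space U" "v \<in> gl_space U" for u v
 proof -
  obtain u' v' where uv: "u' \<in> N" "v' \<in> N" "u = h u'" "v = h v'" using ex[OF U(1)] ex[OF U(2)] by blast
  show ?thesis unfolding uv(3,4) using h(2)[OF uv(1,2)] kh uv(1,2) cl(1)[OF uv(1,2)] by metis
 qed
 have a2: "?k (gl_scale U c u) = fscale c (?k u)" if U: "u \<in> gl_space U" for u c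
 proof -
  obtain u' where uv: "u' \<in> N" "u = h u'" using ex[OF U] by blast
  show ?thesis unfolding uv(2) using h(3)[OF uv(1)] kh uv(1) cl(2)[OF uv(1) uv(1)] by metis
 qed
 have a3: "?k (gl_act U g u) = act g (?k u)" if U: "g \<in> GL sW" "u \<in> gl_space U" for u g
 proof -
  obtain u' where uv: "u' \<in> N" "u = h u'" using ex[OF U(2)] by blast
  show ?thesis unfolding uv(2) using h(4)[OF U(1) uv(1)] kh uv(1) cl(3)[OF uv(1) uv(1) U(1)] by metis
 qed
 show ?thesis unfolding isomorphic_modules_def fmod_simps
  using bij_betw_inv_into[OF h(1)] a1 a2 a3 by blast
qed

text \<open>A subfamily \<open>\<C>\<close> that is maximal subject to its span meeting
  \<open>N\<close> in 0 spans a complement: a simple member not contained in \<open>N\<close> plus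
  this span would meet that sum in 0 and could be added. The projection along the complement is
  equivariant because both summands are stable.\<close>

lemma complement_projection:
 assumes lin: "!!g. g \<in> G ==> flinear (act g)" and fin: "finite \<T>"
  and T: "!!T. T \<in> \<T> ==> simple_sub G act T" and N: "stable G act N" "N \<subseteq> fs.span (\<Union>\<T>)"
 obtains p where "!!u. u \<in> fs.span (\<Union>\<T>) ==> p u \<in> N" "!!u. u \<in> N ==> p u = u"
  "equivariant_on G act act (fs.span (\<Union>\<T>)) p"
proof -
 let ?P = "{\<C>. \<C> \<subseteq> \<T> & N Int fs.span (\<Union>\<C>) = {0}}"
 have sN: "fs.subspace N" using N stableD by blast
 have "finite ?P" using fin by auto
 moreover have "{} \<in> ?P" using fs.subspace_0[OF sN] by auto
 ultimately obtain \<C> where C: "\<C> \<subseteq> \<T>" "N Int fs.span (\<Union>\<C>) = {0}"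
  and mx: "!!\<B>. \<B> \<in> ?P ==> \<C> \<subseteq> \<B> ==> \<C> = \<B>"
  using finite_has_maximal[of ?P] by (metis (mono_tags, lifting) empty_iff mem_Collect_eq)
 let ?C = "fs.span (\<Union>\<C>)"
 let ?NC = "{n + c |n c. n \<in> N & c \<in> ?C}"
 have stC: "stable G act ?C" by (rule stable_span_Union[OF lin]) (use C T simple_subD(1) in blast)+
 have stNC: "stable G act ?NC" by (rule stable_sums[OF lin N(1) stC])
 have CNC: "?C \<subseteq> ?NC"
 proof
  fix c assume "c \<in> ?C" then show "c \<in> ?NC" using fs.subspace_0[OF sN]
   by (intro CollectI exI[of _ 0] exI[of _ c]) auto
 qed
 have sub: "T \<subseteq> ?NC" if "T \<in> \<T>" for T
 proof (rule ccontr)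
  assume not: "\<not> T \<subseteq> ?NC"
  have sT: "fs.subspace T" using T[OF that] simple_subD stableD by blast
  have "T Int ?NC = {0} \<or> T Int ?NC = T"
   by (rule simple_subD(3)[OF T[OF that] stable_Int[OF simple_subD(1)[OF T[OF that]] stNC]]) auto
  then have z: "T Int ?NC = {0}" using not by blast
  have "N Int fs.span (\<Union>(insert T \<C>)) \<subseteq> {0}"
  proof
   fix u assume u: "u \<in> N Int fs.span (\<Union>(insert T \<C>))"
   then have "u \<in> fs.span (T Un \<Union>\<C>)" by simp
   then obtain t c where tc: "u = t + c" "t \<in> T" "c \<in> ?C"
    unfolding fs.span_Un using sT fs.span_eq_iff by blast
   have "t = u + (- c)" using tc by simp
   moreover have "- c \<in> ?C" using tc(3) by (rule fs.span_neg)
   ultimately have "t \<in> T Int ?NC" using tc u by blast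
   then have "t = 0" using z by blast
   then have "u \<in> N Int ?C" using tc u by simp
   then show "u \<in> {0}" using C(2) by simp
  qed
  moreover have "0 \<in> N" "0 \<in> fs.span (\<Union>(insert T \<C>))"
   using fs.subspace_0[OF sN] fs.span_zero by auto
  ultimately have "N Int fs.span (\<Union>(insert T \<C>)) = {0}" by blast
  then have "insert T \<C> \<in> ?P" using C(1) that by blast
  then have "\<C> = insert T \<C>" using mx[of "insert T \<C>"] by blast
  then have "T \<subseteq> ?C" using fs.span_superset[of "\<Union>\<C>"] by blast
  then show False using CNC not by blast
 qed
 have T0: "fs.span (\<Union>\<T>) \<subseteq> ?NC"
  by (rule fs.span_minimal) (use sub stableD(1)[OF stNC] in auto)
 define p where "p u = (THE n. n \<in> N & u - n \<in> ?C)" for u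
 have p: "p (n + c) = n" if "n \<in> N" "c \<in> ?C" for n c
  unfolding p_def
 proof (rule the_equality)
  show "n \<in> N & n + c - n \<in> ?C" using that by simp
  fix n' assume n': "n' \<in> N & n + c - n' \<in> ?C"
  have "(n + c - n') - c \<in> ?C" using fs.span_diff n' that by blast
  then have "n - n' \<in> ?C" by simp
  moreover have "n - n' \<in> N" using fs.subspace_diff[OF sN] that n' by blast
  ultimately have "n - n' \<in> {0}" using C(2) by blast
  then show "n' = n" by simp
 qed
 show ?thesis
 proof (rule that[of p])
  show "p u \<in> N" if "u \<in> fs.span (\<Union>\<T>)" for u
   using subsetD[OF T0 that] p by auto
  show "p u = u" if "u \<in> N" for u using p[OF that fs.span_zero] by simp
  show "equivariant_on G act act (fs.span (\<Union>\<T>)) p"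
   unfolding equivariant_on_def
  proof (intro conjI ballI allI)
   fix u assume "u \<in> fs.span (\<Union>\<T>)"
   then obtain n c where u: "u = n + c" "n \<in> N" "c \<in> ?C" using T0 by blast
   show "p (fscale a u) = fscale a (p u)" for a
    using p[OF fs.subspace_scale[OF sN u(2)] fs.span_scale[OF u(3)]] p[OF u(2,3)]
    unfolding u(1) fs.scale_right_distrib by metis
   show "p (act g u) = act g (p u)" if g: "g \<in> G" for g
    using p[OF stableD(2)[OF N(1) g u(2)] stableD(2)[OF stC g u(3)]] p[OF u(2,3)]
    unfolding u(1) fsp.linear_add[OF lin[OF g]] by metis
   fix v assume "v \<in> fs.span (\<Union>\<T>)"
   then obtain n' c' where v: "v = n' + c'" "n' \<in> N" "c' \<in> ?C" using T0 by blast
   have "u + v = (n + n') + (c + c')" using u v by (simp only: ac_simps)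
   then have "p (u + v) = n + n'"
    using p[OF fs.subspace_add[OF sN u(2) v(2)] fs.span_add[OF u(3) v(3)]] by (simp only:)
   then show "p (u + v) = p u + p v"
    using p[OF u(2,3)] p[OF v(2,3)] by (simp only: u(1) v(1))
  qed
 qed
qed

lemma in_span_Union_finite:
 assumes "u \<in> fs.span (\<Union>\<S>)"
 obtains \<T> where "finite \<T>" "\<T> \<subseteq> \<S>" "u \<in> fs.span (\<Union>\<T>)"
proof -
 obtain t r where t: "finite t" "t \<subseteq> \<Union>\<S>" "u = (\<Sum>a\<in>t. fscale (r a) a)"
  using assms unfolding fs.span_explicit by blast
 obtain \<T> where "finite \<T>" "\<T> \<subseteq> \<S>" "t \<subseteq> \<Union>\<T>" using finite_subset_Union[OF t(1,2)] by blast
 moreover have "u \<in> fs.span (\<Union>\<T>)" unfolding t(3)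
  by (rule fs.span_sum, rule fs.span_scale, rule fs.span_base) (use calculation in blast)
 ultimately show ?thesis using that by blast
qed

text \<open>Each element of \<open>N\<close> lies in the span of finitely many simple members. The
  projection to the part of \<open>N\<close> in that span fixes the element and sends each member to
  0 or to an isomorphic simple submodule of \<open>N\<close>, which writes the element as a sum of
  such pieces.\<close>

lemma sub_of_sum_of_simples:
 assumes lin: "!!g. g \<in> GL sW ==> flinear (act g)"
  and S: "!!T. T \<in> \<S> ==> simple_sub (GL sW) act T" and N: "stable (GL sW) act N" "N \<subseteq> fs.span (\<Union>\<S>)"
 shows "N = fs.span (\<Union>{T. T \<subseteq> N & simple_sub (GL sW) act T &
   (\<exists>T'\<in>\<S>. isomorphic_modules sW (fmod act T') (fmod act T))})" (is "_ = fs.span (\<Union>?D)")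
proof
 show "fs.span (\<Union>?D) \<subseteq> N" by (rule fs.span_minimal) (use stableD(1)[OF N(1)] in auto)
 show "N \<subseteq> fs.span (\<Union>?D)"
 proof
  fix u assume u: "u \<in> N"
  then obtain \<T> where T: "finite \<T>" "\<T> \<subseteq> \<S>" "u \<in> fs.span (\<Union>\<T>)" using N(2) in_span_Union_finite by blast
  have simp: "simple_sub (GL sW) act T" if "T \<in> \<T>" for T using S T that by blast
  have st: "stable (GL sW) act (N Int fs.span (\<Union>\<T>))"
   by (intro stable_Int N stable_span_Union[OF lin] simple_subD(1) simp)
  obtain p where p: "!!u. u \<in> fs.span (\<Union>\<T>) ==> p u \<in> N Int fs.span (\<Union>\<T>)" "!!u. u \<in> N Int fs.span (\<Union>\<T>) ==> p u = u"
   "equivariant_on (GL sW) act act (fs.span (\<Union>\<T>)) p"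
   by (rule complement_projection[OF lin T(1) simp st]) blast+
  have "fs.span (\<Union>T\<in>\<T>. T) = {\<Sum>T\<in>\<T>. v T |v. \<forall>T\<in>\<T>. v T \<in> T}"
   by (rule span_UN_eq_sums[OF T(1)]) (use simp simple_subD(1) stableD(1) in blast)
  then obtain v where v: "u = (\<Sum>T\<in>\<T>. v T)" "\<forall>T\<in>\<T>. v T \<in> T" using T(3) by auto
  have lin': "p (\<Sum>T\<in>\<T>'. v T) = (\<Sum>T\<in>\<T>'. p (v T))" if "\<T>' \<subseteq> \<T>" for \<T>'
  proof -
   obtain p' where p': "flinear p'" "!!u. u \<in> fs.span (\<Union>\<T>) ==> p' u = p u"
    by (rule partial_linear_extend[OF fs.subspace_span equivariant_onD(1,2)[OF p(3)]]) blast+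
   have vT: "v T \<in> fs.span (\<Union>\<T>)" if "T \<in> \<T>'" for T
    by (rule fs.span_base) (use that v \<open>\<T>' \<subseteq> \<T>\<close> in blast)
   have "p (\<Sum>T\<in>\<T>'. v T) = p' (\<Sum>T\<in>\<T>'. v T)"
    by (rule p'(2)[symmetric], rule fs.span_sum, rule vT)
   also have "... = (\<Sum>T\<in>\<T>'. p' (v T))" by (rule fsp.linear_sum[OF p'(1)])
   also have "... = (\<Sum>T\<in>\<T>'. p (v T))" by (rule sum.cong[OF refl p'(2)[OF vT]])
   finally show ?thesis .
  qed
  have "u = (\<Sum>T\<in>\<T>. p (v T))" using p(2)[of u] u T(3) lin'[OF subset_refl] v(1) by simp
  also have "... \<in> fs.span (\<Union>?D)"
  proof (rule fs.span_sum)
   fix T assume TT: "T \<in> \<T>"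
   have sub: "T \<subseteq> fs.span (\<Union>\<T>)" using TT fs.span_base by blast
   have eq: "equivariant_on (GL sW) act act T p" by (rule equivariant_on_subset[OF p(3) sub])
   show "p (v T) \<in> fs.span (\<Union>?D)"
   proof (cases "p ` T = {0}")
    case True
    then have "p (v T) = 0" using v TT by blast
    then show ?thesis using fs.span_zero by simp
   next
    case False
    note im = simple_image[OF lin simp[OF TT] eq False]
    have "isomorphic_modules sW (fmod act T) (fmod act (p ` T))"
     by (rule isomorphic_fmodI[OF _ eq]) (simp add: bij_betw_def im)
    moreover have "p ` T \<subseteq> N" using p(1) sub by blast
    ultimately have "p ` T \<in> ?D" using im(1) T(2) TT by blast
    then show ?thesis using v TT by (intro fs.span_base) blast
   qed
  qed
  finally show "u \<in> fs.span (\<Union>?D)" .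
 qed
qed

text \<open>A simple \<open>N\<close> must coincide with one of the simple pieces into which it
  decomposes, and each piece is a copy of a member of the family.\<close>

lemma simple_sub_iso_summand:
 assumes lin: "!!g. g \<in> GL sW ==> flinear (act g)"
  and S: "!!T. T \<in> \<S> ==> simple_sub (GL sW) act T" and N: "simple_sub (GL sW) act N" "N \<subseteq> fs.span (\<Union>\<S>)"
 obtains T where "T \<in> \<S>" "isomorphic_modules sW (fmod act T) (fmod act N)"
proof -
 let ?D = "{T. T \<subseteq> N & simple_sub (GL sW) act T &
   (\<exists>T'\<in>\<S>. isomorphic_modules sW (fmod act T') (fmod act T))}"
 have Neq: "N = fs.span (\<Union>?D)" by (rule sub_of_sum_of_simples[OF lin S simple_subD(1)[OF N(1)] N(2)])
 have "N = {0}" if e: "?D = {}" using Neq unfolding e Union_empty fs.span_empty .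
 then have "?D ~= {}" using simple_subD(2)[OF N(1)] by blast
 then obtain T T' where T: "T \<subseteq> N" "simple_sub (GL sW) act T" "T' \<in> \<S>" "isomorphic_modules sW (fmod act T') (fmod act T)" by blast
 then have "T = N" using simple_subD(3)[OF N(1) simple_subD(1)[OF T(2)] T(1)] simple_subD(2)[OF T(2)] by blast
 then show ?thesis using T that by blast
qed

section \<open>Independent families of submodules and their eigenspaces\<close>

definition independent_family :: "('a => 'k::field) set set => bool" where
 "independent_family D \<longleftrightarrow> (\<forall>N\<in>D. N Int fs.span (\<Union>(D - {N})) = {0})"

text \<open>Zorn's lemma, since the ideals have infinitely many summands. Dependence involves
  finitely many members, so independence passes to unions of chains. A simple member outside the
  span of a maximal family meets that span in 0 and could be added.\<close>

lemma independent_family_maximal: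
 assumes lin: "!!g. g \<in> G ==> flinear (act g)" and S: "!!T. T \<in> \<S> ==> simple_sub G act T"
 obtains D where "D \<subseteq> \<S>" "independent_family D" "fs.span (\<Union>D) = fs.span (\<Union>\<S>)"
proof -
 have sub0: "0 \<in> T" if "T \<in> \<S>" for T
  using fs.subspace_0 stableD(1)[OF simple_subD(1)[OF S[OF that]]] by blast
 let ?A = "{D. D \<subseteq> \<S> & independent_family D}"
 have "\<exists>M\<in>?A. \<forall>X\<in>?A. M \<subseteq> X --> X = M"
 proof (rule subset_Zorn_nonempty)
  show "?A ~= {}" by (auto simp: independent_family_def intro!: exI[of _ "{}"])
  fix \<C> assume C: "\<C> ~= {}" "subset.chain ?A \<C>"
  have CA: "\<C> \<subseteq> ?A" using C(2) by (simp add: subset.chain_def)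
  have "independent_family (\<Union>\<C>)" unfolding independent_family_def
  proof
   fix N assume N: "N \<in> \<Union>\<C>"
   have "x = 0" if x: "x \<in> N" "x \<in> fs.span (\<Union>(\<Union>\<C> - {N}))" for x
   proof -
    obtain \<T> where T: "finite \<T>" "\<T> \<subseteq> \<Union>\<C> - {N}" "x \<in> fs.span (\<Union>\<T>)"
     using in_span_Union_finite[OF x(2)] by blast
    obtain D where D: "D \<in> \<C>" "insert N \<T> \<subseteq> D"
     using finite_subset_Union_chain[of "insert N \<T>" \<C> ?A] T N C by blast
    have "\<Union>\<T> \<subseteq> \<Union>(D - {N})" using T D by blast
    then have "x \<in> fs.span (\<Union>(D - {N}))" using T(3) fs.span_mono by blast
    then show ?thesis using D CA x unfolding independent_family_def by blast
   qed
   moreover have "0 \<in> N" using N CA sub0 by blast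
   ultimately show "N Int fs.span (\<Union>(\<Union>\<C> - {N})) = {0}" using fs.span_zero by blast
  qed
  then show "\<Union>\<C> \<in> ?A" using CA by blast
 qed
 then obtain D where D0: "D \<in> ?A" and mx0: "\<forall>X\<in>?A. D \<subseteq> X --> X = D" by (rule bexE)
 have D: "D \<subseteq> \<S>" "independent_family D" using D0 by simp_all
 have mx: "X = D" if "X \<subseteq> \<S>" "independent_family X" "D \<subseteq> X" for X using mx0 that by simp
 have stD: "stable G act (fs.span (\<Union>D))"
  by (rule stable_span_Union[OF lin]) (use D S simple_subD(1) in blast)+
 have "T \<subseteq> fs.span (\<Union>D)" if T: "T \<in> \<S>" for T
 proof (rule ccontr)
  assume not: "\<not> T \<subseteq> fs.span (\<Union>D)"
  have "T Int fs.span (\<Union>D) = {0} \<or> T Int fs.span (\<Union>D) = T"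
   by (rule simple_subD(3)[OF S[OF T] stable_Int[OF simple_subD(1)[OF S[OF T]] stD]]) auto
  then have z: "T Int fs.span (\<Union>D) = {0}" using not by blast
  have TD: "T \<notin> D" using not fs.span_base by blast
  have sT: "fs.subspace T" using S[OF T] simple_subD stableD by blast
  have "independent_family (insert T D)" unfolding independent_family_def
  proof
   fix N assume N: "N \<in> insert T D"
   show "N Int fs.span (\<Union>(insert T D - {N})) = {0}"
   proof (cases "N = T")
    case True
    then show ?thesis using z TD by simp
   next
    case False
    then have ND: "N \<in> D" using N by blast
    have "x = 0" if x: "x \<in> N" "x \<in> fs.span (\<Union>(insert T D - {N}))" for x
    proof -
     have eq: "\<Union>(insert T D - {N}) = T Un \<Union>(D - {N})" using False by blast
     obtain t y where ty: "x = t + y" "t \<in> T" "y \<in> fs.span (\<Union>(D - {N}))"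
      using x(2) unfolding eq fs.span_Un using sT fs.span_eq_iff by blast
     have "y \<in> fs.span (\<Union>D)" using ty(3) fs.span_mono[of "\<Union>(D - {N})" "\<Union>D"] by blast
     moreover have "x \<in> fs.span (\<Union>D)" using x(1) ND fs.span_base by blast
     ultimately have "x - y \<in> fs.span (\<Union>D)" using fs.span_diff by blast
     then have "t \<in> T Int fs.span (\<Union>D)" using ty by simp
     then have "t = 0" using z by blast
     then show ?thesis using ty x(1) ND D(2) unfolding independent_family_def by auto
    qed
    moreover have "0 \<in> N" using ND D sub0 by blast
    ultimately show ?thesis using fs.span_zero by blast
   qed
  qed
  then have "insert T D = D" using mx[of "insert T D"] T D(1) by blast
  then show False using TD by blast
 qed
 then have "fs.span (\<Union>\<S>) \<subseteq> fs.span (\<Union>D)" by (intro fs.span_minimal) auto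
 moreover have "fs.span (\<Union>D) \<subseteq> fs.span (\<Union>\<S>)" using D(1) by (intro fs.span_mono) auto
 ultimately show ?thesis using that D by blast
qed

lemma independent_family_sum_zero:
 assumes D: "independent_family D" and F: "finite F" "F \<subseteq> D" and sub: "!!N. N \<in> D ==> fs.subspace N"
  and v: "!!N. N \<in> F ==> v N \<in> N" "(\<Sum>N\<in>F. v N) = 0" and N: "N \<in> F"
 shows "v N = 0"
proof -
 have "v N + (\<Sum>N\<in>F-{N}. v N) = 0" using v(2) sum.remove[OF F(1) N, of v] by simp
 then have eq: "v N = - (\<Sum>N\<in>F-{N}. v N)" by (simp add: add_eq_0_iff2)
 have "(\<Sum>N\<in>F-{N}. v N) \<in> fs.span (\<Union>(D - {N}))"
  by (rule fs.span_sum, rule fs.span_base) (use v F in blast)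
 then have "v N \<in> fs.span (\<Union>(D - {N}))" unfolding eq by (rule fs.span_neg)
 then show ?thesis using D v(1)[OF N] N F(2) unfolding independent_family_def by blast
qed

definition eig :: "(('a => 'k::field) => 'a => 'k) => ('a => 'k) set => 'k => ('a => 'k) set" where
 "eig H N \<theta> = {u \<in> N. H u = fscale \<theta> u}"

lemma subspace_eig:
 assumes "flinear H" "fs.subspace N" shows "fs.subspace (eig H N \<theta>)"
 using assms(2) unfolding fs.subspace_def eig_def
 by (auto simp: fsp.linear_0[OF assms(1)] fsp.linear_add[OF assms(1)] fsp.linear_scale[OF assms(1)]
   fs.scale_right_distrib fs.scale_left_commute)

lemma eig_subset: "eig H N \<theta> \<subseteq> N" by (auto simp: eig_def)

text \<open>Independence forces every component of an eigenvector to be an eigenvector for the same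
  eigenvalue. One nonzero eigenvector from each summand that has any gives an independent set, so a
  finite-dimensional eigenspace involves finitely many summands even of an infinite family.\<close>

lemma dim_eig_decomposition:
 assumes H: "flinear H" and D: "independent_family D" and sub: "!!N. N \<in> D ==> fs.subspace N"
  and HN: "!!N u. N \<in> D ==> u \<in> N ==> H u \<in> N" and fin: "findim (eig H (fs.span (\<Union>D)) \<theta>)"
 shows "finite {N\<in>D. eig H N \<theta> ~= {0}}"
  and "fs.dim (eig H (fs.span (\<Union>D)) \<theta>) = (\<Sum>N | N \<in> D & eig H N \<theta> ~= {0}. fs.dim (eig H N \<theta>))"
proof -
 let ?F = "{N\<in>D. eig H N \<theta> ~= {0}}"
 let ?M = "fs.span (\<Union>D)"
 have sube: "fs.subspace (eig H N \<theta>)" if "N \<in> D" for N using subspace_eig[OF H sub[OF that]] .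
 have incl: "eig H N \<theta> \<subseteq> eig H ?M \<theta>" if "N \<in> D" for N
  using that fs.span_base unfolding eig_def by blast
 have "\<exists>x. x \<in> eig H N \<theta> & x ~= 0" if "N \<in> ?F" for N
  using that fs.subspace_0[OF sube] by blast
 then have "\<forall>N\<in>?F. \<exists>x. x \<in> eig H N \<theta> & x ~= 0" by (rule ballI)
 then obtain x where x': "\<forall>N\<in>?F. x N \<in> eig H N \<theta> & x N ~= 0" by (rule bchoice[THEN exE])
 have x: "x N \<in> eig H N \<theta> & x N ~= 0" if "N \<in> ?F" for N using bspec[OF x' that] .
 have xN: "x N \<in> N" if "N \<in> ?F" for N using x[OF that] by (simp add: eig_def)
 have nsp: "x N \<notin> fs.span (\<Union>(D - {N}))" if "N \<in> ?F" for N
  using x[OF that] xN[OF that] D that unfolding independent_family_def by blast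
 have inj: "inj_on x ?F"
 proof (rule inj_onI, rule ccontr)
  fix N N' assume NN: "N \<in> ?F" "N' \<in> ?F" "x N = x N'" "N ~= N'"
  then have "x N \<in> fs.span (\<Union>(D - {N}))" using xN[OF NN(2)] by (intro fs.span_base) auto
  then show False using nsp NN by blast
 qed
 have "fs.independent (x ` ?F)" unfolding fs.dependent_def
 proof
  assume "\<exists>a\<in>x ` ?F. a \<in> fs.span (x ` ?F - {a})"
  then obtain N where N: "N \<in> ?F" "x N \<in> fs.span (x ` ?F - {x N})" by blast
  have "x ` ?F - {x N} \<subseteq> \<Union>(D - {N})" using xN by blast
  then have "x N \<in> fs.span (\<Union>(D - {N}))" using N(2) fs.span_mono by blast
  then show False using nsp N by blast
 qed
 moreover obtain B where "finite B" "eig H ?M \<theta> \<subseteq> fs.span B" using fin findim_def by blast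
 moreover have "x ` ?F \<subseteq> eig H ?M \<theta>" using x incl by blast
 ultimately have "finite (x ` ?F)" using fs.independent_span_bound[of B "x ` ?F"] by blast
 then show finF: "finite ?F" using finite_imageD inj by blast
 have "eig H ?M \<theta> = fs.span (\<Union>N\<in>?F. eig H N \<theta>)"
 proof
  show "fs.span (\<Union>N\<in>?F. eig H N \<theta>) \<subseteq> eig H ?M \<theta>"
   by (rule fs.span_minimal[OF _ subspace_eig[OF H fs.subspace_span]]) (use incl in blast)
  show "eig H ?M \<theta> \<subseteq> fs.span (\<Union>N\<in>?F. eig H N \<theta>)"
  proof
   fix u assume u: "u \<in> eig H ?M \<theta>"
   then have "u \<in> ?M" "H u = fscale \<theta> u" by (auto simp: eig_def)
   obtain \<T> where T: "finite \<T>" "\<T> \<subseteq> D" "u \<in> fs.span (\<Union>\<T>)" using in_span_Union_finite[OF \<open>u \<in> ?M\<close>] by blast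
   have "fs.span (\<Union>T\<in>\<T>. T) = {\<Sum>T\<in>\<T>. v T |v. \<forall>T\<in>\<T>. v T \<in> T}"
    by (rule span_UN_eq_sums[OF T(1)]) (use T sub in blast)
   then obtain v where v: "u = (\<Sum>T\<in>\<T>. v T)" "\<forall>T\<in>\<T>. v T \<in> T" using T(3) by auto
   have "(\<Sum>T\<in>\<T>. H (v T) - fscale \<theta> (v T)) = H u - fscale \<theta> u"
    unfolding v(1) fsp.linear_sum[OF H] fs.scale_sum_right sum_subtractf ..
   also have "... = 0" using \<open>H u = fscale \<theta> u\<close> by simp
   finally have s0: "(\<Sum>T\<in>\<T>. H (v T) - fscale \<theta> (v T)) = 0" .
   have e: "v T \<in> eig H T \<theta>" if TT: "T \<in> \<T>" for T
   proof -
    have "H (v T) - fscale \<theta> (v T) = 0"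
    proof (rule independent_family_sum_zero[OF D T(1,2) sub _ s0 TT])
     fix N assume N: "N \<in> \<T>"
     then have ND: "N \<in> D" using T by blast
     show "H (v N) - fscale \<theta> (v N) \<in> N"
      using fs.subspace_diff[OF sub[OF ND] HN[OF ND] fs.subspace_scale[OF sub[OF ND]]] v N by blast
    qed
    then show ?thesis using v TT by (simp add: eig_def)
   qed
   show "u \<in> fs.span (\<Union>N\<in>?F. eig H N \<theta>)" unfolding v(1)
   proof (rule fs.span_sum)
    fix T assume TT: "T \<in> \<T>"
    show "v T \<in> fs.span (\<Union>N\<in>?F. eig H N \<theta>)"
    proof (cases "T \<in> ?F")
     case True
     then show ?thesis using e[OF TT] by (intro fs.span_base) blast
    next
     case False
     then have "v T = 0" using e[OF TT] T(2) TT by blast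
     then show ?thesis using fs.span_zero by simp
    qed
   qed
  qed
 qed
 also have "fs.dim (fs.span (\<Union>N\<in>?F. eig H N \<theta>)) = (\<Sum>N\<in>?F. fs.dim (eig H N \<theta>))"
 proof (rule dim_direct_sum[OF finF])
  fix N assume N: "N \<in> ?F"
  then have ND: "N \<in> D" by simp
  show "fs.subspace (eig H N \<theta>)" using sube[OF ND] .
  show "findim (eig H N \<theta>)" using findim_mono[OF fin incl[OF ND]] .
  fix v assume "!!i. i \<in> ?F ==> v i \<in> eig H i \<theta>" "(\<Sum>i\<in>?F. v i) = 0"
  then show "v N = 0" using independent_family_sum_zero[OF D finF _ sub, of v N] N eig_subset by blast
 qed
 finally show "fs.dim (eig H ?M \<theta>) = (\<Sum>N\<in>?F. fs.dim (eig H N \<theta>))" .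
qed

section \<open>Tensor powers\<close>

lemma vector_space_mult: "vector_space ((*) :: 'k::field => 'k => 'k)"
 by unfold_locales (auto simp: algebra_simps)

text \<open>The basis of W is numbered by 0, ..., m - 1 because the number of a basis vector becomes
  the index of the variable recording its weight.\<close>

locale wspace = finite_dimensional_vector_space sW BW
 for sW :: "'k::field_char_0 => 'w::ab_group_add => 'w" and BW +
 fixes b :: "nat => 'w" and m :: nat
 assumes b_bij: "bij_betw b {..<m} BW"
begin

abbreviation "dual \<equiv> dual_space sW"

abbreviation "lin \<equiv> Vector_Spaces.linear sW sW"

definition crd :: "nat => 'w => 'k" where
 "crd j w = representation BW w (b j)"

lemma linI: "(!!u v. X (u + v) = X u + X v) ==> (!!c u. X (sW c u) = sW c (X u)) ==> lin X"
 by (simp add: Vector_Spaces.linear_iff vector_space_axioms)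

lemma linD: assumes "lin X"
 shows "X (u + v) = X u + X v" "X (sW c u) = sW c (X u)" "X (\<Sum>i\<in>A. f i) = (\<Sum>i\<in>A. X (f i))"
proof -
 interpret Vector_Spaces.linear sW sW X by fact
 show "X (u + v) = X u + X v" "X (sW c u) = sW c (X u)" "X (\<Sum>i\<in>A. f i) = (\<Sum>i\<in>A. X (f i))"
  using add scale sum by auto
qed

lemma dual_iff: "\<xi> \<in> dual \<longleftrightarrow> (\<forall>u v. \<xi> (u + v) = \<xi> u + \<xi> v) & (\<forall>c u. \<xi> (sW c u) = c * \<xi> u)"
 by (simp add: dual_space_def Vector_Spaces.linear_iff vector_space_axioms vector_space_mult)

lemma dualD: assumes "\<xi> \<in> dual"
 shows "\<xi> (u + v) = \<xi> u + \<xi> v" "\<xi> (sW c u) = c * \<xi> u" "\<xi> (\<Sum>i\<in>A. f i) = (\<Sum>i\<in>A. \<xi> (f i))"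
proof -
 show add: "\<xi> (u + v) = \<xi> u + \<xi> v" for u v using assms by (simp add: dual_iff)
 show "\<xi> (sW c u) = c * \<xi> u" using assms by (simp add: dual_iff)
 have "\<xi> 0 = 0" using add[of 0 0] by simp
 then show "\<xi> (\<Sum>i\<in>A. f i) = (\<Sum>i\<in>A. \<xi> (f i))"
  by (induction A rule: infinite_finite_induct) (auto simp: add)
qed

lemma b_inj: "i < m ==> j < m ==> b i = b j \<longleftrightarrow> i = j"
 using b_bij by (auto simp: bij_betw_def inj_on_def)

lemma b_in: "i < m ==> b i \<in> BW"
 using b_bij by (auto simp: bij_betw_def)

lemma crd_dual: "crd j \<in> dual"
 unfolding dual_iff crd_def
 by (simp add: representation_add[OF independent_Basis] representation_scale[OF independent_Basis] span_Basis)

lemma crd_b: "i < m ==> j < m ==> crd j (b i) = (if i = j then 1 else 0)"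
 by (simp add: crd_def representation_basis[OF independent_Basis b_in] b_inj)

lemma crd_expand: "w = (\<Sum>j<m. sW (crd j w) (b j))"
proof -
 have "w = (\<Sum>x\<in>BW. sW (representation BW w x) x)"
  using sum_representation_eq[OF independent_Basis _ finite_Basis subset_refl, of w] by (simp add: span_Basis)
 also have "... = (\<Sum>j<m. sW (crd j w) (b j))"
  unfolding crd_def by (rule sum.reindex_bij_betw[OF b_bij, symmetric])
 finally show ?thesis .
qed

lemma dual_expand: assumes "\<xi> \<in> dual" shows "\<xi> w = (\<Sum>j<m. crd j w * \<xi> (b j))"
 using arg_cong[OF crd_expand[of w], of \<xi>] unfolding dualD[OF assms] .

lemma dual_comp: "\<xi> \<in> dual ==> lin X ==> \<xi> o X \<in> dual"
 unfolding dual_iff by (simp add: linD)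

lemma lin_id: "lin id" "lin (%w. w)" by (auto intro!: linI)
lemma lin_comp: "lin X ==> lin Y ==> lin (X o Y)" by (auto intro!: linI simp: linD)
lemma lin_pow: "lin X ==> lin (X ^^ i)" by (induction i) (auto simp: lin_id lin_comp)
lemma lin_sum: "(!!i. i \<in> A ==> lin (Y i)) ==> lin (%w. \<Sum>i\<in>A. Y i w)"
 by (rule linI) (auto simp: linD sum.distrib scale_sum_right intro!: sum.cong)
lemma lin_shift: "lin X ==> lin (%w. X w + sW c w)"
 by (rule linI) (auto simp: linD algebra_simps scale_right_distrib mult.commute)

lemma GL_lin: "g \<in> GL sW ==> lin g" by (simp add: GL_def)

lemma GL_inv: assumes "g \<in> GL sW" shows "inv g \<in> GL sW" "g o inv g = id" "inv g o g = id"
proof -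
 have g: "lin g" "bij g" using assms by (auto simp: GL_def)
 show "g o inv g = id" "inv g o g = id" using g(2) by (auto simp: bij_is_surj bij_is_inj surj_iff[symmetric])
 have "lin (inv g)"
 proof (rule linI)
  show "inv g (u + v) = inv g u + inv g v" for u v
   by (rule inv_f_eq[OF bij_is_inj[OF g(2)]]) (simp add: linD[OF g(1)] surj_f_inv_f bij_is_surj[OF g(2)])
  show "inv g (sW c u) = sW c (inv g u)" for u c
   by (rule inv_f_eq[OF bij_is_inj[OF g(2)]]) (simp add: linD[OF g(1)] surj_f_inv_f bij_is_surj[OF g(2)])
 qed
 then show "inv g \<in> GL sW" using bij_imp_bij_inv[OF g(2)] by (simp add: GL_def)
qed

lemma GL_comp: "g \<in> GL sW ==> h \<in> GL sW ==> g o h \<in> GL sW"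
 by (auto simp: GL_def intro: lin_comp bij_comp)

lemma GL_id: "id \<in> GL sW" by (simp add: GL_def lin_id)

text \<open>The matrix unit with entry 1 in row \<open>i\<close> and column
  \<open>j\<close>.\<close>

definition unit :: "nat => nat => 'w => 'w" where
 "unit i j w = sW (crd j w) (b i)"

lemma lin_unit: "lin (unit i j)"
 by (rule linI) (simp_all add: unit_def dualD[OF crd_dual] scale_left_distrib)

definition dfam :: "'i set => ('i => 'w => 'k) => bool" where
 "dfam I \<xi> \<longleftrightarrow> (\<forall>c\<in>I. \<xi> c \<in> dual)"

abbreviation "pt \<equiv> pure_tensor sW"
abbreviation "E \<equiv> tensor_power sW"
abbreviation idx :: "'i set => ('i => nat) set" where "idx I \<equiv> PiE I (%_. {..<m})"

definition et :: "'i set => ('i => nat) => ('i => 'w => 'k) => 'k" where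
 "et I T = pt I (b o T)"

text \<open>The family of coordinate forms dual to a basis tensor: evaluating a tensor at it reads
  off the coefficient of that basis tensor.\<close>

definition bt :: "('i => nat) => 'i => 'w => 'k" where
 "bt T = (%c. crd (T c))"

lemma pt_apply: "pt I w \<xi> = (if dfam I \<xi> then \<Prod>c\<in>I. \<xi> c (w c) else 0)"
 by (simp add: pure_tensor_def dfam_def)

lemma dfam_bt: "dfam I (bt T)"
 by (simp add: dfam_def bt_def crd_dual)

lemma pt_in_E: "pt I w \<in> E I"
 unfolding tensor_power_def by (rule fs.span_base) simp

lemma et_in_E: "et I T \<in> E I"
 unfolding et_def by (rule pt_in_E)

lemma E_subspace: "fs.subspace (E I)"
 unfolding tensor_power_def by (rule fs.subspace_span)

lemma E_eqI:
 assumes "flinear f" "flinear g" "!!w. f (pt I w) = g (pt I w)" "t \<in> E I"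
 shows "f t = g t"
 using fsp.linear_eq_on_span[OF assms(1,2), of "range (pt I)" t] assms(3,4) unfolding tensor_power_def by blast

lemma E_memI:
 assumes "flinear f" "fs.subspace S" "!!w. f (pt I w) \<in> S" "t \<in> E I"
 shows "f t \<in> S"
proof -
 have "E I \<subseteq> f -` S" unfolding tensor_power_def
  by (rule fs.span_minimal[OF _ fsp.linear_subspace_vimage[OF assms(1,2)]]) (use assms(3) in auto)
 then show ?thesis using assms(4) by auto
qed

lemma flinear_id: "flinear (%t. t)" by (rule flinearI) auto
lemma flinear_compose: "flinear F ==> flinear F' ==> flinear (%t. F (F' t))"
 by (rule flinearI) (simp_all only: fsp.linear_add fsp.linear_scale)
lemma flinear_sum: "(!!i. i \<in> A ==> flinear (F i)) ==> flinear (%t. \<Sum>i\<in>A. F i t)"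
 by (rule fsp.linear_compose_sum) auto
lemma flinear_scale: "flinear F ==> flinear (%t. fscale c (F t))"
 using flinear_compose[of "fscale c" F] by (simp add: flinearI fs_simps algebra_simps)
lemma flinear_coord: "flinear (%t. fscale (t x) y)"
 by (rule flinearI) (auto simp: fs_simps algebra_simps)


lemma pt_expand:
 assumes "finite I"
 shows "pt I w = (\<Sum>T\<in>idx I. fscale (\<Prod>c\<in>I. crd (T c) (w c)) (et I T))"
proof
 fix \<xi>
 show "pt I w \<xi> = (\<Sum>T\<in>idx I. fscale (\<Prod>c\<in>I. crd (T c) (w c)) (et I T)) \<xi>"
 proof (cases "dfam I \<xi>")
  case True
  have "pt I w \<xi> = (\<Prod>c\<in>I. \<Sum>j<m. crd j (w c) * \<xi> c (b j))"
   using True by (auto simp: pt_apply dfam_def intro!: prod.cong dual_expand)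
  also have "... = (\<Sum>T\<in>idx I. \<Prod>c\<in>I. crd (T c) (w c) * \<xi> c (b (T c)))"
   by (rule prod_sum_PiE[OF assms]) auto
  finally show ?thesis using True
   by (simp add: sum_fun_apply fscale_apply et_def pt_apply prod.distrib)
 next
  case False
  then show ?thesis by (simp add: sum_fun_apply fscale_apply et_def pt_apply)
 qed
qed

lemma finite_idx: "finite I ==> finite (idx I)" by (simp add: finite_PiE)

lemma et_bt:
 assumes "finite I" "S \<in> idx I" "T \<in> idx I"
 shows "et I T (bt S) = (if S = T then 1 else 0)"
proof -
 have "et I T (bt S) = (\<Prod>c\<in>I. bt S c (b (T c)))" by (simp add: et_def pt_apply dfam_bt)
 also have "... = (\<Prod>c\<in>I. if S c = T c then 1 else 0)"
  using assms by (intro prod.cong) (auto simp: bt_def crd_b PiE_iff)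
 also have "... = (if \<forall>c\<in>I. S c = T c then 1 else 0)"
  using assms(1) by auto
 finally show ?thesis using assms(2,3) PiE_ext by (metis (no_types, lifting))
qed

lemma E_expand:
 assumes "finite I" "t \<in> E I"
 shows "t = (\<Sum>T\<in>idx I. fscale (t (bt T)) (et I T))"
proof (rule E_eqI[OF _ _ _ assms(2), where f="%t. t" and g="%t. \<Sum>T\<in>idx I. fscale (t (bt T)) (et I T)"])
 show "flinear (%t. \<Sum>T\<in>idx I. fscale (t (bt T)) (et I T))" by (intro flinear_sum flinear_coord)
 show "pt I w = (\<Sum>T\<in>idx I. fscale (pt I w (bt T)) (et I T))" for w
 proof -
  have "pt I w (bt T) = (\<Prod>c\<in>I. crd (T c) (w c))" for T
   by (simp add: pt_apply dfam_bt) (simp add: bt_def)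
  then show ?thesis using pt_expand[OF assms(1), of w] by (simp only:)
 qed
qed (rule flinear_id)

lemma E_span: "finite I ==> E I = fs.span (et I ` idx I)"
proof
 assume "finite I"
 show "E I \<subseteq> fs.span (et I ` idx I)"
 proof
  fix t assume t: "t \<in> E I"
  have "(\<Sum>T\<in>idx I. fscale (t (bt T)) (et I T)) \<in> fs.span (et I ` idx I)"
   by (intro fs.span_sum fs.span_scale fs.span_base imageI)
  then show "t \<in> fs.span (et I ` idx I)" using E_expand[OF \<open>finite I\<close> t] by simp
 qed
 show "fs.span (et I ` idx I) \<subseteq> E I"
  by (rule fs.span_minimal[OF _ E_subspace]) (auto simp: et_in_E)
qed

lemma E_findim: "finite I ==> findim (E I)"
 by (simp add: E_span findim_span finite_idx)

text \<open>The tensor product of the operators \<open>Y c\<close>, each acting in its own position.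
  The value 0 at families with a non-linear entry matches the convention for pure tensors; composing
  with a singular \<open>Y c\<close> could otherwise turn such a family into a linear one.\<close>

definition opf :: "'i set => ('i => 'w => 'w) => (('i => 'w => 'k) => 'k) => ('i => 'w => 'k) => 'k" where
 "opf I Y t = (%\<xi>. if dfam I \<xi> then t (%c. \<xi> c o Y c) else 0)"

lemma flinear_opf: "flinear (opf I Y)"
 by (rule flinearI) (auto simp: opf_def fs_simps)

lemma dfam_comp: "dfam I \<xi> ==> (!!c. c \<in> I ==> lin (Y c)) ==> dfam I (%c. \<xi> c o Y c)"
 by (simp add: dfam_def dual_comp)

lemma opf_pt: "(!!c. c \<in> I ==> lin (Y c)) ==> opf I Y (pt I w) = pt I (%c. Y c (w c))"
 by (auto simp: opf_def pt_apply dfam_comp fun_eq_iff)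

lemma opf_E: "(!!c. c \<in> I ==> lin (Y c)) ==> t \<in> E I ==> opf I Y t \<in> E I"
 by (rule E_memI[OF flinear_opf E_subspace]) (simp_all add: opf_pt pt_in_E)

lemma opf_comp: "(!!c. c \<in> I ==> lin (Y c)) ==> opf I Y (opf I Z t) = opf I (%c. Y c o Z c) t"
 by (auto simp: opf_def dfam_comp comp_assoc fun_eq_iff)

lemma opf_cong:
 assumes "!!c. c \<in> I ==> Y c = Z c" "!!c. c \<in> I ==> lin (Z c)" "t \<in> E I" shows "opf I Y t = opf I Z t"
proof (rule E_eqI[OF flinear_opf flinear_opf _ assms(3)])
 fix w show "opf I Y (pt I w) = opf I Z (pt I w)"
  using assms(1,2) by (simp add: opf_pt) (auto simp: pt_apply fun_eq_iff intro!: prod.cong)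
qed

definition tact :: "('w => 'w) => (('i => 'w => 'k) => 'k) => ('i => 'w => 'k) => 'k" where
 "tact g t = (%\<xi>. t (%c. \<xi> c o g))"

lemma flinear_tact: "flinear (tact g)"
 by (rule flinearI) (auto simp: tact_def fs_simps)

text \<open>Invertibility of \<open>g\<close> makes a form linear exactly when its composition with
  \<open>g\<close> is linear. This reconciles the default value 0 of pure tensors with an action by
  mere substitution.\<close>

lemma tact_pt:
 fixes I :: "'i set"
 assumes "g \<in> GL sW" shows "tact g (pt I w) = pt I (g o w)"
proof
 fix \<xi> :: "'i => 'w => 'k"
 have "\<xi> c \<in> dual" if "\<xi> c o g \<in> dual" for c
  using dual_comp[OF that GL_lin[OF GL_inv(1)[OF assms]]] GL_inv(2)[OF assms]
  by (simp add: comp_assoc)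
 then have "dfam I (%c. \<xi> c o g) \<longleftrightarrow> dfam I \<xi>"
  using GL_lin[OF assms] by (auto simp: dfam_def dual_comp)
 then show "tact g (pt I w) \<xi> = pt I (g o w) \<xi>" by (simp add: tact_def pt_apply)
qed

lemma tact_opf: assumes "g \<in> GL sW" "t \<in> E I" shows "tact g t = opf I (%_. g) t"
 by (rule E_eqI[OF flinear_tact flinear_opf _ assms(2)])
   (simp add: tact_pt[OF assms(1)] opf_pt GL_lin[OF assms(1)] comp_def)

lemma E_stable: "stable (GL sW) tact (E I)"
 unfolding stable_def using E_subspace by (auto simp: tact_opf intro!: opf_E GL_lin)

text \<open>The r-th elementary symmetric function of the commuting operators that apply
  \<open>X\<close> in a single position. These are the coefficients obtained when the tensor power
  of \<open>X\<close> plus a scalar is expanded.\<close>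

definition erop :: "'i set => nat => ('w => 'w) => (('i => 'w => 'k) => 'k) => ('i => 'w => 'k) => 'k" where
 "erop I r X t = (\<Sum>J | J \<subseteq> I & card J = r. opf I (%c. if c \<in> J then X else id) t)"

lemma opf_shift:
 assumes I: "finite I" and X: "lin X" and t: "t \<in> E I"
 shows "opf I (%_ w. X w + sW s w) t = (\<Sum>r\<le>card I. fscale (s ^ r) (erop I (card I - r) X t))"
proof -
 let ?Y = "%J c. if c \<in> J then X else id"
 have lY: "lin (?Y J c)" for J c using X lin_id by auto
 have "opf I (%_ w. X w + sW s w) t = (\<Sum>J\<in>Pow I. fscale (s ^ card (I - J)) (opf I (?Y J) t))"
 proof (rule E_eqI[OF flinear_opf _ _ t, where g="%t. \<Sum>J\<in>Pow I. fscale (s ^ card (I - J)) (opf I (?Y J) t)"])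
  show "flinear (%t. \<Sum>J\<in>Pow I. fscale (s ^ card (I - J)) (opf I (?Y J) t))"
   by (intro flinear_sum flinear_scale flinear_opf)
  fix w
  have "opf I (%_ w. X w + sW s w) (pt I w) = pt I (%c. X (w c) + sW s (w c))"
   by (rule opf_pt) (rule lin_shift[OF X])
  also have "... = (\<Sum>J\<in>Pow I. fscale (s ^ card (I - J)) (pt I (%c. ?Y J c (w c))))"
  proof
   fix \<xi>
   show "pt I (%c. X (w c) + sW s (w c)) \<xi> = (\<Sum>J\<in>Pow I. fscale (s ^ card (I - J)) (pt I (%c. ?Y J c (w c)))) \<xi>"
   proof (cases "dfam I \<xi>")
    case True
    have "pt I (%c. X (w c) + sW s (w c)) \<xi> = (\<Prod>c\<in>I. \<xi> c (X (w c)) + s * \<xi> c (w c))"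
     using True by (auto simp: pt_apply dfam_def dualD intro!: prod.cong)
    also have "... = (\<Sum>J\<in>Pow I. (\<Prod>c\<in>J. \<xi> c (X (w c))) * (\<Prod>c\<in>I-J. s * \<xi> c (w c)))"
     by (rule prod_add[OF I])
    also have "... = (\<Sum>J\<in>Pow I. s ^ card (I - J) * (\<Prod>c\<in>I. \<xi> c (?Y J c (w c))))"
    proof (rule sum.cong[OF refl])
     fix J assume "J \<in> Pow I"
     then have J: "J \<subseteq> I" by simp
     have "(\<Prod>c\<in>I. \<xi> c (?Y J c (w c))) = (\<Prod>c\<in>I-J. \<xi> c (?Y J c (w c))) * (\<Prod>c\<in>J. \<xi> c (?Y J c (w c)))"
      by (rule prod.subset_diff[OF J I])
     also have "... = (\<Prod>c\<in>I-J. \<xi> c (w c)) * (\<Prod>c\<in>J. \<xi> c (X (w c)))"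
      by (intro arg_cong2[where f="(*)"] prod.cong) auto
     finally show "(\<Prod>c\<in>J. \<xi> c (X (w c))) * (\<Prod>c\<in>I-J. s * \<xi> c (w c)) = s ^ card (I - J) * (\<Prod>c\<in>I. \<xi> c (?Y J c (w c)))"
      by (simp add: prod.distrib)
    qed
    finally show ?thesis using True by (simp add: sum_fun_apply fscale_apply pt_apply)
   next
    case False
    then show ?thesis by (simp add: sum_fun_apply fscale_apply pt_apply)
   qed
  qed
  also have "... = (\<Sum>J\<in>Pow I. fscale (s ^ card (I - J)) (opf I (?Y J) (pt I w)))"
   by (simp add: opf_pt[OF lY])
  finally show "opf I (%_ w. X w + sW s w) (pt I w) = (\<Sum>J\<in>Pow I. fscale (s ^ card (I - J)) (opf I (?Y J) (pt I w)))" .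
 qed
 also have "... = (\<Sum>r\<le>card I. \<Sum>J\<in>{J\<in>Pow I. card (I - J) = r}. fscale (s ^ card (I - J)) (opf I (?Y J) t))"
  by (rule sum.group[symmetric]) (use I in \<open>auto intro: card_mono\<close>)
 also have "... = (\<Sum>r\<le>card I. fscale (s ^ r) (erop I (card I - r) X t))"
 proof (rule sum.cong[OF refl])
  fix r assume r: "r \<in> {..card I}"
  have "card (I - J) = r \<longleftrightarrow> card J = card I - r" if "J \<subseteq> I" for J
   using card_Diff_subset[OF finite_subset[OF that I] that] card_mono[OF I that] r by auto
  then have "{J\<in>Pow I. card (I - J) = r} = {J. J \<subseteq> I & card J = card I - r}" by auto
  then show "(\<Sum>J\<in>{J\<in>Pow I. card (I - J) = r}. fscale (s ^ card (I - J)) (opf I (?Y J) t)) = fscale (s ^ r) (erop I (card I - r) X t)"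
   unfolding erop_def fs.scale_sum_right
   by (intro sum.cong) auto
 qed
 finally show ?thesis .
qed

text \<open>The shift by s is singular only if -s is an eigenvalue of \<open>X\<close>. Eigenvectors
  for distinct eigenvalues are independent, so at most dim W values of s are excluded, while a field
  of characteristic 0 is infinite.\<close>

lemma infinite_invertible_shifts:
 assumes X: "lin X" shows "infinite {s. (%w. X w + sW s w) \<in> GL sW}"
proof -
 let ?g = "%s w. X w + sW s w"
 let ?B = "{s. \<exists>w. w ~= 0 & X w = sW (- s) w}"
 have "finite ?B"
 proof (rule ccontr)
  assume "infinite ?B"
  then obtain F where F: "F \<subseteq> ?B" "card F = Suc (card BW)" "finite F"
   using infinite_arbitrarily_large by blast
  have "\<forall>s\<in>F. \<exists>w. w ~= 0 & X w = sW (- s) w" using F by auto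
  then obtain v where v: "\<forall>s\<in>F. v s ~= 0 & X (v s) = sW (- s) (v s)" by (rule bchoice[THEN exE])
  have inj: "inj_on v F"
  proof (rule inj_onI)
   fix s s' assume s: "s \<in> F" "s' \<in> F" "v s = v s'"
   then have "sW (- s) (v s) = sW (- s') (v s)" using v by metis
   then show "s = s'" using v s by simp
  qed
  have "independent (v ` F)"
  proof (rule independent_if_scalars_zero)
   show "finite (v ` F)" using F by simp
   fix f x assume z: "(\<Sum>x\<in>v ` F. sW (f x) x) = 0" and x: "x \<in> v ` F"
   then obtain s where s: "s \<in> F" "x = v s" by blast
   have z': "(\<Sum>s\<in>F. sW (f (v s)) (v s)) \<in> {0}" using z by (simp add: sum.reindex[OF inj])
   have "sW (f (v s)) (v s) \<in> {0}"
   proof (rule eigen_components_in_subspace[OF X _ _ F(3) _ _ z' s(1), where \<theta>="%s. - s"])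
    show "X u \<in> {0}" if "u \<in> {0}" for u using that linD(2)[OF X, of 0 0] by simp
    show "X (sW (f (v i)) (v i)) = sW (- i) (sW (f (v i)) (v i))" if "i \<in> F" for i
     using v that by (simp add: linD[OF X] mult.commute)
   qed (auto simp: inj_on_def)
   then show "f x = 0" using v s by simp
  qed
  then have "card (v ` F) \<le> card BW"
   using independent_span_bound[OF finite_Basis, of "v ` F"] by (simp add: span_Basis)
  then show False using F(2) card_image[OF inj] by simp
 qed
 moreover have "- ?B \<subseteq> {s. ?g s \<in> GL sW}"
 proof
  fix s assume s: "s \<in> - ?B"
  have l: "lin (?g s)" by (rule lin_shift[OF X])
  interpret g: Vector_Spaces.linear sW sW "?g s" by (fact l)
  have "w = 0" if "?g s w = 0" for w
   using s that by (auto simp: add_eq_0_iff2)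
  then have "inj (?g s)" unfolding g.inj_iff_eq_0 by blast
  moreover interpret pr: finite_dimensional_vector_space_pair sW BW sW BW ..
  have "surj (?g s)" using pr.linear_injective_imp_surjective[OF l] \<open>inj (?g s)\<close> by blast
  ultimately show "s \<in> {s. ?g s \<in> GL sW}" using l by (simp add: GL_def bij_def)
 qed
 ultimately have "UNIV = ?B Un {s. ?g s \<in> GL sW}" "finite ?B" by blast+
 show ?thesis
 proof
  assume "finite {s. ?g s \<in> GL sW}"
  then have "finite (UNIV :: 'k set)" using \<open>UNIV = _\<close> \<open>finite ?B\<close> by (metis (lifting) finite_UnI)
  then show False using infinite_UNIV_char_0 by blast
 qed
qed

text \<open>\<open>N\<close> contains the images of \<open>v\<close> under infinitely many
  invertible shifts of \<open>X\<close>, and interpolation in the shift extracts each coefficient.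
  So stability under GL(W) extends to tensor powers of singular operators, for
  \<open>r = card I\<close>, and to derivations, for r = 1.\<close>

lemma erop_in_stable:
 assumes I: "finite I" and X: "lin X" and N: "stable (GL sW) tact N" "N \<subseteq> E I" and v: "v \<in> N" and r: "r \<le> card I"
 shows "erop I r X v \<in> N"
proof -
 have "erop I (card I - (card I - r)) X v \<in> N"
 proof (rule poly_coeffs_in_subspace[OF infinite_invertible_shifts[OF X] stableD(1)[OF N(1)], where n="card I"
   and v="%r. erop I (card I - r) X v" and r="card I - r"])
  fix s assume "s \<in> {s. (%w. X w + sW s w) \<in> GL sW}"
  then have g: "(%w. X w + sW s w) \<in> GL sW" by simp
  have "tact (%w. X w + sW s w) v \<in> N" using stableD(2)[OF N(1) g v] .
  then show "(\<Sum>r\<le>card I. fscale (s ^ r) (erop I (card I - r) X v)) \<in> N"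
   using tact_opf[OF g, of v I] opf_shift[OF I X, of v s] N(2) v by auto
 qed simp
 then show ?thesis using r by simp
qed

lemma opf_const_in_stable:
 assumes I: "finite I" and X: "lin X" and N: "stable (GL sW) tact N" "N \<subseteq> E I" and v: "v \<in> N"
 shows "opf I (%_. X) v \<in> N"
proof -
 have "{J. J \<subseteq> I & card J = card I} = {I}" using I card_subset_eq by blast
 then have "erop I (card I) X v = opf I (%c. if c \<in> I then X else id) v" by (simp add: erop_def)
 also have "... = opf I (%_. X) v" by (rule opf_cong) (use X v N in auto)
 finally show ?thesis using erop_in_stable[OF I X N v order_refl] by simp
qed

end

section \<open>Polarization and the commutant of the symmetric group\<close>

lemma sum_alternating_Pow:
 "finite A ==> (\<Sum>K\<in>Pow A. (-1) ^ card K) = (if A = {} then 1 else 0 :: 'k::comm_ring_1)"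
 using prod_add[of A "%_. -1 :: 'k" "%_. 1"] by (cases "A = {}") (simp_all add: zero_power card_gt_0_iff)

text \<open>A map \<open>f\<close> is weighted by the alternating sum over all \<open>J\<close>
  containing its image, which vanishes unless the image is all of \<open>I\<close>. Self-maps of a
  finite set that are onto are permutations.\<close>

lemma inclusion_exclusion_surjections:
 fixes F :: "('i => 'i) => 'k::comm_ring_1"
 assumes I: "finite I"
 shows "(\<Sum>J\<in>Pow I. (-1) ^ card (I - J) * (\<Sum>f\<in>PiE I (%_. J). F f))
  = (\<Sum>p | p permutes I. F (restrict p I))"
proof -
 have PiE_J: "{f \<in> PiE I (%_. I). f ` I \<subseteq> J} = PiE I (%_. J)" if "J \<subseteq> I" for J
  using that by (auto simp: PiE_iff extensional_def)
 have fin: "finite (PiE I (%_. I))" using I by (simp add: finite_PiE)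
 have "(\<Sum>J\<in>Pow I. (-1) ^ card (I - J) * (\<Sum>f\<in>PiE I (%_. J). F f))
   = (\<Sum>J\<in>Pow I. \<Sum>f\<in>PiE I (%_. I). if f ` I \<subseteq> J then (-1) ^ card (I - J) * F f else 0)"
 proof (rule sum.cong[OF refl])
  fix J assume J: "J \<in> Pow I"
  have "(\<Sum>f\<in>PiE I (%_. I). if f ` I \<subseteq> J then (-1) ^ card (I - J) * F f else 0)
    = (\<Sum>f\<in>{f \<in> PiE I (%_. I). f ` I \<subseteq> J}. (-1) ^ card (I - J) * F f)"
   by (rule sum.inter_filter[OF fin, symmetric])
  then show "(-1) ^ card (I - J) * (\<Sum>f\<in>PiE I (%_. J). F f)
   = (\<Sum>f\<in>PiE I (%_. I). if f ` I \<subseteq> J then (-1) ^ card (I - J) * F f else 0)"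
   using J by (simp add: PiE_J sum_distrib_left)
 qed
 also have "... = (\<Sum>f\<in>PiE I (%_. I). \<Sum>J\<in>Pow I. if f ` I \<subseteq> J then (-1) ^ card (I - J) * F f else 0)"
  by (rule sum.swap)
 also have "... = (\<Sum>f\<in>PiE I (%_. I). if f ` I = I then F f else 0)"
 proof (rule sum.cong[OF refl])
  fix f assume f: "f \<in> PiE I (%_. I)"
  then have fI: "f ` I \<subseteq> I" by auto
  have "(\<Sum>J\<in>Pow I. if f ` I \<subseteq> J then (-1) ^ card (I - J) * F f else 0)
    = (\<Sum>J\<in>{J\<in>Pow I. f ` I \<subseteq> J}. (-1) ^ card (I - J) * F f)"
   by (rule sum.inter_filter[symmetric]) (use I in simp)
  also have "... = (\<Sum>K\<in>Pow (I - f ` I). (-1) ^ card K * F f)"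
   by (rule sum.reindex_bij_witness[of _ "%K. I - K" "%J. I - J"]) (use fI in \<open>auto simp: double_diff\<close>)
  also have "... = (if f ` I = I then F f else 0)"
   using fI I by (auto simp: sum_alternating_Pow sum_distrib_right[symmetric])
  finally show "(\<Sum>J\<in>Pow I. if f ` I \<subseteq> J then (-1) ^ card (I - J) * F f else 0) = (if f ` I = I then F f else 0)" .
 qed
 also have "... = (\<Sum>f\<in>{f\<in>PiE I (%_. I). f ` I = I}. F f)"
  by (rule sum.inter_filter[OF fin, symmetric])
 also have "... = (\<Sum>p | p permutes I. F (restrict p I))"
 proof (rule sum.reindex_bij_witness[of _ "%p. restrict p I" "%f c. if c \<in> I then f c else c"])
  fix f assume "f \<in> {f\<in>PiE I (%_. I). f ` I = I}"
  then have f: "f \<in> PiE I (%_. I)" "f ` I = I" by auto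
  then show r: "restrict (%c. if c \<in> I then f c else c) I = f"
   by (auto simp: restrict_def fun_eq_iff PiE_iff extensional_def)
  show "F (restrict (%c. if c \<in> I then f c else c) I) = F f" by (simp only: r)
  have "inj_on f I" using f I by (simp add: eq_card_imp_inj_on)
  then show "(%c. if c \<in> I then f c else c) \<in> {p. p permutes I}"
   using f(2) by (auto simp: bij_betw_def inj_on_def intro!: bij_imp_permutes)
 next
  fix p assume "p \<in> {p. p permutes I}"
  then have p: "p permutes I" by simp
  show "(%c. if c \<in> I then restrict p I c else c) = p"
   using p by (auto simp: fun_eq_iff permutes_def)
  show "restrict p I \<in> {f\<in>PiE I (%_. I). f ` I = I}"
   using permutes_image[OF p] by (auto simp: PiE_iff)
 qed
 finally show ?thesis .
qed

context wspace
begin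

text \<open>Expanding the tensor power of the sum of the \<open>Y i\<close> with
  \<open>i \<in> J\<close> gives one term for each map from positions to \<open>J\<close>;
  inclusion-exclusion keeps the bijective ones.\<close>

lemma polarization:
 assumes I: "finite I" and Y: "!!i. i \<in> I ==> lin (Y i)" and t: "t \<in> E I"
 shows "(\<Sum>p | p permutes I. opf I (%c. Y (p c)) t)
  = (\<Sum>J\<in>Pow I. fscale ((-1) ^ card (I - J)) (opf I (%_ w. \<Sum>i\<in>J. Y i w) t))"
proof (rule E_eqI[OF _ _ _ t, where f="%t. \<Sum>p | p permutes I. opf I (%c. Y (p c)) t"
  and g="%t. \<Sum>J\<in>Pow I. fscale ((-1) ^ card (I - J)) (opf I (%_ w. \<Sum>i\<in>J. Y i w) t)"])
 show "flinear (%t. \<Sum>p | p permutes I. opf I (%c. Y (p c)) t)" by (intro flinear_sum flinear_opf)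
 show "flinear (%t. \<Sum>J\<in>Pow I. fscale ((-1) ^ card (I - J)) (opf I (%_ w. \<Sum>i\<in>J. Y i w) t))"
  by (intro flinear_sum flinear_scale flinear_opf)
 fix w
 have 1: "opf I (%c. Y (p c)) (pt I w) = pt I (%c. Y (p c) (w c))" if "p permutes I" for p
  by (rule opf_pt, rule Y) (use that in \<open>simp add: permutes_in_image\<close>)
 have 2: "opf I (%_ w. \<Sum>i\<in>J. Y i w) (pt I w) = pt I (%c. \<Sum>i\<in>J. Y i (w c))" if "J \<in> Pow I" for J
  by (rule opf_pt, rule lin_sum, rule Y) (use that in auto)
 have "(\<Sum>p | p permutes I. pt I (%c. Y (p c) (w c))) \<xi>
   = (\<Sum>J\<in>Pow I. fscale ((-1) ^ card (I - J)) (pt I (%c. \<Sum>i\<in>J. Y i (w c)))) \<xi>" for \<xi>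
 proof (cases "dfam I \<xi>")
  case True
  have "(\<Sum>J\<in>Pow I. fscale ((-1) ^ card (I - J)) (pt I (%c. \<Sum>i\<in>J. Y i (w c)))) \<xi>
    = (\<Sum>J\<in>Pow I. (-1) ^ card (I - J) * (\<Prod>c\<in>I. \<Sum>i\<in>J. \<xi> c (Y i (w c))))"
   using True by (auto simp: sum_fun_apply fscale_apply pt_apply dfam_def dualD intro!: sum.cong prod.cong)
  also have "... = (\<Sum>J\<in>Pow I. (-1) ^ card (I - J) * (\<Sum>f\<in>PiE I (%_. J). \<Prod>c\<in>I. \<xi> c (Y (f c) (w c))))"
   by (intro sum.cong refl arg_cong2[where f="(*)"] prod_sum_PiE) (use I finite_subset in auto)
  also have "... = (\<Sum>p | p permutes I. \<Prod>c\<in>I. \<xi> c (Y (restrict p I c) (w c)))"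
   by (rule inclusion_exclusion_surjections[OF I])
  finally show ?thesis using True by (simp add: sum_fun_apply pt_apply)
 next
  case False
  then show ?thesis by (simp add: sum_fun_apply fscale_apply pt_apply)
 qed
 then have 3: "(\<Sum>p | p permutes I. pt I (%c. Y (p c) (w c)))
   = (\<Sum>J\<in>Pow I. fscale ((-1) ^ card (I - J)) (pt I (%c. \<Sum>i\<in>J. Y i (w c))))" by (rule ext)
 have "(\<Sum>p | p permutes I. opf I (%c. Y (p c)) (pt I w)) = (\<Sum>p | p permutes I. pt I (%c. Y (p c) (w c)))"
  by (rule sum.cong[OF refl], rule 1) simp
 also note 3
 also have "(\<Sum>J\<in>Pow I. fscale ((-1) ^ card (I - J)) (pt I (%c. \<Sum>i\<in>J. Y i (w c))))
   = (\<Sum>J\<in>Pow I. fscale ((-1) ^ card (I - J)) (opf I (%_ w. \<Sum>i\<in>J. Y i w) (pt I w)))"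
  by (rule sum.cong[OF refl], rule arg_cong[where f="fscale _"], rule 2[symmetric])
 finally show "(\<Sum>p | p permutes I. opf I (%c. Y (p c)) (pt I w))
  = (\<Sum>J\<in>Pow I. fscale ((-1) ^ card (I - J)) (opf I (%_ w. \<Sum>i\<in>J. Y i w) (pt I w)))" .
qed

definition pact :: "('i => 'i) => (('i => 'w => 'k) => 'k) => ('i => 'w => 'k) => 'k" where
 "pact p t = (%\<xi>. t (\<xi> o p))"

lemma flinear_pact: "flinear (pact p)"
 by (rule flinearI) (auto simp: pact_def fs_simps)

lemma pact_pact: "pact p (pact q t) = pact (p o q) t"
 by (simp add: pact_def comp_assoc)

lemma pact_id: "pact id t = t"
 by (simp add: pact_def)

lemma pact_pt: assumes "p permutes I" shows "pact p (pt I w) = pt I (w o inv p)"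
proof
 fix \<xi>
 have d: "dfam I (\<xi> o p) \<longleftrightarrow> dfam I \<xi>"
  using permutes_image[OF assms] unfolding dfam_def by (metis (no_types, lifting) comp_apply imageE imageI)
 have "(\<Prod>c\<in>I. \<xi> c (w (inv p c))) = (\<Prod>c\<in>I. \<xi> (p c) (w (inv p (p c))))"
  using prod.permute[OF assms, of "%c. \<xi> c (w (inv p c))"] by (simp add: comp_def)
 then show "pact p (pt I w) \<xi> = pt I (w o inv p) \<xi>"
  using d by (simp add: pact_def pt_apply permutes_inverses[OF assms])
qed

lemma pact_E: "p permutes I ==> t \<in> E I ==> pact p t \<in> E I"
 by (rule E_memI[OF flinear_pact E_subspace]) (simp_all add: pact_pt pt_in_E)

lemma tact_pact: "tact g (pact p t) = pact p (tact g t)"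
 by (simp add: tact_def pact_def comp_def)

lemma idx_comp: "p permutes I ==> T \<in> idx I ==> T o p \<in> idx I"
 by (auto simp: PiE_iff extensional_def permutes_in_image permutes_not_in)

lemma opf_unit:
 assumes I: "finite I" and t: "t \<in> E I"
 shows "opf I (%c. unit (S c) (T c)) t = fscale (t (bt T)) (et I S)"
proof (rule E_eqI[OF flinear_opf flinear_coord[where x="bt T" and y="et I S"] _ t])
 fix w
 have "opf I (%c. unit (S c) (T c)) (pt I w) = pt I (%c. unit (S c) (T c) (w c))" by (rule opf_pt[OF lin_unit])
 also have "... = fscale (pt I w (bt T)) (et I S)"
 proof
  fix \<xi>
  have "pt I w (bt T) = (\<Prod>c\<in>I. crd (T c) (w c))" by (simp add: pt_apply dfam_bt) (simp add: bt_def)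
  then show "pt I (%c. unit (S c) (T c) (w c)) \<xi> = fscale (pt I w (bt T)) (et I S) \<xi>"
   by (auto simp: fscale_apply et_def pt_apply unit_def dfam_def dualD prod.distrib)
 qed
 finally show "opf I (%c. unit (S c) (T c)) (pt I w) = fscale (pt I w (bt T)) (et I S)" .
qed

lemma polarization_in_stable:
 assumes I: "finite I" and Y: "!!i. i \<in> I ==> lin (Y i)" and N: "stable (GL sW) tact N" "N \<subseteq> E I" and v: "v \<in> N"
 shows "(\<Sum>p | p permutes I. opf I (%c. Y (p c)) v) \<in> N"
proof -
 have sN: "fs.subspace N" using stableD(1)[OF N(1)] .
 have vE: "v \<in> E I" using v N by blast
 have "(\<Sum>p | p permutes I. opf I (%c. Y (p c)) v)
  = (\<Sum>J\<in>Pow I. fscale ((-1) ^ card (I - J)) (opf I (%_ w. \<Sum>i\<in>J. Y i w) v))"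
  by (rule polarization[OF I _ vE]) (rule Y)
 also have "... \<in> N"
  by (intro fs.subspace_sum[OF sN] fs.subspace_scale[OF sN] opf_const_in_stable[OF I _ N v] lin_sum Y) auto
 finally show ?thesis .
qed

text \<open>The half of Schur-Weyl duality that yields semisimplicity. The matrix of
  \<open>B\<close> is invariant under simultaneous reindexing, so |I|! times \<open>B\<close> is a
  combination of symmetrized tensor products of matrix units. Polarization expresses these by tensor
  powers of single operators, which preserve \<open>N\<close>. Dividing by |I|! uses characteristic
  0.\<close>

lemma perm_equivariant_in_stable:
 fixes I :: "'i set"
 assumes I: "finite I" and B: "flinear B" "!!t. t \<in> E I ==> B t \<in> E I"
  and eq: "!!p t. p permutes I ==> t \<in> E I ==> B (pact p t) = pact p (B t)"
  and N: "stable (GL sW) tact N" "N \<subseteq> E I" and v: "v \<in> N"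
 shows "B v \<in> N"
proof -
 have sN: "fs.subspace N" using stableD(1)[OF N(1)] .
 have vE: "v \<in> E I" using v N by blast
 define \<beta> where "\<beta> S T = B (et I T) (bt S)" for S T
 let ?U = "%S T. opf I (%c. unit (S c) (T c)) v"
 have Bv: "B v = (\<Sum>T\<in>idx I. \<Sum>S\<in>idx I. fscale (\<beta> S T) (?U S T))"
 proof -
  have "B v = B (\<Sum>T\<in>idx I. fscale (v (bt T)) (et I T))" using E_expand[OF I vE] by simp
  also have "... = (\<Sum>T\<in>idx I. fscale (v (bt T)) (B (et I T)))"
   by (simp only: fsp.linear_sum[OF B(1)] fsp.linear_scale[OF B(1)])
  also have "... = (\<Sum>T\<in>idx I. fscale (v (bt T)) (\<Sum>S\<in>idx I. fscale (\<beta> S T) (et I S)))"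
   unfolding \<beta>_def using E_expand[OF I B(2)[OF et_in_E]] by (intro sum.cong refl arg_cong2[where f=fscale])
  also have "... = (\<Sum>T\<in>idx I. \<Sum>S\<in>idx I. fscale (\<beta> S T) (?U S T))"
   by (simp only: opf_unit[OF I vE] fs.scale_sum_right fs.scale_scale mult.commute)
  finally show ?thesis .
 qed
 have inv: "\<beta> (S o p) (T o p) = \<beta> S T" if p: "p permutes I" for S T p
 proof -
  have ip: "inv p permutes I" using p by (rule permutes_inv)
  have "pact (inv p) (et I T) = et I (T o p)"
   unfolding et_def pact_pt[OF ip] by (simp add: inv_inv_eq[OF permutes_bij[OF p]] comp_assoc)
  then have "B (et I (T o p)) = pact (inv p) (B (et I T))" using eq[OF ip et_in_E] by metis
  moreover have "bt (S o p) o inv p = (bt S :: 'i => 'w => 'k)"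
   using permutes_inverses[OF p] by (simp add: bt_def fun_eq_iff)
  ultimately show ?thesis by (simp add: \<beta>_def pact_def)
 qed
 \<comment> \<open>Invariance of \<open>\<beta>\<close> allows both sums to be reindexed by
   \<open>p\<close>, so every permutation contributes the same vector \<open>B v\<close>.\<close>
 have *: "(\<Sum>T\<in>idx I. \<Sum>S\<in>idx I. fscale (\<beta> S T) (?U (S o p) (T o p))) = B v" if p: "p permutes I" for p
 proof -
  have ip: "inv p permutes I" using p by (rule permutes_inv)
  have pp: "f o p o inv p = f" "f o inv p o p = f" for f :: "'i => nat"
   using permutes_inverses[OF p] by (auto simp: fun_eq_iff)
  have bij: "bij_betw (%T. T o p) (idx I) (idx I)"
  proof (rule bij_betw_byWitness[where f'="%T. T o inv p"])
   show "\<forall>a\<in>idx I. a o p o inv p = a" "\<forall>a\<in>idx I. a o inv p o p = a" using pp by blast+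
   show "(%T. T o p) ` idx I \<subseteq> idx I" "(%T. T o inv p) ` idx I \<subseteq> idx I"
    using idx_comp[OF p] idx_comp[OF ip] by blast+
  qed
  have "B v = (\<Sum>T\<in>idx I. \<Sum>S\<in>idx I. fscale (\<beta> S (T o p)) (?U S (T o p)))"
   unfolding Bv by (rule sum.reindex_bij_betw[OF bij, symmetric])
  also have "... = (\<Sum>T\<in>idx I. \<Sum>S\<in>idx I. fscale (\<beta> (S o p) (T o p)) (?U (S o p) (T o p)))"
   by (intro sum.cong refl sum.reindex_bij_betw[OF bij, symmetric])
  finally show ?thesis by (simp only: inv[OF p])
 qed
 let ?P = "{p. p permutes I}"
 have "(\<Sum>p\<in>?P. B v) = (\<Sum>p\<in>?P. \<Sum>T\<in>idx I. \<Sum>S\<in>idx I. fscale (\<beta> S T) (?U (S o p) (T o p)))"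
  by (rule sum.cong[OF refl]) (simp only: * mem_Collect_eq)
 also have "... = (\<Sum>T\<in>idx I. \<Sum>p\<in>?P. \<Sum>S\<in>idx I. fscale (\<beta> S T) (?U (S o p) (T o p)))"
  by (rule sum.swap)
 also have "... = (\<Sum>T\<in>idx I. \<Sum>S\<in>idx I. \<Sum>p\<in>?P. fscale (\<beta> S T) (?U (S o p) (T o p)))"
  by (intro sum.cong refl sum.swap)
 also have "... = (\<Sum>T\<in>idx I. \<Sum>S\<in>idx I. fscale (\<beta> S T) (\<Sum>p\<in>?P. opf I (%c. unit (S (p c)) (T (p c))) v))"
  by (simp only: fs.scale_sum_right comp_apply)
 also have "... \<in> N"
  by (intro fs.subspace_sum[OF sN] fs.subspace_scale[OF sN]
    polarization_in_stable[OF I _ N v, where Y="%c. unit (S c) (T c)" for S T] lin_unit)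
 finally have "(\<Sum>p\<in>?P. B v) \<in> N" .
 moreover have "(\<Sum>p\<in>?P. B v) = fscale (of_nat (card ?P)) (B v)"
  by (simp add: fs_simps)
 moreover have "card ?P ~= 0" using card_permutations[OF refl I] by simp
 ultimately show ?thesis
  using fs.subspace_scale[OF sN, of "fscale (of_nat (card ?P)) (B v)" "inverse (of_nat (card ?P))"] by simp
qed

text \<open>A linear projection to \<open>Z\<close> is averaged over the permutations. Only the
  group has to be finite; the surrounding function space may be infinite-dimensional.\<close>

lemma maschke:
 fixes I :: "'i set"
 assumes I: "finite I" and Z: "stable {p. p permutes I} pact Z"
 obtains P where "flinear P" "!!u. P u \<in> Z" "!!u. u \<in> Z ==> P u = u"
  "!!p u. p permutes I ==> P (pact p u) = pact p (P u)"
proof -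
 let ?G = "{p. p permutes I}"
 have sZ: "fs.subspace Z" using stableD(1)[OF Z] .
 obtain P0 where P0: "P0 ` UNIV \<subseteq> Z" "flinear P0" "\<forall>v\<in>Z. P0 v = v"
  using fsp.linear_exists_left_inverse_on[OF flinear_id sZ] by auto
 have finG: "finite ?G" using I by (simp add: finite_permutations)
 have cG: "of_nat (card ?G) ~= (0 :: 'k)" using card_permutations[OF refl I] by simp
 define P where "P u = fscale (inverse (of_nat (card ?G))) (\<Sum>q\<in>?G. pact q (P0 (pact (inv q) u)))" for u
 show ?thesis
 proof (rule that[of P])
  show "flinear P" unfolding P_def
   by (intro flinear_scale flinear_sum flinear_compose[OF flinear_pact] flinear_compose[OF P0(2)] flinear_pact)
  show "P u \<in> Z" for u unfolding P_def
   by (intro fs.subspace_scale[OF sZ] fs.subspace_sum[OF sZ] stableD(2)[OF Z]) (use P0(1) in auto)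
  show "P u = u" if u: "u \<in> Z" for u
  proof -
   have "pact q (P0 (pact (inv q) u)) = u" if "q \<in> ?G" for q
   proof -
    have q: "q permutes I" using that by simp
    have "pact (inv q) u \<in> Z" using stableD(2)[OF Z _ u, of "inv q"] permutes_inv[OF q] by simp
    then have "P0 (pact (inv q) u) = pact (inv q) u" using P0(3) by blast
    then show ?thesis by (simp add: pact_pact pact_id permutes_inv_o[OF q])
   qed
   then have "(\<Sum>q\<in>?G. pact q (P0 (pact (inv q) u))) = (\<Sum>q\<in>?G. u)" by (rule sum.cong[OF refl])
   also have "... = fscale (of_nat (card ?G)) u" by (simp add: fs_simps)
   finally show ?thesis using cG by (simp add: P_def)
  qed
  show "P (pact p u) = pact p (P u)" if p: "p permutes I" for p u
  proof -
   have bij: "bij_betw (%q. p o q) ?G ?G"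
    by (rule bij_betw_byWitness[where f'="%q. inv p o q"])
      (auto simp: comp_assoc[symmetric] permutes_inv_o[OF p] permutes_compose p permutes_inv[OF p])
   have "(\<Sum>q\<in>?G. pact q (P0 (pact (inv q) (pact p u))))
     = (\<Sum>q\<in>?G. pact (p o q) (P0 (pact (inv (p o q)) (pact p u))))"
    by (rule sum.reindex_bij_betw[OF bij, symmetric])
   also have "... = (\<Sum>q\<in>?G. pact p (pact q (P0 (pact (inv q) u))))"
   proof (rule sum.cong[OF refl])
    fix q assume "q \<in> ?G"
    then have q: "q permutes I" by simp
    have "inv (p o q) o p = inv q"
     using o_inv_distrib[OF permutes_bij[OF p] permutes_bij[OF q]] permutes_inv_o(2)[OF p]
     by (simp add: comp_assoc)
    then show "pact (p o q) (P0 (pact (inv (p o q)) (pact p u))) = pact p (pact q (P0 (pact (inv q) u)))"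
     by (simp only: pact_pact)
   qed
   also have "... = pact p (\<Sum>q\<in>?G. pact q (P0 (pact (inv q) u)))"
    by (rule fsp.linear_sum[OF flinear_pact, symmetric])
   finally show ?thesis unfolding P_def by (simp only: fsp.linear_scale[OF flinear_pact])
  qed
 qed
qed

section \<open>Simple submodules of tensor powers\<close>

definition cyc :: "'i set => (('i => 'w => 'k) => 'k) => (('i => 'w => 'k) => 'k) set" where
 "cyc I x = fs.span ((%p. pact p x) ` {p. p permutes I})"

lemma cyc_stable: "stable {p. p permutes I} pact (cyc I x)"
 unfolding cyc_def
 by (rule stable_span[OF flinear_pact]) (auto simp: pact_pact intro!: fs.span_base imageI permutes_compose)

lemma cyc_self: "x \<in> cyc I x"
 unfolding cyc_def by (rule fs.span_base) (auto simp: pact_id intro!: image_eqI[of _ _ id] permutes_id)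

lemma cyc_minimal: "stable {p. p permutes I} pact Z ==> x \<in> Z ==> cyc I x \<subseteq> Z"
 unfolding cyc_def by (rule fs.span_minimal) (auto simp: stable_def)

lemma cyc_subset_E: "x \<in> E I ==> cyc I x \<subseteq> E I"
 by (rule cyc_minimal) (auto simp: stable_def E_subspace pact_E)

definition glspan :: "(('i => 'w => 'k) => 'k) => (('i => 'w => 'k) => 'k) set" where
 "glspan x = fs.span ((%g. tact g x) ` GL sW)"

lemma tact_tact: "tact g (tact h t) = tact (g o h) t"
 by (simp add: tact_def comp_assoc)

lemma tact_id: "tact id t = t"
 by (simp add: tact_def)

lemma glspan_stable: "stable (GL sW) tact (glspan x)"
 unfolding glspan_def
 by (rule stable_span[OF flinear_tact]) (auto simp: tact_tact intro!: fs.span_base imageI GL_comp)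

lemma glspan_self: "x \<in> glspan x"
 unfolding glspan_def by (rule fs.span_base) (auto simp: tact_id intro!: image_eqI[of _ _ id] GL_id)

lemma glspan_minimal: "stable (GL sW) tact N ==> x \<in> N ==> glspan x \<subseteq> N"
 unfolding glspan_def by (rule fs.span_minimal) (auto simp: stable_def)

lemma glspan_operator:
 assumes "y \<in> glspan x"
 obtains a where "flinear a" "!!p t. a (pact p t) = pact p (a t)" "a x = y"
proof -
 obtain F r where F: "finite F" "F \<subseteq> (%g. tact g x) ` GL sW" "y = (\<Sum>u\<in>F. fscale (r u) u)"
  using assms unfolding glspan_def fs.span_explicit by blast
 have "\<forall>u\<in>F. \<exists>g. u = tact g x" using F by blast
 then obtain g where g: "\<forall>u\<in>F. u = tact (g u) x" by (rule bchoice[THEN exE])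
 show ?thesis
 proof (rule that[of "%t. \<Sum>u\<in>F. fscale (r u) (tact (g u) t)"])
  show "flinear (%t. \<Sum>u\<in>F. fscale (r u) (tact (g u) t))"
   by (intro flinear_sum flinear_scale flinear_tact)
  show "(\<Sum>u\<in>F. fscale (r u) (tact (g u) (pact p t))) = pact p (\<Sum>u\<in>F. fscale (r u) (tact (g u) t))" for p t
   by (simp only: tact_pact fsp.linear_sum[OF flinear_pact] fsp.linear_scale[OF flinear_pact])
  have "(\<Sum>u\<in>F. fscale (r u) (tact (g u) x)) = (\<Sum>u\<in>F. fscale (r u) u)"
   by (rule sum.cong[OF refl]) (use g in \<open>metis (full_types)\<close>)
  then show "(\<Sum>u\<in>F. fscale (r u) (tact (g u) x)) = y" using F(3) by simp
 qed
qed

text \<open>A nonzero \<open>y\<close> in a stable part of \<open>glspan x\<close> is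
  \<open>a x\<close> for an operator \<open>a\<close> commuting with permutations. Simplicity makes
  \<open>a\<close> injective on \<open>cyc I x\<close>; its inverse, composed with an equivariant
  projection to the image, commutes with permutations too. Such an operator preserves the stable
  part, and it takes \<open>y\<close> back to \<open>x\<close>.\<close>

lemma glspan_simple:
 fixes I :: "'i set"
 assumes I: "finite I" and x: "x \<in> E I" "simple_sub {p. p permutes I} pact (cyc I x)"
 shows "simple_sub (GL sW) tact (glspan x)"
 unfolding simple_sub_def
proof (intro conjI glspan_stable allI impI)
 have x0: "x ~= 0"
 proof
  assume "x = 0"
  then have "cyc I x \<subseteq> {0}" by (intro cyc_minimal) (auto simp: stable_def fsp.linear_0[OF flinear_pact])
  then show False using simple_subD(2)[OF x(2)] cyc_self[of x I] by blast
 qed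
 show "glspan x ~= {0}" using glspan_self[of x] x0 by blast
 fix N assume N: "N \<subseteq> glspan x" "stable (GL sW) tact N"
 show "N = {0} \<or> N = glspan x"
 proof (cases "N = {0}")
  case False
  then obtain y where y: "y \<in> N" "y ~= 0" using fs.subspace_0[OF stableD(1)[OF N(2)]] by blast
  obtain a where a: "flinear a" "!!p t. a (pact p t) = pact p (a t)" "a x = y"
   using glspan_operator[of y x] y N by blast
  have glE: "glspan x \<subseteq> E I" by (rule glspan_minimal[OF E_stable x(1)])
  have yE: "y \<in> E I" using y N glE by blast
  let ?Z = "cyc I x"
  have eqa: "equivariant_on {p. p permutes I} pact pact ?Z a"
   unfolding equivariant_on_def using a(1,2) fsp.linear_add fsp.linear_scale by blast
  have nz: "a ` ?Z ~= {0}" using a(3) y(2) cyc_self[of x I] by blast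
  note im = simple_image[OF flinear_pact x(2) eqa nz]
  have aZ: "stable {p. p permutes I} pact (a ` ?Z)" using simple_subD(1)[OF im(1)] .
  obtain P where P: "flinear P" "!!u. P u \<in> a ` ?Z" "!!u. u \<in> a ` ?Z ==> P u = u"
   "!!p u. p permutes I ==> P (pact p u) = pact p (P u)"
   by (rule maschke[OF I aZ]) blast
  obtain \<theta> where th: "\<theta> ` UNIV \<subseteq> ?Z" "flinear \<theta>" "\<forall>v\<in>?Z. \<theta> (a v) = v"
   using fsp.linear_exists_left_inverse_on[OF a(1) stableD(1)[OF cyc_stable] im(2)] by blast
  have "\<theta> (P y) \<in> N"
  proof (rule perm_equivariant_in_stable[OF I _ _ _ N(2) _ y(1), where B="%t. \<theta> (P t)"])
   show "flinear (%t. \<theta> (P t))" by (rule flinear_compose[OF th(2) P(1)])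
   show "\<theta> (P t) \<in> E I" for t using th(1) cyc_subset_E[OF x(1)] by blast
   show "\<theta> (P (pact p t)) = pact p (\<theta> (P t))" if p: "p permutes I" for p t
   proof -
    obtain z where z: "z \<in> ?Z" "P t = a z" using P(2)[of t] by blast
    have "pact p z \<in> ?Z" using stableD(2)[OF cyc_stable _ z(1)] p by blast
    then show ?thesis using th(3) z by (simp only: P(4)[OF p] z(2) a(2)[symmetric])
   qed
   show "N \<subseteq> E I" using N glE by blast
  qed
  moreover have "P y = a x" using P(3)[of y] a(3) cyc_self[of x I] by blast
  ultimately have "x \<in> N" using th(3) cyc_self[of x I] by simp
  then show ?thesis using glspan_minimal[OF N(2)] N(1) by blast
 qed simp
qed

lemma exists_simple_sub:
 assumes lin: "!!g. g \<in> G ==> flinear (act g)" and C: "stable G act C" "findim C" "C ~= {0}"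
 obtains Z where "Z \<subseteq> C" "simple_sub G act Z"
proof -
 let ?P = "%Z. stable G act Z & Z \<subseteq> C & Z ~= {0}"
 obtain Z where Z: "?P Z" and mn: "!!Z'. ?P Z' ==> fs.dim Z \<le> fs.dim Z'"
  using ex_has_least_nat[of ?P C fs.dim] C by blast
 have "Z' = {0} \<or> Z' = Z" if Z': "Z' \<subseteq> Z" "stable G act Z'" for Z'
 proof (rule ccontr)
  assume neg: "\<not> (Z' = {0} \<or> Z' = Z)"
  have sZ: "fs.subspace Z" "fs.subspace Z'" using Z Z' stableD(1) by blast+
  have fin: "findim Z" "findim Z'" using findim_mono[OF C(2)] Z Z' by blast+
  have le: "fs.dim Z \<le> fs.dim Z'" using mn[of Z'] neg Z Z' by blast
  obtain B where B: "finite B" "B \<subseteq> Z'" "fs.independent B" "fs.span B = Z'" "card B = fs.dim Z'"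
   by (rule findim_basis[OF sZ(2) fin(2)])
  obtain x where x: "x \<in> Z" "x \<notin> Z'" using neg Z' by blast
  have "fs.independent (insert x B)" using fs.independent_insertI[of x B] B x by blast
  then have "card (insert x B) = fs.dim (insert x B)" using fs.dim_eq_card_independent by metis
  also have "... \<le> fs.dim Z" by (rule fs_dim_mono[OF _ fin(1)]) (use B x Z' in blast)
  finally have "card (insert x B) \<le> fs.dim Z" .
  moreover have "x \<notin> B" using x B by blast
  ultimately show False using le B(1,5) by simp
 qed
 then have "simple_sub G act Z" unfolding simple_sub_def using Z by blast
 then show ?thesis using that Z by blast
qed

text \<open>The vectors generating simple modules of the symmetric group span everything, since an
  equivariant complement would contain a further simple submodule. Each of these vectors also
  generates a simple GL(W)-module.\<close>

lemma E_sum_of_simples: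
 fixes I :: "'i set"
 assumes I: "finite I"
 shows "E I = fs.span (\<Union>{N. N \<subseteq> E I & simple_sub (GL sW) tact N})" (is "_ = fs.span (\<Union>?\<S>)")
proof
 show "fs.span (\<Union>?\<S>) \<subseteq> E I" by (rule fs.span_minimal[OF _ E_subspace]) blast
 let ?G = "{p. p permutes I}"
 let ?X = "{x \<in> E I. simple_sub ?G pact (cyc I x)}"
 let ?S = "fs.span ?X"
 have cycp: "cyc I (pact p x) = cyc I x" if "p permutes I" for p x
 proof
  show "cyc I (pact p x) \<subseteq> cyc I x"
   by (rule cyc_minimal[OF cyc_stable]) (use stableD(2)[OF cyc_stable _ cyc_self] that in blast)
  have "pact (inv p) (pact p x) \<in> cyc I (pact p x)"
   using stableD(2)[OF cyc_stable _ cyc_self] permutes_inv[OF that] by blast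
  then have "x \<in> cyc I (pact p x)" by (simp add: pact_pact pact_id permutes_inv_o[OF that])
  then show "cyc I x \<subseteq> cyc I (pact p x)" by (rule cyc_minimal[OF cyc_stable])
 qed
 have S: "stable ?G pact ?S"
  by (rule stable_span[OF flinear_pact]) (auto simp: cycp pact_E intro!: fs.span_base)
 have SE: "?S \<subseteq> E I" by (rule fs.span_minimal[OF _ E_subspace]) blast
 obtain P where P: "flinear P" "!!u. P u \<in> ?S" "!!u. u \<in> ?S ==> P u = u"
  "!!p u. p permutes I ==> P (pact p u) = pact p (P u)"
  by (rule maschke[OF I S]) blast
 let ?C = "{u \<in> E I. P u = 0}"
 have C: "stable ?G pact ?C" unfolding stable_def fs.subspace_def
  using E_subspace[of I] pact_E[of _ I]
  by (auto simp: fs.subspace_def fsp.linear_0[OF P(1)] fsp.linear_add[OF P(1)] fsp.linear_scale[OF P(1)] P(4) fsp.linear_0[OF flinear_pact])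
 have "?C = {0}"
 proof (rule ccontr)
  assume nz: "?C ~= {0}"
  have "findim ?C" by (rule findim_mono[OF E_findim[OF I]]) blast
  then obtain Z where Z: "Z \<subseteq> ?C" "simple_sub ?G pact Z"
   using exists_simple_sub[OF flinear_pact C _ nz] by blast
  obtain x where x: "x \<in> Z" "x ~= 0"
   using simple_subD(2)[OF Z(2)] fs.subspace_0[OF stableD(1)[OF simple_subD(1)[OF Z(2)]]] by blast
  have "cyc I x = {0} \<or> cyc I x = Z"
   by (rule simple_subD(3)[OF Z(2) cyc_stable cyc_minimal[OF simple_subD(1)[OF Z(2)] x(1)]])
  then have "cyc I x = Z" using cyc_self[of x I] x(2) by blast
  then have "x \<in> ?X" using Z x by blast
  then have "P x = x" by (intro P(3) fs.span_base)
  then show False using Z x by auto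
 qed
 have "E I \<subseteq> ?S"
 proof
  fix u assume u: "u \<in> E I"
  have "P u \<in> E I" using P(2) SE by blast
  then have "u - P u \<in> ?C" using u E_subspace[of I] P(3)[OF P(2)] by (auto simp: fsp.linear_diff[OF P(1)] fs.subspace_diff)
  then have "u = P u" using \<open>?C = {0}\<close> by auto
  then show "u \<in> ?S" using P(2)[of u] by simp
 qed
 also have "?S \<subseteq> fs.span (\<Union>?\<S>)"
 proof (rule fs.span_mono, rule subsetI)
  fix x assume "x \<in> ?X"
  then have x: "x \<in> E I" "simple_sub ?G pact (cyc I x)" by auto
  have "glspan x \<in> ?\<S>" using glspan_simple[OF I x] glspan_minimal[OF E_stable x(1)] by blast
  then show "x \<in> \<Union>?\<S>" using glspan_self[of x] by blast
 qed
 finally show "E I \<subseteq> fs.span (\<Union>?\<S>)" .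
qed

end

section \<open>Weights and highest weights\<close>

definition nprime :: "nat => nat" where
 "nprime = enumerate {p. prime p}"

lemma prime_nprime: "prime (nprime i)"
 using enumerate_in_set[OF primes_infinite, of i] by (simp add: nprime_def)

lemma inj_nprime: "inj nprime"
 unfolding nprime_def using primes_infinite by (rule strict_mono_imp_inj_on[OF strict_mono_enumerate])

text \<open>Weights are encoded as eigenvalues of the diagonal matrix whose entries are distinct primes.\<close>

definition theta :: "nat multiset => 'k::field_char_0" where
 "theta M = of_nat (\<Prod>i\<in>#M. nprime i)"

text \<open>Unique factorization recovers the multiset from the product of primes, and
  characteristic 0 keeps distinct integers distinct in the field. A single operator thus separates
  all weights.\<close>

lemma theta_inj: "theta M = (theta N :: 'k::field_char_0) \<longleftrightarrow> M = N"
proof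
 assume "theta M = (theta N :: 'k)"
 then have "(\<Prod>i\<in>#M. nprime i) = (\<Prod>i\<in>#N. nprime i)" unfolding theta_def by (simp only: of_nat_eq_iff)
 moreover have "prime_factorization (\<Prod>i\<in>#M. nprime i) = image_mset nprime M" for M
  by (rule prime_factorization_prod_mset_primes) (auto simp: prime_nprime)
 ultimately have "image_mset nprime M = image_mset nprime N" by metis
 then have "image_mset (inv nprime) (image_mset nprime M) = image_mset (inv nprime) (image_mset nprime N)" by simp
 then show "M = N" by (simp add: multiset.map_comp comp_def inv_f_f[OF inj_nprime])
qed simp

lemma theta_add_mset: "theta (add_mset i M) = of_nat (nprime i) * (theta M :: 'k::field_char_0)"
 by (simp add: theta_def)

context wspace
begin

definition hW :: "'w => 'w" where
 "hW w = (\<Sum>j<m. sW (of_nat (nprime j) * crd j w) (b j))"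

lemma hW_b: "i < m ==> hW (b i) = sW (of_nat (nprime i)) (b i)"
proof -
 assume i: "i < m"
 have "hW (b i) = (\<Sum>j<m. if j = i then sW (of_nat (nprime i)) (b i) else 0)"
  unfolding hW_def by (rule sum.cong) (auto simp: crd_b i)
 then show ?thesis using i by simp
qed

lemma hW_GL: "hW \<in> GL sW"
proof -
 define h' where "h' w = (\<Sum>j<m. sW (inverse (of_nat (nprime j)) * crd j w) (b j))" for w
 have nz': "of_nat (nprime j) ~= (0 :: 'k)" for j using prime_nprime[of j] by (auto dest: prime_gt_0_nat)
 have nz: "of_nat (nprime j) * inverse (of_nat (nprime j)) = (1 :: 'k)" "inverse (of_nat (nprime j)) * of_nat (nprime j) = (1 :: 'k)" for j
  by (rule right_inverse[OF nz'], rule left_inverse[OF nz'])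
 have l: "lin hW" "lin h'" unfolding hW_def h'_def
  by (rule linI; simp add: dualD[OF crd_dual] algebra_simps scale_left_distrib sum.distrib scale_sum_right)+
 have h'b: "h' (b i) = sW (inverse (of_nat (nprime i))) (b i)" if i: "i < m" for i
 proof -
  have "h' (b i) = (\<Sum>j<m. if j = i then sW (inverse (of_nat (nprime i))) (b i) else 0)"
   unfolding h'_def by (rule sum.cong) (auto simp: crd_b i)
  then show ?thesis using i by simp
 qed
 have "hW (h' w) = w & h' (hW w) = w" for w
 proof -
  have "hW (h' (\<Sum>j<m. sW (crd j w) (b j))) = (\<Sum>j<m. sW (crd j w) (b j))"
   by (simp only: linD[OF l(1)] linD[OF l(2)]) (auto simp: h'b hW_b linD[OF l(1)] nz intro!: sum.cong)
  moreover have "h' (hW (\<Sum>j<m. sW (crd j w) (b j))) = (\<Sum>j<m. sW (crd j w) (b j))"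
   by (simp only: linD[OF l(1)] linD[OF l(2)]) (auto simp: h'b hW_b linD[OF l(2)] nz intro!: sum.cong)
  ultimately show ?thesis using crd_expand[of w] by simp
 qed
 then have "bij hW" by (intro o_bij[of h']) (auto simp: fun_eq_iff)
 then show ?thesis using l by (simp add: GL_def)
qed

definition wt :: "'i set => ('i => nat) => nat multiset" where
 "wt I T = image_mset T (mset_set I)"

lemma wt_props: "finite I ==> size (wt I T) = card I" "finite I ==> set_mset (wt I T) = T ` I"
 "finite I ==> sum_mset (wt I T) = (\<Sum>c\<in>I. T c)"
 by (auto simp: wt_def sum_unfold_sum_mset)

lemma theta_wt: "theta (wt I T) = (\<Prod>c\<in>I. of_nat (nprime (T c)) :: 'k)"
 by (simp add: theta_def wt_def multiset.map_comp comp_def flip: prod_unfold_prod_mset)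

lemma tact_hW_et:
 assumes "T \<in> idx I" shows "tact hW (et I T) = fscale (theta (wt I T)) (et I T)"
proof
 fix \<xi>
 have "(\<Prod>c\<in>I. \<xi> c (hW (b (T c)))) = (\<Prod>c\<in>I. of_nat (nprime (T c)) * \<xi> c (b (T c)))" if "dfam I \<xi>"
  using that assms by (intro prod.cong) (auto simp: hW_b dfam_def dualD PiE_iff)
 then show "tact hW (et I T) \<xi> = fscale (theta (wt I T)) (et I T) \<xi>"
  by (simp add: et_def tact_pt[OF hW_GL] pt_apply fscale_apply theta_wt prod.distrib)
qed

lemma tact_hW_coeff:
 assumes I: "finite I" and u: "u \<in> E I" and S: "S \<in> idx I"
 shows "tact hW u (bt S) = theta (wt I S) * u (bt S)"
proof -
 have "tact hW u = tact hW (\<Sum>T\<in>idx I. fscale (u (bt T)) (et I T))" using E_expand[OF I u] by simp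
 also have "... = (\<Sum>T\<in>idx I. fscale (u (bt T)) (tact hW (et I T)))"
  by (simp only: fsp.linear_sum[OF flinear_tact] fsp.linear_scale[OF flinear_tact])
 finally have "tact hW u (bt S) = (\<Sum>T\<in>idx I. u (bt T) * tact hW (et I T) (bt S))"
  by (simp add: sum_fun_apply fscale_apply)
 also have "... = (\<Sum>T\<in>idx I. if T = S then theta (wt I S) * u (bt S) else 0)"
  by (rule sum.cong[OF refl]) (auto simp: tact_hW_et fscale_apply et_bt[OF I S])
 finally show ?thesis using S finite_idx[OF I] by simp
qed

lemma E_ext: assumes "finite I" "u \<in> E I" "v \<in> E I" "!!T. T \<in> idx I ==> u (bt T) = v (bt T)" shows "u = v"
proof -
 have "(\<Sum>T\<in>idx I. fscale (u (bt T)) (et I T)) = (\<Sum>T\<in>idx I. fscale (v (bt T)) (et I T))"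
  by (rule sum.cong[OF refl]) (simp only: assms(4))
 then show ?thesis using E_expand[OF assms(1,2)] E_expand[OF assms(1,3)] by simp
qed

lemma E_eig_iff:
 assumes I: "finite I" and u: "u \<in> E I"
 shows "tact hW u = fscale (theta M) u \<longleftrightarrow> (\<forall>T\<in>idx I. u (bt T) ~= 0 --> wt I T = M)"
proof
 assume "tact hW u = fscale (theta M) u"
 then have "tact hW u x = theta M * u x" for x by (simp only: fscale_apply)
 then have "theta (wt I T) * u (bt T) = theta M * u (bt T)" if "T \<in> idx I" for T
  using tact_hW_coeff[OF I u that] by metis
 then show "\<forall>T\<in>idx I. u (bt T) ~= 0 --> wt I T = M" by (auto simp: theta_inj)
next
 assume *: "\<forall>T\<in>idx I. u (bt T) ~= 0 --> wt I T = M"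
 show "tact hW u = fscale (theta M) u"
 proof (rule E_ext[OF I])
  show "tact hW u \<in> E I" using stableD(2)[OF E_stable hW_GL u] .
  show "fscale (theta M) u \<in> E I" using fs.subspace_scale[OF E_subspace u] .
  show "tact hW u (bt T) = fscale (theta M) u (bt T)" if "T \<in> idx I" for T
   using tact_hW_coeff[OF I u that] * that by (cases "u (bt T) = 0") (auto simp: fscale_apply)
 qed
qed

lemma stable_sub_has_weight:
 assumes I: "finite I" and N: "stable (GL sW) tact N" "N \<subseteq> E I" "N ~= {0}"
 obtains M where "eig (tact hW) N (theta M) ~= {0}" "size M = card I" "set_mset M \<subseteq> {..<m}"
proof -
 obtain u where u: "u \<in> N" "u ~= 0" using fs.subspace_0[OF stableD(1)[OF N(1)]] N(3) by blast
 have uE: "u \<in> E I" using u N by blast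
 define c where "c M = (\<Sum>T\<in>{T\<in>idx I. wt I T = M}. fscale (u (bt T)) (et I T))" for M
 have sum: "(\<Sum>M\<in>wt I ` idx I. c M) = u"
  unfolding c_def using sum.image_gen[OF finite_idx[OF I], of "%T. fscale (u (bt T)) (et I T)" "wt I"] E_expand[OF I uE] by simp
 have Hc: "tact hW (c M) = fscale (theta M) (c M)" for M
 proof -
  have "tact hW (c M) = (\<Sum>T\<in>{T\<in>idx I. wt I T = M}. fscale (u (bt T)) (tact hW (et I T)))"
   unfolding c_def by (simp only: fsp.linear_sum[OF flinear_tact] fsp.linear_scale[OF flinear_tact])
  also have "... = (\<Sum>T\<in>{T\<in>idx I. wt I T = M}. fscale (theta M) (fscale (u (bt T)) (et I T)))"
   by (rule sum.cong[OF refl]) (auto simp: tact_hW_et mult.commute)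
  finally show ?thesis unfolding c_def fs.scale_sum_right .
 qed
 have cN: "c M \<in> N" if "M \<in> wt I ` idx I" for M
  by (rule fs.eigen_components_in_subspace[OF flinear_tact stableD(1)[OF N(1)], where F="wt I ` idx I" and \<theta>=theta and u=c])
    (use finite_idx[OF I] stableD(2)[OF N(1) hW_GL] Hc sum u(1) that in \<open>auto simp: inj_on_def theta_inj\<close>)
 have "\<exists>M\<in>wt I ` idx I. c M ~= 0"
 proof (rule ccontr)
  assume "\<not> ?thesis"
  then have "(\<Sum>M\<in>wt I ` idx I. c M) = 0" by (intro sum.neutral) blast
  then show False using sum u(2) by simp
 qed
 then obtain T where T: "T \<in> idx I" "c (wt I T) ~= 0" by blast
 show ?thesis
 proof (rule that[of "wt I T"])
  have "c (wt I T) \<in> eig (tact hW) N (theta (wt I T))" using cN T Hc by (simp add: eig_def)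
  then show "eig (tact hW) N (theta (wt I T)) ~= {0}" using T(2) by blast
  show "size (wt I T) = card I" "set_mset (wt I T) \<subseteq> {..<m}"
   using T(1) I by (auto simp: wt_props PiE_iff)
 qed
qed

lemma E_zero_slot:
 assumes I: "finite I" and u: "u \<in> E I" and c: "c \<in> I" "\<xi> c = (%_. 0)" shows "u \<xi> = 0"
proof -
 have "et I T \<xi> = 0" for T
  unfolding et_def pt_apply using I c by (auto intro!: prod_zero bexI[of _ c])
 then show ?thesis using fun_cong[OF E_expand[OF I u], of \<xi>] by (simp add: sum_fun_apply fscale_apply)
qed

section \<open>The Lie algebra action and Newton's identities\<close>

definition Dop :: "'i set => ('w => 'w) => (('i => 'w => 'k) => 'k) => ('i => 'w => 'k) => 'k" where
 "Dop I X t = (\<Sum>c\<in>I. opf I ((%_. id)(c := X)) t)"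

lemma flinear_Dop: "flinear (Dop I X)"
 unfolding Dop_def by (intro flinear_sum flinear_opf)

lemma lin_upd: "lin X ==> lin (((%_. id)(c := X)) e)" by (auto simp: lin_id)

lemma Dop_E: "lin X ==> t \<in> E I ==> Dop I X t \<in> E I"
 unfolding Dop_def by (intro fs.subspace_sum[OF E_subspace] opf_E lin_upd)

text \<open>The coefficient at \<open>S\<close> collects coefficients of the argument at indices
  where one entry i of \<open>S\<close> is changed to j. So the operator trades an occurrence of j
  in a weight for an i.\<close>

lemma Dop_coeff:
 assumes I: "finite I" and u: "u \<in> E I" and S: "S \<in> idx I" and ij: "i < m" "j < m"
 shows "Dop I (unit i j) u (bt S) = (\<Sum>c\<in>I. if S c = i then u (bt (S(c := j))) else 0)"
 unfolding Dop_def sum_fun_apply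
proof (rule sum.cong[OF refl])
 fix c assume c: "c \<in> I"
 have Sc: "S c < m" using S c by auto
 have "crd (S c) o unit i j = (if S c = i then crd j else (%_. 0))"
  using Sc ij by (auto simp: fun_eq_iff unit_def dualD[OF crd_dual] crd_b)
 then have "(%e. bt S e o ((%_. id)(c := unit i j)) e) = (if S c = i then bt (S(c := j)) else (bt S)(c := %_. 0))"
  by (auto simp: fun_eq_iff bt_def)
 then show "opf I ((%_. id)(c := unit i j)) u (bt S) = (if S c = i then u (bt (S(c := j))) else 0)"
  using E_zero_slot[OF I u c, of "(bt S)(c := %_. 0)"] by (simp add: opf_def dfam_bt)
qed

lemma Dop_in_stable:
 assumes I: "finite I" and X: "lin X" and N: "stable (GL sW) tact N" "N \<subseteq> E I" and v: "v \<in> N"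
 shows "Dop I X v \<in> N"
proof (cases "I = {}")
 case True
 then show ?thesis using fs.subspace_0[OF stableD(1)[OF N(1)]] by (simp add: Dop_def)
next
 case False
 have eq: "{J. J \<subseteq> I & card J = 1} = (%c. {c}) ` I" by (auto simp: card_1_singleton_iff)
 have "erop I 1 X v = (\<Sum>c\<in>I. opf I (%e. if e \<in> {c} then X else id) v)"
  unfolding erop_def eq by (subst sum.reindex) (auto simp: inj_on_def)
 also have "... = Dop I X v" unfolding Dop_def by (intro sum.cong refl arg_cong2[where f="opf I"]) auto
 finally show ?thesis using erop_in_stable[OF I X N v, of 1] False I by (simp add: Suc_le_eq card_gt_0_iff)
qed

lemma Dop_Dop:
 assumes I: "finite I" and X: "lin X" and Y: "lin Y"
 shows "Dop I X (Dop I Y t) = Dop I (X o Y) t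
  + (\<Sum>c\<in>I. \<Sum>d\<in>I-{c}. opf I (%e. if e = c then X else if e = d then Y else id) t)"
proof -
 have "Dop I X (Dop I Y t) = (\<Sum>c\<in>I. \<Sum>d\<in>I. opf I (%e. ((%_. id)(c := X)) e o ((%_. id)(d := Y)) e) t)"
  unfolding Dop_def by (simp only: fsp.linear_sum[OF flinear_opf] opf_comp[OF lin_upd[OF X]])
 also have "... = (\<Sum>c\<in>I. opf I ((%_. id)(c := X o Y)) t
   + (\<Sum>d\<in>I-{c}. opf I (%e. if e = c then X else if e = d then Y else id) t))"
 proof (rule sum.cong[OF refl])
  fix c assume c: "c \<in> I"
  have "(%e. ((%_. id)(c := X)) e o ((%_. id)(c := Y)) e) = (%_. id)(c := X o Y)" by auto
  moreover have "(%e. ((%_. id)(c := X)) e o ((%_. id)(d := Y)) e) = (%e. if e = c then X else if e = d then Y else id)"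
   if "d \<in> I - {c}" for d using that by auto
  ultimately show "(\<Sum>d\<in>I. opf I (%e. ((%_. id)(c := X)) e o ((%_. id)(d := Y)) e) t)
   = opf I ((%_. id)(c := X o Y)) t + (\<Sum>d\<in>I-{c}. opf I (%e. if e = c then X else if e = d then Y else id) t)"
   unfolding sum.remove[OF I c] by (simp only: cong: sum.cong)
 qed
 finally show ?thesis unfolding Dop_def sum.distrib .
qed

text \<open>In the product of two derivations only the terms in which both hit the same position
  depend on the order.\<close>

lemma Dop_commutator:
 assumes I: "finite I" and X: "lin X" and Y: "lin Y"
 shows "Dop I X (Dop I Y t) = Dop I Y (Dop I X t) + Dop I (X o Y) t - Dop I (Y o X) t"
proof -
 have swap: "(\<Sum>c\<in>I. \<Sum>d\<in>I-{c}. f c d) = (\<Sum>c\<in>I. \<Sum>d\<in>I-{c}. f d c)" for f :: "_ => _ => ('a => 'w => 'k) => 'k"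
  unfolding sum.Sigma[OF I, of "%c. I - {c}", simplified] using I
  by (subst sum.Sigma, simp, simp, subst sum.Sigma, simp, simp)
    (rule sum.reindex_bij_witness[of _ prod.swap prod.swap]; auto)
 have "(\<Sum>c\<in>I. \<Sum>d\<in>I-{c}. opf I (%e. if e = c then X else if e = d then Y else id) t)
   = (\<Sum>c\<in>I. \<Sum>d\<in>I-{c}. opf I (%e. if e = d then X else if e = c then Y else id) t)"
  by (rule swap)
 also have "... = (\<Sum>c\<in>I. \<Sum>d\<in>I-{c}. opf I (%e. if e = c then Y else if e = d then X else id) t)"
  by (intro sum.cong refl arg_cong2[where f="opf I"]) auto
 finally show ?thesis unfolding Dop_Dop[OF I X Y] Dop_Dop[OF I Y X] by simp
qed

lemma unit_comp: "j < m ==> k < m ==> unit i j o unit k l = (if j = k then unit i l else (%_. 0))"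
 by (auto simp: unit_def fun_eq_iff dualD[OF crd_dual] crd_b)

lemma Dop_zero: assumes "finite I" "t \<in> E I" shows "Dop I (%_. 0) t = 0"
proof -
 have "opf I ((%_. id)(c := %_. 0)) t = 0" if c: "c \<in> I" for c
 proof
  fix \<xi>
  show "opf I ((%_. id)(c := %_. 0)) t \<xi> = 0 \<xi>"
  proof (cases "dfam I \<xi>")
   case True
   then have "\<xi> c \<in> dual" using c by (simp add: dfam_def)
   then have "\<xi> c 0 = 0" using dualD(2)[of "\<xi> c" 0 0] by simp
   then have "t (%e. \<xi> e o ((%_. id)(c := %_. 0)) e) = 0"
    by (intro E_zero_slot[OF assms c]) (simp add: comp_def)
   then show ?thesis by (simp add: opf_def)
  qed (simp add: opf_def)
 qed
 then show ?thesis unfolding Dop_def by (rule sum.neutral[OF ballI])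
qed

lemma Dop_expand:
 assumes I: "finite I" and X: "lin X" and t: "t \<in> E I"
 shows "Dop I X t = (\<Sum>i<m. \<Sum>j<m. fscale (crd i (X (b j))) (Dop I (unit i j) t))"
proof (rule E_eqI[OF flinear_Dop _ _ t, where g="%t. \<Sum>i<m. \<Sum>j<m. fscale (crd i (X (b j))) (Dop I (unit i j) t)"])
 show "flinear (%t. \<Sum>i<m. \<Sum>j<m. fscale (crd i (X (b j))) (Dop I (unit i j) t))"
  by (intro flinear_sum flinear_scale flinear_Dop)
 fix w
 have upd: "opf I ((%_. id)(c := Y)) (pt I w) \<xi> = (if dfam I \<xi> then \<xi> c (Y (w c)) * (\<Prod>e\<in>I-{c}. \<xi> e (w e)) else 0)"
  if "c \<in> I" "lin Y" for c Y \<xi>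
 proof -
  have "opf I ((%_. id)(c := Y)) (pt I w) = pt I (%e. ((%_. id)(c := Y)) e (w e))"
   by (rule opf_pt[OF lin_upd[OF that(2)]])
  moreover have "(\<Prod>e\<in>I. \<xi> e (((%_. id)(c := Y)) e (w e))) = \<xi> c (Y (w c)) * (\<Prod>e\<in>I-{c}. \<xi> e (w e))"
  proof -
   have "(\<Prod>e\<in>I-{c}. \<xi> e (((%_. id)(c := Y)) e (w e))) = (\<Prod>e\<in>I-{c}. \<xi> e (w e))"
    by (rule prod.cong) auto
   then show ?thesis unfolding prod.remove[OF I that(1)] by simp
  qed
  ultimately show ?thesis by (simp add: pt_apply)
 qed
 have lc: "\<xi> (X v) = (\<Sum>i<m. \<Sum>j<m. crd i (X (b j)) * \<xi> (unit i j v))" if "\<xi> \<in> dual" for \<xi> v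
 proof -
  have "\<xi> (X v) = (\<Sum>i<m. crd i (X v) * \<xi> (b i))" by (rule dual_expand[OF that])
  also have "... = (\<Sum>i<m. (\<Sum>j<m. crd j v * crd i (X (b j))) * \<xi> (b i))"
   using dual_expand[OF dual_comp[OF crd_dual X], where w=v] by simp
  finally show ?thesis by (simp add: unit_def dualD[OF that] sum_distrib_right sum_distrib_left mult.commute mult.left_commute)
 qed
 show "Dop I X (pt I w) = (\<Sum>i<m. \<Sum>j<m. fscale (crd i (X (b j))) (Dop I (unit i j) (pt I w)))"
 proof
  fix \<xi>
  show "Dop I X (pt I w) \<xi> = (\<Sum>i<m. \<Sum>j<m. fscale (crd i (X (b j))) (Dop I (unit i j) (pt I w))) \<xi>"
  proof (cases "dfam I \<xi>")
   case True
   have "Dop I X (pt I w) \<xi> = (\<Sum>c\<in>I. \<xi> c (X (w c)) * (\<Prod>e\<in>I-{c}. \<xi> e (w e)))"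
    using True by (auto simp: Dop_def sum_fun_apply upd X intro!: sum.cong)
   also have "... = (\<Sum>c\<in>I. \<Sum>i<m. \<Sum>j<m. crd i (X (b j)) * (\<xi> c (unit i j (w c)) * (\<Prod>e\<in>I-{c}. \<xi> e (w e))))"
   proof (rule sum.cong[OF refl])
    fix c assume "c \<in> I"
    then have "\<xi> c \<in> dual" using True by (simp add: dfam_def)
    then show "\<xi> c (X (w c)) * (\<Prod>e\<in>I-{c}. \<xi> e (w e)) = (\<Sum>i<m. \<Sum>j<m. crd i (X (b j)) * (\<xi> c (unit i j (w c)) * (\<Prod>e\<in>I-{c}. \<xi> e (w e))))"
     by (subst lc) (simp_all add: sum_distrib_right mult.assoc)
   qed
   also have "... = (\<Sum>i<m. \<Sum>c\<in>I. \<Sum>j<m. crd i (X (b j)) * (\<xi> c (unit i j (w c)) * (\<Prod>e\<in>I-{c}. \<xi> e (w e))))"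
    by (rule sum.swap)
   also have "... = (\<Sum>i<m. \<Sum>j<m. \<Sum>c\<in>I. crd i (X (b j)) * (\<xi> c (unit i j (w c)) * (\<Prod>e\<in>I-{c}. \<xi> e (w e))))"
    by (intro sum.cong refl sum.swap)
   also have "... = (\<Sum>i<m. \<Sum>j<m. crd i (X (b j)) * Dop I (unit i j) (pt I w) \<xi>)"
    using True by (auto simp: Dop_def sum_fun_apply upd lin_unit sum_distrib_left intro!: sum.cong)
   finally show ?thesis by (simp add: sum_fun_apply fscale_apply)
  next
   case False
   then show ?thesis by (simp add: sum_fun_apply fscale_apply Dop_def opf_def)
  qed
 qed
qed

end

context wspace
begin

text \<open>For i > 1 this is the monomial symmetric function of the partition (i, 1^r) in the
  commuting operators that apply \<open>X\<close> in a single position. For i = 1 every term is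
  counted r + 1 times.\<close>

definition Mop :: "'i set => nat => nat => ('w => 'w) => (('i => 'w => 'k) => 'k) => ('i => 'w => 'k) => 'k" where
 "Mop I r i X t = (\<Sum>J | J \<subseteq> I & card J = r. \<Sum>p\<in>I-J.
   opf I (%c. if c = p then X ^^ i else if c \<in> J then X else id) t)"

lemma sum_remove_element:
 assumes I: "finite I"
 shows "(\<Sum>J | J \<subseteq> I & card J = Suc r. \<Sum>p\<in>J. f J p)
  = (\<Sum>J | J \<subseteq> I & card J = r. \<Sum>p\<in>I-J. (f (insert p J) p :: 'b::comm_monoid_add))"
proof -
 have fin: "finite {J. J \<subseteq> I & card J = r}" for r using I by simp
 have "(\<Sum>J | J \<subseteq> I & card J = Suc r. \<Sum>p\<in>J. f J p)
   = (\<Sum>(J, p)\<in>Sigma {J. J \<subseteq> I & card J = Suc r} (%J. J). f J p)"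
  by (rule sum.Sigma) (use I finite_subset in auto)
 also have "... = (\<Sum>(J, p)\<in>Sigma {J. J \<subseteq> I & card J = r} (%J. I - J). f (insert p J) p)"
 proof (rule sum.reindex_bij_witness[of _ "%(J, p). (insert p J, p)" "%(J, p). (J - {p}, p)"])
  fix x assume x: "x \<in> Sigma {J. J \<subseteq> I & card J = Suc r} (%J. J)"
  then show "(case (case x of (J, p) => (J - {p}, p)) of (J, p) => (insert p J, p)) = x"
   by (auto simp: insert_absorb)
  show "(case x of (J, p) => (J - {p}, p)) \<in> Sigma {J. J \<subseteq> I & card J = r} (%J. I - J)"
   using x by (auto simp: card_Diff_singleton)
  show "(case (case x of (J, p) => (J - {p}, p)) of (J, p) => f (insert p J) p) = (case x of (J, p) => f J p)"
   using x by (auto simp: insert_absorb)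
 next
  fix x assume x: "x \<in> Sigma {J. J \<subseteq> I & card J = r} (%J. I - J)"
  then show "(case (case x of (J, p) => (insert p J, p)) of (J, p) => (J - {p}, p)) = x" by auto
  show "(case x of (J, p) => (insert p J, p)) \<in> Sigma {J. J \<subseteq> I & card J = Suc r} (%J. J)"
   using x finite_subset[OF _ I] by auto
 qed
 also have "... = (\<Sum>J | J \<subseteq> I & card J = r. \<Sum>p\<in>I-J. f (insert p J) p)"
  by (rule sum.Sigma[symmetric]) (use I in auto)
 finally show ?thesis .
qed

text \<open>The product of an elementary symmetric function and a power sum: the power of
  \<open>X\<close> falls either on a free position or on one of the r positions already carrying
  \<open>X\<close>, where the exponent grows by one.\<close>

lemma erop_Dop:
 assumes I: "finite I" and X: "lin X"
 shows "erop I r X (Dop I (X ^^ i) t) = Mop I r i X t + (if r = 0 then 0 else Mop I (r - 1) (Suc i) X t)"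
proof -
 let ?Y = "%J p c. (if c \<in> J then X else id) o ((%_. id)(p := X ^^ i)) c"
 have l: "lin (if c \<in> J then X else id)" for c J using X lin_id by auto
 have Yout: "?Y J p = (%c. if c = p then X ^^ i else if c \<in> J then X else id)" if "p \<notin> J" for J p
  using that by auto
 have Yin: "?Y J p = (%c. if c = p then X ^^ Suc i else if c \<in> J then X else id)" if "p \<in> J" for J p
  using that by auto
 have "erop I r X (Dop I (X ^^ i) t) = (\<Sum>J | J \<subseteq> I & card J = r. \<Sum>p\<in>I. opf I (?Y J p) t)"
  unfolding erop_def Dop_def by (simp only: fsp.linear_sum[OF flinear_opf] opf_comp[OF l])
 also have "... = (\<Sum>J | J \<subseteq> I & card J = r. (\<Sum>p\<in>I-J. opf I (?Y J p) t) + (\<Sum>p\<in>J. opf I (?Y J p) t))"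
  by (rule sum.cong[OF refl], rule sum.subset_diff) (use I in auto)
 also have "... = (\<Sum>J | J \<subseteq> I & card J = r. \<Sum>p\<in>I-J. opf I (?Y J p) t)
   + (\<Sum>J | J \<subseteq> I & card J = r. \<Sum>p\<in>J. opf I (?Y J p) t)"
  by (rule sum.distrib)
 also have "(\<Sum>J | J \<subseteq> I & card J = r. \<Sum>p\<in>I-J. opf I (?Y J p) t) = Mop I r i X t"
  unfolding Mop_def by (intro sum.cong refl arg_cong2[where f="opf I"] Yout) auto
 also have "(\<Sum>J | J \<subseteq> I & card J = r. \<Sum>p\<in>J. opf I (?Y J p) t) = (if r = 0 then 0 else Mop I (r - 1) (Suc i) X t)"
 proof (cases r)
  case 0
  have "J = {}" if "J \<subseteq> I" "card J = 0" for J using that I finite_subset by fastforce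
  then show ?thesis using 0 by (auto intro!: sum.neutral)
 next
  case (Suc s)
  have "(\<Sum>J | J \<subseteq> I & card J = r. \<Sum>p\<in>J. opf I (?Y J p) t)
    = (\<Sum>J | J \<subseteq> I & card J = s. \<Sum>p\<in>I-J. opf I (?Y (insert p J) p) t)"
   unfolding Suc by (rule sum_remove_element[OF I])
  also have "... = Mop I s (Suc i) X t"
   unfolding Mop_def by (intro sum.cong refl arg_cong2[where f="opf I"]) auto
  finally show ?thesis using Suc by simp
 qed
 finally show ?thesis .
qed

lemma Mop_one:
 assumes I: "finite I" shows "Mop I r 1 X t = fscale (of_nat (Suc r)) (erop I (Suc r) X t)"
proof -
 have "Mop I r 1 X t = (\<Sum>J | J \<subseteq> I & card J = r. \<Sum>p\<in>I-J. opf I (%c. if c \<in> insert p J then X else id) t)"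
  unfolding Mop_def by (intro sum.cong refl arg_cong2[where f="opf I"]) auto
 also have "... = (\<Sum>J | J \<subseteq> I & card J = Suc r. \<Sum>p\<in>J. opf I (%c. if c \<in> J then X else id) t)"
  by (rule sum_remove_element[OF I, symmetric])
 also have "... = (\<Sum>J | J \<subseteq> I & card J = Suc r. fscale (of_nat (Suc r)) (opf I (%c. if c \<in> J then X else id) t))"
  by (rule sum.cong[OF refl]) (auto simp: fs_simps)
 finally show ?thesis unfolding erop_def fs.scale_sum_right .
qed

lemma Mop_zero: "finite I ==> Mop I 0 i X t = Dop I (X ^^ i) t"
proof -
 assume I: "finite I"
 have eq: "{J. J \<subseteq> I & card J = 0} = {{}}" using I finite_subset by fastforce
 have 1: "Mop I 0 i X t = (\<Sum>p\<in>I. opf I (%c. if c = p then X ^^ i else if c \<in> {} then X else id) t)"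
  unfolding Mop_def eq by simp
 have fe: "(%c. if c = p then X ^^ i else if c \<in> {} then X else id) = (%_. id)(p := X ^^ i)" for p by auto
 show ?thesis unfolding Dop_def 1 fe ..
qed

text \<open>By Newton's identities a set of pairs closed under the Lie algebra is closed under the group.\<close>

lemma Dop_closed_tact_closed:
 fixes I :: "'i set"
 assumes I: "finite I" and QE: "Q \<subseteq> E I \<times> E I"
  and add: "!!s s' t t'. (s, s') \<in> Q ==> (t, t') \<in> Q ==> (s + t, s' + t') \<in> Q"
  and scale: "!!c t t'. (t, t') \<in> Q ==> (fscale c t, fscale c t') \<in> Q"
  and D: "!!X t t'. lin X ==> (t, t') \<in> Q ==> (Dop I X t, Dop I X t') \<in> Q"
  and t: "(t, t') \<in> Q" and g: "g \<in> GL sW"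
 shows "(tact g t, tact g t') \<in> Q"
proof -
 have lg: "lin g" using GL_lin[OF g] .
 have e: "erop I (Suc r) g t = fscale (inverse (of_nat (Suc r))) (Mop I r 1 g t)" for r t
  unfolding Mop_one[OF I] by (simp del: of_nat_Suc)
 have M: "(Mop I r i g t, Mop I r i g t') \<in> Q" if "(t, t') \<in> Q" for r i t t'
  using that
 proof (induction r arbitrary: i t t')
  case 0
  then show ?case unfolding Mop_zero[OF I] by (intro D lin_pow lg)
 next
  case (Suc r)
  \<comment> \<open>The product formula solved for the term with more occupied positions, so that
    induction on \<open>r\<close> reduces everything to derivations.\<close>
  have *: "Mop I (Suc r) i g t = fscale (inverse (of_nat (Suc r))) (Mop I r 1 g (Dop I (g ^^ i) t)) + fscale (- 1) (Mop I r (Suc i) g t)" for t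
   using erop_Dop[OF I lg, of "Suc r" i t] unfolding e by simp
  show ?case unfolding *
   by (intro add scale Suc.IH D lin_pow lg Suc.prems)
 qed
 have er: "(erop I r g t, erop I r g t') \<in> Q" if r: "r ~= 0" for r
 proof -
  obtain s where s: "r = Suc s" using r not0_implies_Suc by blast
  show ?thesis unfolding s e by (intro scale M t)
 qed
 \<comment> \<open>The top elementary symmetric function applies \<open>g\<close> in every position,
   which is the group action.\<close>
 have "tact g u = (if card I = 0 then u else erop I (card I) g u)" if u: "u \<in> E I" for u
 proof -
  have "{J. J \<subseteq> I & card J = card I} = {I}" using I card_subset_eq by blast
  then have "erop I (card I) g u = opf I (%c. if c \<in> I then g else id) u" by (simp add: erop_def)
  also have "... = opf I (%_. g) u" by (rule opf_cong) (use lg u in auto)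
  also have "... = tact g u" by (rule tact_opf[OF g u, symmetric])
  finally have 1: "erop I (card I) g u = tact g u" .
  have "tact g u = u" if "card I = 0"
  proof -
   have "I = {}" using that I by simp
   then have "tact g u = opf I (%_. id) u" unfolding tact_opf[OF g u] by (intro opf_cong) (use u in \<open>auto simp: lin_id\<close>)
   also have "... = u" by (rule E_eqI[OF flinear_opf flinear_id _ u]) (simp add: opf_pt lin_id)
   finally show ?thesis .
  qed
  then show ?thesis using 1 by simp
 qed
 moreover have "t \<in> E I" "t' \<in> E I" using QE t by auto
 ultimately show ?thesis using t er[of "card I"] by simp
qed

text \<open>The subspace of pairs generated from (u, u') by strictly lower matrix units acting on
  both entries at once. For highest weight vectors of the same weight in simple modules it is the
  graph of an isomorphism.\<close>

inductive_set lowering :: "'i set => (('i => 'w => 'k) => 'k) => (('i => 'w => 'k) => 'k)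
  => ((('i => 'w => 'k) => 'k) \<times> (('i => 'w => 'k) => 'k)) set"
 for I u u' where
 base: "(u, u') \<in> lowering I u u'"
| low: "(t, t') \<in> lowering I u u' ==> i < m ==> j < m ==> j < i
  ==> (Dop I (unit i j) t, Dop I (unit i j) t') \<in> lowering I u u'"
| add: "(s, s') \<in> lowering I u u' ==> (t, t') \<in> lowering I u u' ==> (s + t, s' + t') \<in> lowering I u u'"
| scale: "(t, t') \<in> lowering I u u' ==> (fscale c t, fscale c t') \<in> lowering I u u'"

text \<open>Small indices are high: trading an index for a smaller one decreases the sum of indices.
  A highest weight vector is therefore one whose weight has the least index sum.\<close>

definition top_vector :: "'i set => (('i => 'w => 'k) => 'k) set => nat multiset => (('i => 'w => 'k) => 'k) => bool" where
 "top_vector I N M u \<longleftrightarrow> u \<in> eig (tact hW) N (theta M) & u ~= 0 &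
   (\<forall>M'. eig (tact hW) N (theta M') ~= {0} --> sum_mset M \<le> sum_mset M')"

lemma wt_upd:
 assumes "finite I" "c \<in> I" shows "add_mset (S c) (wt I (S(c := j))) = add_mset j (wt I S)"
proof -
 have I: "mset_set I = add_mset c (mset_set (I - {c}))"
  using mset_set.remove[OF assms] .
 have "image_mset (S(c := j)) (mset_set (I - {c})) = image_mset S (mset_set (I - {c}))"
  using assms by (intro image_mset_cong) auto
 then show ?thesis unfolding wt_def I by simp
qed

text \<open>A raising operator would produce a weight of smaller index sum, and there is none. A
  diagonal matrix unit counts the occurrences of its index in the weight.\<close>

lemma top_vector_raise:
 assumes I: "finite I" and N: "stable (GL sW) tact N" "N \<subseteq> E I" and u: "top_vector I N M u" and ij: "i < m" "j < m"
 shows "i < j ==> Dop I (unit i j) u = 0" "i = j ==> Dop I (unit i j) u = fscale (of_nat (count M i)) u"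
proof -
 have uN: "u \<in> N" "tact hW u = fscale (theta M) u" using u by (auto simp: top_vector_def eig_def)
 have uE: "u \<in> E I" using uN N by blast
 have sup: "wt I T = M" if "T \<in> idx I" "u (bt T) ~= 0" for T using E_eig_iff[OF I uE] uN(2) that by blast
 have DE: "Dop I (unit i j) u \<in> E I" by (rule Dop_E[OF lin_unit uE])
 note co = Dop_coeff[OF I uE _ ij]
 have upd_idx: "S(c := j) \<in> idx I" if "S \<in> idx I" "c \<in> I" for S c using that ij by (auto simp: PiE_iff extensional_def)
 show "Dop I (unit i j) u = 0" if "i < j"
 proof (rule ccontr)
  assume nz: "Dop I (unit i j) u ~= 0"
  have supp: "add_mset i M = add_mset j (wt I S)" if S: "S \<in> idx I" "Dop I (unit i j) u (bt S) ~= 0" for S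
  proof -
   obtain c where "c \<in> I" "(if S c = i then u (bt (S(c := j))) else 0) ~= 0"
    using S(2) unfolding co[OF S(1)] by (rule sum.not_neutral_contains_not_neutral)
   then have c: "c \<in> I" "S c = i" "u (bt (S(c := j))) ~= 0" by (auto split: if_splits)
   have "wt I (S(c := j)) = M" by (rule sup[OF upd_idx[OF S(1) c(1)] c(3)])
   then show ?thesis using wt_upd[OF I c(1), of S j] c(2) by simp
  qed
  obtain S where S: "S \<in> idx I" "Dop I (unit i j) u (bt S) ~= 0"
   using nz E_ext[OF I DE fs.subspace_0[OF E_subspace]] by auto
  have "wt I S' = wt I S" if "S' \<in> idx I" "Dop I (unit i j) u (bt S') ~= 0" for S'
   using supp[OF that] supp[OF S] by simp
  then have "tact hW (Dop I (unit i j) u) = fscale (theta (wt I S)) (Dop I (unit i j) u)"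
   using E_eig_iff[OF I DE] by blast
  then have "Dop I (unit i j) u \<in> eig (tact hW) N (theta (wt I S))"
   using Dop_in_stable[OF I lin_unit N uN(1)] by (simp add: eig_def)
  then have "sum_mset M \<le> sum_mset (wt I S)" using u nz unfolding top_vector_def by blast
  moreover have "i + sum_mset M = j + sum_mset (wt I S)" using arg_cong[OF supp[OF S], of sum_mset] by simp
  ultimately show False using that by simp
 qed
 show "Dop I (unit i j) u = fscale (of_nat (count M i)) u" if "i = j"
 proof (rule E_ext[OF I DE fs.subspace_scale[OF E_subspace uE]])
  fix S assume S: "S \<in> idx I"
  have "Dop I (unit i j) u (bt S) = (\<Sum>c\<in>I. if S c = i then u (bt S) else 0)"
   unfolding co[OF S] by (rule sum.cong[OF refl]) (use \<open>i = j\<close> in \<open>auto simp: fun_upd_idem\<close>)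
  also have "... = of_nat (card {c\<in>I. S c = i}) * u (bt S)"
   using I by (simp add: sum.If_cases Int_def)
  also have "card {c\<in>I. S c = i} = count (wt I S) i"
  proof -
   have "count (wt I S) i = (\<Sum>c\<in>S -` {i} Int I. 1)"
    unfolding wt_def count_image_mset using I by (intro sum.cong) auto
   moreover have "S -` {i} Int I = {c\<in>I. S c = i}" by auto
   ultimately show ?thesis by simp
  qed
  also have "of_nat (count (wt I S) i) * u (bt S) = of_nat (count M i) * u (bt S)"
   using sup[OF S] by (cases "u (bt S) = 0") auto
  finally show "Dop I (unit i j) u (bt S) = fscale (of_nat (count M i)) u (bt S)" by (simp add: fscale_apply)
 qed
qed

lemma lowering_props:
 assumes I: "finite I" and N: "stable (GL sW) tact N" "N \<subseteq> E I" and N': "stable (GL sW) tact N'" "N' \<subseteq> E I"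
  and u: "u \<in> N" "u' \<in> N'" and t: "(t, t') \<in> lowering I u u'"
 shows "t \<in> N & t' \<in> N'"
 using t
proof (induction rule: lowering.induct)
 case base
 then show ?case using u by simp
next
 case (low t t' i j)
 then show ?case using Dop_in_stable[OF I lin_unit N] Dop_in_stable[OF I lin_unit N'] by blast
next
 case (add s s' t t')
 then show ?case using fs.subspace_add[OF stableD(1)[OF N(1)]] fs.subspace_add[OF stableD(1)[OF N'(1)]] by blast
next
 case (scale t t' c)
 then show ?case using fs.subspace_scale[OF stableD(1)[OF N(1)]] fs.subspace_scale[OF stableD(1)[OF N'(1)]] by blast
qed

text \<open>The operator is moved past the lowering operators. Each commutator is a combination of
  matrix units applied to a shorter word, and on (u, u') the raising and diagonal units act by a
  scalar common to both entries.\<close>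

lemma lowering_Dop_unit:
 assumes I: "finite I" and N: "stable (GL sW) tact N" "N \<subseteq> E I" and N': "stable (GL sW) tact N'" "N' \<subseteq> E I"
  and u: "top_vector I N M u" "top_vector I N' M u'" and t: "(t, t') \<in> lowering I u u'" and ij: "i < m" "j < m"
 shows "(Dop I (unit i j) t, Dop I (unit i j) t') \<in> lowering I u u'"
 using t ij
proof (induction arbitrary: i j rule: lowering.induct)
 case base
 consider "i < j" | "i = j" | "j < i" by linarith
 then show ?case
 proof cases
  case 1
  have "(fscale 0 u, fscale 0 u') \<in> lowering I u u'" by (intro lowering.scale lowering.base)
  then show ?thesis unfolding top_vector_raise(1)[OF I N u(1) base 1] top_vector_raise(1)[OF I N' u(2) base 1] fs.scale_zero_left .
 next
  case 2
  show ?thesis unfolding top_vector_raise(2)[OF I N u(1) base 2] top_vector_raise(2)[OF I N' u(2) base 2]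
   by (intro lowering.scale lowering.base)
 next
  case 3
  then show ?thesis using base by (intro lowering.low lowering.base)
 qed
next
 case (low t t' k l)
 have tE: "t \<in> E I" "t' \<in> E I"
  using lowering_props[OF I N N' _ _ low.hyps(1)] u N N' by (auto simp: top_vector_def eig_def)
 have eq: "Dop I (unit i j) (Dop I (unit k l) s) = Dop I (unit k l) (Dop I (unit i j) s)
   + fscale (if j = k then 1 else 0) (Dop I (unit i l) s) + fscale (if l = i then -1 else 0) (Dop I (unit k j) s)"
  if "s \<in> E I" for s
  unfolding Dop_commutator[OF I lin_unit lin_unit, of i j k l]
  using unit_comp[of j k i l] unit_comp[of l i k j] low.prems low.hyps Dop_zero[OF I that] by auto
 have "(Dop I (unit k l) (Dop I (unit i j) t) + fscale (if j = k then 1 else 0) (Dop I (unit i l) t) + fscale (if l = i then -1 else 0) (Dop I (unit k j) t),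
   Dop I (unit k l) (Dop I (unit i j) t') + fscale (if j = k then 1 else 0) (Dop I (unit i l) t') + fscale (if l = i then -1 else 0) (Dop I (unit k j) t')) \<in> lowering I u u'"
  by (intro lowering.add lowering.scale lowering.low low.IH low.prems low.hyps)
 then show ?case unfolding eq[OF tE(1)] eq[OF tE(2)] .
next
 case (add s s' t t')
 then show ?case unfolding fsp.linear_add[OF flinear_Dop] by (intro lowering.add)
next
 case (scale t t' c)
 then show ?case unfolding fsp.linear_scale[OF flinear_Dop] by (intro lowering.scale)
qed

text \<open>Matrix units span the Lie algebra, and closure under the Lie algebra passes to the group
  by Newton's identities.\<close>

lemma lowering_tact:
 assumes I: "finite I" and N: "stable (GL sW) tact N" "N \<subseteq> E I" and N': "stable (GL sW) tact N'" "N' \<subseteq> E I"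
  and u: "top_vector I N M u" "top_vector I N' M u'" and t: "(t, t') \<in> lowering I u u'" and g: "g \<in> GL sW"
 shows "(tact g t, tact g t') \<in> lowering I u u'"
proof (rule Dop_closed_tact_closed[OF I _ lowering.add lowering.scale _ t g])
 have uN: "u \<in> N" "u' \<in> N'" using u by (auto simp: top_vector_def eig_def)
 have LE: "t \<in> E I & t' \<in> E I" if "(t, t') \<in> lowering I u u'" for t t'
  using lowering_props[OF I N N' uN that] N N' by blast
 then show "lowering I u u' \<subseteq> E I \<times> E I" by auto
 have "(fscale 0 u, fscale 0 u') \<in> lowering I u u'" by (intro lowering.scale lowering.base)
 then have zero: "(0, 0) \<in> lowering I u u'" unfolding fs.scale_zero_left .
 have sum: "(\<Sum>i\<in>F. f i, \<Sum>i\<in>F. f' i) \<in> lowering I u u'" if "finite F" "!!i. i \<in> F ==> (f i, f' i) \<in> lowering I u u'"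
  for F :: "nat set" and f f'
 proof -
  have "(sum f F, sum f' F) \<in> lowering I u u'" using that
  proof (induction F rule: finite_induct)
   case empty
   show ?case using zero by (simp only: sum.empty)
  next
   case (insert x F)
   then show ?case unfolding sum.insert[OF insert(1,2)] by (intro lowering.add) auto
  qed
  then show ?thesis .
 qed
 fix X t t' assume X: "lin X" and t: "(t, t') \<in> lowering I u u'"
 show "(Dop I X t, Dop I X t') \<in> lowering I u u'"
  unfolding Dop_expand[OF I X conjunct1[OF LE[OF t]]] Dop_expand[OF I X conjunct2[OF LE[OF t]]]
  by (intro sum lowering.scale lowering_Dop_unit[OF I N N' u t]) auto
qed

definition deep :: "'i set => nat => (('i => 'w => 'k) => 'k) set" where
 "deep I d = {u \<in> E I. \<forall>T\<in>idx I. u (bt T) ~= 0 --> d < sum_mset (wt I T)}"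

lemma deep_subspace: "fs.subspace (deep I d)"
 using E_subspace[of I] unfolding fs.subspace_def deep_def
 by (auto simp: fscale_apply)

lemma Dop_lowers:
 assumes I: "finite I" and u: "u \<in> E I" "!!T. T \<in> idx I ==> u (bt T) ~= 0 ==> d \<le> sum_mset (wt I T)"
  and ij: "i < m" "j < m" "j < i"
 shows "Dop I (unit i j) u \<in> deep I d"
 unfolding deep_def
proof (intro CollectI conjI ballI impI)
 show "Dop I (unit i j) u \<in> E I" by (rule Dop_E[OF lin_unit u(1)])
 fix S assume S: "S \<in> idx I" "Dop I (unit i j) u (bt S) ~= 0"
 obtain c where "c \<in> I" "(if S c = i then u (bt (S(c := j))) else 0) ~= 0"
  using S(2) unfolding Dop_coeff[OF I u(1) S(1) ij(1,2)] by (rule sum.not_neutral_contains_not_neutral)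
 then have c: "c \<in> I" "S c = i" "u (bt (S(c := j))) ~= 0" by (auto split: if_splits)
 have "S(c := j) \<in> idx I" using S(1) c(1) ij by (auto simp: PiE_iff extensional_def)
 then have "d \<le> sum_mset (wt I (S(c := j)))" using u(2) c(3) by blast
 moreover have "i + sum_mset (wt I (S(c := j))) = j + sum_mset (wt I S)"
  using arg_cong[OF wt_upd[OF I c(1), of S j], of sum_mset] c(2) by simp
 ultimately show "d < sum_mset (wt I S)" using ij by simp
qed

text \<open>Lowering operators strictly increase the index sum, so up to deeper terms a pair is a
  multiple of (u, u') with one scalar for both entries. This common scalar excludes the pairs (0,
  u') and (u, 0).\<close>

lemma lowering_top:
 assumes I: "finite I" and N: "stable (GL sW) tact N" "N \<subseteq> E I" and N': "stable (GL sW) tact N'" "N' \<subseteq> E I"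
  and u: "top_vector I N M u" "top_vector I N' M u'" and t: "(t, t') \<in> lowering I u u'"
 shows "\<exists>c. t - fscale c u \<in> deep I (sum_mset M) & t' - fscale c u' \<in> deep I (sum_mset M)"
proof -
 let ?A = "deep I (sum_mset M)"
 have uN: "u \<in> N" "u' \<in> N'" using u by (auto simp: top_vector_def eig_def)
 have uE: "u \<in> E I" "u' \<in> E I" using uN N N' by auto
 have su: "wt I T = M" if "T \<in> idx I" "u (bt T) ~= 0" for T
  using E_eig_iff[OF I uE(1)] u(1) that unfolding top_vector_def eig_def by blast
 have su': "wt I T = M" if "T \<in> idx I" "u' (bt T) ~= 0" for T
  using E_eig_iff[OF I uE(2)] u(2) that unfolding top_vector_def eig_def by blast
 have Dd: "Dop I (unit i j) s \<in> ?A" if s: "s - fscale c v \<in> ?A" and v: "v \<in> E I" "!!T. T \<in> idx I ==> v (bt T) ~= 0 ==> wt I T = M"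
  and ij: "i < m" "j < m" "j < i" for s c v i j
 proof -
  have eq: "Dop I (unit i j) s = Dop I (unit i j) (s - fscale c v) + fscale c (Dop I (unit i j) v)"
   by (simp only: fsp.linear_diff[OF flinear_Dop] fsp.linear_scale[OF flinear_Dop] diff_add_cancel)
  have 1: "Dop I (unit i j) (s - fscale c v) \<in> ?A"
   by (rule Dop_lowers[OF I _ _ ij]) (use s in \<open>auto simp: deep_def\<close>)
  have 2: "Dop I (unit i j) v \<in> ?A"
   by (rule Dop_lowers[OF I v(1) _ ij]) (use v(2) in auto)
  show ?thesis by (subst eq) (intro fs.subspace_add[OF deep_subspace] fs.subspace_scale[OF deep_subspace] 1 2)
 qed
 show ?thesis using t
 proof (induction rule: lowering.induct)
  case base
  have "u - fscale 1 u = 0" "u' - fscale 1 u' = 0" by simp_all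
  then show ?case using fs.subspace_0[OF deep_subspace] by (intro exI[of _ 1]) (simp only: simp_thms)
 next
  case (low t t' i j)
  then obtain c where "t - fscale c u \<in> ?A" "t' - fscale c u' \<in> ?A" by blast
  then have "Dop I (unit i j) t \<in> ?A" "Dop I (unit i j) t' \<in> ?A"
   using Dd[OF _ uE(1) su] Dd[OF _ uE(2) su'] low.hyps by blast+
  then show ?case by (intro exI[of _ 0]) (simp only: fs.scale_zero_left diff_zero simp_thms)
 next
  case (add s s' t t')
  then obtain c d where cd: "s - fscale c u \<in> ?A" "s' - fscale c u' \<in> ?A" "t - fscale d u \<in> ?A" "t' - fscale d u' \<in> ?A" by blast
  have eq: "s + t - fscale (c + d) v = (s - fscale c v) + (t - fscale d v)" for s t v :: "('a => 'w => 'k) => 'k"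
   by (simp add: fs_simps algebra_simps)
  show ?case by (rule exI[of _ "c + d"], unfold eq) (intro conjI fs.subspace_add[OF deep_subspace] cd)
 next
  case (scale t t' a)
  then obtain c where cd: "t - fscale c u \<in> ?A" "t' - fscale c u' \<in> ?A" by blast
  have eq: "fscale a t - fscale (a * c) v = fscale a (t - fscale c v)" for t v :: "('a => 'w => 'k) => 'k"
   by (simp add: fs_simps algebra_simps)
  show ?case by (rule exI[of _ "a * c"], unfold eq) (intro conjI fs.subspace_scale[OF deep_subspace] cd)
 qed
qed

lemma top_vector_not_deep:
 assumes I: "finite I" and N: "N \<subseteq> E I" and u: "top_vector I N M u" and c: "fscale c u \<in> deep I (sum_mset M)"
 shows "c = 0"
proof (rule ccontr)
 assume "c ~= 0"
 have uE: "u \<in> E I" using u N by (auto simp: top_vector_def eig_def)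
 have "\<exists>T\<in>idx I. u (bt T) ~= 0"
  using E_ext[OF I uE fs.subspace_0[OF E_subspace]] u by (auto simp: top_vector_def)
 then obtain T where T: "T \<in> idx I" "u (bt T) ~= 0" by blast
 then have "wt I T = M" using E_eig_iff[OF I uE] u unfolding top_vector_def eig_def by blast
 moreover have "sum_mset M < sum_mset (wt I T)" using c T \<open>c ~= 0\<close> by (auto simp: deep_def fscale_apply)
 ultimately show False by simp
qed

text \<open>The two projections of the set of pairs are nonzero stable subspaces of \<open>N\<close>
  and \<open>N'\<close>, hence everything. The pairs with first entry 0 give a stable subspace of
  \<open>N'\<close> that omits \<open>u'\<close>, hence 0, and likewise on the other side. So the
  set is the graph of an isomorphism.\<close>

theorem highest_weight_iso:
 fixes I :: "'i set"
 assumes I: "finite I" and N: "simple_sub (GL sW) tact N" "N \<subseteq> E I" and N': "simple_sub (GL sW) tact N'" "N' \<subseteq> E I"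
  and u: "top_vector I N M u" "top_vector I N' M u'"
 shows "isomorphic_modules sW (fmod tact N) (fmod tact N')"
proof -
 let ?Q = "lowering I u u'"
 note st = simple_subD(1)[OF N(1)] simple_subD(1)[OF N'(1)]
 have sN: "fs.subspace N" "fs.subspace N'" using st stableD(1) by blast+
 have uN: "u \<in> N" "u' \<in> N'" "u ~= 0" "u' ~= 0" using u by (auto simp: top_vector_def eig_def)
 have QN: "t \<in> N" "t' \<in> N'" if "(t, t') \<in> ?Q" for t t'
  using lowering_props[OF I st(1) N(2) st(2) N'(2) uN(1,2) that] by auto
 have Qg: "(tact g t, tact g t') \<in> ?Q" if "(t, t') \<in> ?Q" "g \<in> GL sW" for t t' g
  by (rule lowering_tact[OF I st(1) N(2) st(2) N'(2) u that])
 have "(fscale 0 u, fscale 0 u') \<in> ?Q" by (intro lowering.scale lowering.base)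
 then have Q0: "(0, 0) \<in> ?Q" unfolding fs.scale_zero_left .
 have Qd: "(s - t, s' - t') \<in> ?Q" if "(s, s') \<in> ?Q" "(t, t') \<in> ?Q" for s s' t t'
  using lowering.add[OF that(1) lowering.scale[OF that(2), of "-1"]] by simp
 note top = lowering_top[OF I st(1) N(2) st(2) N'(2) u]
 have s1: "stable (GL sW) tact {t. \<exists>t'. (t, t') \<in> ?Q}"
  unfolding stable_def fs.subspace_def using Q0 lowering.add lowering.scale Qg by blast
 have s2: "stable (GL sW) tact {t'. \<exists>t. (t, t') \<in> ?Q}"
  unfolding stable_def fs.subspace_def using Q0 lowering.add lowering.scale Qg by blast
 have z: "fscale c 0 = (0 :: ('i => 'w => 'k) => 'k)" "tact g 0 = (0 :: ('i => 'w => 'k) => 'k)" for c g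
  using fsp.linear_0[OF flinear_tact] by auto
 have k1: "stable (GL sW) tact {t'. (0, t') \<in> ?Q}"
  unfolding stable_def fs.subspace_def
 proof (intro conjI ballI allI; unfold mem_Collect_eq)
  show "(0, x + y) \<in> ?Q" if "(0, x) \<in> ?Q" "(0, y) \<in> ?Q" for x y using lowering.add[OF that] by simp
  show "(0, fscale c x) \<in> ?Q" if "(0, x) \<in> ?Q" for c x using lowering.scale[OF that, of c] z by simp
  show "(0, tact g x) \<in> ?Q" if "g \<in> GL sW" "(0, x) \<in> ?Q" for g x using Qg[OF that(2,1)] z by simp
 qed (rule Q0)
 have k2: "stable (GL sW) tact {t. (t, 0) \<in> ?Q}"
  unfolding stable_def fs.subspace_def
 proof (intro conjI ballI allI; unfold mem_Collect_eq)
  show "(x + y, 0) \<in> ?Q" if "(x, 0) \<in> ?Q" "(y, 0) \<in> ?Q" for x y using lowering.add[OF that] by simp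
  show "(fscale c x, 0) \<in> ?Q" if "(x, 0) \<in> ?Q" for c x using lowering.scale[OF that, of c] z by simp
  show "(tact g x, 0) \<in> ?Q" if "g \<in> GL sW" "(x, 0) \<in> ?Q" for g x using Qg[OF that(2,1)] z by simp
 qed (rule Q0)
 have e1: "{t. \<exists>t'. (t, t') \<in> ?Q} = N"
  using simple_subD(3)[OF N(1) s1] QN(1) lowering.base[of u u' I] uN(3) by blast
 have e2: "{t'. \<exists>t. (t, t') \<in> ?Q} = N'"
  using simple_subD(3)[OF N'(1) s2] QN(2) lowering.base[of u u' I] uN(4) by blast
 have c0: "fscale c u \<in> deep I (sum_mset M)" if "0 - fscale c u \<in> deep I (sum_mset M)" for c u
  using fs.subspace_neg[OF deep_subspace that] by simp
 have f1: "t' = 0" if "(0, t') \<in> ?Q" for t'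
 proof -
  have "{t'. (0, t') \<in> ?Q} ~= N'"
  proof
   assume "{t'. (0, t') \<in> ?Q} = N'"
   then have "(0, u') \<in> ?Q" using uN by blast
   then obtain c where c: "0 - fscale c u \<in> deep I (sum_mset M)" "u' - fscale c u' \<in> deep I (sum_mset M)" using top by blast
   have "c = 0" by (rule top_vector_not_deep[OF I N(2) u(1) c0[OF c(1)]])
   then have "fscale 1 u' \<in> deep I (sum_mset M)" using c(2) by simp
   then show False using top_vector_not_deep[OF I N'(2) u(2)] by fastforce
  qed
  then have "{t'. (0, t') \<in> ?Q} = {0}" using simple_subD(3)[OF N'(1) k1] QN(2) by blast
  then show ?thesis using that by blast
 qed
 have f2: "t = 0" if "(t, 0) \<in> ?Q" for t
 proof -
  have "{t. (t, 0) \<in> ?Q} ~= N"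
  proof
   assume "{t. (t, 0) \<in> ?Q} = N"
   then have "(u, 0) \<in> ?Q" using uN by blast
   then obtain c where c: "u - fscale c u \<in> deep I (sum_mset M)" "0 - fscale c u' \<in> deep I (sum_mset M)" using top by blast
   have "c = 0" by (rule top_vector_not_deep[OF I N'(2) u(2) c0[OF c(2)]])
   then have "fscale 1 u \<in> deep I (sum_mset M)" using c(1) by simp
   then show False using top_vector_not_deep[OF I N(2) u(1)] by fastforce
  qed
  then have "{t. (t, 0) \<in> ?Q} = {0}" using simple_subD(3)[OF N(1) k2] QN(1) by blast
  then show ?thesis using that by blast
 qed
 define h where "h t = (THE t'. (t, t') \<in> ?Q)" for t
 have h: "h t = t'" if "(t, t') \<in> ?Q" for t t'
  unfolding h_def
 proof (rule the_equality)
  show "(t, t') \<in> ?Q" by (fact that)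
  fix s assume "(t, s) \<in> ?Q"
  then have "(t - t, s - t') \<in> ?Q" using Qd that by blast
  then have "(0, s - t') \<in> ?Q" unfolding diff_self .
  then have "s - t' = 0" by (rule f1)
  then show "s = t'" unfolding right_minus_eq .
 qed
 have hQ: "(t, h t) \<in> ?Q" if t: "t \<in> N" for t
 proof -
  obtain t' where t': "(t, t') \<in> ?Q" using t e1 by blast
  then show ?thesis unfolding h[OF t'] .
 qed
 show ?thesis
 proof (rule isomorphic_fmodI[where h=h])
  show "bij_betw h N N'" unfolding bij_betw_def
  proof
   show "inj_on h N"
   proof (rule inj_onI)
    fix x y assume xy: "x \<in> N" "y \<in> N" "h x = h y"
    have "(x - y, h x - h y) \<in> ?Q" using Qd hQ xy by blast
    then have "(x - y, 0) \<in> ?Q" unfolding xy(3) diff_self .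
    then have "x - y = 0" by (rule f2)
    then show "x = y" unfolding right_minus_eq .
   qed
   show "h ` N = N'"
   proof
    show "h ` N \<subseteq> N'" using hQ QN(2) by blast
    show "N' \<subseteq> h ` N"
    proof
     fix t' assume "t' \<in> N'"
     then obtain t where t: "(t, t') \<in> ?Q" using e2 by blast
     then show "t' \<in> h ` N" using h[OF t] QN(1)[OF t] by blast
    qed
   qed
  qed
  show "equivariant_on (GL sW) tact tact N h"
   unfolding equivariant_on_def
   using h[OF lowering.add[OF hQ hQ]] h[OF lowering.scale[OF hQ]] h[OF Qg[OF hQ]] by blast
 qed
qed

end

section \<open>Semistandard tableaux\<close>

lemma finite_cells: "finite (cells lam)"
proof (rule finite_subset)
 show "cells lam \<subseteq> {..<length lam} \<times> {..<Suc (sum_list lam)}"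
  by (auto simp: cells_def less_Suc_eq_le intro!: order_trans[OF less_imp_le member_le_sum_list])
qed auto

lemma cells_left: "(i, j) \<in> cells lam ==> j' \<le> j ==> (i, j') \<in> cells lam"
 by (auto simp: cells_def)

lemma cells_up:
 assumes "is_partition lam" "(i, j) \<in> cells lam" "i' \<le> i" shows "(i', j) \<in> cells lam"
proof (cases "i' = i")
 case False
 then have "lam ! i \<le> lam ! i'" using assms by (auto simp: is_partition_def cells_def sorted_wrt_iff_nth_less)
 then show ?thesis using assms by (auto simp: cells_def)
qed (use assms in simp)

lemma row_group_permutes: "p \<in> row_group lam ==> p permutes cells lam" by (simp add: row_group_def)
lemma column_group_permutes: "q \<in> column_group lam ==> q permutes cells lam" by (simp add: column_group_def)

lemma row_fst: "p \<in> row_group lam ==> fst (p c) = fst c" by (simp add: row_group_def del: split_paired_All)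
lemma col_snd: "q \<in> column_group lam ==> snd (q c) = snd c" by (simp add: column_group_def del: split_paired_All)
lemma row_groupI: "p permutes cells lam ==> (!!c. fst (p c) = fst c) ==> p \<in> row_group lam" by (simp add: row_group_def del: split_paired_All)
lemma column_groupI: "p permutes cells lam ==> (!!c. snd (p c) = snd c) ==> p \<in> column_group lam" by (simp add: column_group_def del: split_paired_All)

lemma finite_groups: "finite (row_group lam)" "finite (column_group lam)"
 by (rule finite_subset[OF _ finite_permutations[OF finite_cells[of lam]]], auto simp: row_group_def column_group_def)+

lemma id_groups: "id \<in> row_group lam" "id \<in> column_group lam"
 by (auto simp: row_group_def column_group_def permutes_id)

lemma inv_keeps:
 assumes "q permutes C" "!!c. f (q c) = f c" shows "f (inv q c) = f c"
 using assms(2)[of "inv q c"] permutes_inverses(1)[OF assms(1)] by simp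

lemma bij_left_mult:
 assumes "q permutes C" "!!x. x \<in> H ==> q o x \<in> H" "!!x. x \<in> H ==> inv q o x \<in> H"
 shows "bij_betw (%x. q o x) H H"
proof (rule bij_betw_byWitness[where f'="%x. inv q o x"])
 show "\<forall>a\<in>H. inv q o (q o a) = a" "\<forall>a\<in>H. q o (inv q o a) = a"
  using permutes_inv_o[OF assms(1)] by (auto simp: comp_assoc[symmetric])
qed (use assms(2,3) in blast)+

lemma bij_row: "p \<in> row_group lam ==> bij_betw (%x. p o x) (row_group lam) (row_group lam)"
proof (rule bij_left_mult[OF row_group_permutes])
 assume p: "p \<in> row_group lam"
 note pp = row_group_permutes[OF p]
 fix x assume x: "x \<in> row_group lam"
 show "p o x \<in> row_group lam"
  by (rule row_groupI[OF permutes_compose[OF row_group_permutes[OF x] pp]]) (simp add: row_fst[OF p] row_fst[OF x])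
 show "inv p o x \<in> row_group lam"
  by (rule row_groupI[OF permutes_compose[OF row_group_permutes[OF x] permutes_inv[OF pp]]])
    (simp add: inv_keeps[where f=fst, OF pp row_fst[OF p]] row_fst[OF x])
qed

lemma bij_column: "q \<in> column_group lam ==> bij_betw (%x. q o x) (column_group lam) (column_group lam)"
proof (rule bij_left_mult[OF column_group_permutes])
 assume p: "q \<in> column_group lam"
 note pp = column_group_permutes[OF p]
 fix x assume x: "x \<in> column_group lam"
 show "q o x \<in> column_group lam"
  by (rule column_groupI[OF permutes_compose[OF column_group_permutes[OF x] pp]]) (simp add: col_snd[OF p] col_snd[OF x])
 show "inv q o x \<in> column_group lam"
  by (rule column_groupI[OF permutes_compose[OF column_group_permutes[OF x] permutes_inv[OF pp]]])
    (simp add: inv_keeps[where f=snd, OF pp col_snd[OF p]] col_snd[OF x])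
qed

lemma column_comp: "q \<in> column_group lam ==> q' \<in> column_group lam ==> q o q' \<in> column_group lam"
 by (rule column_groupI[OF permutes_compose[OF column_group_permutes column_group_permutes]]) (simp_all add: col_snd)

lemma sign_comp_permutes: "finite C ==> p permutes C ==> q permutes C ==> sign (p o q) = sign p * sign q"
 by (rule sign_compose) (auto simp: permutation_permutes)

lemma sign_square: "sign p * sign p = (1::int)" by (simp add: sign_def)

text \<open>The coordinates, with respect to the standard basis of the tensor power, of the Young symmetrizer
 applied to the basis tensor of the filling \<open>T\<close>.\<close>

definition vv :: "nat list => (nat \<times> nat => nat) => (nat \<times> nat => nat) => 'k::field_char_0" where
 "vv lam T = (%S. \<Sum>p\<in>row_group lam. \<Sum>q\<in>column_group lam. of_int (sign q) * (if T o q o p = S then 1 else 0))"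

lemma vv_column:
 assumes q: "q \<in> column_group lam"
 shows "vv lam (T o q) = (fscale (of_int (sign q)) (vv lam T) :: _ => 'k::field_char_0)"
proof
 fix S :: "nat \<times> nat => nat"
 have *: "(\<Sum>r\<in>column_group lam. of_int (sign r) * (if T o q o r o p = S then 1 else 0 :: 'k))
   = of_int (sign q) * (\<Sum>r\<in>column_group lam. of_int (sign r) * (if T o r o p = S then 1 else 0))" for p
 proof -
  have "(\<Sum>r\<in>column_group lam. of_int (sign r) * (if T o r o p = S then 1 else 0 :: 'k))
   = (\<Sum>r\<in>column_group lam. of_int (sign (q o r)) * (if T o (q o r) o p = S then 1 else 0))"
   by (rule sum.reindex_bij_betw[OF bij_column[OF q], symmetric])
  also have "... = (\<Sum>r\<in>column_group lam. of_int (sign q) * (of_int (sign r) * (if T o q o r o p = S then 1 else 0)))"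
   by (rule sum.cong[OF refl])
     (simp add: sign_comp_permutes[OF finite_cells column_group_permutes[OF q] column_group_permutes] comp_assoc)
  also have "... = of_int (sign q) * (\<Sum>r\<in>column_group lam. of_int (sign r) * (if T o q o r o p = S then 1 else 0))"
   by (rule sum_distrib_left[symmetric])
  finally have eq: "(\<Sum>r\<in>column_group lam. of_int (sign r) * (if T o r o p = S then 1 else 0 :: 'k))
   = of_int (sign q) * (\<Sum>r\<in>column_group lam. of_int (sign r) * (if T o q o r o p = S then 1 else 0))" .
  have "of_int (sign q) * of_int (sign q) = (1 :: 'k)" by (simp add: sign_def)
  then show ?thesis unfolding eq mult.assoc[symmetric] by simp
 qed
 show "vv lam (T o q) S = fscale (of_int (sign q)) (vv lam T :: _ => 'k) S"
  unfolding vv_def fscale_apply * sum_distrib_left[symmetric] ..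
qed

text \<open>Garnir relation. Some two cells in a common row are moved into \<open>G\<close> by each column permutation, so
 that the antisymmetrizer of \<open>G\<close> is killed by the row symmetrizer.\<close>

lemma vv_garnir:
 assumes G: "G \<subseteq> cells lam"
  and coll: "!!q. q \<in> column_group lam ==> \<exists>c c'. c ~= c' & fst c = fst c' & q c \<in> G & q c' \<in> G"
 shows "(\<Sum>s | s permutes G. fscale (of_int (sign s)) (vv lam (T o s))) = (0 :: _ => 'k::field_char_0)"
proof
 fix S :: "nat \<times> nat => nat"
 have finG: "finite G" using G finite_cells finite_subset by blast
 let ?P = "{s. s permutes G}"
 \<comment> \<open>A transposition of two cells in one row becomes, through \<open>q\<close>, a
   transposition inside \<open>G\<close>. Reindexing the row group by the first and the permutations
   of \<open>G\<close> by the second turns the sum into its negative.\<close>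
 have F0: "(\<Sum>s\<in>?P. \<Sum>p\<in>row_group lam. of_int (sign s) * (if T o s o q o p = S then 1 else 0)) = (0 :: 'k)" (is "?F = 0")
  if q: "q \<in> column_group lam" for q
 proof -
  obtain c c' where c: "c ~= c'" "fst c = fst c'" "q c \<in> G" "q c' \<in> G" using coll[OF q] by blast
  have qp: "q permutes cells lam" using column_group_permutes[OF q] .
  have cc: "c \<in> cells lam" "c' \<in> cells lam" using c G permutes_in_image[OF qp] by blast+
  let ?t = "transpose c c'" and ?t' = "transpose (q c) (q c')"
  have tr: "?t \<in> row_group lam"
   by (rule row_groupI[OF permutes_swap_id[OF cc]]) (use c(2) in \<open>simp add: transpose_def\<close>)
  have tG: "?t' permutes G" using c by (simp add: permutes_swap_id)
  have qt: "q o ?t = ?t' o q"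
   by (rule ext) (simp add: transpose_def inj_eq[OF permutes_inj[OF qp]])
  have sg: "sign (s o ?t') = - sign s" if "s permutes G" for s
  proof -
   have "q c ~= q c'" using c(1) permutes_inj[OF qp] by (simp add: inj_eq)
   then show ?thesis using sign_comp_permutes[OF finG that tG] by (simp add: sign_swap_id)
  qed
  have "?F = (\<Sum>s\<in>?P. \<Sum>p\<in>row_group lam. of_int (sign s) * (if T o s o q o (?t o p) = S then 1 else 0))"
   by (intro sum.cong refl sum.reindex_bij_betw[OF bij_row[OF tr], symmetric])
  also have "... = (\<Sum>s\<in>?P. \<Sum>p\<in>row_group lam. - (of_int (sign (s o ?t')) * (if T o (s o ?t') o q o p = S then 1 else 0)))"
  proof (intro sum.cong refl)
   fix s p :: "nat \<times> nat => nat \<times> nat" assume "s \<in> ?P"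
   then have "s permutes G" by simp
   moreover have "T o s o q o (?t o p) = T o (s o ?t') o q o p"
    using qt by (metis comp_assoc)
   ultimately show "of_int (sign s) * (if T o s o q o (?t o p) = S then 1 else 0 :: 'k)
    = - (of_int (sign (s o ?t')) * (if T o (s o ?t') o q o p = S then 1 else 0))" by (simp add: sg)
  qed
  also have "... = - (\<Sum>s\<in>?P. \<Sum>p\<in>row_group lam. of_int (sign (s o ?t')) * (if T o (s o ?t') o q o p = S then 1 else 0))"
   by (simp add: sum_negf)
  also have "(\<Sum>s\<in>?P. \<Sum>p\<in>row_group lam. of_int (sign (s o ?t')) * (if T o (s o ?t') o q o p = S then 1 else 0)) = ?F"
  proof (rule sum.reindex_bij_betw)
   show "bij_betw (%s. s o ?t') ?P ?P"
    by (rule bij_betw_byWitness[where f'="%s. s o ?t'"])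
      (auto simp: comp_assoc permutes_compose[OF tG])
  qed
  finally have neg: "?F = - ?F" .
  have "x = 0" if "x = - x" for x :: 'k
  proof -
   have "2 * x = 0" using that by (metis add.right_inverse mult_2)
   then show ?thesis by simp
  qed
  from this[OF neg] show ?thesis .
 qed
 have "(\<Sum>s\<in>?P. fscale (of_int (sign s)) (vv lam (T o s))) S
   = (\<Sum>s\<in>?P. \<Sum>p\<in>row_group lam. \<Sum>q\<in>column_group lam. of_int (sign s) * (of_int (sign q) * (if T o s o q o p = S then 1 else 0 :: 'k)))"
  by (simp add: sum_fun_apply fscale_apply vv_def sum_distrib_left)
 also have "... = (\<Sum>s\<in>?P. \<Sum>q\<in>column_group lam. \<Sum>p\<in>row_group lam. of_int (sign s) * (of_int (sign q) * (if T o s o q o p = S then 1 else 0)))"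
  by (intro sum.cong refl sum.swap)
 also have "... = (\<Sum>q\<in>column_group lam. \<Sum>s\<in>?P. \<Sum>p\<in>row_group lam. of_int (sign s) * (of_int (sign q) * (if T o s o q o p = S then 1 else 0)))"
  by (rule sum.swap)
 also have "... = (\<Sum>q\<in>column_group lam. of_int (sign q) * (\<Sum>s\<in>?P. \<Sum>p\<in>row_group lam. of_int (sign s) * (if T o s o q o p = S then 1 else 0)))"
  by (simp only: sum_distrib_left mult.left_commute)
 also have "... = 0" by (rule sum.neutral, rule ballI) (simp only: F0 mult_zero_right)
 finally show "(\<Sum>s\<in>?P. fscale (of_int (sign s)) (vv lam (T o s))) S = (0 :: _ => 'k) S" by simp
qed

section \<open>Straightening of fillings\<close>

definition fillings :: "nat list => nat multiset => (nat \<times> nat => nat) set" where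
 "fillings lam M = {T \<in> extensional (cells lam). image_mset T (mset_set (cells lam)) = M}"

lemma fillings_comp:
 assumes "T \<in> fillings lam M" "s permutes cells lam" shows "T o s \<in> fillings lam M"
proof -
 have "image_mset s (mset_set (cells lam)) = mset_set (cells lam)"
  using image_mset_mset_set[OF permutes_inj_on[OF assms(2)], of "cells lam"] permutes_image[OF assms(2)] by simp
 then have "image_mset (T o s) (mset_set (cells lam)) = M"
  using assms(1) by (simp add: fillings_def multiset.map_comp[symmetric])
 moreover have "T o s \<in> extensional (cells lam)"
  using assms by (auto simp: fillings_def extensional_def permutes_not_in)
 ultimately show ?thesis by (simp add: fillings_def)
qed

lemma fillings_in: "T \<in> fillings lam M ==> c \<in> cells lam ==> T c \<in># M"
 using finite_cells[of lam] by (auto simp: fillings_def)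

lemma finite_fillings: "finite (fillings lam M)"
proof (rule finite_subset)
 show "fillings lam M \<subseteq> PiE (cells lam) (%_. set_mset M)"
 proof (rule subsetI, rule PiE_I)
  fix T c assume T: "T \<in> fillings lam M"
  show "c \<in> cells lam ==> T c \<in> set_mset M" using fillings_in[OF T] by blast
  have "T \<in> extensional (cells lam)" using T by (simp add: fillings_def)
  then show "c \<notin> cells lam ==> T c = undefined" by (rule extensional_arb)
 qed
qed (simp add: finite_PiE finite_cells)

definition rowdeg :: "nat list => (nat \<times> nat => nat) => nat" where
 "rowdeg lam T = (\<Sum>c\<in>cells lam. T c * fst c)"

text \<open>Of the two statistics, \<open>coldeg\<close> is constant under column permutations and
  grows when larger entries move right, which drives the straightening; \<open>rowdeg\<close> is
  constant under row permutations and grows when larger entries move down, which provides leading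
  terms.\<close>

definition coldeg :: "nat list => (nat \<times> nat => nat) => nat" where
 "coldeg lam T = (\<Sum>c\<in>cells lam. T c * snd c)"

lemma coldeg_column: assumes "q \<in> column_group lam" shows "coldeg lam (T o q) = coldeg lam T"
proof -
 have "coldeg lam T = (\<Sum>c\<in>cells lam. T (q c) * snd (q c))"
  unfolding coldeg_def using sum.permute[OF column_group_permutes[OF assms], of "%c. T c * snd c"] by (simp add: comp_def)
 then show ?thesis by (simp add: coldeg_def col_snd[OF assms])
qed

lemma rowdeg_row: assumes "p \<in> row_group lam" shows "rowdeg lam (T o p) = rowdeg lam T"
proof -
 have "rowdeg lam T = (\<Sum>c\<in>cells lam. T (p c) * fst (p c))"
  unfolding rowdeg_def using sum.permute[OF row_group_permutes[OF assms], of "%c. T c * fst c"] by (simp add: comp_def)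
 then show ?thesis by (simp add: rowdeg_def row_fst[OF assms])
qed

lemma transpose_column:
 "(i, j) \<in> cells lam ==> (i', j) \<in> cells lam ==> transpose (i, j) (i', j) \<in> column_group lam"
 by (rule column_groupI) (simp_all add: permutes_swap_id transpose_def)

lemma rowdeg_swap:
 assumes c: "(i, j) \<in> cells lam" "(i', j) \<in> cells lam" and i: "i < i'" "T (i', j) < T (i, j)"
 shows "rowdeg lam T < rowdeg lam (T o transpose (i, j) (i', j))"
proof -
 let ?R = "cells lam - {(i, j)} - {(i', j)}"
 have split: "(\<Sum>c\<in>cells lam. f c) = f (i, j) + (f (i', j) + (\<Sum>c\<in>?R. f c))" for f :: "nat \<times> nat => nat"
  using sum.remove[OF finite_cells c(1), of f] sum.remove[of "cells lam - {(i, j)}" "(i', j)" f] c i finite_cells by simp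
 have "(\<Sum>c\<in>?R. (T o transpose (i, j) (i', j)) c * fst c) = (\<Sum>c\<in>?R. T c * fst c)"
  by (rule sum.cong) (auto simp: transpose_def)
 moreover have "T (i, j) * i + T (i', j) * i' < T (i', j) * i + T (i, j) * i'"
 proof -
  obtain x where x: "i' = i + Suc x" using less_imp_Suc_add[OF i(1)] by auto
  have "A * i + B * (i + Suc x) < B * i + A * (i + Suc x)" if "B < A" for A B :: nat
  proof -
   have "B + x * B < A + x * A" by (rule add_less_le_mono[OF that]) (use that in simp)
   then show ?thesis by (simp add: algebra_simps)
  qed
  from this[OF i(2)] show ?thesis unfolding x .
 qed
 ultimately show ?thesis unfolding rowdeg_def split using i by simp
qed

text \<open>Exchanging an inversion in a column increases \<open>rowdeg\<close>, so a column
  permutation maximizing it leaves no inversion.\<close>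

lemma column_sorting:
 obtains q where "q \<in> column_group lam" "!!q'. q' \<in> column_group lam ==> rowdeg lam (T o q') \<le> rowdeg lam (T o q)"
  "!!i i' j. (i, j) \<in> cells lam ==> (i', j) \<in> cells lam ==> i < i' ==> T (q (i, j)) \<le> T (q (i', j))"
proof -
 let ?A = "(%q. rowdeg lam (T o q)) ` column_group lam"
 have "finite ?A" "?A ~= {}" using finite_groups(2)[of lam] id_groups(2)[of lam] by blast+
 then have "Max ?A \<in> ?A" by (rule Max_in)
 then obtain q where q: "q \<in> column_group lam" "rowdeg lam (T o q) = Max ?A" by auto
 have mx: "rowdeg lam (T o q') \<le> rowdeg lam (T o q)" if "q' \<in> column_group lam" for q'
  unfolding q(2) using \<open>finite ?A\<close> that by (intro Max_ge) auto
 have "T (q (i, j)) \<le> T (q (i', j))" if c: "(i, j) \<in> cells lam" "(i', j) \<in> cells lam" "i < i'" for i i' j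
 proof (rule ccontr)
  assume "\<not> ?thesis"
  then have "rowdeg lam (T o q) < rowdeg lam (T o q o transpose (i, j) (i', j))"
   using rowdeg_swap[OF c, of "T o q"] by simp
  also have "... \<le> rowdeg lam (T o q)"
   using mx[OF column_comp[OF q(1) transpose_column[OF c(1,2)]]] by (simp add: comp_assoc)
  finally show False by simp
 qed
 then show ?thesis using that q mx by blast
qed

text \<open>The Garnir set joins column j from row i downwards with column j + 1 from the top to row
  i. It has one cell more than column j, so by the pigeonhole principle every column permutation
  brings two cells of a common row into it. Entries in its right part are smaller than
  \<open>T (i, j)\<close> and those in its left part are not, so permutations mixing the two parts
  increase \<open>coldeg\<close>.\<close>

lemma straightening_step:
 assumes lam: "is_partition lam" and T: "T \<in> fillings lam M"
  and col: "!!i i' j. (i, j) \<in> cells lam ==> (i', j) \<in> cells lam ==> i < i' ==> T (i, j) < T (i', j)"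
  and bad: "(i, Suc j) \<in> cells lam" "T (i, Suc j) < T (i, j)"
 shows "(vv lam T :: _ => 'k::field_char_0) \<in> fs.span (vv lam ` {S \<in> fillings lam M. coldeg lam T < coldeg lam S})"
proof -
 define G1 where "G1 = {(i', j) |i'. i \<le> i' & (i', j) \<in> cells lam}"
 define G2 where "G2 = (%i'. (i', Suc j)) ` {..i}"
 define G where "G = G1 Un G2"
 have G2c: "G2 \<subseteq> cells lam" using cells_up[OF lam bad(1)] by (auto simp: G2_def)
 have Gc: "G \<subseteq> cells lam" using G2c by (auto simp: G_def G1_def)
 have finG: "finite G" using Gc finite_cells finite_subset by blast
 have fin1: "finite G1" "finite G2" using finG by (auto simp: G_def)
 have disj: "G1 Int G2 = {}" by (auto simp: G1_def G2_def)
 have snd1: "snd c = j" if "c \<in> G1" for c using that by (auto simp: G1_def)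
 have snd2: "snd c = Suc j" if "c \<in> G2" for c using that by (auto simp: G2_def)
 define R where "R = {i'. (i', j) \<in> cells lam}"
 have finR: "finite R" unfolding R_def using finite_cells[of lam] by (rule finite_imageI[of _ fst, THEN finite_subset[rotated]]) force
 have iR: "{..i} \<subseteq> R" unfolding R_def using cells_up[OF lam cells_left[OF bad(1), of j]] by auto
 have G1R: "G1 = (%i'. (i', j)) ` (R - {..<i})" by (auto simp: G1_def R_def)
 have c1: "card G1 = card R - i"
 proof -
  have "{..<i} \<subseteq> R" using iR by auto
  then have "card (R - {..<i}) = card R - i" by (simp add: card_Diff_subset)
  moreover have "card ((%i'. (i', j)) ` (R - {..<i})) = card (R - {..<i})" by (rule card_image) (auto simp: inj_on_def)
  ultimately show ?thesis using G1R by simp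
 qed
 have c2: "card G2 = Suc i" unfolding G2_def by (subst card_image) (auto simp: inj_on_def)
 have "Suc i \<le> card R" using card_mono[OF finR iR] by simp
 then have cG: "card G = Suc (card R)" unfolding G_def using card_Un_disjoint[OF fin1 disj] c1 c2 by simp
 have coll: "\<exists>c c'. c ~= c' & fst c = fst c' & q c \<in> G & q c' \<in> G" if q: "q \<in> column_group lam" for q
 proof -
  have qp: "q permutes cells lam" using column_group_permutes[OF q] .
  let ?H = "{c. q c \<in> G}"
  have Hc: "?H \<subseteq> cells lam" using Gc permutes_in_image[OF qp] by blast
  have "q ` ?H = G" using surj_image_vimage_eq[OF permutes_surj[OF qp], of G] by (simp add: vimage_def)
  then have "card ?H = card G" using card_image[OF inj_on_subset[OF permutes_inj[OF qp] subset_UNIV], of ?H] by simp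
  moreover have "fst ` ?H \<subseteq> R"
  proof clarify
   fix a d assume d: "q (a, d) \<in> G"
   have "snd (q (a, d)) = d" using col_snd[OF q, of "(a, d)"] by simp
   moreover have "q (a, d) \<in> G1 \<or> q (a, d) \<in> G2" using d by (simp add: G_def)
   ultimately have "j \<le> d" using snd1[of "q (a, d)"] snd2[of "q (a, d)"] by linarith
   then show "fst (a, d) \<in> R" unfolding R_def using cells_left[of a d lam j] Hc d by auto
  qed
  ultimately have "\<not> inj_on fst ?H"
   using card_inj_on_le[OF _ \<open>fst ` ?H \<subseteq> R\<close> finR] cG by auto
  then show ?thesis unfolding inj_on_def by blast
 qed
 let ?P = "{s. s permutes G}" and ?Q = "{s. s permutes G & s \<in> column_group lam}"
 have finP: "finite ?P" using finG by (simp add: finite_permutations)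
 have sub: "s permutes cells lam" if "s permutes G" for s using permutes_subset[OF that Gc] .
 let ?W = "vv lam ` {S \<in> fillings lam M. coldeg lam T < coldeg lam S} :: (_ => 'k) set"
 have up: "coldeg lam T < coldeg lam (T o s)" if s: "s \<in> ?P - ?Q" for s
 proof -
  have sG: "s permutes G" "s \<notin> column_group lam" using s by auto
  \<comment> \<open>Centered at \<open>T (i, j)\<close>, entries are negative on the right part and
    nonnegative on the left part, so any exchange between the parts raises the sum over the right
    part.\<close>
  define f where "f c = int (T c) - int (T (i, j))" for c
  have f1: "0 \<le> f c" if c: "c \<in> G1" for c
  proof -
   obtain i' where i': "c = (i', j)" "i \<le> i'" "(i', j) \<in> cells lam" using c by (auto simp: G1_def)
   then show ?thesis using col[OF cells_left[OF bad(1)], of j i'] by (cases "i = i'") (auto simp: f_def)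
  qed
  have f2: "f c < 0" if c: "c \<in> G2" for c
  proof -
   obtain i' where i': "c = (i', Suc j)" "i' \<le> i" using c by (auto simp: G2_def)
   then have "T c \<le> T (i, Suc j)" using col[of i' "Suc j" i] G2c c bad(1) by (cases "i = i'") auto
   then show ?thesis using bad(2) by (simp add: f_def)
  qed
  have sG2: "s ` G2 \<subseteq> G" using permutes_image[OF sG(1)] by (auto simp: G_def)
  have ne: "G2 - s ` G2 ~= {}"
  proof
   assume "G2 - s ` G2 = {}"
   then have eq: "s ` G2 = G2" using card_seteq[of "s ` G2" G2] fin1 card_image_le[of G2 s] by blast
   have "s c \<in> G1" if "c \<in> G1" for c
   proof -
    have "s c \<in> G" using that permutes_in_image[OF sG(1)] by (simp add: G_def)
    moreover have "s c \<notin> G2"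
    proof
     assume "s c \<in> G2"
     then have "s c \<in> s ` G2" using eq by simp
     then obtain d where "d \<in> G2" "s c = s d" by (rule imageE)
     then have "c \<in> G2" using permutes_inj[OF sG(1)] by (simp add: inj_eq)
     then show False using that disj by blast
    qed
    ultimately show ?thesis by (simp add: G_def)
   qed
   note s1 = this
   have "snd (s c) = snd c" for c
   proof -
    consider "c \<in> G1" | "c \<in> G2" | "c \<notin> G" by (auto simp: G_def)
    then show ?thesis
    proof cases
     case 1 show ?thesis using snd1[OF s1[OF 1]] snd1[OF 1] by simp
    next
     case 2
     then have "s c \<in> G2" using eq by blast
     then show ?thesis using snd2[of "s c"] snd2[OF 2] by simp
    next
     case 3 show ?thesis using permutes_not_in[OF sG(1) 3] by simp
    qed
   qed
   then show False using sG(2) column_groupI[OF sub[OF sG(1)]] by blast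
  qed
  have fins: "finite (s ` G2)" using fin1 by simp
  have "(\<Sum>c\<in>s ` G2. f c) - (\<Sum>c\<in>G2. f c) = (\<Sum>c\<in>s ` G2 - G2. f c) - (\<Sum>c\<in>G2 - s ` G2. f c)"
   using sum.Int_Diff[OF fins, where g=f and B=G2] sum.Int_Diff[OF fin1(2), where g=f and B="s ` G2"] by (simp add: Int_commute)
  moreover have "0 \<le> (\<Sum>c\<in>s ` G2 - G2. f c)"
   by (rule sum_nonneg) (use sG2 f1 in \<open>auto simp: G_def\<close>)
  moreover have "(\<Sum>c\<in>G2 - s ` G2. f c) < 0"
   using sum_strict_mono[of "G2 - s ` G2" f "%_. 0"] fin1 ne f2 by auto
  ultimately have "(\<Sum>c\<in>G2. f c) < (\<Sum>c\<in>s ` G2. f c)" by simp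
  also have "(\<Sum>c\<in>s ` G2. f c) = (\<Sum>c\<in>G2. f (s c))"
   using sum.reindex[OF permutes_inj_on[OF sG(1)], where A=G2 and g=f] by (simp add: comp_def)
  finally have lt: "(\<Sum>c\<in>G2. int (T c)) < (\<Sum>c\<in>G2. int (T (s c)))" by (simp add: f_def sum_subtractf)
  have tot: "(\<Sum>c\<in>G. int (T (s c))) = (\<Sum>c\<in>G. int (T c))"
   using sum.permute[OF sG(1), of "%c. int (T c)"] by (simp add: comp_def)
  have g: "(\<Sum>c\<in>G. int (U c) * int (snd c)) = int j * (\<Sum>c\<in>G. int (U c)) + (\<Sum>c\<in>G2. int (U c))" for U :: "nat \<times> nat => nat"
  proof -
   have "(\<Sum>c\<in>G1. int (U c) * int (snd c)) = int j * (\<Sum>c\<in>G1. int (U c))"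
    by (auto simp: sum_distrib_left snd1 intro!: sum.cong)
   moreover have "(\<Sum>c\<in>G2. int (U c) * int (snd c)) = int j * (\<Sum>c\<in>G2. int (U c)) + (\<Sum>c\<in>G2. int (U c))"
    by (auto simp: sum_distrib_left snd2 algebra_simps sum.distrib[symmetric] intro!: sum.cong)
   ultimately show ?thesis unfolding G_def by (simp add: sum.union_disjoint[OF fin1 disj] algebra_simps)
  qed
  have cd: "int (coldeg lam U) = (\<Sum>c\<in>cells lam - G. int (U c) * int (snd c)) + (\<Sum>c\<in>G. int (U c) * int (snd c))" for U
   unfolding coldeg_def using sum.subset_diff[OF Gc finite_cells, of "%c. int (U c) * int (snd c)"] by simp
  have "(\<Sum>c\<in>cells lam - G. int ((T o s) c) * int (snd c)) = (\<Sum>c\<in>cells lam - G. int (T c) * int (snd c))"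
   by (rule sum.cong) (auto simp: permutes_not_in[OF sG(1)])
  then have "int (coldeg lam T) < int (coldeg lam (T o s))" unfolding cd g using lt tot by simp
  then show ?thesis by simp
 qed
 have "0 = (\<Sum>s\<in>?P. fscale (of_int (sign s)) (vv lam (T o s)) :: _ => 'k)"
  by (rule vv_garnir[OF Gc coll, symmetric])
 also have "... = (\<Sum>s\<in>?P-?Q. fscale (of_int (sign s)) (vv lam (T o s))) + (\<Sum>s\<in>?Q. fscale (of_int (sign s)) (vv lam (T o s)))"
  by (rule sum.subset_diff[OF _ finP]) auto
 \<comment> \<open>The sign cancels against column antisymmetry, so each permutation of the Garnir
   set that preserves columns contributes the vector of \<open>T\<close> itself; the identity is one
   of them.\<close>
 also have "(\<Sum>s\<in>?Q. fscale (of_int (sign s)) (vv lam (T o s)) :: _ => 'k) = (\<Sum>s\<in>?Q. vv lam T)"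
 proof (rule sum.cong[OF refl])
  fix s assume s: "s \<in> ?Q"
  then have "vv lam (T o s) = (fscale (of_int (sign s)) (vv lam T) :: _ => 'k)" by (intro vv_column) simp
  then show "fscale (of_int (sign s)) (vv lam (T o s)) = (vv lam T :: _ => 'k)"
   by (simp add: of_int_mult[symmetric] sign_square del: of_int_mult)
 qed
 also have "... = fscale (of_nat (card ?Q)) (vv lam T)" by (simp add: fs_simps)
 finally have e0: "0 = (\<Sum>s\<in>?P-?Q. fscale (of_int (sign s)) (vv lam (T o s)) :: _ => 'k) + fscale (of_nat (card ?Q)) (vv lam T)" .
 have "fscale (of_nat (card ?Q)) (vv lam T) = - (\<Sum>s\<in>?P-?Q. fscale (of_int (sign s)) (vv lam (T o s)) :: _ => 'k)"
  by (rule minus_unique[OF e0[symmetric], symmetric])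
 also have "... \<in> fs.span ?W"
 proof (intro fs.span_neg fs.span_sum fs.span_scale fs.span_base imageI CollectI conjI up)
  show "T o s \<in> fillings lam M" if "s \<in> ?P - ?Q" for s
   by (rule fillings_comp[OF T sub]) (use that in auto)
 qed
 finally have "fscale (of_nat (card ?Q)) (vv lam T) \<in> fs.span ?W" .
 moreover have "card ?Q ~= 0"
 proof -
  have "id \<in> ?Q" using id_groups by (simp add: permutes_id)
  moreover have "finite ?Q" using finP by (rule finite_subset[rotated]) auto
  ultimately show ?thesis by (metis card_0_eq empty_iff)
 qed
 ultimately show ?thesis
  using fs.span_scale[of "fscale (of_nat (card ?Q)) (vv lam T)" ?W "inverse (of_nat (card ?Q))"] by simp
qed

definition ssyt_content :: "nat list => nat multiset => (nat \<times> nat => nat) set" where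
 "ssyt_content lam M = {T \<in> ssyt lam. image_mset T (mset_set (cells lam)) = M}"

lemma ssyt_contentI:
 assumes T: "T \<in> fillings lam M"
  and col: "!!i i' j. (i, j) \<in> cells lam ==> (i', j) \<in> cells lam ==> i < i' ==> T (i, j) < T (i', j)"
  and row: "!!i j. (i, Suc j) \<in> cells lam ==> T (i, j) \<le> T (i, Suc j)"
 shows "T \<in> ssyt_content lam M"
proof -
 have "T (i, j) \<le> T (i, j + d)" if "(i, j + d) \<in> cells lam" for i j d
  using that
 proof (induction d)
  case (Suc d)
  then have "(i, j + d) \<in> cells lam" using cells_left[of i "j + Suc d"] by simp
  then show ?case using Suc row[of i "j + d"] by simp
 qed simp
 then have "T (i, j) \<le> T (i, j')" if "(i, j') \<in> cells lam" "j < j'" for i j j'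
  using that less_imp_add_positive[OF that(2)] by blast
 then show ?thesis using T col by (auto simp: ssyt_content_def ssyt_def fillings_def)
qed

lemma ssyt_content_subset: "ssyt_content lam M \<subseteq> fillings lam M"
 by (auto simp: ssyt_content_def ssyt_def fillings_def)

text \<open>Induction on the distance of \<open>coldeg\<close> from an upper bound. Sorting the
  columns costs a sign, a repeated entry in a column makes the vector its own negative, and a
  descent in a row is traded by the Garnir relation for fillings with larger
  \<open>coldeg\<close>.\<close>

lemma straightening:
 assumes lam: "is_partition lam" and T: "T \<in> fillings lam M"
 shows "(vv lam T :: _ => 'k::field_char_0) \<in> fs.span (vv lam ` ssyt_content lam M)"
proof -
 define Bd where "Bd = sum_mset M * (\<Sum>c\<in>cells lam. snd c)"
 have le: "coldeg lam T \<le> Bd" if "T \<in> fillings lam M" for T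
 proof -
  have "T c \<le> sum_mset M" if "c \<in> cells lam" for c
   using fillings_in[OF \<open>T \<in> fillings lam M\<close> that] by (metis le_add1 multi_member_split sum_mset.add_mset)
  then show ?thesis unfolding coldeg_def Bd_def sum_distrib_left by (intro sum_mono mult_le_mono1)
 qed
 show ?thesis using T
 proof (induction "Bd - coldeg lam T" arbitrary: T rule: less_induct)
  case less
  obtain q where q: "q \<in> column_group lam"
   "!!i i' j. (i, j) \<in> cells lam ==> (i', j) \<in> cells lam ==> i < i' ==> T (q (i, j)) \<le> T (q (i', j))"
   by (rule column_sorting[of lam T]) blast
  let ?T = "T o q"
  have T1: "?T \<in> fillings lam M" by (rule fillings_comp[OF less.prems column_group_permutes[OF q(1)]])
  have "(vv lam ?T :: _ => 'k) \<in> fs.span (vv lam ` ssyt_content lam M)"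
  proof (cases "\<exists>i i' j. (i, j) \<in> cells lam & (i', j) \<in> cells lam & i < i' & ?T (i, j) = ?T (i', j)")
   case True
   then obtain i i' j where c: "(i, j) \<in> cells lam" "(i', j) \<in> cells lam" "i < i'" "?T (i, j) = ?T (i', j)" by blast
   have "?T o transpose (i, j) (i', j) = ?T" using c(4) by (auto simp: fun_eq_iff transpose_def)
   then have "(vv lam ?T :: _ => 'k) = fscale (of_int (sign (transpose (i, j) (i', j)))) (vv lam ?T)"
    using vv_column[OF transpose_column[OF c(1,2)], of ?T] by simp
   then have "(vv lam ?T :: _ => 'k) = - vv lam ?T" using c(3) by (simp add: sign_swap_id)
   then have "vv lam ?T = (0 :: _ => 'k)" by (auto simp: fun_eq_iff)
   then show ?thesis using fs.span_zero by simp
  next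
   case False
   then have col: "?T (i, j) < ?T (i', j)" if "(i, j) \<in> cells lam" "(i', j) \<in> cells lam" "i < i'" for i i' j
    using q(2)[OF that] that by (metis comp_apply le_neq_implies_less)
   show ?thesis
   proof (cases "\<exists>i j. (i, Suc j) \<in> cells lam & ?T (i, Suc j) < ?T (i, j)")
    case True
    then obtain i j where bad: "(i, Suc j) \<in> cells lam" "?T (i, Suc j) < ?T (i, j)" by blast
    have "vv lam ` {S \<in> fillings lam M. coldeg lam ?T < coldeg lam S} \<subseteq> (fs.span (vv lam ` ssyt_content lam M) :: (_ => 'k) set)"
    proof clarify
     fix S assume S: "S \<in> fillings lam M" "coldeg lam ?T < coldeg lam S"
     have "Bd - coldeg lam S < Bd - coldeg lam T" using S le[OF S(1)] coldeg_column[OF q(1), of T] by simp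
     then show "vv lam S \<in> (fs.span (vv lam ` ssyt_content lam M) :: (_ => 'k) set)" by (rule less.hyps[OF _ S(1)])
    qed
    then show ?thesis using straightening_step[OF lam T1 col bad] fs.span_minimal[OF _ fs.subspace_span] by blast
   next
    case False
    then have "?T \<in> ssyt_content lam M" by (intro ssyt_contentI[OF T1 col]) (auto simp: not_less)
    then show ?thesis by (intro fs.span_base imageI)
   qed
  qed
  moreover have "(vv lam T :: _ => 'k) = fscale (of_int (sign q)) (vv lam ?T)"
   unfolding vv_column[OF q(1)] by (simp add: of_int_mult[symmetric] sign_square del: of_int_mult)
  ultimately show ?case using fs.span_scale by metis
 qed
qed

section \<open>Linear independence of the vectors of semistandard tableaux\<close>

lemma strict_mono_perm_id:
 fixes f :: "nat => nat"
 assumes "!!i i'. i < i' ==> i' < l ==> f i < f i'" "f ` {..<l} \<subseteq> {..<l}" "i < l"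
 shows "f i = i"
proof -
 have ge: "i \<le> f i" if "i < l" for i
  using that
 proof (induction i)
  case (Suc i)
  then show ?case using assms(1)[of i "Suc i"] by simp
 qed simp
 have inj: "inj_on f {..<l}"
 proof (rule inj_onI)
  fix x y assume "x \<in> {..<l}" "y \<in> {..<l}" "f x = f y"
  then show "x = y" using assms(1)[of x y] assms(1)[of y x] by (cases x y rule: linorder_cases) auto
 qed
 have "f ` {..<l} = {..<l}" by (rule card_seteq) (use assms(2) card_image[OF inj] in auto)
 then have "(\<Sum>i<l. f i) = (\<Sum>i<l. i)" using sum.reindex[OF inj, of "%x. x"] by simp
 then show ?thesis
  using sum_strict_mono_ex1[of "{..<l}" "%i. i" f] ge assms(3) by (metis finite_lessThan lessThan_iff nat_neq_iff le_neq_implies_less order_less_irrefl)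
qed

text \<open>A maximizer of \<open>rowdeg\<close> leaves the columns weakly sorted, which for
  strictly increasing columns only the identity does. A column permutation that does not decrease
  \<open>rowdeg\<close> is then a maximizer itself.\<close>

lemma rowdeg_column_less:
 assumes lam: "is_partition lam" and T: "T \<in> ssyt lam" and q: "q \<in> column_group lam"
  and le: "rowdeg lam T \<le> rowdeg lam (T o q)"
 shows "q = id"
proof -
 have col: "T (i, j) < T (i', j)" if "(i, j) \<in> cells lam" "(i', j) \<in> cells lam" "i < i'" for i i' j
  using T that by (auto simp: ssyt_def)
 have max_id: "r = id" if r: "r \<in> column_group lam"
  "!!i i' j. (i, j) \<in> cells lam ==> (i', j) \<in> cells lam ==> i < i' ==> T (r (i, j)) \<le> T (r (i', j))" for r
 proof
  fix c :: "nat \<times> nat"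
  obtain i j where c: "c = (i, j)" by fastforce
  have rp: "r permutes cells lam" using column_group_permutes[OF r(1)] .
  have sr: "snd (r c) = snd c" for c using col_snd[OF r(1)] .
  show "r c = id c"
  proof (cases "c \<in> cells lam")
   case True
   define l where "l = card {i'. (i', j) \<in> cells lam}"
   have fin: "finite {i'. (i', j) \<in> cells lam}"
    using finite_cells[of lam] by (rule finite_imageI[of _ fst, THEN finite_subset[rotated]]) force
   have R: "{i'. (i', j) \<in> cells lam} = {..<l}"
   proof -
    let ?A = "{i'. (i', j) \<in> cells lam}"
    have "\<exists>n. ?A = {..<n}"
    proof -
     have dc: "x \<in> ?A" if "y \<in> ?A" "x \<le> y" for x y using cells_up[OF lam] that by auto
     have "?A = {..<Suc (Max ?A)}"
     proof (intro equalityI subsetI)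
      fix x assume "x \<in> ?A" then show "x \<in> {..<Suc (Max ?A)}" using Max_ge[OF fin] by (simp add: less_Suc_eq_le)
     next
      fix x assume "x \<in> {..<Suc (Max ?A)}"
      moreover have "Max ?A \<in> ?A" by (rule Max_in[OF fin]) (use True c in auto)
      ultimately show "x \<in> ?A" using dc by (simp add: less_Suc_eq_le del: mem_Collect_eq)
     qed
     then show ?thesis by blast
    qed
    then obtain n where n: "?A = {..<n}" by blast
    show ?thesis unfolding l_def n by simp
   qed
   let ?f = "%i. fst (r (i, j))"
   have rc: "r (x, j) = (?f x, j)" for x using sr[of "(x, j)"] by (cases "r (x, j)") simp
   have mem: "(x, j) \<in> cells lam \<longleftrightarrow> x < l" for x using arg_cong[OF R, of "%A. x \<in> A"] by simp
   have rin: "(?f x, j) \<in> cells lam" if "x < l" for x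
    using permutes_in_image[OF rp, of "(x, j)"] mem[of x] that rc[of x] by metis
   have sm: "?f x < ?f y" if "x < y" "y < l" for x y
   proof -
    have xl: "x < l" using that by simp
    have xy: "(x, j) \<in> cells lam" "(y, j) \<in> cells lam" using mem xl that(2) by simp_all
    have le: "T (?f x, j) \<le> T (?f y, j)"
     using r(2)[OF xy that(1)] arg_cong[OF rc[of x], of T] arg_cong[OF rc[of y], of T] by linarith
    have ne: "?f x ~= ?f y"
    proof
     assume "?f x = ?f y"
     then have "(?f x, j) = (?f y, j)" by simp
     then have "r (x, j) = r (y, j)" by (rule trans[OF trans[OF rc] rc[symmetric]])
     then show False using that(1) injD[OF permutes_inj[OF rp]] by fastforce
    qed
    show ?thesis
    proof (rule ccontr)
     assume "\<not> ?thesis"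
     then have "?f y < ?f x" using ne by simp
     then have "T (?f y, j) < T (?f x, j)" by (rule col[OF rin[OF that(2)] rin[OF xl]])
     then show False using le by simp
    qed
   qed
   have "?f i = i"
   proof (rule strict_mono_perm_id[of l ?f])
    show "?f ` {..<l} \<subseteq> {..<l}" using rin mem by blast
    show "i < l" using True c mem by simp
   qed (rule sm)
   then show ?thesis using rc[of i] c by simp
  next
   case False
   then show ?thesis using permutes_not_in[OF rp] by simp
  qed
 qed
 obtain r where r: "r \<in> column_group lam" "!!q'. q' \<in> column_group lam ==> rowdeg lam (T o q') \<le> rowdeg lam (T o r)"
  "!!i i' j. (i, j) \<in> cells lam ==> (i', j) \<in> cells lam ==> i < i' ==> T (r (i, j)) \<le> T (r (i', j))"
  by (rule column_sorting[of lam T]) blast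
 have "r = id" by (rule max_id[OF r(1,3)])
 then have mx: "rowdeg lam (T o q') \<le> rowdeg lam T" if "q' \<in> column_group lam" for q' using r(2)[OF that] by simp
 have "T (q (i, j)) \<le> T (q (i', j))" if c: "(i, j) \<in> cells lam" "(i', j) \<in> cells lam" "i < i'" for i i' j
 proof (rule ccontr)
  assume "\<not> ?thesis"
  then have "rowdeg lam (T o q) < rowdeg lam (T o q o transpose (i, j) (i', j))"
   using rowdeg_swap[OF c, of "T o q"] by simp
  also have "... \<le> rowdeg lam T"
   using mx[OF column_comp[OF q transpose_column[OF c(1,2)]]] by (simp add: comp_assoc)
  finally show False using le by simp
 qed
 then show ?thesis by (rule max_id[OF q])
qed

text \<open>A row of a semistandard tableau is the sorted list of its entries, and a row permutation
  preserves the multiset of entries of each row.\<close>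

lemma ssyt_row_unique:
 assumes T: "T \<in> ssyt lam" "T' \<in> ssyt lam" and p: "p \<in> row_group lam" "T' o p = T"
 shows "T' = T"
proof
 fix c :: "nat \<times> nat"
 obtain i j where c: "c = (i, j)" by fastforce
 show "T' c = T c"
 proof (cases "c \<in> cells lam")
  case False
  have "T \<in> extensional (cells lam)" "T' \<in> extensional (cells lam)" using T by (simp_all add: ssyt_def)
  then show ?thesis using extensional_arb False by metis
 next
  case True
  let ?n = "lam ! i"
  have ij: "i < length lam" "j < ?n" using True c by (auto simp: cells_def)
  let ?R = "Pair i ` {..<?n}"
  have pp: "p permutes cells lam" "!!c. fst (p c) = fst c" using row_group_permutes[OF p(1)] row_fst[OF p(1)] by blast+
  have R: "?R = {d \<in> cells lam. fst d = i}" using ij by (auto simp: cells_def)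
  have pR: "p ` ?R = ?R"
  proof -
   have "p ` ?R \<subseteq> ?R" unfolding R using permutes_in_image[OF pp(1)] pp(2) by auto
   then show ?thesis by (intro card_seteq) (auto simp: card_image[OF inj_on_subset[OF permutes_inj[OF pp(1)] subset_UNIV]])
  qed
  have ms: "mset (map (%j. U (i, j)) [0..<?n]) = image_mset U (mset_set ?R)" for U :: "nat \<times> nat => nat"
  proof -
   have "mset_set ?R = image_mset (Pair i) (mset_set {..<?n})"
    by (rule image_mset_mset_set[symmetric]) (auto simp: inj_on_def)
   then show ?thesis by (simp add: multiset.map_comp comp_def lessThan_atLeast0)
  qed
  have "image_mset T (mset_set ?R) = image_mset T' (image_mset p (mset_set ?R))"
   unfolding p(2)[symmetric] by (simp add: multiset.map_comp)
  also have "image_mset p (mset_set ?R) = mset_set (p ` ?R)"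
   by (rule image_mset_mset_set) (use permutes_inj[OF pp(1)] in \<open>auto simp: inj_on_def inj_def\<close>)
  finally have meq: "mset (map (%j. T (i, j)) [0..<?n]) = mset (map (%j. T' (i, j)) [0..<?n])"
   unfolding ms pR .
  have srt: "sorted (map (%j. U (i, j)) [0..<?n])" if "U \<in> ssyt lam" for U
   using that ij by (auto simp: ssyt_def cells_def sorted_wrt_iff_nth_less)
  have "map (%j. T (i, j)) [0..<?n] = map (%j. T' (i, j)) [0..<?n]"
   using properties_for_sort[OF meq srt[OF T(1)]] sorted_sort_id[OF srt[OF T(2)]] by simp
  then have "map (%j. T (i, j)) [0..<?n] ! j = map (%j. T' (i, j)) [0..<?n] ! j" by (rule arg_cong)
  then show ?thesis using ij c by simp
 qed
qed

text \<open>Leading terms: among the tableaux with nonzero coefficient take \<open>T\<close> with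
  the largest \<open>rowdeg\<close>. Another one reaches the coordinate \<open>T\<close> only
  through a column permutation not decreasing its \<open>rowdeg\<close>, hence through the identity,
  and then a row permutation forces equality. The diagonal coordinate counts the row permutations
  fixing \<open>T\<close>, which is nonzero in characteristic 0.\<close>

lemma vv_independent:
 assumes lam: "is_partition lam" and X: "finite X" "X \<subseteq> ssyt lam"
  and z: "(\<Sum>T\<in>X. fscale (a T) (vv lam T)) = (0 :: _ => 'k::field_char_0)" and T0: "T0 \<in> X"
 shows "a T0 = 0"
proof (rule ccontr)
 assume "a T0 ~= 0"
 let ?Y = "{T\<in>X. a T ~= 0}"
 have "finite (rowdeg lam ` ?Y)" "rowdeg lam ` ?Y ~= {}" using X T0 \<open>a T0 ~= 0\<close> by auto
 then have "Max (rowdeg lam ` ?Y) \<in> rowdeg lam ` ?Y" by (rule Max_in)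
 then obtain T where T: "T \<in> X" "a T ~= 0" "rowdeg lam T = Max (rowdeg lam ` ?Y)" by auto
 have mx: "rowdeg lam T' \<le> rowdeg lam T" if "T' \<in> ?Y" for T'
  unfolding T(3) using that \<open>finite (rowdeg lam ` ?Y)\<close> by (intro Max_ge) auto
 have only_id: "q = id & T' = T" if "T' \<in> ?Y" "q \<in> column_group lam" "p \<in> row_group lam" "T' o q o p = T" for T' q p
 proof -
  have "rowdeg lam T' \<le> rowdeg lam (T' o q)" using mx[OF that(1)] rowdeg_row[OF that(3), of "T' o q"] that(4) by simp
  then have "q = id" using rowdeg_column_less[OF lam _ that(2), of T'] that(1) X(2) by blast
  then show ?thesis using ssyt_row_unique[of T lam T' p] that T X(2) by auto
 qed
 have vT: "vv lam T T = (of_nat (card {p\<in>row_group lam. T o p = T}) :: 'k)"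
 proof -
  have "(\<Sum>q\<in>column_group lam. of_int (sign q) * (if T o q o p = T then 1 else 0 :: 'k)) = (if T o p = T then 1 else 0)"
   if p: "p \<in> row_group lam" for p
  proof -
   have "(\<Sum>q\<in>column_group lam. of_int (sign q) * (if T o q o p = T then 1 else 0 :: 'k))
     = (\<Sum>q\<in>column_group lam. if q = id then (if T o p = T then 1 else 0) else 0)"
    using only_id[of T _ p] p T by (intro sum.cong refl) (auto simp: sign_id)
   then show ?thesis using finite_groups(2)[of lam] id_groups(2)[of lam] by simp
  qed
  then have "vv lam T T = (\<Sum>p\<in>row_group lam. if T o p = T then 1 else 0 :: 'k)" by (simp add: vv_def)
  then show ?thesis using finite_groups(1)[of lam] by (simp add: sum.If_cases Int_def)
 qed
 have vT': "vv lam T' T = (0 :: 'k)" if "T' \<in> ?Y" "T' ~= T" for T'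
  unfolding vv_def
 proof (rule sum.neutral, rule ballI, rule sum.neutral, rule ballI)
  fix p q assume "p \<in> row_group lam" "q \<in> column_group lam"
  then have "T' o q o p ~= T" using only_id[OF that(1)] that(2) by blast
  then show "of_int (sign q) * (if T' o q o p = T then 1 else 0) = (0 :: 'k)" by simp
 qed
 have "0 = (\<Sum>T'\<in>X. a T' * vv lam T' T)" using fun_cong[OF z, of T] by (simp add: sum_fun_apply fscale_apply)
 also have "... = (\<Sum>T'\<in>X. if T' = T then a T * vv lam T T else 0)"
  by (rule sum.cong[OF refl]) (use vT' in auto)
 also have "... = a T * vv lam T T" using X T by simp
 finally have "vv lam T T = (0 :: 'k)" using T by simp
 moreover have "id \<in> {p\<in>row_group lam. T o p = T}" using id_groups by simp
 ultimately show False unfolding vT using finite_groups(1)[of lam] by (auto simp: card_eq_0_iff)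
qed

lemma finite_ssyt_content: "finite (ssyt_content lam M)"
 using finite_subset[OF ssyt_content_subset finite_fillings] .

lemma xcoeff_schur: "xcoeff (schur lam) M = int (card (ssyt_content lam M))"
 by (simp add: schur_def Abs_xps_inverse ssyt_content_def)

theorem dim_vv:
 assumes lam: "is_partition lam"
 shows "fs.dim (fs.span (vv lam ` fillings lam M :: (_ => 'k::field_char_0) set)) = card (ssyt_content lam M)"
proof -
 let ?S = "ssyt_content lam M" and ?v = "vv lam :: _ => _ => 'k"
 have sub: "?S \<subseteq> ssyt lam" by (auto simp: ssyt_content_def)
 have inj: "inj_on ?v ?S"
 proof (rule inj_onI, rule ccontr)
  fix T T' assume T: "T \<in> ?S" "T' \<in> ?S" "?v T = ?v T'" "T ~= T'"
  have z: "(\<Sum>U\<in>{T, T'}. fscale (if U = T then 1 else -1) (?v U)) = 0" using T by simp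
  have "(if T = T then 1 else -1 :: 'k) = 0"
   by (rule vv_independent[OF lam _ _ z, of T]) (use T sub in auto)
  then show False by simp
 qed
 have ind: "fs.independent (?v ` ?S)"
 proof (rule fs.independent_if_scalars_zero)
  show "finite (?v ` ?S)" using finite_ssyt_content by simp
  fix f x assume z: "(\<Sum>x\<in>?v ` ?S. fscale (f x) x) = 0" and x: "x \<in> ?v ` ?S"
  have "(\<Sum>T\<in>?S. fscale (f (?v T)) (?v T)) = 0" using z sum.reindex[OF inj, of "%x. fscale (f x) x"] by (simp add: comp_def)
  then show "f x = 0" using vv_independent[OF lam finite_ssyt_content sub, of "%T. f (?v T)"] x by blast
 qed
 have "fs.span (?v ` fillings lam M) = fs.span (?v ` ?S)"
  unfolding fs.span_eq
 proof
  show "?v ` fillings lam M \<subseteq> fs.span (?v ` ?S)" using straightening[OF lam] by blast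
  show "?v ` ?S \<subseteq> fs.span (?v ` fillings lam M)"
   by (rule subset_trans[OF image_mono[OF ssyt_content_subset] fs.span_superset])
 qed
 then show ?thesis using fs.dim_span_eq_card_independent[OF ind] card_image[OF inj] by simp
qed

text \<open>Symmetry of Schur functions is obtained from the dimension formula: relabelling entries
  by \<open>\<pi>\<close> is a linear map from the span for content \<open>M\<close> that covers the
  span for the relabelled content. The count of tableaux does not involve the field, so the
  rationals serve.\<close>

lemma card_ssyt_permute_le:
 assumes lam: "is_partition lam" and pi: "bij \<pi>"
 shows "card (ssyt_content lam (image_mset \<pi> M)) \<le> card (ssyt_content lam M)"
proof -
 let ?C = "cells lam"
 define F :: "((nat \<times> nat => nat) => rat) => (nat \<times> nat => nat) => rat"
  where "F f = (%S. if S \<in> extensional ?C then f (restrict (inv \<pi> o S) ?C) else 0)" for f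
 have F: "flinear F" by (rule flinearI) (auto simp: F_def fs_simps)
 have Fv: "F (vv lam T) = vv lam (restrict (\<pi> o T) ?C)" if T: "T \<in> extensional ?C" for T
 proof
  fix S
  have ext: "U o r \<in> extensional ?C" if "U \<in> extensional ?C" "r permutes ?C" for U :: "nat \<times> nat => nat" and r
   using that by (auto simp: extensional_def permutes_not_in)
  have key: "(T o r = restrict (inv \<pi> o S) ?C) \<longleftrightarrow> (restrict (\<pi> o T) ?C o r = S)"
   if S: "S \<in> extensional ?C" and r: "r permutes ?C" for r
  proof -
   have "(T o r = restrict (inv \<pi> o S) ?C) \<longleftrightarrow> (\<forall>c\<in>?C. T (r c) = inv \<pi> (S c))"
    using ext[OF T r] by (auto simp: fun_eq_iff restrict_def extensional_def)
   also have "... \<longleftrightarrow> (\<forall>c\<in>?C. \<pi> (T (r c)) = S c)"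
    using pi by (metis bij_inv_eq_iff)
   also have "... \<longleftrightarrow> (restrict (\<pi> o T) ?C o r = S)"
    using S permutes_in_image[OF r] permutes_not_in[OF r] by (auto simp: fun_eq_iff restrict_def extensional_def)
   finally show ?thesis .
  qed
  show "F (vv lam T) S = vv lam (restrict (\<pi> o T) ?C) S"
  proof (cases "S \<in> extensional ?C")
   case True
   then show ?thesis unfolding F_def vv_def
    using key[OF True permutes_compose[OF row_group_permutes column_group_permutes]] by (simp add: comp_assoc cong: sum.cong)
  next
   case False
   have "restrict (\<pi> o T) ?C o q o p ~= S" if "p \<in> row_group lam" "q \<in> column_group lam" for p q
    using False ext[OF ext[OF restrict_extensional column_group_permutes[OF that(2)]] row_group_permutes[OF that(1)]] by metis
   then show ?thesis using False by (simp add: F_def vv_def)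
  qed
 qed
 have sub: "vv lam ` fillings lam (image_mset \<pi> M) \<subseteq> F ` vv lam ` fillings lam M"
 proof clarify
  fix T assume T: "T \<in> fillings lam (image_mset \<pi> M)"
  define U where "U = restrict (inv \<pi> o T) ?C"
  have "restrict (\<pi> o U) ?C = T"
   using T pi unfolding U_def fillings_def by (auto simp: fun_eq_iff restrict_def extensional_def bij_is_surj surj_f_inv_f)
  moreover have "U \<in> fillings lam M"
  proof -
   have "image_mset U (mset_set ?C) = image_mset (inv \<pi>) (image_mset T (mset_set ?C))"
    unfolding U_def multiset.map_comp using finite_cells[of lam] by (intro image_mset_cong) auto
   also have "... = M" using T pi by (simp add: fillings_def multiset.map_comp comp_def bij_is_inj)
   finally show ?thesis by (simp add: fillings_def U_def)
  qed
  ultimately show "vv lam T \<in> F ` vv lam ` fillings lam M"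
   using Fv[of U] by (intro image_eqI[of _ _ "vv lam U"]) (auto simp: U_def)
 qed
 have fin: "findim (fs.span (vv lam ` fillings lam M :: (_ => rat) set))"
  by (rule findim_span) (simp add: finite_fillings)
 have "fs.span (vv lam ` fillings lam (image_mset \<pi> M)) \<subseteq> F ` fs.span (vv lam ` fillings lam M)"
  unfolding fsp.linear_span_image[OF F, symmetric] by (rule fs.span_mono[OF sub])
 then have "fs.dim (fs.span (vv lam ` fillings lam (image_mset \<pi> M) :: (_ => rat) set)) \<le> fs.dim (F ` fs.span (vv lam ` fillings lam M))"
  by (rule fs_dim_mono[OF _ findim_image[OF F fin]])
 also have "... \<le> fs.dim (fs.span (vv lam ` fillings lam M :: (_ => rat) set))"
  using rank_nullity[OF F fs.subspace_span fin] by simp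
 finally show ?thesis unfolding dim_vv[OF lam] .
qed

lemma schur_symmetric:
 assumes lam: "is_partition lam" shows "schur lam \<in> Sym_bar"
 unfolding Sym_bar_def
proof (intro CollectI allI impI)
 fix \<pi> :: "nat => nat" and M assume pi: "bij \<pi>"
 have "image_mset (inv \<pi>) (image_mset \<pi> M) = M" using pi by (simp add: multiset.map_comp comp_def bij_is_inj)
 then have "card (ssyt_content lam M) \<le> card (ssyt_content lam (image_mset \<pi> M))"
  using card_ssyt_permute_le[OF lam bij_imp_bij_inv[OF pi], of "image_mset \<pi> M"] by simp
 then show "xcoeff (schur lam) (image_mset \<pi> M) = xcoeff (schur lam) M"
  using card_ssyt_permute_le[OF lam pi, of M] by (simp add: xcoeff_schur)
qed

section \<open>Expansion into Schur functions\<close>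

text \<open>The content of the tableau whose row \<open>i\<close> is filled with \<open>i\<close>,
  that is, the monomial with exponents given by the partition.\<close>

definition shape_mset :: "nat list => nat multiset" where
 "shape_mset lam = image_mset fst (mset_set (cells lam))"

lemma count_shape_mset: "count (shape_mset lam) i = (if i < length lam then lam ! i else 0)"
proof -
 have "count (shape_mset lam) i = (\<Sum>c\<in>fst -` {i} Int cells lam. 1)"
  unfolding shape_mset_def count_image_mset using finite_cells[of lam] by (intro sum.cong) auto
 also have "fst -` {i} Int cells lam = (if i < length lam then Pair i ` {..<lam ! i} else {})"
  by (auto simp: cells_def)
 finally show ?thesis by (auto simp: card_image inj_on_def)
qed

lemma shape_mset_inj:
 assumes "is_partition lam" "is_partition mu" "shape_mset lam = shape_mset mu" shows "lam = mu"
proof -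
 have c: "(if i < length lam then lam ! i else 0) = (if i < length mu then mu ! i else 0)" for i
  using assms(3) count_shape_mset by metis
 have pos: "nu ! i ~= 0" if "is_partition nu" "i < length nu" for nu i
  using that nth_mem[of i nu] unfolding is_partition_def by metis
 have len: "length lam = length mu"
 proof (cases "length lam" "length mu" rule: linorder_cases)
  case less
  then show ?thesis using c[of "length lam"] pos[OF assms(2) less] by simp
 next
  case greater
  then show ?thesis using c[of "length mu"] pos[OF assms(1) greater] by simp
 qed
 show ?thesis
 proof (rule nth_equalityI[OF len])
  fix i assume "i < length lam" then show "lam ! i = mu ! i" using c[of i] len by simp
 qed
qed

lemma card_cells: "card (cells lam) = sum_list lam"
proof -
 have "cells lam = (\<Union>i<length lam. Pair i ` {..<lam ! i})" by (auto simp: cells_def)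
 then have "card (cells lam) = (\<Sum>i<length lam. card (Pair i ` {..<lam ! i}))"
  by (simp only:) (rule card_UN_disjoint, auto)
 also have "... = (\<Sum>i<length lam. lam ! i)" by (simp add: card_image inj_on_def)
 finally show ?thesis by (simp add: sum_list_sum_nth lessThan_atLeast0)
qed

lemma size_shape_mset: "size (shape_mset lam) = sum_list lam"
 by (simp add: shape_mset_def card_cells)

definition parts :: "nat => nat list set" where
 "parts k = {lam. is_partition lam & sum_list lam = k}"

lemma finite_parts: "finite (parts k)"
proof (rule finite_subset)
 have "length mu \<le> sum_list mu" if "0 \<notin> set mu" for mu :: "nat list"
  using that by (induction mu) auto
 moreover have "set mu \<subseteq> {..sum_list mu}" for mu :: "nat list"
  by (auto intro: member_le_sum_list)
 ultimately show "parts k \<subseteq> {mu. set mu \<subseteq> {..k} & length mu \<le> k}"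
  unfolding is_partition_def parts_def by blast
 show "finite {mu. set mu \<subseteq> {..k} & length mu \<le> k}"
  by (rule finite_lists_length_le) simp
qed

lemma ssyt_entry_ge_row:
 assumes "is_partition lam" "T \<in> ssyt lam" "(i, j) \<in> cells lam" shows "i \<le> T (i, j)"
 using assms(3)
proof (induction i)
 case (Suc i)
 have "(i, j) \<in> cells lam" using cells_up[OF assms(1) Suc.prems] by simp
 moreover from this have "T (i, j) < T (Suc i, j)" using assms(2) Suc.prems by (auto simp: ssyt_def)
 ultimately show ?case using Suc.IH by simp
qed simp

text \<open>Each entry is at least its row index. Summing over the cells gives a numerical
  substitute for the dominance order, with equality only for the filling by row indices.\<close>

lemma ssyt_content_depth:
 assumes lam: "is_partition lam" and T: "T \<in> ssyt_content lam M"
 shows "sum_mset (shape_mset lam) \<le> sum_mset M"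
  "sum_mset (shape_mset lam) = sum_mset M ==> T = restrict fst (cells lam) & M = shape_mset lam"
proof -
 let ?C = "cells lam"
 have T': "T \<in> ssyt lam" "M = image_mset T (mset_set ?C)" using T by (auto simp: ssyt_content_def)
 have ge: "fst c \<le> T c" if "c \<in> ?C" for c using ssyt_entry_ge_row[OF lam T'(1), of "fst c" "snd c"] that by simp
 have s: "sum_mset (image_mset f (mset_set ?C)) = (\<Sum>c\<in>?C. f c)" for f :: "_ => nat" by (simp add: sum_unfold_sum_mset)
 show "sum_mset (shape_mset lam) \<le> sum_mset M" unfolding T'(2) shape_mset_def s by (rule sum_mono[OF ge])
 assume "sum_mset (shape_mset lam) = sum_mset M"
 then have eq: "(\<Sum>c\<in>?C. fst c) = (\<Sum>c\<in>?C. T c)" unfolding T'(2) shape_mset_def s .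
 have f: "T c = fst c" if "c \<in> ?C" for c
 proof (rule ccontr)
  assume "T c ~= fst c"
  then have "fst c < T c" using ge[OF that] by (simp add: le_neq_implies_less)
  then have "(\<Sum>c\<in>?C. fst c) < (\<Sum>c\<in>?C. T c)"
   by (intro sum_strict_mono_ex1 ballI bexI[of _ c] ge that finite_cells)
  then show False using eq by simp
 qed
 have "T \<in> extensional ?C" using T'(1) unfolding ssyt_def by blast
 then have "T = restrict fst ?C" by (rule extensionalityI[OF _ restrict_extensional]) (simp only: f restrict_apply if_True)
 moreover have "M = shape_mset lam"
  unfolding T'(2) shape_mset_def by (rule image_mset_cong, rule f) (simp only: elem_mset_set[OF finite_cells])
 ultimately show "T = restrict fst ?C & M = shape_mset lam" ..
qed

lemma ssyt_content_shape:
 assumes lam: "is_partition lam" shows "ssyt_content lam (shape_mset lam) = {restrict fst (cells lam)}"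
proof
 show "ssyt_content lam (shape_mset lam) \<subseteq> {restrict fst (cells lam)}"
  using ssyt_content_depth(2)[OF lam] by blast
 have "image_mset (restrict fst (cells lam)) (mset_set (cells lam)) = shape_mset lam"
  unfolding shape_mset_def using finite_cells[of lam] by (intro image_mset_cong) auto
 then show "{restrict fst (cells lam)} \<subseteq> ssyt_content lam (shape_mset lam)"
  by (auto simp: ssyt_content_def ssyt_def)
qed

definition kostka :: "nat list => nat list => int" where
 "kostka lam mu = xcoeff (schur lam) (shape_mset mu)"

lemma kostka_self: "is_partition lam ==> kostka lam lam = 1"
 by (simp add: kostka_def xcoeff_schur ssyt_content_shape)

lemma kostka_triangular:
 assumes "is_partition lam" "is_partition mu" "kostka lam mu ~= 0" "lam ~= mu"
 shows "sum_mset (shape_mset lam) < sum_mset (shape_mset mu)"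
proof -
 have "ssyt_content lam (shape_mset mu) ~= {}" using assms(3) by (auto simp: kostka_def xcoeff_schur)
 then obtain T where T: "T \<in> ssyt_content lam (shape_mset mu)" by blast
 have "sum_mset (shape_mset lam) ~= sum_mset (shape_mset mu)"
  using ssyt_content_depth(2)[OF assms(1) T] shape_mset_inj[OF assms(2,1)] assms(4) by blast
 then show ?thesis using ssyt_content_depth(1)[OF assms(1) T] by simp
qed

section \<open>Existence and uniqueness of Schur expansions\<close>

lemma extend_to_permutation:
 assumes "finite A" "inj_on f A"
 obtains p :: "'a => 'a" where "bij p" "!!x. x \<in> A ==> p x = f x"
proof -
 let ?B = "f ` A"
 have "card (?B - A) = card (A - ?B)"
  using card_image[OF assms(2)] assms(1) card_Diff_subset_Int[of ?B A] card_Diff_subset_Int[of A ?B]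
  by (simp add: Int_commute)
 then obtain g where g: "bij_betw g (?B - A) (A - ?B)"
  using finite_same_card_bij[of "?B - A" "A - ?B"] assms(1) by auto
 define p where "p x = (if x \<in> A then f x else if x \<in> ?B then g x else x)" for x
 have "bij_betw p A ?B" by (subst bij_betw_cong[of _ _ f]) (auto simp: p_def bij_betw_def assms)
 moreover have "bij_betw p (?B - A) (A - ?B)" by (subst bij_betw_cong[of _ _ g]) (auto simp: p_def g)
 ultimately have "bij_betw p (A Un (?B - A)) (?B Un (A - ?B))" by (rule bij_betw_combine) auto
 moreover have "bij_betw p (- (A Un ?B)) (- (A Un ?B))" by (subst bij_betw_cong[of _ _ "%x. x"]) (auto simp: p_def bij_betw_def)
 moreover have "A Un (?B - A) = A Un ?B" "?B Un (A - ?B) = A Un ?B" by auto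
 ultimately have "bij_betw p (A Un ?B) (A Un ?B)" "bij_betw p (- (A Un ?B)) (- (A Un ?B))" by simp_all
 then have "bij_betw p (A Un ?B Un - (A Un ?B)) (A Un ?B Un - (A Un ?B))" by (rule bij_betw_combine) (rule Compl_disjoint)
 then have "bij p" by (simp only: Compl_partition)
 then show ?thesis using that[of p] by (simp add: p_def)
qed

text \<open>Listing the support by decreasing multiplicity gives a partition and a renaming of
  variables. A symmetric series is therefore determined by its coefficients at shapes of
  partitions.\<close>

lemma mset_is_permuted_shape:
 fixes M :: "nat multiset"
 obtains p mu where "bij p" "mu \<in> parts (size M)" "M = image_mset p (shape_mset mu)"
proof -
 define xs where "xs = rev (sort_key (count M) (sorted_list_of_set (set_mset M)))"
 have xs: "set xs = set_mset M" "distinct xs" by (simp_all add: xs_def)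
 define mu where "mu = map (count M) xs"
 have "sorted (map (count M) (sort_key (count M) (sorted_list_of_set (set_mset M))))" by simp
 then have "sorted_wrt (\<ge>) mu" unfolding mu_def xs_def rev_map[symmetric] sorted_wrt_rev by (simp add: sorted_wrt_mono_rel)
 then have part: "is_partition mu" unfolding is_partition_def mu_def using xs(1) by (auto simp: not_in_iff[symmetric] count_eq_zero_iff)
 have "inj_on (%i. xs ! i) {..<length xs}" using xs(2) by (auto simp: inj_on_def nth_eq_iff_index_eq)
 then obtain p where p: "bij p" "!!i. i < length xs ==> p i = xs ! i"
  using extend_to_permutation[of "{..<length xs}" "%i. xs ! i"] by (metis finite_lessThan lessThan_iff)
 have M: "M = image_mset p (shape_mset mu)"
 proof (rule multiset_eqI)
  fix x
  obtain i where i: "x = p i" using bij_is_surj[OF p(1)] by (metis surjD)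
  have "count (image_mset p (shape_mset mu)) x = count (shape_mset mu) i"
  proof -
   have "p -` {p i} = {i}" using bij_is_inj[OF p(1)] by (auto simp: inj_eq)
   then show ?thesis unfolding i count_image_mset
    by (cases "i \<in># shape_mset mu") (auto simp: not_in_iff[symmetric] count_eq_zero_iff)
  qed
  also have "... = (if i < length xs then count M (xs ! i) else 0)" by (simp add: count_shape_mset mu_def)
  also have "... = count M x"
  proof (cases "i < length xs")
   case True
   then show ?thesis using p(2) i by simp
  next
   case False
   have "x \<notin> set xs"
   proof
    assume "x \<in> set xs"
    then obtain i' where i': "i' < length xs" "x = xs ! i'" by (metis in_set_conv_nth)
    then have "p i' = p i" using p(2) i by simp
    then have "i' = i" using bij_is_inj[OF p(1)] by (simp add: inj_eq)
    then show False using False i' by simp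
   qed
   then show ?thesis using False xs(1) by (simp add: not_in_iff)
  qed
  finally show "count M x = count (image_mset p (shape_mset mu)) x" by simp
 qed
 moreover have "mu \<in> parts (size M)" using part arg_cong[OF M, of size] by (simp add: parts_def size_shape_mset)
 ultimately show ?thesis using that p(1) by blast
qed

lemma xcoeff_schur_sum: "xcoeff (schur_sum a) M = (\<Sum>lam\<in>parts (size M). a lam * xcoeff (schur lam) M)"
 by (simp add: schur_sum_def Abs_xps_inverse parts_def)

lemma schur_sum_eqI:
 assumes f: "f \<in> Sym_bar" and eq: "!!k mu. mu \<in> parts k ==> (\<Sum>lam\<in>parts k. a lam * kostka lam mu) = xcoeff f (shape_mset mu)"
 shows "f = schur_sum a"
proof (rule xps_eqI)
 fix M :: "nat multiset"
 obtain p mu where p: "bij p" "mu \<in> parts (size M)" "M = image_mset p (shape_mset mu)" by (rule mset_is_permuted_shape[of M])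
 have "xcoeff (schur lam) M = kostka lam mu" if "lam \<in> parts (size M)" for lam
  using schur_symmetric[of lam] that p(1,3) by (simp add: parts_def Sym_bar_def kostka_def)
 then have "xcoeff (schur_sum a) M = xcoeff f (shape_mset mu)" unfolding xcoeff_schur_sum using eq[OF p(2)] by simp
 also have "... = xcoeff f M" using f p(1,3) by (simp add: Sym_bar_def)
 finally show "xcoeff f M = xcoeff (schur_sum a) M" by simp
qed

text \<open>The Kostka matrix is unitriangular with respect to the index sum of shapes, so the
  equations are solved level by level; the correction at level \<open>d\<close> does not disturb the
  lower levels.\<close>

lemma kostka_solvable: "\<exists>a. \<forall>mu\<in>parts k. (\<Sum>lam\<in>parts k. a lam * kostka lam mu) = g mu"
proof -
 let ?n = "%mu. sum_mset (shape_mset mu)"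
 have "\<exists>a. \<forall>mu\<in>parts k. ?n mu < d --> (\<Sum>lam\<in>parts k. a lam * kostka lam mu) = g mu" for d
 proof (induction d)
  case (Suc d)
  then obtain a where a: "!!mu. mu \<in> parts k ==> ?n mu < d ==> (\<Sum>lam\<in>parts k. a lam * kostka lam mu) = g mu" by blast
  define e where "e mu = (if ?n mu = d then g mu - (\<Sum>lam\<in>parts k. a lam * kostka lam mu) else 0)" for mu
  have "(\<Sum>lam\<in>parts k. (a lam + e lam) * kostka lam mu) = g mu" if mu: "mu \<in> parts k" "?n mu < Suc d" for mu
  proof -
   have "e lam * kostka lam mu = (if lam = mu then e mu else 0)" if lam: "lam \<in> parts k" for lam
   proof (cases "lam = mu \<or> kostka lam mu = 0 \<or> ?n lam ~= d")
    case False
    then show ?thesis using kostka_triangular[of lam mu] lam mu by (auto simp: parts_def)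
   qed (use kostka_self mu in \<open>auto simp: e_def parts_def\<close>)
   then have "(\<Sum>lam\<in>parts k. e lam * kostka lam mu) = (\<Sum>lam\<in>parts k. if lam = mu then e mu else 0)"
    by (rule sum.cong[OF refl])
   also have "... = e mu" using mu finite_parts by simp
   finally have "(\<Sum>lam\<in>parts k. (a lam + e lam) * kostka lam mu) = (\<Sum>lam\<in>parts k. a lam * kostka lam mu) + e mu"
    by (simp add: distrib_right sum.distrib)
   then show ?thesis using a[OF mu(1)] mu(2) by (cases "?n mu = d") (auto simp: e_def)
  qed
  then show ?case by (intro exI[of _ "%lam. a lam + e lam"]) blast
 qed simp
 then obtain a where "\<forall>mu\<in>parts k. ?n mu < Suc (Max (?n ` parts k)) --> (\<Sum>lam\<in>parts k. a lam * kostka lam mu) = g mu" by blast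
 moreover have "?n mu < Suc (Max (?n ` parts k))" if "mu \<in> parts k" for mu
  using that finite_parts by (simp add: less_Suc_eq_le)
 ultimately show ?thesis by blast
qed

text \<open>The coefficients are a definite description, so existence needs uniqueness beside it:
  the difference of two solutions, evaluated at a shape of least index sum where they differ, has a
  single surviving term.\<close>

theorem schur_sum_schur_coeff:
 assumes f: "f \<in> Sym_bar" shows "f = schur_sum (schur_coeff f)"
proof -
 have "\<forall>k. \<exists>a. \<forall>mu\<in>parts k. (\<Sum>lam\<in>parts k. a lam * kostka lam mu) = xcoeff f (shape_mset mu)"
  by (intro allI kostka_solvable)
 then obtain A where A: "\<forall>k. \<forall>mu\<in>parts k. (\<Sum>lam\<in>parts k. A k lam * kostka lam mu) = xcoeff f (shape_mset mu)"
  by (rule choice[THEN exE])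
 define a where "a lam = (if is_partition lam then A (sum_list lam) lam else 0)" for lam
 have "f = schur_sum a"
 proof (rule schur_sum_eqI[OF f])
  fix k mu assume mu: "mu \<in> parts k"
  have "(\<Sum>lam\<in>parts k. a lam * kostka lam mu) = (\<Sum>lam\<in>parts k. A k lam * kostka lam mu)"
   by (rule sum.cong) (auto simp: a_def parts_def)
  then show "(\<Sum>lam\<in>parts k. a lam * kostka lam mu) = xcoeff f (shape_mset mu)" using A mu by simp
 qed
 have uniq: "a' = a" if a': "f = schur_sum a'" "\<forall>lam. \<not> is_partition lam --> a' lam = 0" for a'
 proof (rule ccontr)
  assume "a' ~= a"
  then obtain lam0 where lam0: "a' lam0 ~= a lam0" by blast
  then have p0: "is_partition lam0" using a'(2) a_def[of lam0] by (cases "is_partition lam0") simp_all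
  define k where "k = sum_list lam0"
  let ?n = "%mu. sum_mset (shape_mset mu)"
  obtain lam where lam: "lam \<in> parts k" "a' lam ~= a lam"
   and mn: "!!mu. mu \<in> parts k ==> a' mu ~= a mu ==> ?n lam \<le> ?n mu"
   using ex_has_least_nat[of "%mu. mu \<in> parts k & a' mu ~= a mu" lam0 ?n] lam0 p0 by (auto simp: parts_def k_def)
  have sz: "size (shape_mset lam) = k" using lam by (simp add: size_shape_mset parts_def)
  have "(\<Sum>mu\<in>parts k. a' mu * kostka mu lam) = (\<Sum>mu\<in>parts k. a mu * kostka mu lam)"
   using xcoeff_schur_sum[of a' "shape_mset lam"] xcoeff_schur_sum[of a "shape_mset lam"] a'(1) \<open>f = schur_sum a\<close>
   by (simp add: sz kostka_def)
  then have "0 = (\<Sum>mu\<in>parts k. (a' mu - a mu) * kostka mu lam)" by (simp add: left_diff_distrib sum_subtractf)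
  also have "... = (\<Sum>mu\<in>parts k. if mu = lam then a' lam - a lam else 0)"
  proof (rule sum.cong[OF refl])
   fix mu assume mu: "mu \<in> parts k"
   show "(a' mu - a mu) * kostka mu lam = (if mu = lam then a' lam - a lam else 0)"
   proof (cases "mu = lam \<or> kostka mu lam = 0 \<or> a' mu = a mu")
    case False
    then show ?thesis using kostka_triangular[of mu lam] mn[OF mu] mu lam by (auto simp: parts_def)
   qed (use kostka_self lam in \<open>auto simp: parts_def\<close>)
  qed
  also have "... = a' lam - a lam" using lam finite_parts by simp
  finally show False using lam by simp
 qed
 have "f = schur_sum a & (\<forall>lam. \<not> is_partition lam --> a lam = 0)" using \<open>f = schur_sum a\<close> by (simp add: a_def)
 then have "f = schur_sum (schur_coeff f) & (\<forall>lam. \<not> is_partition lam --> schur_coeff f lam = 0)"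
  unfolding schur_coeff_def by (rule theI[where P="%a. f = schur_sum a & (\<forall>lam. \<not> is_partition lam --> a lam = 0)"]) (rule uniq, blast+)
 then show ?thesis by blast
qed

section \<open>Multiplicities and characters\<close>

context wspace
begin

definition simples :: "nat => ((nat => 'w => 'k) => 'k) set set" where
 "simples k = {N. N \<subseteq> E {..<k} & simple_sub (GL sW) tact N}"

abbreviation "iso_mod \<equiv> isomorphic_modules sW"

text \<open>An isomorphism class is represented by its members inside one fixed tensor power, so
  that the classes of degree \<open>k\<close> form a set over which sums can be taken.\<close>

definition cls :: "nat => ((nat => 'w => 'k) => 'k) set => ((nat => 'w => 'k) => 'k) set set" where
 "cls k N = {N' \<in> simples k. iso_mod (fmod tact N) (fmod tact N')}"

definition classes :: "nat => ((nat => 'w => 'k) => 'k) set set set" where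
 "classes k = cls k ` simples k"

lemma iso_mod_refl: "iso_mod M M"
 unfolding isomorphic_modules_def by (rule exI[of _ "%x. x"]) (simp add: bij_betw_def)

lemma simplesD: "N \<in> simples k ==> N \<subseteq> E {..<k}" "N \<in> simples k ==> simple_sub (GL sW) tact N"
 "N \<in> simples k ==> stable (GL sW) tact N"
 by (auto simp: simples_def simple_sub_def)

lemma classes_disjoint:
 assumes "\<kappa> \<in> classes k" "\<kappa>' \<in> classes k" "N \<in> \<kappa>" "N' \<in> \<kappa>'" "iso_mod (fmod tact N) (fmod tact N')"
 shows "\<kappa> = \<kappa>'"
proof -
 obtain A B where A: "A \<in> simples k" "\<kappa> = cls k A" and B: "B \<in> simples k" "\<kappa>' = cls k B" using assms(1,2) by (auto simp: classes_def)
 have 1: "iso_mod (fmod tact A) (fmod tact N)" "iso_mod (fmod tact B) (fmod tact N')" using A B assms(3,4) by (auto simp: cls_def)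
 have AB: "iso_mod (fmod tact A) (fmod tact B)"
  by (rule isomorphic_modules_trans[OF isomorphic_modules_trans[OF 1(1) assms(5)] isomorphic_fmod_sym[OF 1(2) simplesD(3)[OF B(1)]]])
 have BA: "iso_mod (fmod tact B) (fmod tact A)" by (rule isomorphic_fmod_sym[OF AB simplesD(3)[OF A(1)]])
 show ?thesis unfolding A(2) B(2) cls_def
  using isomorphic_modules_trans[OF AB] isomorphic_modules_trans[OF BA] by blast
qed

lemma cls_self: "N \<in> simples k ==> N \<in> cls k N" by (simp add: cls_def iso_mod_refl)

lemma class_members: "\<kappa> \<in> classes k ==> N \<in> \<kappa> ==> N \<in> simples k" by (auto simp: classes_def cls_def)

lemma class_iso:
 assumes "\<kappa> \<in> classes k" "N \<in> \<kappa>" "N' \<in> \<kappa>" shows "iso_mod (fmod tact N) (fmod tact N')"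
proof -
 obtain A where A: "A \<in> simples k" "\<kappa> = cls k A" using assms(1) by (auto simp: classes_def)
 then have "iso_mod (fmod tact A) (fmod tact N)" "iso_mod (fmod tact A) (fmod tact N')" using assms by (auto simp: cls_def)
 then show ?thesis using isomorphic_fmod_sym[OF _ simplesD(3)[OF A(1)]] isomorphic_modules_trans by blast
qed

definition rep :: "((nat => 'w => 'k) => 'k) set set => ((nat => 'w => 'k) => 'k) set" where
 "rep \<kappa> = (SOME N. N \<in> \<kappa>)"

lemma rep_in: "\<kappa> \<in> classes k ==> rep \<kappa> \<in> \<kappa>"
 unfolding rep_def classes_def by (auto intro!: someI_ex[of "%N. N \<in> _"] cls_self)

definition chi :: "((nat => 'w => 'k) => 'k) set set => nat multiset => nat" where
 "chi \<kappa> M = fs.dim (eig (tact hW) (rep \<kappa>) (theta M))"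

lemma dim_eig_iso:
 assumes N: "stable (GL sW) act N" and lin: "flinear (act hW)" and fin: "findim (eig (act hW) N \<theta>)"
  and iso: "iso_mod (fmod act N) (fmod act' N')" and N': "stable (GL sW) act' N'"
 shows "fs.dim (eig (act' hW) N' \<theta>) = fs.dim (eig (act hW) N \<theta>)" "findim (eig (act' hW) N' \<theta>)"
proof -
 obtain h where h: "bij_betw h N N'" "equivariant_on (GL sW) act act' N h" using iso by (rule isomorphic_fmodE)
 note hD = equivariant_onD[OF h(2)]
 have sub: "eig (act hW) N \<theta> \<subseteq> N" by (rule eig_subset)
 have im: "eig (act' hW) N' \<theta> = h ` eig (act hW) N \<theta>"
 proof
  show "h ` eig (act hW) N \<theta> \<subseteq> eig (act' hW) N' \<theta>"
  proof clarify
   fix u assume "u \<in> eig (act hW) N \<theta>"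
   then have u: "u \<in> N" "act hW u = fscale \<theta> u" by (auto simp: eig_def)
   have "act' hW (h u) = fscale \<theta> (h u)" using hD(3)[OF hW_GL u(1)] hD(2)[OF u(1)] u(2) by simp
   then show "h u \<in> eig (act' hW) N' \<theta>" using h(1) u(1) by (auto simp: eig_def bij_betw_def)
  qed
  show "eig (act' hW) N' \<theta> \<subseteq> h ` eig (act hW) N \<theta>"
  proof
   fix v assume "v \<in> eig (act' hW) N' \<theta>"
   then have v: "v \<in> N'" "act' hW v = fscale \<theta> v" by (auto simp: eig_def)
   obtain u where u: "u \<in> N" "v = h u" using h(1) v(1) by (auto simp: bij_betw_def)
   have "h (act hW u) = h (fscale \<theta> u)" using hD(3)[OF hW_GL u(1)] hD(2)[OF u(1)] v(2) u(2) by simp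
   then have "act hW u = fscale \<theta> u"
    using h(1) stableD(2)[OF N hW_GL u(1)] fs.subspace_scale[OF stableD(1)[OF N] u(1)] by (auto simp: bij_betw_def dest: inj_onD)
   then show "v \<in> h ` eig (act hW) N \<theta>" using u by (auto simp: eig_def)
  qed
 qed
 have s: "fs.subspace (eig (act hW) N \<theta>)" by (rule subspace_eig[OF lin stableD(1)[OF N]])
 show "fs.dim (eig (act' hW) N' \<theta>) = fs.dim (eig (act hW) N \<theta>)" unfolding im
 proof (rule fs_dim_eq_partial_iso[OF s fin])
  show "inj_on h (eig (act hW) N \<theta>)" using h(1) sub by (auto simp: bij_betw_def intro: inj_on_subset)
 qed (use hD sub in blast)+
 obtain h' where h': "flinear h'" "!!u. u \<in> N ==> h' u = h u"
  by (rule partial_linear_extend[OF stableD(1)[OF N] hD(1,2)]) blast+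
 have "h ` eig (act hW) N \<theta> = h' ` eig (act hW) N \<theta>" using h'(2) sub by (intro image_cong) auto
 then show "findim (eig (act' hW) N' \<theta>)" unfolding im using findim_image[OF h'(1) fin] by simp
qed

lemma eig_zero_iff:
 assumes "flinear H" "fs.subspace N" "findim (eig H N \<theta>)"
 shows "eig H N \<theta> = {0} \<longleftrightarrow> fs.dim (eig H N \<theta>) = 0"
proof
 assume "fs.dim (eig H N \<theta>) = 0"
 moreover obtain B where "finite B" "fs.span B = eig H N \<theta>" "card B = fs.dim (eig H N \<theta>)"
  by (rule findim_basis[OF subspace_eig[OF assms(1,2)] assms(3)])
 ultimately show "eig H N \<theta> = {0}" by auto
qed simp

lemma simples_eig_findim: "N \<in> simples k ==> findim (eig (tact hW) N \<theta>)"
 by (rule findim_mono[OF E_findim[OF finite_lessThan] subset_trans[OF eig_subset simplesD(1)]])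

lemma simples_eig_size:
 assumes "N \<in> simples k" "eig (tact hW) N (theta M) ~= {0}" shows "size M = k" "set_mset M \<subseteq> {..<m}"
proof -
 have N: "N \<subseteq> E {..<k}" "fs.subspace N" using simplesD[OF assms(1)] stableD(1) by auto
 obtain u where u: "u \<in> N" "tact hW u = fscale (theta M) u" "u ~= 0"
  using assms(2) fs.subspace_0[OF subspace_eig[OF flinear_tact N(2), where \<theta>="theta M"]] unfolding eig_def by blast
 have uE: "u \<in> E {..<k}" using u N by blast
 have "\<exists>T\<in>idx {..<k}. u (bt T) ~= 0"
  using E_ext[OF _ uE fs.subspace_0[OF E_subspace]] u(3) by auto
 then obtain T where T: "T \<in> idx {..<k}" "u (bt T) ~= 0" by blast
 then have "wt {..<k} T = M" using E_eig_iff[OF _ uE, of M] u(2) by blast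
 then show "size M = k" "set_mset M \<subseteq> {..<m}" using T(1) wt_props[of "{..<k}" T] by (auto simp: PiE_iff)
qed

definition weights :: "nat => nat multiset set" where
 "weights k = {M. size M = k & set_mset M \<subseteq> {..<m}}"

lemma finite_weights: "finite (weights k)"
proof -
 have "weights k \<subseteq> mset ` {xs. set xs \<subseteq> {..<m} & length xs = k}"
 proof
  fix M assume M: "M \<in> weights k"
  obtain xs where "M = mset xs" using ex_mset by metis
  then show "M \<in> mset ` {xs. set xs \<subseteq> {..<m} & length xs = k}" using M by (auto simp: weights_def)
 qed
 then show ?thesis by (rule finite_subset) (simp add: finite_lists_length_eq)
qed

lemma simples_has_top:
 assumes N: "N \<in> simples k"
 obtains M u where "top_vector {..<k} N M u" "M \<in> weights k"
proof -
 let ?P = "%M. eig (tact hW) N (theta M) ~= {0}"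
 obtain M0 where M0: "?P M0"
  using stable_sub_has_weight[OF _ simplesD(3,1)[OF N] simple_subD(2)[OF simplesD(2)[OF N]]] by blast
 obtain M where M: "?P M" "!!M'. ?P M' ==> sum_mset M \<le> sum_mset M'"
  using ex_has_least_nat[of ?P M0 sum_mset] M0 by blast
 obtain u where u: "u \<in> eig (tact hW) N (theta M)" "u ~= 0"
  using M(1) fs.subspace_0[OF subspace_eig[OF flinear_tact stableD(1)[OF simplesD(3)[OF N]], where \<theta>="theta M"]] by blast
 show ?thesis
  by (rule that[of M u]) (use u M simples_eig_size[OF N M(1)] in \<open>auto simp: top_vector_def weights_def\<close>)
qed

text \<open>Non-isomorphic simple modules have different highest weights, and there are finitely
  many weights of size \<open>k\<close> in m indices.\<close>

lemma finite_classes: "finite (classes k)"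
proof -
 define f where "f \<kappa> = (SOME M. \<exists>u. top_vector {..<k} (rep \<kappa>) M u & M \<in> weights k)" for \<kappa>
 have f: "\<exists>u. top_vector {..<k} (rep \<kappa>) (f \<kappa>) u & f \<kappa> \<in> weights k" if "\<kappa> \<in> classes k" for \<kappa>
 proof -
  have "rep \<kappa> \<in> simples k" using class_members[OF that rep_in[OF that]] .
  then have "\<exists>M. \<exists>u. top_vector {..<k} (rep \<kappa>) M u & M \<in> weights k" using simples_has_top[of "rep \<kappa>" k] by metis
  then show ?thesis unfolding f_def by (rule someI_ex)
 qed
 have "inj_on f (classes k)"
 proof (rule inj_onI)
  fix \<kappa> \<kappa>' assume k: "\<kappa> \<in> classes k" "\<kappa>' \<in> classes k" "f \<kappa> = f \<kappa>'"
  note r = rep_in[OF k(1)] rep_in[OF k(2)]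
  note s = class_members[OF k(1) r(1)] class_members[OF k(2) r(2)]
  obtain u u' where u: "top_vector {..<k} (rep \<kappa>) (f \<kappa>) u" "top_vector {..<k} (rep \<kappa>') (f \<kappa>) u'"
   using f[OF k(1)] f[OF k(2)] k(3) by auto
  have "iso_mod (fmod tact (rep \<kappa>)) (fmod tact (rep \<kappa>'))"
   by (rule highest_weight_iso[OF _ simplesD(2,1)[OF s(1)] simplesD(2,1)[OF s(2)] u]) simp
  then show "\<kappa> = \<kappa>'" by (rule classes_disjoint[OF k(1,2) r])
 qed
 moreover have "f ` classes k \<subseteq> weights k" using f by blast
 ultimately show ?thesis using finite_weights finite_imageD finite_subset by blast
qed

text \<open>Among the classes with nonzero coefficient choose one whose highest weight
  \<open>M\<close> has the least index sum. If \<open>M\<close> occurred in another such class it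
  would be the highest weight there as well and the two would be isomorphic, so the equation at
  \<open>M\<close> has one term.\<close>

lemma characters_independent:
 assumes z: "!!M. M \<in> weights k ==> (\<Sum>\<kappa>\<in>classes k. a \<kappa> * int (chi \<kappa> M)) = 0" and k0: "\<kappa>0 \<in> classes k"
 shows "a \<kappa>0 = 0"
proof (rule ccontr)
 assume a0: "a \<kappa>0 ~= 0"
 let ?P = "%(\<kappa>, M, u). \<kappa> \<in> classes k & a \<kappa> ~= 0 & top_vector {..<k} (rep \<kappa>) M u & M \<in> weights k"
 have rs: "rep \<kappa> \<in> simples k" if "\<kappa> \<in> classes k" for \<kappa> using class_members[OF that rep_in[OF that]] .
 obtain M0 u0 where "top_vector {..<k} (rep \<kappa>0) M0 u0" "M0 \<in> weights k" using simples_has_top[OF rs[OF k0]] by blast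
 then have "?P (\<kappa>0, M0, u0)" using k0 a0 by simp
 then obtain x where x: "?P x" and mn: "!!y. ?P y ==> sum_mset (fst (snd x)) \<le> sum_mset (fst (snd y))"
  using ex_has_least_nat[of ?P "(\<kappa>0, M0, u0)" "%x. sum_mset (fst (snd x))"] by blast
 obtain \<kappa> M u where xx: "x = (\<kappa>, M, u)" by (cases x) auto
 have K: "\<kappa> \<in> classes k" "a \<kappa> ~= 0" "top_vector {..<k} (rep \<kappa>) M u" "M \<in> weights k" using x xx by auto
 have other: "chi \<kappa>' M = 0" if K': "\<kappa>' \<in> classes k" "a \<kappa>' ~= 0" "\<kappa>' ~= \<kappa>" for \<kappa>'
 proof (rule ccontr)
  assume "chi \<kappa>' M ~= 0"
  then have nz: "eig (tact hW) (rep \<kappa>') (theta M) ~= {0}" unfolding chi_def by auto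
  have st: "fs.subspace (rep \<kappa>')" using stableD(1)[OF simplesD(3)[OF rs[OF K'(1)]]] .
  obtain v where v: "v \<in> eig (tact hW) (rep \<kappa>') (theta M)" "v ~= 0"
   using nz fs.subspace_0[OF subspace_eig[OF flinear_tact st, where \<theta>="theta M"]] by blast
  obtain M' u' where M': "top_vector {..<k} (rep \<kappa>') M' u'" "M' \<in> weights k" using simples_has_top[OF rs[OF K'(1)]] by blast
  have "sum_mset M \<le> sum_mset M'" using mn[of "(\<kappa>', M', u')"] K' M' xx by simp
  then have "top_vector {..<k} (rep \<kappa>') M v" using v M'(1) by (force simp: top_vector_def)
  then have "iso_mod (fmod tact (rep \<kappa>)) (fmod tact (rep \<kappa>'))"
   using highest_weight_iso[OF _ simplesD(2,1)[OF rs[OF K(1)]] simplesD(2,1)[OF rs[OF K'(1)]] K(3)] by simp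
  then show False using classes_disjoint[OF K(1) K'(1) rep_in[OF K(1)] rep_in[OF K'(1)]] K'(3) by blast
 qed
 have "0 = (\<Sum>\<kappa>'\<in>classes k. a \<kappa>' * int (chi \<kappa>' M))" using z[OF K(4)] by simp
 also have "... = (\<Sum>\<kappa>'\<in>classes k. if \<kappa>' = \<kappa> then a \<kappa> * int (chi \<kappa> M) else 0)"
 proof (rule sum.cong[OF refl])
  fix \<kappa>' assume "\<kappa>' \<in> classes k"
  then show "a \<kappa>' * int (chi \<kappa>' M) = (if \<kappa>' = \<kappa> then a \<kappa> * int (chi \<kappa> M) else 0)"
   using other[of \<kappa>'] by (cases "\<kappa>' = \<kappa>"; cases "a \<kappa>' = 0") simp_all
 qed
 also have "... = a \<kappa> * int (chi \<kappa> M)" using K finite_classes by simp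
 finally have "chi \<kappa> M = 0" using K by simp
 then have "eig (tact hW) (rep \<kappa>) (theta M) = {0}"
  using eig_zero_iff[OF flinear_tact stableD(1)[OF simplesD(3)[OF rs[OF K(1)]]] simples_eig_findim[OF rs[OF K(1)]]] by (simp add: chi_def)
 then show False using K(3) by (auto simp: top_vector_def)
qed

text \<open>A common frame for Schur functors and for the infinite-dimensional ideals: a stable
  subspace of a sum of equivariant images of tensor powers, with finite-dimensional weight spaces.
  \<open>\<H>\<close> lists the tensor degrees together with the maps.\<close>

definition poly_module :: "(('w => 'w) => ('a => 'k) => 'a => 'k) => ('a => 'k) set
  => (nat \<times> (((nat => 'w => 'k) => 'k) => 'a => 'k)) set => bool" where
 "poly_module act N \<H> \<longleftrightarrow> (\<forall>g. flinear (act g)) & (\<forall>u. act id u = u) & (\<forall>g h u. act (g o h) u = act g (act h u)) &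
   (\<forall>(k, h)\<in>\<H>. equivariant_on (GL sW) tact act (E {..<k}) h) &
   stable (GL sW) act N & N \<subseteq> fs.span (\<Union>(k, h)\<in>\<H>. h ` E {..<k}) &
   (\<forall>M. findim (eig (act hW) N (theta M)))"

lemma irreducible_iff_simple:
 assumes "!!g. flinear (act g)" "!!u. act id u = u" "!!g h u. act (g o h) u = act g (act h u)"
 shows "irreducible_module sW (fmod act T) \<longleftrightarrow> simple_sub (GL sW) act T"
 unfolding irreducible_module_def gl_module_def gl_submodule_def simple_sub_def stable_def fmod_simps
 using assms(2,3) fs.vector_space_axioms
 by (auto simp: fsp.linear_add[OF assms(1)] fsp.linear_scale[OF assms(1)])

section \<open>Decompositions of polynomial modules\<close>

context
 fixes act :: "('w => 'w) => ('a => 'k) => 'a => 'k" and N \<H>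
 assumes pm: "poly_module act N \<H>"
begin

lemma pmD: "flinear (act g)" "act id u = u" "act (g o h) u = act g (act h u)" "stable (GL sW) act N"
 "(k, h') \<in> \<H> ==> equivariant_on (GL sW) tact act (E {..<k}) h'"
 "N \<subseteq> fs.span (\<Union>(k, h)\<in>\<H>. h ` E {..<k})" "findim (eig (act hW) N (theta M))"
 using pm unfolding poly_module_def by auto

definition pieces :: "('a => 'k) set set" where
 "pieces = {T. simple_sub (GL sW) act T & (\<exists>k. \<exists>T'\<in>simples k. iso_mod (fmod tact T') (fmod act T))}"

lemma image_in_pieces:
 assumes kh: "(k, h) \<in> \<H>" shows "h ` E {..<k} \<subseteq> fs.span (\<Union>pieces)"
proof -
 note eqv = pmD(5)[OF kh]
 obtain h' where h': "flinear h'" "!!u. u \<in> E {..<k} ==> h' u = h u"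
  by (rule partial_linear_extend[OF E_subspace equivariant_onD(1,2)[OF eqv]]) blast+
 have E: "E {..<k} = fs.span (\<Union>(simples k))" using E_sum_of_simples[of "{..<k}"] by (simp add: simples_def)
 have "h ` E {..<k} = h' ` E {..<k}" using h'(2) by (intro image_cong) auto
 also have "... = fs.span (h' ` \<Union>(simples k))" unfolding E by (rule fsp.linear_span_image[OF h'(1), symmetric])
 also have "... \<subseteq> fs.span (\<Union>pieces)"
 proof (rule fs.span_minimal[OF _ fs.subspace_span], clarify)
  fix x T assume T: "T \<in> simples k" "x \<in> T"
  have TE: "T \<subseteq> E {..<k}" using simplesD(1)[OF T(1)] .
  have eqT: "equivariant_on (GL sW) tact act T h" by (rule equivariant_on_subset[OF eqv TE])
  have hx: "h' x = h x" using h'(2) T TE by blast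
  show "h' x \<in> fs.span (\<Union>pieces)"
  proof (cases "h ` T = {0}")
   case True
   then have "h x = 0" using T(2) by blast
   then show ?thesis unfolding hx using fs.span_zero by simp
  next
   case False
   note im = simple_image[OF pmD(1) simplesD(2)[OF T(1)] eqT False]
   have "iso_mod (fmod tact T) (fmod act (h ` T))"
    by (rule isomorphic_fmodI[OF _ eqT]) (simp add: bij_betw_def im)
   then have "h ` T \<in> pieces" using im(1) T(1) by (auto simp: pieces_def)
   then show ?thesis unfolding hx using T(2) by (intro fs.span_base) blast
  qed
 qed
 finally show ?thesis .
qed

lemma N_in_pieces: "N \<subseteq> fs.span (\<Union>pieces)"
proof -
 have "fs.span (\<Union>(k, h)\<in>\<H>. h ` E {..<k}) \<subseteq> fs.span (\<Union>pieces)"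
  by (rule fs.span_minimal[OF _ fs.subspace_span]) (use image_in_pieces in auto)
 then show ?thesis using pmD(6) by blast
qed

lemma pieces_simple: "T \<in> pieces ==> simple_sub (GL sW) act T" by (simp add: pieces_def)

lemma simple_in_pieces:
 assumes "simple_sub (GL sW) act T" "T \<subseteq> N" shows "T \<in> pieces"
proof -
 have "T \<subseteq> fs.span (\<Union>pieces)" using assms(2) N_in_pieces by blast
 then obtain T' where T': "T' \<in> pieces" "iso_mod (fmod act T') (fmod act T)"
  using simple_sub_iso_summand[OF pmD(1) pieces_simple assms(1)] by blast
 then show ?thesis using assms(1) isomorphic_modules_trans unfolding pieces_def by blast
qed

lemma decompositionD:
 assumes D: "irreducible_decomposition sW (fmod act N) D"
 shows "T \<in> D ==> simple_sub (GL sW) act T" "T \<in> D ==> T \<subseteq> N" "T \<in> D ==> T \<in> pieces" "N = fs.span (\<Union>D)" "independent_family D"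
proof -
 show s: "simple_sub (GL sW) act T" if "T \<in> D" for T
  using D that irreducible_iff_simple[OF pmD(1-3)] by (auto simp: irreducible_decomposition_def)
 show sub: "T \<subseteq> N" if "T \<in> D" for T using D that by (auto simp: irreducible_decomposition_def gl_submodule_def)
 show "T \<in> pieces" if "T \<in> D" for T using simple_in_pieces[OF s[OF that] sub[OF that]] .
 show "N = fs.span (\<Union>D)" "independent_family D" using D by (auto simp: irreducible_decomposition_def independent_family_def)
qed

text \<open>A submodule of a sum of simple modules is the sum of its own simple submodules, from
  which Zorn's lemma selects an independent family.\<close>

lemma decomposition_exists: "\<exists>D. irreducible_decomposition sW (fmod act N) D"
proof -
 let ?S = "{T. T \<subseteq> N & simple_sub (GL sW) act T & (\<exists>T'\<in>pieces. iso_mod (fmod act T') (fmod act T))}"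
 have N: "N = fs.span (\<Union>?S)" by (rule sub_of_sum_of_simples[OF pmD(1) pieces_simple pmD(4) N_in_pieces])
 obtain D where D: "D \<subseteq> ?S" "independent_family D" "fs.span (\<Union>D) = fs.span (\<Union>?S)"
  by (rule independent_family_maximal[of "GL sW" act ?S]) (use pmD(1) in blast)+
 have "irreducible_decomposition sW (fmod act N) D"
  unfolding irreducible_decomposition_def
 proof (intro conjI ballI)
  fix T assume T: "T \<in> D"
  have s: "simple_sub (GL sW) act T" "T \<subseteq> N" using T D(1) by blast+
  show "gl_submodule sW (fmod act N) T" unfolding gl_submodule_def fmod_simps
   by (intro conjI ballI s(2) stableD[OF simple_subD(1)[OF s(1)]])
  show "irreducible_module sW ((fmod act N)\<lparr>gl_space := T\<rparr>)"
   unfolding fmod_simps irreducible_iff_simple[OF pmD(1-3)] by (rule s(1))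
  show "T Int module.span (gl_scale (fmod act N)) (\<Union>(D - {T})) = {0}"
   using D(2) T unfolding fmod_simps independent_family_def by (rule bspec)
 next
  show "gl_space (fmod act N) = module.span (gl_scale (fmod act N)) (\<Union>D)" unfolding fmod_simps D(3) by (rule N)
 qed
 then show ?thesis by blast
qed

definition in_class :: "((nat => 'w => 'k) => 'k) set set => ('a => 'k) set => bool" where
 "in_class \<kappa> T \<longleftrightarrow> (\<exists>T'\<in>\<kappa>. iso_mod (fmod tact T') (fmod act T))"

lemma in_class_dim:
 assumes "\<kappa> \<in> classes k" "in_class \<kappa> T" "simple_sub (GL sW) act T"
 shows "fs.dim (eig (act hW) T (theta M)) = chi \<kappa> M" "findim (eig (act hW) T (theta M))"
proof -
 obtain T' where T': "T' \<in> \<kappa>" "iso_mod (fmod tact T') (fmod act T)" using assms(2) by (auto simp: in_class_def)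
 have s: "T' \<in> simples k" "rep \<kappa> \<in> simples k" using class_members[OF assms(1)] T'(1) rep_in[OF assms(1)] by auto
 have st: "stable (GL sW) act T" using simple_subD(1)[OF assms(3)] .
 have "iso_mod (fmod tact (rep \<kappa>)) (fmod act T)"
  by (rule isomorphic_modules_trans[OF class_iso[OF assms(1) rep_in[OF assms(1)] T'(1)] T'(2)])
 then show "fs.dim (eig (act hW) T (theta M)) = chi \<kappa> M" "findim (eig (act hW) T (theta M))"
  unfolding chi_def by (rule dim_eig_iso[OF simplesD(3)[OF s(2)] flinear_tact simples_eig_findim[OF s(2)] _ st])+
qed

text \<open>The size of a weight selects the degree, as simple modules from other tensor powers have
  no eigenvector for it. A class occurs finitely often because all its members share some weight,
  and finitely many summands meet a given weight space.\<close>

lemma decomposition_character: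
 assumes D: "irreducible_decomposition sW (fmod act N) D"
 shows "\<kappa> \<in> classes k ==> finite {T\<in>D. in_class \<kappa> T}"
  "M \<in> weights k ==> fs.dim (eig (act hW) N (theta M)) = (\<Sum>\<kappa>\<in>classes k. card {T\<in>D. in_class \<kappa> T} * chi \<kappa> M)"
proof -
 note DD = decompositionD[OF D]
 have st: "stable (GL sW) act T" if "T \<in> D" for T using simple_subD(1)[OF DD(1)[OF that]] .
 let ?F = "%M. {T\<in>D. eig (act hW) T (theta M) ~= {0}}"
 have fin: "finite (?F M)" and dim: "fs.dim (eig (act hW) N (theta M)) = (\<Sum>T\<in>?F M. fs.dim (eig (act hW) T (theta M)))" for M
 proof -
  have f: "findim (eig (act hW) (fs.span (\<Union>D)) (theta M))" using pmD(7) DD(4) by simp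
  show "finite (?F M)" by (rule dim_eig_decomposition(1)[OF pmD(1) DD(5) stableD(1)[OF st] stableD(2)[OF st hW_GL] f])
  show "fs.dim (eig (act hW) N (theta M)) = (\<Sum>T\<in>?F M. fs.dim (eig (act hW) T (theta M)))"
   using dim_eig_decomposition(2)[OF pmD(1) DD(5) stableD(1)[OF st] stableD(2)[OF st hW_GL] f] DD(4) by simp
 qed
 have finc: "finite {T\<in>D. in_class \<kappa> T}" if \<kappa>: "\<kappa> \<in> classes k" for \<kappa> k
 proof -
  have s: "rep \<kappa> \<in> simples k" using class_members[OF \<kappa>] rep_in[OF \<kappa>] by auto
  obtain M u where Mu: "top_vector {..<k} (rep \<kappa>) M u" using simples_has_top[OF s] by blast
  have "chi \<kappa> M ~= 0" unfolding chi_def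
   using Mu eig_zero_iff[OF flinear_tact stableD(1)[OF simplesD(3)[OF s]] simples_eig_findim[OF s], of "theta M"] by (auto simp: top_vector_def)
  then have "{T\<in>D. in_class \<kappa> T} \<subseteq> ?F M" using in_class_dim(1)[OF \<kappa> _ DD(1), of _ M] by fastforce
  then show ?thesis using fin finite_subset by blast
 qed
 show "\<kappa> \<in> classes k ==> finite {T\<in>D. in_class \<kappa> T}" by (rule finc)
 assume M: "M \<in> weights k"
 have ex: "\<exists>\<kappa>\<in>classes k. in_class \<kappa> T" if T: "T \<in> ?F M" for T
 proof -
  have TD: "T \<in> D" using T by simp
  obtain k' T' where T': "T' \<in> simples k'" "iso_mod (fmod tact T') (fmod act T)" using DD(3)[OF TD] by (auto simp: pieces_def)
  have "eig (tact hW) T' (theta M) ~= {0}"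
  proof
   assume e: "eig (tact hW) T' (theta M) = {0}"
   have "fs.dim (eig (act hW) T (theta M)) = 0" "findim (eig (act hW) T (theta M))"
    using dim_eig_iso[OF simplesD(3)[OF T'(1)] flinear_tact simples_eig_findim[OF T'(1)] T'(2) st[OF TD], of "theta M"] e by auto
   then show False using T eig_zero_iff[OF pmD(1) stableD(1)[OF st[OF TD]]] by blast
  qed
  then have "k' = k" using simples_eig_size(1)[OF T'(1)] M by (simp add: weights_def)
  then have "cls k T' \<in> classes k" "in_class (cls k T') T" using T' cls_self by (auto simp: classes_def in_class_def)
  then show ?thesis by blast
 qed
 have un: "\<kappa> = \<kappa>'" if u: "\<kappa> \<in> classes k" "\<kappa>' \<in> classes k" "in_class \<kappa> T" "in_class \<kappa>' T" "T \<in> D" for \<kappa> \<kappa>' T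
 proof -
  obtain A B where A: "A \<in> \<kappa>" "iso_mod (fmod tact A) (fmod act T)" "B \<in> \<kappa>'" "iso_mod (fmod tact B) (fmod act T)"
   using u(3,4) by (auto simp: in_class_def)
  have "iso_mod (fmod act T) (fmod tact B)"
   by (rule isomorphic_fmod_sym[OF A(4) simplesD(3)[OF class_members[OF u(2) A(3)]]])
  then show ?thesis using classes_disjoint[OF u(1,2) A(1,3)] isomorphic_modules_trans[OF A(2)] by blast
 qed
 have "(\<Sum>\<kappa>\<in>classes k. card {T\<in>D. in_class \<kappa> T} * chi \<kappa> M) = (\<Sum>\<kappa>\<in>classes k. \<Sum>T\<in>{T\<in>D. in_class \<kappa> T}. fs.dim (eig (act hW) T (theta M)))"
  by (rule sum.cong[OF refl]) (use in_class_dim(1) DD(1) in simp)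
 also have "... = (\<Sum>T\<in>(\<Union>\<kappa>\<in>classes k. {T\<in>D. in_class \<kappa> T}). fs.dim (eig (act hW) T (theta M)))"
 proof (rule sum.UNION_disjoint[symmetric, OF finite_classes])
  show "\<forall>\<kappa>\<in>classes k. finite {T\<in>D. in_class \<kappa> T}" using finc by blast
  show "\<forall>\<kappa>\<in>classes k. \<forall>\<kappa>'\<in>classes k. \<kappa> ~= \<kappa>' --> {T\<in>D. in_class \<kappa> T} Int {T\<in>D. in_class \<kappa>' T} = {}" using un by blast
 qed
 also have "... = (\<Sum>T\<in>?F M. fs.dim (eig (act hW) T (theta M)))"
 proof (rule sum.mono_neutral_right)
  show "finite (\<Union>\<kappa>\<in>classes k. {T\<in>D. in_class \<kappa> T})" using finite_classes finc by blast
  show "?F M \<subseteq> (\<Union>\<kappa>\<in>classes k. {T\<in>D. in_class \<kappa> T})" using ex by blast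
  show "\<forall>T\<in>(\<Union>\<kappa>\<in>classes k. {T\<in>D. in_class \<kappa> T}) - ?F M. fs.dim (eig (act hW) T (theta M)) = 0" by auto
 qed
 finally show "fs.dim (eig (act hW) N (theta M)) = (\<Sum>\<kappa>\<in>classes k. card {T\<in>D. in_class \<kappa> T} * chi \<kappa> M)" using dim by simp
qed

text \<open>Both decompositions compute the same weight multiplicities, so independence of
  characters takes the place of a Krull-Schmidt argument.\<close>

lemma class_card_unique:
 assumes D: "irreducible_decomposition sW (fmod act N) D" "irreducible_decomposition sW (fmod act N) D'" and \<kappa>: "\<kappa> \<in> classes k"
 shows "card {T\<in>D. in_class \<kappa> T} = card {T\<in>D'. in_class \<kappa> T}"
proof -
 have "int (card {T\<in>D. in_class \<kappa> T}) - int (card {T\<in>D'. in_class \<kappa> T}) = 0"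
 proof (rule characters_independent[OF _ \<kappa>])
  fix M assume M: "M \<in> weights k"
  have "(\<Sum>\<kappa>\<in>classes k. int (card {T\<in>D. in_class \<kappa> T} * chi \<kappa> M)) = (\<Sum>\<kappa>\<in>classes k. int (card {T\<in>D'. in_class \<kappa> T} * chi \<kappa> M))"
   using decomposition_character(2)[OF D(1) M] decomposition_character(2)[OF D(2) M] by (simp only: of_nat_sum[symmetric])
  then show "(\<Sum>\<kappa>\<in>classes k. (int (card {T\<in>D. in_class \<kappa> T}) - int (card {T\<in>D'. in_class \<kappa> T})) * int (chi \<kappa> M)) = 0"
   by (simp add: left_diff_distrib sum_subtractf)
 qed
 then show ?thesis by simp
qed

definition mlt :: "((nat => 'w => 'k) => 'k) set set => nat" where
 "mlt \<kappa> = card {T \<in> (SOME D. irreducible_decomposition sW (fmod act N) D). in_class \<kappa> T}"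

lemma mlt_eq: "irreducible_decomposition sW (fmod act N) D ==> \<kappa> \<in> classes k ==> card {T\<in>D. in_class \<kappa> T} = mlt \<kappa>"
 unfolding mlt_def by (rule class_card_unique[OF _ someI_ex[OF decomposition_exists]])

lemma mlt_character: "M \<in> weights k ==> fs.dim (eig (act hW) N (theta M)) = (\<Sum>\<kappa>\<in>classes k. mlt \<kappa> * chi \<kappa> M)"
 unfolding mlt_def by (rule decomposition_character(2)[OF someI_ex[OF decomposition_exists]])

text \<open>The definite description in \<open>gl_mult\<close> ranges over all decompositions; it
  denotes because one exists and the count in a class is the same in all of them.\<close>

lemma gl_mult_mlt:
 assumes \<kappa>: "\<kappa> \<in> classes k" "T0 \<in> \<kappa>" and U: "iso_mod (fmod tact T0) U"
 shows "gl_mult sW (fmod act N) U = mlt \<kappa>"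
proof -
 have T0s: "T0 \<in> simples k" using class_members[OF \<kappa>] .
 have eq: "{T\<in>D. iso_mod ((fmod act N)\<lparr>gl_space := T\<rparr>) U} = {T\<in>D. in_class \<kappa> T}"
  if D: "irreducible_decomposition sW (fmod act N) D" for D
 proof -
  have "iso_mod (fmod act T) U \<longleftrightarrow> in_class \<kappa> T" if T: "T \<in> D" for T
  proof
   have sT: "stable (GL sW) act T" using simple_subD(1)[OF decompositionD(1)[OF D T]] .
   assume "iso_mod (fmod act T) U"
   then have "iso_mod U (fmod act T)" by (rule isomorphic_fmod_sym[OF _ sT])
   then show "in_class \<kappa> T" using isomorphic_modules_trans[OF U] \<kappa>(2) by (auto simp: in_class_def)
  next
   assume "in_class \<kappa> T"
   then obtain T' where T': "T' \<in> \<kappa>" "iso_mod (fmod tact T') (fmod act T)" by (auto simp: in_class_def)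
   have "iso_mod (fmod act T) (fmod tact T')"
    by (rule isomorphic_fmod_sym[OF T'(2) simplesD(3)[OF class_members[OF \<kappa>(1) T'(1)]]])
   then show "iso_mod (fmod act T) U"
    using isomorphic_modules_trans[OF isomorphic_modules_trans[OF _ class_iso[OF \<kappa>(1) T'(1) \<kappa>(2)]] U] by blast
  qed
  then show ?thesis by auto
 qed
 show ?thesis unfolding gl_mult_def
 proof (rule the_equality)
  obtain D where D: "irreducible_decomposition sW (fmod act N) D" using decomposition_exists by blast
  show "\<exists>D. irreducible_decomposition sW (fmod act N) D & finite {T\<in>D. iso_mod ((fmod act N)\<lparr>gl_space := T\<rparr>) U} &
    mlt \<kappa> = card {T\<in>D. iso_mod ((fmod act N)\<lparr>gl_space := T\<rparr>) U}"
   using D eq[OF D] decomposition_character(1)[OF D \<kappa>(1)] mlt_eq[OF D \<kappa>(1)] by (intro exI[of _ D]) simp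
  fix n assume "\<exists>D. irreducible_decomposition sW (fmod act N) D & finite {T\<in>D. iso_mod ((fmod act N)\<lparr>gl_space := T\<rparr>) U} &
    n = card {T\<in>D. iso_mod ((fmod act N)\<lparr>gl_space := T\<rparr>) U}"
  then obtain D where D: "irreducible_decomposition sW (fmod act N) D" "n = card {T\<in>D. iso_mod ((fmod act N)\<lparr>gl_space := T\<rparr>) U}" by blast
  then show "n = mlt \<kappa>" using eq[OF D(1)] mlt_eq[OF D(1) \<kappa>(1)] by simp
 qed
qed

text \<open>Every simple summand is a copy of a submodule of a tensor power, so irreducible
  representations of any other kind, such as negative powers of the determinant when m > 0, do not
  occur.\<close>

lemma gl_mult_zero:
 assumes U: "!!k T. T \<in> simples k ==> \<not> iso_mod (fmod tact T) U"
 shows "gl_mult sW (fmod act N) U = 0"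
proof -
 have eq: "{T\<in>D. iso_mod ((fmod act N)\<lparr>gl_space := T\<rparr>) U} = {}"
  if D: "irreducible_decomposition sW (fmod act N) D" for D
 proof -
  have "\<not> iso_mod (fmod act T) U" if T: "T \<in> D" for T
  proof
   assume i: "iso_mod (fmod act T) U"
   obtain k T' where T': "T' \<in> simples k" "iso_mod (fmod tact T') (fmod act T)"
    using decompositionD(3)[OF D T] by (auto simp: pieces_def)
   then show False using U isomorphic_modules_trans[OF T'(2) i] by blast
  qed
  then show ?thesis by auto
 qed
 show ?thesis unfolding gl_mult_def
 proof (rule the_equality)
  obtain D where D: "irreducible_decomposition sW (fmod act N) D" using decomposition_exists by blast
  show "\<exists>D. irreducible_decomposition sW (fmod act N) D & finite {T\<in>D. iso_mod ((fmod act N)\<lparr>gl_space := T\<rparr>) U} &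
    0 = card {T\<in>D. iso_mod ((fmod act N)\<lparr>gl_space := T\<rparr>) U}"
   by (intro exI[of _ D] conjI D) (simp_all only: eq[OF D] finite.emptyI card.empty)
  fix n assume "\<exists>D. irreducible_decomposition sW (fmod act N) D & finite {T\<in>D. iso_mod ((fmod act N)\<lparr>gl_space := T\<rparr>) U} &
    n = card {T\<in>D. iso_mod ((fmod act N)\<lparr>gl_space := T\<rparr>) U}"
  then obtain D where D: "irreducible_decomposition sW (fmod act N) D" "n = card {T\<in>D. iso_mod ((fmod act N)\<lparr>gl_space := T\<rparr>) U}" by blast
  show "n = 0" unfolding D(2) eq[OF D(1)] by simp
 qed
qed

end

end

section \<open>The character of a Schur functor\<close>

text \<open>The vector \<open>H u - \<theta>0 u\<close> is a vanishing sum of eigenvectors for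
  distinct eigenvalues, so every component with an eigenvalue other than \<open>\<theta>0\<close> is
  0.\<close>

lemma eigen_sum:
 fixes H :: "('a => 'k::field) => 'a => 'k"
 assumes H: "flinear H" and F: "finite F" "inj_on \<theta> F" "!!i. i \<in> F ==> H (c i) = fscale (\<theta> i) (c i)"
  and u: "u = (\<Sum>i\<in>F. c i)" "H u = fscale \<theta>0 u"
 shows "u = (\<Sum>i\<in>{i\<in>F. \<theta> i = \<theta>0}. c i)"
proof -
 let ?d = "%i. fscale (\<theta> i - \<theta>0) (c i)"
 have "(\<Sum>i\<in>F. ?d i) = H u - fscale \<theta>0 u"
  unfolding u(1) fsp.linear_sum[OF H] fs.scale_sum_right sum_subtractf[symmetric]
  by (rule sum.cong[OF refl]) (simp only: F(3) fs.scale_left_diff_distrib)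
 then have z: "(\<Sum>i\<in>F. ?d i) \<in> {0}" using u(2) by simp
 have "?d i = 0" if "i \<in> F" for i
 proof -
  have "?d i \<in> {0}"
  proof (rule fs.eigen_components_in_subspace[OF H _ _ F(1,2) _ z that])
   show "H (?d j) = fscale (\<theta> j) (?d j)" if "j \<in> F" for j
    by (simp only: fsp.linear_scale[OF H] F(3)[OF that] fs.scale_left_commute)
   show "H v \<in> {0}" if "v \<in> {0}" for v using that fsp.linear_0[OF H] by auto
  qed simp
  then show ?thesis by simp
 qed
 then have "c i = 0" if "i \<in> F" "\<theta> i ~= \<theta>0" for i
  using that fs.scale_eq_0_iff[of "\<theta> i - \<theta>0" "c i"] by auto
 then show ?thesis unfolding u(1) using F(1) by (intro sum.mono_neutral_right) auto
qed

context wspace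
begin

lemma schur_functor_fmod:
 "schur_functor sW lam = fmod tact (young_symmetrizer lam ` E (cells lam))"
 by (simp add: schur_functor_def fmod_def tact_def[abs_def])

lemma young_pact:
 "young_symmetrizer lam t = (\<Sum>p\<in>row_group lam. \<Sum>q\<in>column_group lam. fscale (of_int (sign q)) (pact (p o q) t))"
 by (simp add: young_symmetrizer_def pact_def fun_eq_iff sum_fun_apply fscale_apply comp_assoc)

lemma flinear_young: "flinear (young_symmetrizer lam :: ((nat \<times> nat => 'w => 'k) => 'k) => _)"
 unfolding young_pact by (intro flinear_sum flinear_scale flinear_pact)

lemma young_E: "t \<in> E (cells lam) ==> young_symmetrizer lam t \<in> E (cells lam)"
 unfolding young_pact
 by (intro fs.subspace_sum[OF E_subspace] fs.subspace_scale[OF E_subspace] pact_E permutes_compose row_group_permutes column_group_permutes)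

lemma young_tact: "young_symmetrizer lam (tact g t) = tact g (young_symmetrizer lam t)"
 unfolding young_pact by (simp only: fsp.linear_sum[OF flinear_tact] fsp.linear_scale[OF flinear_tact] tact_pact)

lemma inv_group:
 "bij_betw inv (row_group lam) (row_group lam)" "bij_betw inv (column_group lam) (column_group lam)"
proof -
 have r: "inv p \<in> row_group lam" if "p \<in> row_group lam" for p
  by (rule row_groupI[OF permutes_inv[OF row_group_permutes[OF that]]]) (rule inv_keeps[where f=fst, OF row_group_permutes[OF that] row_fst[OF that]])
 have c: "inv p \<in> column_group lam" if "p \<in> column_group lam" for p
  by (rule column_groupI[OF permutes_inv[OF column_group_permutes[OF that]]]) (rule inv_keeps[where f=snd, OF column_group_permutes[OF that] col_snd[OF that]])
 show "bij_betw inv (row_group lam) (row_group lam)"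
  by (rule bij_betw_byWitness[where f'=inv]) (use r permutes_bij[OF row_group_permutes] inv_inv_eq in auto)
 show "bij_betw inv (column_group lam) (column_group lam)"
  by (rule bij_betw_byWitness[where f'=inv]) (use c permutes_bij[OF column_group_permutes] inv_inv_eq in auto)
qed

text \<open>Permuting tensor positions moves a filling by the inverse permutation. Inversion
  permutes both groups and preserves signs, which restores the form of \<open>vv\<close>.\<close>

lemma young_et:
 assumes T: "T \<in> idx (cells lam)" and S: "S \<in> idx (cells lam)"
 shows "young_symmetrizer lam (et (cells lam) T) (bt S) = vv lam T S"
proof -
 let ?C = "cells lam"
 have pq: "pact (p o q) (et ?C T) (bt S) = (if T o inv q o inv p = S then 1 else 0)"
  if "p \<in> row_group lam" "q \<in> column_group lam" for p q
 proof -
  note per = row_group_permutes[OF that(1)] column_group_permutes[OF that(2)]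
  have pp: "p o q permutes ?C" by (rule permutes_compose[OF per(2,1)])
  have "pact (p o q) (et ?C T) = et ?C (T o inv (p o q))"
   unfolding et_def pact_pt[OF pp] by (simp add: comp_assoc)
  also have "T o inv (p o q) = T o inv q o inv p"
   using o_inv_distrib[OF permutes_bij[OF per(1)] permutes_bij[OF per(2)]] by (simp add: comp_assoc)
  finally have eq: "pact (p o q) (et ?C T) = et ?C (T o inv q o inv p)" .
  have "T o inv q o inv p \<in> idx ?C" by (intro idx_comp permutes_inv per T)
  then show ?thesis unfolding eq using et_bt[OF finite_cells S] by auto
 qed
 have "young_symmetrizer lam (et ?C T) (bt S)
   = (\<Sum>p\<in>row_group lam. \<Sum>q\<in>column_group lam. of_int (sign q) * (if T o inv q o inv p = S then 1 else 0))"
  unfolding young_pact sum_fun_apply fscale_apply by (intro sum.cong refl arg_cong2[where f="(*)"] pq)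
 also have "... = (\<Sum>p\<in>row_group lam. \<Sum>q\<in>column_group lam. of_int (sign (inv q)) * (if T o inv q o inv p = S then 1 else 0))"
 proof (intro sum.cong refl)
  fix p q assume "q \<in> column_group lam"
  then have "permutation q" using column_group_permutes finite_cells permutation_permutes by blast
  then show "of_int (sign q) * (if T o inv q o inv p = S then 1 else 0) = (of_int (sign (inv q)) * (if T o inv q o inv p = S then 1 else 0) :: 'k)"
   by (simp only: sign_inverse)
 qed
 also have "... = (\<Sum>p\<in>row_group lam. \<Sum>q\<in>column_group lam. of_int (sign q) * (if T o q o inv p = S then 1 else 0))"
  by (intro sum.cong refl sum.reindex_bij_betw[OF inv_group(2)])
 also have "... = vv lam T S" unfolding vv_def by (rule sum.reindex_bij_betw[OF inv_group(1)])
 finally show ?thesis .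
qed

text \<open>The symmetrizer commutes with the torus, so the weight space is spanned by the
  symmetrized basis tensors of weight \<open>M\<close>. Since \<open>M\<close> uses only indices
  below m, these tensors correspond to all fillings of content \<open>M\<close>, and taking
  coordinates turns them into the vectors \<open>vv\<close>.\<close>

lemma dim_eig_schur_functor:
 assumes lam: "is_partition lam" and M: "set_mset M \<subseteq> {..<m}"
 shows "fs.dim (eig (tact hW) (young_symmetrizer lam ` E (cells lam)) (theta M)) = card (ssyt_content lam M)"
proof -
 let ?C = "cells lam"
 let ?y = "%T. young_symmetrizer lam (et ?C T)"
 let ?N = "young_symmetrizer lam ` E ?C"
 define A where "A M = {T \<in> idx ?C. wt ?C T = M}" for M
 have A: "A M = fillings lam M"
  using M by (auto simp: A_def fillings_def wt_def PiE_iff finite_cells image_subset_iff)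
 have yE: "?y T \<in> E ?C" for T by (rule young_E[OF et_in_E])
 have Hy: "tact hW (?y T) = fscale (theta (wt ?C T)) (?y T)" if "T \<in> idx ?C" for T
  unfolding young_tact[symmetric] tact_hW_et[OF that] by (rule fsp.linear_scale[OF flinear_young])
 have eigeq: "eig (tact hW) ?N (theta M) = fs.span (?y ` A M)"
 proof
  have "fs.subspace ?N" by (rule fsp.linear_subspace_image[OF flinear_young E_subspace])
  then show "fs.span (?y ` A M) \<subseteq> eig (tact hW) ?N (theta M)"
   by (intro fs.span_minimal subspace_eig[OF flinear_tact]) (auto simp: eig_def A_def Hy et_in_E)
  show "eig (tact hW) ?N (theta M) \<subseteq> fs.span (?y ` A M)"
  proof
   fix u assume "u \<in> eig (tact hW) ?N (theta M)"
   then obtain t where t: "t \<in> E ?C" "u = young_symmetrizer lam t" and Hu: "tact hW u = fscale (theta M) u" by (auto simp: eig_def)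
   define c where "c M' = (\<Sum>T\<in>A M'. fscale (t (bt T)) (?y T))" for M'
   let ?F = "wt ?C ` idx ?C"
   have finF: "finite ?F" using finite_idx[OF finite_cells] by simp
   have "u = (\<Sum>T\<in>idx ?C. fscale (t (bt T)) (?y T))"
    using arg_cong[OF E_expand[OF finite_cells t(1)], of "young_symmetrizer lam"]
    by (simp only: t(2) fsp.linear_sum[OF flinear_young] fsp.linear_scale[OF flinear_young])
   also have "... = (\<Sum>M'\<in>?F. c M')" unfolding c_def A_def
    by (rule sum.group[symmetric]) (use finF finite_idx[OF finite_cells] in auto)
   finally have us: "u = (\<Sum>M'\<in>?F. c M')" .
   have Hc: "tact hW (c M') = fscale (theta M') (c M')" for M'
   proof -
    have "tact hW (c M') = (\<Sum>T\<in>A M'. fscale (t (bt T)) (tact hW (?y T)))"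
     unfolding c_def by (simp only: fsp.linear_sum[OF flinear_tact] fsp.linear_scale[OF flinear_tact])
    also have "... = (\<Sum>T\<in>A M'. fscale (theta M') (fscale (t (bt T)) (?y T)))"
     by (rule sum.cong[OF refl]) (auto simp: A_def Hy mult.commute)
    finally show ?thesis unfolding c_def fs.scale_sum_right .
   qed
   have "u = (\<Sum>M'\<in>{M'\<in>?F. theta M' = (theta M :: 'k)}. c M')"
    by (rule eigen_sum[OF flinear_tact finF _ Hc us Hu]) (auto simp: inj_on_def theta_inj)
   also have "{M'\<in>?F. theta M' = (theta M :: 'k)} \<subseteq> {M}" by (auto simp: theta_inj)
   then have "(\<Sum>M'\<in>{M'\<in>?F. theta M' = (theta M :: 'k)}. c M') \<in> fs.span (?y ` A M)"
    by (intro fs.span_sum) (auto simp: c_def intro!: fs.span_sum fs.span_scale intro: fs.span_base)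
   finally show "u \<in> fs.span (?y ` A M)" .
  qed
 qed
 define Cf where "Cf = (%(t :: (nat \<times> nat => 'w => 'k) => 'k) S. if S \<in> idx ?C then t (bt S) else 0)"
 have Cf: "flinear Cf" by (rule flinearI) (auto simp: Cf_def fs_simps)
 have Cy: "Cf (?y T) = vv lam T" if T: "T \<in> idx ?C" for T
 proof
  fix S
  have "vv lam T S = (0 :: 'k)" if S: "S \<notin> idx ?C"
   unfolding vv_def
  proof (rule sum.neutral, rule ballI, rule sum.neutral, rule ballI)
   fix p q assume "p \<in> row_group lam" "q \<in> column_group lam"
   then have "T o q o p \<in> idx ?C" by (intro idx_comp row_group_permutes column_group_permutes T)
   then have "T o q o p ~= S" using S by blast
   then show "of_int (sign q) * (if T o q o p = S then 1 else 0) = (0 :: 'k)" by simp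
  qed
  then show "Cf (?y T) S = vv lam T S" using young_et[OF T] by (simp add: Cf_def)
 qed
 have inj: "inj_on Cf (E ?C)"
 proof (rule inj_onI)
  fix u v assume uv: "u \<in> E ?C" "v \<in> E ?C" "Cf u = Cf v"
  have "u (bt T) = v (bt T)" if "T \<in> idx ?C" for T using fun_cong[OF uv(3), of T] that by (simp add: Cf_def)
  then show "u = v" by (rule E_ext[OF finite_cells uv(1,2)])
 qed
 have "fs.span (?y ` A M) \<subseteq> E ?C" by (rule fs.span_minimal[OF _ E_subspace]) (use yE in blast)
 then have "inj_on Cf (fs.span (?y ` A M))" by (rule inj_on_subset[OF inj])
 moreover have "findim (fs.span (?y ` A M))" unfolding A by (rule findim_span) (simp add: finite_fillings)
 ultimately have "fs.dim (fs.span (?y ` A M)) = fs.dim (Cf ` fs.span (?y ` A M))"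
  by (intro fs_dim_eq_partial_iso[symmetric]) (auto simp: fsp.linear_add[OF Cf] fsp.linear_scale[OF Cf])
 also have "Cf ` fs.span (?y ` A M) = fs.span (Cf ` ?y ` A M)" by (rule fsp.linear_span_image[OF Cf, symmetric])
 also have "Cf ` ?y ` A M = vv lam ` A M" unfolding image_image by (rule image_cong[OF refl Cy]) (simp add: A_def)
 finally show ?thesis unfolding eigeq A dim_vv[OF lam] .
qed

text \<open>Numbering the cells transports the tensor power indexed by cells to the one indexed by
  an initial segment, in which the simple modules are classified.\<close>

lemma schur_functor_poly_module:
 "\<exists>h. poly_module tact (young_symmetrizer lam ` E (cells lam)) {(sum_list lam, h)}"
proof -
 let ?C = "cells lam" and ?k = "sum_list lam"
 let ?N = "young_symmetrizer lam ` E ?C"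
 obtain e where e: "bij_betw e {..<?k} ?C"
  using finite_same_card_bij[of "{..<?k}" ?C] finite_cells card_cells by auto
 define h where "h t = (%\<xi> :: nat \<times> nat => 'w => 'k. t (%l. \<xi> (e l)))" for t :: "(nat => 'w => 'k) => 'k"
 have lh: "flinear h" by (rule flinearI) (auto simp: h_def fs_simps)
 have ei: "e ` {..<?k} = ?C" using e by (simp add: bij_betw_def)
 have hp: "h (pt {..<?k} w) = pt ?C (%c. w (inv_into {..<?k} e c))" for w
 proof
  fix \<xi>
  have "dfam {..<?k} (%l. \<xi> (e l)) \<longleftrightarrow> dfam ?C \<xi>" unfolding dfam_def ei[symmetric] by simp
  moreover have "(\<Prod>c\<in>?C. \<xi> c (w (inv_into {..<?k} e c))) = (\<Prod>l<?k. \<xi> (e l) (w l))"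
   using e by (subst prod.reindex_bij_betw[OF e, symmetric]) (auto simp: bij_betw_def intro!: prod.cong)
  ultimately show "h (pt {..<?k} w) \<xi> = pt ?C (%c. w (inv_into {..<?k} e c)) \<xi>" by (simp add: h_def pt_apply)
 qed
 have "E ?C \<subseteq> h ` E {..<?k}"
 proof -
  have "range (pt ?C) \<subseteq> h ` range (pt {..<?k})"
  proof clarify
   fix w
   have "pt ?C w = pt ?C (%c. w (e (inv_into {..<?k} e c)))"
    by (auto simp: pt_apply fun_eq_iff f_inv_into_f ei intro!: prod.cong)
   also have "... = h (pt {..<?k} (%l. w (e l)))" by (rule hp[symmetric])
   finally show "pt ?C w \<in> h ` range (pt {..<?k})" by blast
  qed
  then show ?thesis unfolding tensor_power_def fsp.linear_span_image[OF lh, symmetric] by (rule fs.span_mono)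
 qed
 moreover have "?N \<subseteq> E ?C" using young_E by blast
 ultimately have sub: "?N \<subseteq> fs.span (\<Union>(k, h)\<in>{(?k, h)}. h ` E {..<k})" using fs.span_superset by fastforce
 have st: "stable (GL sW) tact ?N"
  unfolding stable_def
 proof (intro conjI ballI)
  show "fs.subspace ?N" by (rule fsp.linear_subspace_image[OF flinear_young E_subspace])
  fix g u assume g: "g \<in> GL sW" "u \<in> ?N"
  then obtain t where t: "t \<in> E ?C" "u = young_symmetrizer lam t" by blast
  show "tact g u \<in> ?N" unfolding t(2) young_tact[symmetric] by (rule imageI[OF stableD(2)[OF E_stable g(1) t(1)]])
 qed
 have "poly_module tact ?N {(?k, h)}"
  unfolding poly_module_def
 proof (intro conjI allI)
  show "\<forall>(k, h)\<in>{(?k, h)}. equivariant_on (GL sW) tact tact (E {..<k}) h"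
  proof -
   have "h (tact g t) = tact g (h t)" for g t by (simp add: h_def tact_def)
   then show ?thesis by (simp add: equivariant_on_def fsp.linear_add[OF lh] fsp.linear_scale[OF lh])
  qed
  show "findim (eig (tact hW) ?N (theta M))" for M
   by (rule findim_mono[OF E_findim[OF finite_cells[of lam]] subset_trans[OF eig_subset \<open>?N \<subseteq> E ?C\<close>]])
 qed (use st sub flinear_tact tact_id in \<open>auto simp: tact_tact\<close>)
 then show ?thesis by blast
qed

end

section \<open>Products of linear ideals\<close>

text \<open>The type \<open>'a\<close> may be larger than the space of interest: later it consists
  of all functions from W to V, of which only the linear ones count. The ideals enter through the
  linear forms vanishing on the subspaces \<open>Z x\<close>.\<close>

locale forms = vector_space sY for sY :: "'k::field_char_0 => 'a::ab_group_add => 'a" +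
 fixes X :: "'x set" and Z :: "'x => 'a set"
 assumes finX: "finite X" and Zsub: "x \<in> X ==> subspace (Z x)"
begin

lemma vs_mult: "vector_space ((*) :: 'k => 'k => 'k)"
 by unfold_locales (auto simp: algebra_simps)


interpretation yy: vector_space_pair sY sY
 by (intro vector_space_pair.intro vector_space_axioms)

abbreviation "Lin \<equiv> dual_space sY"

lemma Lin_iff: "l \<in> Lin \<longleftrightarrow> (\<forall>y y'. l (y + y') = l y + l y') & (\<forall>c y. l (sY c y) = c * l y)"
 unfolding dual_space_def mem_Collect_eq Vector_Spaces.linear_iff using vs_mult vector_space_axioms by blast

lemma LinD:
 assumes "l \<in> Lin"
 shows "l (y + y') = l y + l y'" "l (sY c y) = c * l y" "l 0 = 0" "l (y - y') = l y - l y'"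
proof -
 show 1: "l (y + y') = l y + l y'" "l (sY c y) = c * l y" for y y' c using assms by (auto simp: Lin_iff)
 show "l 0 = 0" using 1(1)[of 0 0] by simp
 show "l (y - y') = l y - l y'" using 1(1)[of "y - y'" y'] by simp
qed

lemma Lin_add: "l \<in> Lin ==> l' \<in> Lin ==> (%y. l y + c * l' y) \<in> Lin"
 by (simp add: Lin_iff algebra_simps)

definition L :: "'x => ('a => 'k) set" where "L x = {l \<in> Lin. \<forall>y\<in>Z x. l y = 0}"

text \<open>\<open>J A k\<close> is the degree \<open>k\<close> part of the product over \<open>x \<in> A\<close> of the ideals generated by \<open>L x\<close>.\<close>

inductive J :: "'x set => nat => ('a => 'k) => bool" where
 one: "J {} 0 (%y. 1)"
| zero: "J A k (%y. 0)"
| add: "J A k f ==> J A k g ==> J A k (%y. f y + g y)"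
| scale: "J A k f ==> J A k (%y. c * f y)"
| lin: "l \<in> Lin ==> J A k f ==> J A (Suc k) (%y. l y * f y)"
| fac: "x \<notin> A ==> l \<in> L x ==> J A k f ==> J (insert x A) (Suc k) (%y. l y * f y)"

lemma J_sum: "(!!i. i \<in> F ==> J A k (f i)) ==> J A k (%y. \<Sum>i\<in>F. f i y)"
 by (induction F rule: infinite_finite_induct) (auto intro: J.zero J.add)

lemma J_diff: assumes "J A k f" "J A k g" shows "J A k (%y. f y - g y)"
 using J.add[OF assms(1) J.scale[OF assms(2), of "-1"]] by simp

lemma L_Lin: "l \<in> L x ==> l \<in> Lin" by (simp add: L_def)

lemma J_remove: "J A k f ==> J (A - {x}) k f"
proof (induction rule: J.induct)
 case (fac x' A l k f)
 show ?case
 proof (cases "x' = x")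
  case True
  then show ?thesis using fac J.lin[OF L_Lin[OF fac(2)] fac(4)] by simp
 next
  case False
  then have "insert x' A - {x} = insert x' (A - {x})" by auto
  then show ?thesis using J.fac[OF _ fac(2) fac(4)] fac(1) by simp
 qed
qed (auto intro: J.intros)

lemma J_empty: "J A k f ==> J {} k f"
 by (induction rule: J.induct) (auto intro: J.intros L_Lin)

lemma J_at_0: "J A k f ==> 0 < k ==> f 0 = 0"
 by (induction rule: J.induct) (auto simp: LinD L_def)

lemma J_small: "J A k f ==> finite A ==> k < card A ==> f y = 0"
 by (induction rule: J.induct) auto

section \<open>Cancellation and division by a linear form\<close>

lemma J_line: "J A k f ==> \<exists>p. \<forall>t. f (y + sY t e) = poly p t"
proof (induction rule: J.induct)
 case one show ?case by (rule exI[of _ 1]) simp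
next
 case (zero A k) show ?case by (rule exI[of _ 0]) simp
next
 case (add A k f g)
 then obtain p q where "\<forall>t. f (y + sY t e) = poly p t" "\<forall>t. g (y + sY t e) = poly q t" by blast
 then show ?case by (intro exI[of _ "p + q"]) simp
next
 case (scale A k f c)
 then obtain p where "\<forall>t. f (y + sY t e) = poly p t" by blast
 then show ?case by (intro exI[of _ "smult c p"]) simp
next
 case (lin l A k f)
 then obtain p where "\<forall>t. f (y + sY t e) = poly p t" by blast
 then show ?case using LinD[OF lin(1)] by (intro exI[of _ "[:l y, l e:] * p"]) (simp add: distrib_right)
next
 case (fac x A l k f)
 then obtain p where "\<forall>t. f (y + sY t e) = poly p t" by blast
 then show ?case using LinD[OF L_Lin[OF fac(2)]] by (intro exI[of _ "[:l y, l e:] * p"]) (simp add: distrib_right)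
qed

text \<open>On the line through \<open>y\<close> in direction \<open>e\<close> both factors are
  polynomials in one variable over an infinite field, and the linear one is not the zero
  polynomial.\<close>

lemma cancel:
 assumes z: "z \<in> Lin" and S: "subspace S" "e \<in> S" "z e ~= 0" and f: "J A k f"
  and zf: "!!y. y \<in> S ==> z y * f y = 0" and y: "y \<in> S"
 shows "f y = 0"
proof -
 obtain p where p: "\<forall>t. f (y + sY t e) = poly p t" using J_line[OF f] by blast
 let ?q = "[:z y, z e:]"
 have "poly (?q * p) t = 0" for t
 proof -
  have "poly ?q t = z (y + sY t e)" using LinD[OF z] by simp
  then show ?thesis unfolding poly_mult using zf[OF subspace_add[OF S(1) y subspace_scale[OF S(1,2)]], of t] p by simp
 qed
 then have "?q * p = 0" using poly_all_0_iff_0 by blast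
 moreover have "?q ~= 0" using S(3) by simp
 ultimately have "p = 0" using mult_eq_0_iff by blast
 then show ?thesis using p[rule_format, of 0] by simp
qed

text \<open>The forms in \<open>L x\<close> with \<open>x \<in> A\<close> vanish at
  \<open>e\<close>, so they are unchanged by the projection along \<open>e\<close> to the kernel of
  \<open>z\<close>. Composing a product with this projection therefore keeps its special factors,
  and the difference is \<open>z\<close> times an element of the same ideal. This is the sense in
  which \<open>z\<close> is a nonzerodivisor modulo that ideal.\<close>

lemma J_divide:
 assumes z: "z \<in> Lin" "z e = 1" and f: "J A k f" and e: "!!x. x \<in> A ==> e \<in> Z x"
 shows "\<exists>f'. (\<forall>y. f y = f (y - sY (z y) e) + z y * f' y) & (case k of 0 => f' = (%y. 0) | Suc k' => J A k' f')"
 using f e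
proof (induction rule: J.induct)
 case one show ?case by (rule exI[of _ "%y. 0"]) simp
next
 case (zero A k) show ?case by (rule exI[of _ "%y. 0"]) (simp add: J.zero split: nat.split)
next
 case (add A k f g)
 obtain f' where f': "!!y. f y = f (y - sY (z y) e) + z y * f' y" "case k of 0 => f' = (%y. 0) | Suc k' => J A k' f'"
  using add.IH(1)[OF add.prems] by blast
 obtain g' where g': "!!y. g y = g (y - sY (z y) e) + z y * g' y" "case k of 0 => g' = (%y. 0) | Suc k' => J A k' g'"
  using add.IH(2)[OF add.prems] by blast
 have "f y + g y = f (y - sY (z y) e) + g (y - sY (z y) e) + z y * (f' y + g' y)" for y
  using f'(1)[of y] g'(1)[of y] by (simp add: distrib_left)
 moreover have "case k of 0 => (%y. f' y + g' y) = (%y. 0) | Suc k' => J A k' (%y. f' y + g' y)"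
  using f'(2) g'(2) by (cases k) (auto simp: J.add)
 ultimately show ?case by (intro exI[of _ "%y. f' y + g' y"] conjI allI)
next
 case (scale A k f c)
 obtain f' where f': "!!y. f y = f (y - sY (z y) e) + z y * f' y" "case k of 0 => f' = (%y. 0) | Suc k' => J A k' f'"
  using scale.IH[OF scale.prems] by blast
 have "c * f y = c * f (y - sY (z y) e) + z y * (c * f' y)" for y
  using arg_cong[OF f'(1)[of y], of "%v. c * v"] by (simp add: distrib_left mult.left_commute)
 moreover have "case k of 0 => (%y. c * f' y) = (%y. 0) | Suc k' => J A k' (%y. c * f' y)"
  using f'(2) by (cases k) (auto simp: J.scale)
 ultimately show ?case by (intro exI[of _ "%y. c * f' y"] conjI allI)
next
 case (lin l A k f)
 obtain f' where f': "!!y. f y = f (y - sY (z y) e) + z y * f' y" "case k of 0 => f' = (%y. 0) | Suc k' => J A k' f'"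
  using lin.IH[OF lin.prems] by blast
 \<comment> \<open>The quotient comes from splitting l(y) into its value at the projected point and
   z(y) times l(e).\<close>
 let ?g = "%y. l y * f' y + l e * (f y - z y * f' y)"
 have e1: "l y * f y = l (y - sY (z y) e) * f (y - sY (z y) e) + z y * ?g y" for y
 proof -
  have fy: "f (y - sY (z y) e) = f y - z y * f' y" by (rule eq_diff_eq[THEN iffD2, OF f'(1)[of y, symmetric]])
  have "L * F = (L - Z * E) * (F - Z * G) + Z * (L * G + E * (F - Z * G))" for L F E G Z :: 'k by (simp add: algebra_simps)
  then show ?thesis unfolding fy LinD(2,4)[OF lin(1)] .
 qed
 have e2: "J A k ?g"
 proof (cases k)
  case 0
  then show ?thesis using f'(2) lin(2) by (simp add: J.scale)
 next
  case (Suc k')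
  then have "J A k' f'" using f'(2) by simp
  then show ?thesis
   unfolding Suc by (intro J.add J.lin[OF lin(1)] J.scale J_diff lin(2)[unfolded Suc] J.lin[OF z(1)])
 qed
 show ?case by (intro exI[of _ ?g] conjI allI e1) (simp only: nat.case e2)
next
 case (fac x A l k f)
 obtain f' where f': "!!y. f y = f (y - sY (z y) e) + z y * f' y" "case k of 0 => f' = (%y. 0) | Suc k' => J A k' f'"
  using fac.IH fac.prems by blast
 have "l e = 0" using fac(2) fac.prems[of x] by (simp add: L_def)
 then have "l (y - sY (z y) e) = l y" for y using LinD[OF L_Lin[OF fac(2)]] by simp
 then have e1: "l y * f y = l (y - sY (z y) e) * f (y - sY (z y) e) + z y * (l y * f' y)" for y
  using arg_cong[OF f'(1)[of y], of "%v. l y * v"] by (simp add: algebra_simps)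
 have e2: "J (insert x A) k (%y. l y * f' y)"
  using f'(2) J.fac[OF fac(1,2)] by (cases k) (auto simp: J.zero)
 show ?case by (intro exI[of _ "%y. l y * f' y"] conjI allI e1) (simp only: nat.case e2)
qed

lemma J_divide_on:
 assumes S: "subspace S" and z: "z \<in> Lin" and e: "e \<in> S" "z e ~= 0" "!!x. x \<in> A ==> e \<in> Z x" and A: "A \<subseteq> X"
  and f: "J A k f" "!!y. y \<in> S ==> z y = 0 ==> f y = 0"
 obtains f' where "!!y. y \<in> S ==> f y = z y * f' y" "case k of 0 => f' = (%y. 0) | Suc k' => J A k' f'"
proof -
 let ?e = "sY (1 / z e) e"
 have ze: "z ?e = 1" using LinD(2)[OF z] e(2) by simp
 have eZ: "?e \<in> Z x" if "x \<in> A" for x using subspace_scale[OF Zsub e(3)[OF that]] A that by blast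
 obtain f' where f': "!!y. f y = f (y - sY (z y) ?e) + z y * f' y" "case k of 0 => f' = (%y. 0) | Suc k' => J A k' f'"
  using J_divide[OF z ze f(1) eZ] by blast
 have "f (y - sY (z y) ?e) = 0" if "y \<in> S" for y
  using that S e(1) LinD(2,4)[OF z] ze by (intro f(2) subspace_diff subspace_scale) auto
 then have "f y = z y * f' y" if "y \<in> S" for y using f'(1)[of y] that by simp
 then show ?thesis by (rule that[OF _ f'(2)])
qed

text \<open>Membership in the ideal modulo the linear forms that vanish on \<open>S\<close>; no
  quotient ring is formed.\<close>

definition on :: "'a set => 'x set => nat => ('a => 'k) => bool" where
 "on S A k f \<longleftrightarrow> (\<exists>g. J A k g & (\<forall>y\<in>S. f y = g y))"

lemma on_J: "J A k f ==> on S A k f" by (auto simp: on_def)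
lemma on_cong: "on S A k f ==> (!!y. y \<in> S ==> g y = f y) ==> on S A k g" by (auto simp: on_def)
lemma on_subset: "on S A k f ==> S' \<subseteq> S ==> on S' A k f" by (auto simp: on_def)
lemma on_remove: "on S A k f ==> on S (A - {x}) k f" unfolding on_def using J_remove by blast
lemma on_add: assumes "on S A k f" "on S A k g" shows "on S A k (%y. f y + g y)"
proof -
 obtain f' g' where "J A k f'" "\<forall>y\<in>S. f y = f' y" "J A k g'" "\<forall>y\<in>S. g y = g' y" using assms by (auto simp: on_def)
 then show ?thesis unfolding on_def using J.add[of A k f' g'] by (intro exI[of _ "%y. f' y + g' y"]) simp
qed
lemma on_sum: "(!!i. i \<in> F ==> on S A k (f i)) ==> on S A k (%y. \<Sum>i\<in>F. f i y)"
 by (induction F rule: infinite_finite_induct) (auto intro: on_J[OF J.zero] on_add)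
lemma on_scale: assumes "on S A k f" shows "on S A k (%y. c * f y)"
proof -
 obtain f' where "J A k f'" "\<forall>y\<in>S. f y = f' y" using assms by (auto simp: on_def)
 then show ?thesis unfolding on_def using J.scale[of A k f' c] by (intro exI[of _ "%y. c * f' y"]) simp
qed
lemma on_fac: assumes "x \<in> A" "l \<in> L x" "on S (A - {x}) k f" shows "on S A (Suc k) (%y. l y * f y)"
proof -
 obtain f' where f': "J (A - {x}) k f'" "\<forall>y\<in>S. f y = f' y" using assms(3) by (auto simp: on_def)
 have "J (insert x (A - {x})) (Suc k) (%y. l y * f' y)" by (rule J.fac[OF _ assms(2) f'(1)]) simp
 then show ?thesis unfolding on_def insert_Diff[OF assms(1)] using f'(2) by (intro exI[of _ "%y. l y * f' y"]) simp
qed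

lemma subspace_K: "A \<subseteq> X ==> subspace (\<Inter>x\<in>A. Z x)"
 using Zsub by (intro subspace_Inter) auto

section \<open>Splitting linear forms and generic forms\<close>

lemma separate:
 assumes U: "subspace U" and T: "subspace T" and z: "z \<in> Lin" "!!y. y \<in> U ==> y \<in> T ==> z y = 0"
 obtains l where "l \<in> Lin" "!!y. y \<in> T ==> l y = 0" "!!y. y \<in> U ==> l y = z y"
proof -
 have "\<exists>p. range p \<subseteq> T & Vector_Spaces.linear sY sY p & (\<forall>v\<in>T. p (id v) = v)"
  by (rule yy.linear_exists_left_inverse_on[OF linear_id T]) simp
 then obtain p where p: "range p \<subseteq> T" "Vector_Spaces.linear sY sY p" "!!v. v \<in> T ==> p v = v" by auto
 define q where "q v = v - p v" for v
 have q: "Vector_Spaces.linear sY sY q" unfolding q_def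
  using yy.linear_compose_sub[OF linear_id p(2)] by simp
 obtain g where g: "range g \<subseteq> U" "Vector_Spaces.linear sY sY g" "!!v. v \<in> q ` U ==> q (g v) = v"
  using yy.linear_exists_right_inverse_on[OF q U] by blast
 have 1: "(%y. z (g (q y))) \<in> Lin"
  by (simp add: Lin_iff LinD[OF z(1)] yy.linear_add[OF q] yy.linear_add[OF g(2)] yy.linear_scale[OF q] yy.linear_scale[OF g(2)])
 have 2: "z (g (q y)) = 0" if "y \<in> T" for y
 proof -
  have "q y = 0" using p(3)[OF that] by (simp add: q_def)
  then show ?thesis using yy.linear_0[OF g(2)] LinD(3)[OF z(1)] by simp
 qed
 have 3: "z (g (q y)) = z y" if y: "y \<in> U" for y
 proof -
  let ?d = "g (q y) - y"
  have "q ?d = 0" using g(3)[of "q y"] y yy.linear_diff[OF q] by simp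
  then have "?d \<in> T" using p(1) unfolding q_def by (metis eq_iff_diff_eq_0 rangeI subsetD)
  moreover have "?d \<in> U" using g(1) y subspace_diff[OF U] by blast
  ultimately show ?thesis using z(2)[of ?d] LinD(4)[OF z(1)] by simp
 qed
 show ?thesis using that 1 2 3 by blast
qed

text \<open>The annihilator of an intersection is the sum of the annihilators. Adding one subspace
  at a time, \<open>z\<close> is split on \<open>S\<close> into a form vanishing on
  \<open>Z x\<close> and a form vanishing on the intersection of the others.\<close>

lemma duality:
 assumes S: "subspace S" and A: "A \<subseteq> X" and z: "z \<in> Lin" "!!y. y \<in> S ==> \<forall>x\<in>A. y \<in> Z x ==> z y = 0"
 shows "\<exists>l. (\<forall>x\<in>A. l x \<in> L x) & (\<forall>y\<in>S. z y = (\<Sum>x\<in>A. l x y))"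
proof -
 have "finite A" using A finX finite_subset by blast
 then show ?thesis using A z
 proof (induction A arbitrary: z)
  case empty
  then show ?case by simp
 next
  case (insert x A)
  have U: "subspace (S Int (\<Inter>x\<in>A. Z x))" using S subspace_K insert.prems(1) by (intro subspace_inter) auto
  obtain l where l: "l \<in> Lin" "!!y. y \<in> Z x ==> l y = 0" "!!y. y \<in> S Int (\<Inter>x\<in>A. Z x) ==> l y = z y"
   by (rule separate[OF U Zsub insert.prems(2)]) (use insert.prems in auto)
  have "(%y. z y + (-1) * l y) \<in> Lin" by (rule Lin_add[OF insert.prems(2) l(1)])
  then obtain l' where l': "\<forall>x\<in>A. l' x \<in> L x" "\<forall>y\<in>S. z y + (-1) * l y = (\<Sum>x\<in>A. l' x y)"
   using insert.IH[of "%y. z y + (-1) * l y"] insert.prems l(3) by auto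
  have "(\<Sum>v\<in>A. (l'(x := l)) v y) = (\<Sum>v\<in>A. l' v y)" for y using insert.hyps by (intro sum.cong) auto
  then show ?case using l l' insert.hyps by (intro exI[of _ "l'(x := l)"]) (auto simp: L_def algebra_simps)
 qed
qed

text \<open>With zero intersection every linear form is on \<open>S\<close> a sum of forms
  \<open>l x \<in> L x\<close>, and \<open>l x\<close> carries the ideal for \<open>A - {x}\<close>
  into the ideal for \<open>A\<close>.\<close>

lemma mult_on:
 assumes S: "subspace S" and A: "A \<subseteq> X" and K: "!!y. y \<in> S ==> \<forall>x\<in>A. y \<in> Z x ==> y = 0" and z: "z \<in> Lin"
  and h: "!!x. x \<in> A ==> on S (A - {x}) k h"
 shows "on S A (Suc k) (%y. z y * h y)"
proof -
 obtain l where l: "\<forall>x\<in>A. l x \<in> L x" "\<forall>y\<in>S. z y = (\<Sum>x\<in>A. l x y)"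
  using duality[OF S A z] K LinD(3)[OF z] by blast
 have "on S A (Suc k) (%y. \<Sum>x\<in>A. l x y * h y)" using l(1) h by (intro on_sum on_fac) auto
 then show ?thesis by (rule on_cong) (use l(2) in \<open>simp add: sum_distrib_right\<close>)
qed

lemma functional_at: "v ~= 0 ==> \<exists>l\<in>Lin. l v = 1"
 using vector_space_pair.linear_independent_extend[OF vector_space_pair.intro[OF vector_space_axioms vs_mult], of "{v}" "%_. 1"]
 by (auto simp: dual_space_def)

lemma generic_functional:
 assumes "finite F" "0 \<notin> F" shows "\<exists>z\<in>Lin. \<forall>v\<in>F. z v ~= 0"
 using assms
proof (induction F)
 case empty
 have "(%y. 0) \<in> Lin" by (simp add: Lin_iff)
 then show ?case by blast
next
 case (insert v F)
 then obtain z where z: "z \<in> Lin" "\<forall>v\<in>F. z v ~= 0" by auto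
 obtain l where l: "l \<in> Lin" "l v = 1" using functional_at insert.prems by auto
 let ?bad = "(%u. - z u / l u) ` insert v F Un {0}"
 obtain c where c: "c \<notin> ?bad" using ex_new_if_finite[OF infinite_UNIV_char_0, of ?bad] insert.hyps by auto
 have "z u + c * l u ~= 0" if u: "u \<in> insert v F" for u
 proof
  assume e: "z u + c * l u = 0"
  show False
  proof (cases "l u = 0")
   case True
   then show False using e z(2) u l(2) by auto
  next
   case False
   then have "c = - z u / l u" using e by (simp add: field_simps eq_neg_iff_add_eq_0)
   then show False using c u by blast
  qed
 qed
 then show ?case using Lin_add[OF z(1) l(1), of c] by (intro bexI[of _ "%y. z y + c * l y"] ballI)
qed

text \<open>The number of generators is the induction measure in place of a dimension. Projecting
  along a generator on which \<open>z\<close> is nonzero kills it and carries the others into the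
  hyperplane.\<close>

lemma span_slice:
 assumes B: "finite B" and z: "z \<in> Lin" and e: "e \<in> span B" "z e ~= 0"
 obtains B' where "finite B'" "card B' < card B" "span B' = {y \<in> span B. z y = 0}"
proof -
 obtain b where b: "b \<in> B" "z b ~= 0"
 proof -
  have "\<not> (\<forall>b\<in>B. z b = 0)"
  proof
   assume "\<forall>b\<in>B. z b = 0"
   moreover have "subspace {y. z y = 0}" by (auto simp: subspace_def LinD[OF z])
   ultimately have "span B \<subseteq> {y. z y = 0}" by (intro span_minimal) auto
   then show False using e by blast
  qed
  then show ?thesis using that by blast
 qed
 define \<pi> where "\<pi> y = y - sY (z y / z b) b" for y
 have lin: "Vector_Spaces.linear sY sY \<pi>"
  unfolding Vector_Spaces.linear_iff using vector_space_axioms by (auto simp: \<pi>_def LinD[OF z] scale_right_diff_distrib scale_left_distrib add_divide_distrib)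
 have sp: "span (\<pi> ` (B - {b})) = {y \<in> span B. z y = 0}"
 proof
  have "subspace {y \<in> span B. z y = 0}"
   using subspace_span[of B] by (auto simp: subspace_def LinD[OF z])
  moreover have "\<pi> v \<in> {y \<in> span B. z y = 0}" if "v \<in> B" for v
   using b that by (auto simp: \<pi>_def LinD[OF z] intro!: span_diff span_scale intro: span_base)
  ultimately show "span (\<pi> ` (B - {b})) \<subseteq> {y \<in> span B. z y = 0}" by (intro span_minimal) auto
  show "{y \<in> span B. z y = 0} \<subseteq> span (\<pi> ` (B - {b}))"
  proof clarify
   fix y assume y: "y \<in> span B" "z y = 0"
   have "\<pi> b = 0" using b by (simp add: \<pi>_def)
   have "\<pi> y = y" using y by (simp add: \<pi>_def)
   moreover have "\<pi> y \<in> span (\<pi> ` B)" using yy.linear_span_image[OF lin, of B] y(1) by blast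
   moreover have "\<pi> ` B = insert 0 (\<pi> ` (B - {b}))" using b(1) \<open>\<pi> b = 0\<close> by auto
   ultimately show "y \<in> span (\<pi> ` (B - {b}))" by (simp add: span_insert_0)
  qed
 qed
 have "card (\<pi> ` (B - {b})) < card B"
  using card_image_le[of "B - {b}" \<pi>] card_Diff1_less[OF B b(1)] B by simp
 then show ?thesis by (rule that[OF _ _ sp, rotated]) (simp add: B)
qed

text \<open>The bound \<open>card A \<le> k\<close> is necessary: on the zero space every linear
  form kills the constant 1, which lies in none of the ideals with nonempty
  \<open>A\<close>.\<close>

definition regular_on :: "'a set => ('a => 'k) => bool" where
 "regular_on S z \<longleftrightarrow> z \<in> Lin & (S = {0} \<or> (\<exists>e\<in>S. z e ~= 0)) &
   (\<forall>A k h. A \<subseteq> X --> card A \<le> k --> J {} k h --> on S A (Suc k) (%y. z y * h y) --> on S A k h)"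

text \<open>The form is chosen nonzero on every \<open>S Int (\<Inter>x\<in>A. Z x) ~= {0}\<close>. If this intersection is zero, every
 linear form is on \<open>S\<close> a sum of elements of the \<open>L x\<close>, and one restricts to the hyperplane.\<close>

lemma regular_exists: "finite B ==> \<exists>z. regular_on (span B) z"
proof (induction "card B" arbitrary: B rule: less_induct)
 case less
 let ?S = "span B"
 have S: "subspace ?S" by simp
 show ?case
 proof (cases "?S = {0}")
  case True
  have "on ?S A k h" if "card A \<le> k" "J {} k h" "A \<subseteq> X" for A k h
  proof (cases "A = {}")
   case False
   then have "0 < k" using that finX finite_subset[OF that(3)] by (metis card_gt_0_iff order.strict_trans2)
   then show ?thesis using J_at_0[OF that(2)] unfolding True by (intro on_cong[OF on_J[OF J.zero]]) auto
  qed (use that on_J in simp)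
  moreover have "(%y. 0) \<in> Lin" by (simp add: Lin_iff)
  ultimately show ?thesis unfolding regular_on_def using True by blast
 next
  case False
  define e where "e A = (SOME v. v \<in> ?S & (\<forall>x\<in>A. v \<in> Z x) & v ~= 0)" for A
  define G where "G = {A \<in> Pow X. \<exists>v. v \<in> ?S & (\<forall>x\<in>A. v \<in> Z x) & v ~= 0}"
  have eG: "e A \<in> ?S & (\<forall>x\<in>A. e A \<in> Z x) & e A ~= 0" if "A \<in> G" for A
   using that someI_ex[of "%v. v \<in> ?S & (\<forall>x\<in>A. v \<in> Z x) & v ~= 0"] unfolding e_def G_def by blast
  have "finite (e ` G)" using finX by (simp add: G_def)
  moreover have "0 \<notin> e ` G" using eG by auto
  ultimately obtain z where z: "z \<in> Lin" "!!A. A \<in> G ==> z (e A) ~= 0" using generic_functional[of "e ` G"] by blast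
  have "{} \<in> G" using False span_zero[of B] by (auto simp: G_def)
  then have e0: "e {} \<in> ?S" "z (e {}) ~= 0" using eG z(2) by auto
  obtain B' where B': "finite B'" "card B' < card B" "span B' = {y \<in> ?S. z y = 0}" by (rule span_slice[OF less.prems z(1) e0])
  obtain z' where z': "regular_on (span B') z'" using less.hyps[OF B'(2,1)] by blast
  have "on ?S A k h" if "A \<subseteq> X" "card A \<le> k" "J {} k h" "on ?S A (Suc k) (%y. z y * h y)" for A k h
   using that
  proof (induction "card A" arbitrary: A k h rule: less_induct)
   case (less A k h)
   have finA: "finite A" using less.prems(1) finX finite_subset by blast
   show ?case
   proof (cases "A \<in> G")
    case True
    obtain f where f: "J A (Suc k) f" "!!y. y \<in> ?S ==> z y * h y = f y" using less.prems(4) unfolding on_def by blast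
    have f0: "f y = 0" if "y \<in> ?S" "z y = 0" for y using f(2)[OF that(1)] that(2) by simp
    obtain f' where f': "!!y. y \<in> ?S ==> f y = z y * f' y" "case Suc k of 0 => f' = (%y. 0) | Suc k' => J A k' f'"
     by (rule J_divide_on[OF S z(1) _ z(2)[OF True] _ less.prems(1) f(1) f0]) (use eG[OF True] in blast)+
    have J': "J A k f'" using f'(2) by simp
    have "h y - f' y = 0" if y: "y \<in> ?S" for y
    proof (rule cancel[OF z(1) S e0 J_diff[OF less.prems(3) J_empty[OF J']] _ y])
     show "z v * (h v - f' v) = 0" if "v \<in> ?S" for v using f(2)[OF that] f'(1)[OF that] by (simp add: algebra_simps)
    qed
    then show ?thesis by (intro on_cong[OF on_J[OF J']]) simp
   next
    case False
    have K: "y = 0" if "y \<in> ?S" "\<forall>x\<in>A. y \<in> Z x" for y using False that less.prems(1) by (auto simp: G_def)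
    have "A ~= {}" using False \<open>{} \<in> G\<close> by blast
    then obtain k' where k': "k = Suc k'" using less.prems(2) finA by (cases k) auto
    have cA: "card (A - {x}) < card A" "A - {x} \<subseteq> X" "card (A - {x}) \<le> k'" if "x \<in> A" for x
     using card_Diff1_less[OF finA that] less.prems(1,2) k' by auto
    have hx: "on ?S (A - {x}) k h" if "x \<in> A" for x
     by (rule less.hyps[OF cA(1)[OF that] cA(2)[OF that] _ less.prems(3) on_remove[OF less.prems(4)]]) (use cA(3)[OF that] k' in simp)
    have wh: "on ?S A (Suc k) (%y. w y * h y)" if "w \<in> Lin" for w
     by (rule mult_on[OF S less.prems(1) K that hx])
    \<comment> \<open>Every linear form multiplies \<open>h\<close> into the ideal, in particular
      the form that is regular on the hyperplane; its regularity gives membership of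
      \<open>h\<close> there.\<close>
    have "on (span B') A k h"
     using z' less.prems(1-3) on_subset[OF wh[of z'], of "span B'"] unfolding regular_on_def B'(3) by blast
    then obtain g where g: "J A k g" "!!y. y \<in> ?S ==> z y = 0 ==> h y = g y" unfolding on_def B'(3) by blast
    obtain f where f: "!!y. y \<in> ?S ==> h y - g y = z y * f y" "case k of 0 => f = (%y. 0) | Suc k' => J {} k' f"
     by (rule J_divide_on[OF S z(1) e0 _ _ J_diff[OF less.prems(3) J_empty[OF g(1)]]]) (use g(2) in auto)
    have Jf: "J {} k' f" using f(2) k' by simp
    \<comment> \<open>The degree has dropped by one together with the size of the set, so the inner
      induction applies to the quotient \<open>f\<close>.\<close>
    have "on ?S (A - {x}) k' f" if x: "x \<in> A" for x
    proof (rule less.hyps[OF cA(1)[OF x] cA(2)[OF x] cA(3)[OF x] Jf])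
     have "on ?S (A - {x}) k (%y. h y + (-1) * g y)"
      by (intro on_add hx x on_scale on_J J_remove g(1))
     then show "on ?S (A - {x}) (Suc k') (%y. z y * f y)"
      unfolding k'[symmetric] by (rule on_cong) (use f(1) in simp)
    qed
    then have "on ?S A k (%y. z y * f y)" unfolding k' by (intro mult_on[OF S less.prems(1) K z(1)])
    then have "on ?S A k (%y. z y * f y + g y)" by (rule on_add[OF _ on_J[OF g(1)]])
    then show ?thesis by (rule on_cong) (use f(1) in \<open>simp add: algebra_simps\<close>)
   qed
  qed
  then show ?thesis using z(1) e0 unfolding regular_on_def by blast
 qed
qed

section \<open>The complex of ideals and its exactness\<close>

definition ord :: "'x => nat" where "ord = (SOME f. inj_on f X)"

lemma ord_inj: "inj_on ord X"
proof -
 have "\<exists>f :: 'x => nat. inj_on f X" using finite_imp_inj_to_nat_seg[OF finX] by blast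
 then show ?thesis unfolding ord_def by (rule someI_ex)
qed

definition sg :: "'x => 'x set => 'k" where "sg x A = (-1) ^ card {y \<in> A. ord y < ord x}"

lemma sg_square: "sg x A * sg x A = 1" by (simp add: sg_def power_mult_distrib[symmetric])

lemma sg_swap:
 assumes "x \<in> X" "y \<in> X" "x ~= y" "A \<subseteq> X" "x \<notin> A" "y \<notin> A"
 shows "sg x (insert y A) * sg y (insert x A) = - (sg x A * sg y A)"
proof -
 have fin: "finite {v \<in> A. P v}" for P using finite_subset[OF assms(4) finX] by simp
 have ne: "ord x ~= ord y" using ord_inj assms(1-3) by (auto dest: inj_onD)
 have i: "sg u (insert v A) = (if ord v < ord u then - sg u A else sg u A)" if "v \<notin> A" for u v
 proof -
  have "{w \<in> insert v A. ord w < ord u} = (if ord v < ord u then insert v {w \<in> A. ord w < ord u} else {w \<in> A. ord w < ord u})" by auto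
  then show ?thesis using that fin by (simp add: sg_def)
 qed
 show ?thesis using ne i[OF assms(5), of y] i[OF assms(6), of x] by auto
qed

text \<open>The differential of the complex whose terms are the ideals for subsets of
  \<open>X\<close>: each ideal is included in the ideals for the sets with one element less, with
  signs from a total order.\<close>

definition bd :: "('x set => 'k) => 'x set => 'k" where
 "bd c A = (\<Sum>x\<in>X - A. sg x A * c (insert x A))"

lemma bd_linear:
 "bd (%A. c A + d A) A = bd c A + bd d A" "bd (%A. a * c A) A = a * bd c A" "bd (%A. \<Sum>i\<in>F. f i A) A = (\<Sum>i\<in>F. bd (f i) A)"
proof -
 show "bd (%A. \<Sum>i\<in>F. f i A) A = (\<Sum>i\<in>F. bd (f i) A)" unfolding bd_def sum_distrib_left by (rule sum.swap)
qed (simp_all add: bd_def distrib_left sum.distrib sum_distrib_left mult.left_commute)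

lemma bd_cong: "(!!x. x \<in> X - A ==> c (insert x A) = d (insert x A)) ==> bd c A = bd d A"
 unfolding bd_def by (intro sum.cong) auto

lemma sg_swap':
 assumes "x \<in> X" "y \<in> X" "x ~= y" "A \<subseteq> X" "x \<notin> A" "y \<notin> A"
 shows "sg x A * sg y (insert x A) = - (sg y A * sg x (insert y A))"
proof -
 have "sg x A * sg y (insert x A) = sg x A * sg y (insert x A) * (sg x (insert y A) * sg x (insert y A))"
  by (simp only: sg_square mult_1_right)
 also have "... = sg x A * (sg x (insert y A) * sg y (insert x A)) * sg x (insert y A)" by (simp only: mult_ac)
 also have "... = - ((sg x A * sg x A) * (sg y A * sg x (insert y A)))" unfolding sg_swap[OF assms] by (simp only: mult_ac mult_minus_left mult_minus_right)
 finally show ?thesis by (simp only: sg_square mult_1_left)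
qed

lemma bd_bd: assumes A: "A \<subseteq> X" shows "bd (bd c) A = 0"
proof -
 let ?P = "{(x, y). x \<in> X - A & y \<in> X - A & x ~= y}"
 let ?t = "%x y. sg x A * sg y (insert x A) * c (insert y (insert x A))"
 have sig: "?P = (SIGMA x:X - A. X - insert x A)" by auto
 have eq: "bd (bd c) A = (\<Sum>(x, y)\<in>?P. ?t x y)"
 proof -
  have "bd (bd c) A = (\<Sum>x\<in>X - A. \<Sum>y\<in>X - insert x A. ?t x y)"
   by (simp only: bd_def sum_distrib_left mult.assoc)
  also have "... = (\<Sum>(x, y)\<in>?P. ?t x y)" unfolding sig by (rule sum.Sigma) (use finX in auto)
  finally show ?thesis .
 qed
 have "bd (bd c) A = (\<Sum>(x, y)\<in>?P. ?t y x)" unfolding eq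
  by (rule sum.reindex_bij_witness[of _ prod.swap prod.swap]) auto
 also have "... = (\<Sum>(x, y)\<in>?P. - ?t x y)"
 proof (rule sum.cong[OF refl], clarify)
  fix x y assume "x \<in> X" "y \<in> X" "x \<notin> A" "y \<notin> A" "x ~= y"
  then have "sg y A * sg x (insert y A) = - (sg x A * sg y (insert x A))" using sg_swap'[of y x A] A by simp
  then show "?t y x = - ?t x y" by (simp add: insert_commute)
 qed
 also have "... = - bd (bd c) A" unfolding eq by (simp add: sum_negf[symmetric] case_prod_unfold)
 finally have "bd (bd c) A + bd (bd c) A = 0" by (simp only: eq_neg_iff_add_eq_0)
 then have "2 * bd (bd c) A = 0" by (simp only: mult_2)
 then show ?thesis by simp
qed

text \<open>Removing and inserting different elements cancels by the sign rule. With the same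
  element the signs square to 1, and every \<open>x\<close>, inside or outside \<open>A\<close>,
  contributes \<open>l x\<close> once.\<close>

lemma homotopy:
 assumes A: "A \<subseteq> X"
 shows "bd (%A. \<Sum>v\<in>A. sg v (A - {v}) * (l v * h (A - {v}))) A + (\<Sum>v\<in>A. sg v (A - {v}) * (l v * bd h (A - {v})))
  = (\<Sum>x\<in>X. l x) * h A"
proof -
 have finA: "finite A" using A finX finite_subset by blast
 have 1: "sg x A * (\<Sum>v\<in>insert x A. sg v (insert x A - {v}) * (l v * h (insert x A - {v})))
   = l x * h A + (\<Sum>v\<in>A. sg x A * (sg v (insert x A - {v}) * (l v * h (insert x A - {v}))))" if x: "x \<in> X - A" for x
 proof -
  have "insert x A - {x} = A" using x by auto
  then show ?thesis using x finA sg_square[of x A] by (simp add: distrib_left sum_distrib_left mult.assoc[symmetric])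
 qed
 have 2: "sg v (A - {v}) * (l v * bd h (A - {v})) = l v * h A
   + (\<Sum>x\<in>X - A. sg v (A - {v}) * (l v * (sg x (A - {v}) * h (insert x (A - {v})))))" if v: "v \<in> A" for v
 proof -
  have "X - (A - {v}) = insert v (X - A)" "insert v (A - {v}) = A" using v A by auto
  then have 1: "bd h (A - {v}) = sg v (A - {v}) * h A + (\<Sum>x\<in>X - A. sg x (A - {v}) * h (insert x (A - {v})))"
   using v finX by (simp add: bd_def)
  have "sg v (A - {v}) * (l v * (sg v (A - {v}) * h A + T)) = (sg v (A - {v}) * sg v (A - {v})) * (l v * h A) + sg v (A - {v}) * (l v * T)" for T
   by (simp only: distrib_left mult_ac)
  then show ?thesis unfolding 1 by (simp only: sg_square mult_1_left sum_distrib_left)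
 qed
 have 3: "sg x A * (sg v (insert x A - {v}) * (l v * h (insert x A - {v})))
   + sg v (A - {v}) * (l v * (sg x (A - {v}) * h (insert x (A - {v})))) = 0" if "x \<in> X - A" "v \<in> A" for x v
 proof -
  have e: "insert x A - {v} = insert x (A - {v})" "insert v (A - {v}) = A" using that by auto
  have "sg x A * sg v (insert x (A - {v})) = - (sg x (A - {v}) * sg v (A - {v}))"
   using sg_swap[of x v "A - {v}"] that A unfolding e(2) by auto
  then have "sg x A * sg v (insert x (A - {v})) * (l v * h (insert x (A - {v}))) + sg x (A - {v}) * sg v (A - {v}) * (l v * h (insert x (A - {v}))) = 0" by simp
  then show ?thesis unfolding e(1) by (simp add: mult_ac)
 qed
 have s1: "bd (%A. \<Sum>v\<in>A. sg v (A - {v}) * (l v * h (A - {v}))) A = (\<Sum>x\<in>X - A. l x * h A)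
   + (\<Sum>x\<in>X - A. \<Sum>v\<in>A. sg x A * (sg v (insert x A - {v}) * (l v * h (insert x A - {v}))))" (is "_ = ?a + ?P")
  unfolding bd_def sum.distrib[symmetric] by (rule sum.cong[OF refl 1])
 have s2: "(\<Sum>v\<in>A. sg v (A - {v}) * (l v * bd h (A - {v}))) = (\<Sum>v\<in>A. l v * h A)
   + (\<Sum>v\<in>A. \<Sum>x\<in>X - A. sg v (A - {v}) * (l v * (sg x (A - {v}) * h (insert x (A - {v})))))" (is "_ = ?b + ?Q")
  unfolding sum.distrib[symmetric] by (rule sum.cong[OF refl 2])
 have z: "?P + ?Q = 0" by (subst sum.swap[of _ A]) (simp add: sum.distrib[symmetric] 3)
 have "(\<Sum>x\<in>X. l x) * h A = ?a + ?b"
  using sum.subset_diff[OF A finX, of l] by (simp add: sum_distrib_right distrib_right)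
 moreover have "(?a + ?P) + (?b + ?Q) = (?a + ?b) + (?P + ?Q)" by (simp only: add_ac)
 ultimately show ?thesis unfolding s1 s2 z by simp
qed

lemma J_bd:
 assumes "!!A. A \<subseteq> X ==> J A k (c A)" "A \<subseteq> X" shows "J A k (%y. bd (%A. c A y) A)"
 unfolding bd_def
proof (intro J_sum J.scale)
 fix x assume x: "x \<in> X - A"
 then have "J (insert x A - {x}) k (c (insert x A))" using assms by (intro J_remove) auto
 moreover have "insert x A - {x} = A" using x by auto
 ultimately show "J A k (c (insert x A))" by simp
qed

text \<open>The induction hypothesis on the hyperplane z = 0 corrects the cycle by a boundary so
  that it becomes z times a family \<open>h\<close>, one degree lower. For proper subsets the degree
  bound survives this loss, so regularity puts \<open>h A\<close> into its ideal. Cancelling z shows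
  that \<open>h\<close> is a cycle, and since z is the sum of the \<open>l x\<close> the homotopy
  makes z times \<open>h\<close> a boundary.\<close>

lemma exactness:
 assumes ne: "X ~= {}" and k: "card X \<le> k"
 shows "finite B ==> (!!y. y \<in> span B ==> \<forall>x\<in>X. y \<in> Z x ==> y = 0) ==> (!!A. A \<subseteq> X ==> on (span B) A k (c A)) ==>
  (!!A y. A \<subseteq> X ==> y \<in> span B ==> bd (%A. c A y) A = 0) ==>
  \<exists>d. (\<forall>A\<subseteq>X. J A k (d A)) & (\<forall>A\<subseteq>X. \<forall>y\<in>span B. c A y = bd (%A. d A y) A)"
proof (induction "card B" arbitrary: B rule: less_induct)
 case (less B)
 let ?S = "span B"
 note K = less.prems(2) and c = less.prems(3) and bc = less.prems(4)
 have S: "subspace ?S" by simp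
 obtain k' where k': "k = Suc k'" using ne k finX by (cases k) auto
 obtain z where z: "regular_on ?S z" using regular_exists[OF less.prems(1)] by blast
 then have zL: "z \<in> Lin" by (simp add: regular_on_def)
 have "\<forall>A\<in>Pow X. \<exists>g. J A k g & (\<forall>y\<in>?S. c A y = g y)" using c by (auto simp: on_def)
 then obtain g where g: "\<forall>A\<in>Pow X. J A k (g A) & (\<forall>y\<in>?S. c A y = g A y)" by (rule bchoice[THEN exE])
 show ?case
 proof (cases "?S = {0}")
  case True
  have "c A 0 = 0" if "A \<subseteq> X" for A using g that True J_at_0[of A k "g A"] k' by auto
  then show ?thesis unfolding True by (intro exI[of _ "%A y. 0"]) (auto simp: J.zero bd_def)
 next
  case False
  then obtain e where e: "e \<in> ?S" "z e ~= 0" using z by (auto simp: regular_on_def)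
  obtain B' where B': "finite B'" "card B' < card B" "span B' = {y \<in> ?S. z y = 0}" by (rule span_slice[OF less.prems(1) zL e])
  have "\<exists>d. (\<forall>A\<subseteq>X. J A k (d A)) & (\<forall>A\<subseteq>X. \<forall>y\<in>span B'. c A y = bd (%A. d A y) A)"
   by (rule less.hyps[OF B'(2,1)]) (use K bc on_subset[OF c] in \<open>auto simp: B'(3)\<close>)
  then obtain d where d0: "(\<forall>A\<subseteq>X. J A k (d A)) & (\<forall>A\<subseteq>X. \<forall>y\<in>span B'. c A y = bd (%A. d A y) A)" by (rule exE)
  have d: "!!A. A \<subseteq> X ==> J A k (d A)" "!!A y. A \<subseteq> X ==> y \<in> ?S ==> z y = 0 ==> c A y = bd (%A. d A y) A"
   using d0 unfolding B'(3) by simp_all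
  define u where "u A y = g A y - bd (%A. d A y) A" for A y
  have uJ: "J A k (u A)" if "A \<subseteq> X" for A unfolding u_def using g J_bd[of k d, OF d(1) that] that by (intro J_diff) auto
  have "\<forall>A\<in>Pow X. \<exists>h. (\<forall>y\<in>?S. u A y = z y * h y) & J {} k' h"
  proof
   fix A assume A: "A \<in> Pow X"
   obtain h where "!!y. y \<in> ?S ==> u A y = z y * h y" "case k of 0 => h = (%y. 0) | Suc k' => J {} k' h"
   proof (rule J_divide_on[OF S zL e _ _ J_empty[OF uJ]])
    show "u A y = 0" if "y \<in> ?S" "z y = 0" for y using g A d(2)[of A y] that by (simp add: u_def)
   qed (use A in auto)
   then show "\<exists>h. (\<forall>y\<in>?S. u A y = z y * h y) & J {} k' h" using k' by auto
  qed
  then obtain h where "\<forall>A\<in>Pow X. (\<forall>y\<in>?S. u A y = z y * h A y) & J {} k' (h A)" by (rule bchoice[THEN exE])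
  then have h: "!!A y. A \<subseteq> X ==> y \<in> ?S ==> u A y = z y * h A y" "!!A. A \<subseteq> X ==> J {} k' (h A)" by auto
  \<comment> \<open>At the full set the degree may be too small for regularity. But the component of
    the differential at \<open>X - {x}\<close> has \<open>c X\<close> as its only term, so a cycle
    vanishes at \<open>X\<close>.\<close>
  have hX: "h X y = 0" if y: "y \<in> ?S" for y
  proof (rule cancel[OF zL S e h(2)[OF subset_refl] _ y])
   fix v assume v: "v \<in> ?S"
   obtain x where x: "x \<in> X" using ne by blast
   have "X - (X - {x}) = {x}" "insert x (X - {x}) = X" using x by auto
   then have "sg x (X - {x}) * c X v = 0" using bc[of "X - {x}" v] v by (simp add: bd_def)
   then have "c X v = 0" using sg_square[of x "X - {x}"] by auto
   then show "z v * h X v = 0" using h(1)[OF subset_refl v] g v by (simp add: u_def bd_def)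
  qed
  have hA: "on ?S A k' (h A)" if A: "A \<subseteq> X" for A
  proof (cases "A = X")
   case True
   then show ?thesis using hX by (intro on_cong[OF on_J[OF J.zero]]) auto
  next
   case False
   then have "card A < card X" using A by (intro psubset_card_mono[OF finX]) blast
   then have "card A \<le> k'" using k k' by simp
   moreover have "on ?S A (Suc k') (%y. z y * h A y)"
    unfolding k'[symmetric] by (rule on_cong[OF on_J[OF uJ[OF A]]]) (use h(1)[OF A] in simp)
   ultimately show ?thesis using z A h(2)[OF A] unfolding regular_on_def by blast
  qed
  have bh: "bd (%A. h A y) A = 0" if A: "A \<subseteq> X" and y: "y \<in> ?S" for A y
  proof (rule cancel[OF zL S e _ _ y])
   show "J {} k' (%y. bd (%A. h A y) A)" unfolding bd_def using h(2) A by (intro J_sum J.scale) auto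
   fix v assume v: "v \<in> ?S"
   have "z v * bd (%A. h A v) A = bd (%A. z v * h A v) A" by (simp only: bd_linear(2))
   also have "... = bd (%A. c A v + (-1) * bd (%A. d A v) A) A"
    using A v h(1)[symmetric] g by (intro bd_cong) (auto simp: u_def)
   also have "... = 0" unfolding bd_linear using bc[OF A v] bd_bd[OF A, of "%A. d A v"] by simp
   finally show "z v * bd (%A. h A v) A = 0" .
  qed
  obtain l where l: "\<forall>x\<in>X. l x \<in> L x" "\<forall>y\<in>?S. z y = (\<Sum>x\<in>X. l x y)"
   using duality[OF S subset_refl zL] K LinD(3)[OF zL] by blast
  define s where "s A y = (\<Sum>v\<in>A. sg v (A - {v}) * (l v y * h (A - {v}) y))" for A y
  have "on ?S A k (s A)" if A: "A \<subseteq> X" for A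
   unfolding s_def k'
  proof (intro on_sum on_scale)
   fix v assume v: "v \<in> A"
   have "A - {v} \<subseteq> X" "v \<in> X" using A v by auto
   then show "on ?S A (Suc k') (%y. l v y * h (A - {v}) y)" using l(1) by (intro on_fac[OF v _ hA]) auto
  qed
  then have "\<forall>A\<in>Pow X. \<exists>g. J A k g & (\<forall>y\<in>?S. s A y = g y)" by (auto simp: on_def)
  then obtain s' where s': "\<forall>A\<in>Pow X. J A k (s' A) & (\<forall>y\<in>?S. s A y = s' A y)" by (rule bchoice[THEN exE])
  have "c A y = bd (%A. d A y + s' A y) A" if A: "A \<subseteq> X" and y: "y \<in> ?S" for A y
  proof -
   have "(\<Sum>v\<in>A. sg v (A - {v}) * (l v y * bd (%A. h A y) (A - {v}))) = 0"
   proof (rule sum.neutral, rule ballI)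
    fix v assume "v \<in> A"
    have "A - {v} \<subseteq> X" using A by blast
    then show "sg v (A - {v}) * (l v y * bd (%A. h A y) (A - {v})) = 0" using bh[OF _ y] by simp
   qed
   then have "bd (%A. s A y) A = z y * h A y"
    unfolding s_def using homotopy[OF A, of "%v. l v y" "%A. h A y"] l(2) y by simp
   moreover have "bd (%A. s A y) A = bd (%A. s' A y) A" using s' A y by (intro bd_cong) auto
   ultimately show ?thesis using h(1)[OF A y] g A y by (simp add: u_def bd_linear algebra_simps)
  qed
  moreover have "J A k (%y. d A y + s' A y)" if "A \<subseteq> X" for A using d(1) s' that by (intro J.add) auto
  ultimately show ?thesis by (intro exI[of _ "%A y. d A y + s' A y"]) blast
 qed
qed

section \<open>Products, substitutions and projections\<close>

lemma J_mult: "J A k f ==> A Int B = {} ==> J B l g ==> J (A Un B) (k + l) (%y. f y * g y)"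
proof (induction rule: J.induct)
 case (add A k f g')
 then show ?case using J.add by (simp add: distrib_right)
next
 case (scale A k f c)
 then show ?case using J.scale[of "A Un B" "k + l" "%y. f y * g y" c] by (simp add: mult.assoc)
next
 case (lin l' A k f)
 then show ?case using J.lin[of l' "A Un B" "k + l" "%y. f y * g y"] by (simp add: mult.assoc)
next
 case (fac x A l' k f)
 then show ?case using J.fac[of x "A Un B" l' "k + l" "%y. f y * g y"] by (simp add: mult.assoc)
qed (auto intro: J.zero)

lemma J_compose:
 assumes "!!y y'. \<eta> (y + y') = \<eta> y + \<eta> y'" "!!a y. \<eta> (sY a y) = sY a (\<eta> y)" "!!x y. x \<in> X ==> y \<in> Z x ==> \<eta> y \<in> Z x"
 shows "J A k f ==> A \<subseteq> X ==> J A k (%y. f (\<eta> y))"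
proof (induction rule: J.induct)
 case (lin l A k f)
 then show ?case by (intro J.lin) (auto simp: Lin_iff assms)
next
 case (fac x A l k f)
 have "(%y. l (\<eta> y)) \<in> L x" using fac(2,5) assms(3) by (auto simp: L_def Lin_iff assms(1,2))
 then show ?case using fac by (intro J.fac) auto
qed (auto intro: J.intros)

text \<open>For a linear form l the difference of l and its composition with \<open>P\<close> lies
  in \<open>L x\<close>, and for products the differences telescope. With \<open>P\<close> a
  projection to \<open>Z x\<close> this shows that functions vanishing there come from the linear
  forms in \<open>L x\<close>.\<close>

lemma J_minus_projection:
 assumes P: "!!y y'. P (y + y') = P y + P y'" "!!a y. P (sY a y) = sY a (P y)" "!!y. y \<in> Z x ==> P y = y"
 shows "J A k f ==> J {x} k (%y. f y - f (P y))"
proof (induction rule: J.induct)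
 case (add A k f g)
 then show ?case using J.add[OF add.IH] by (simp add: algebra_simps)
next
 case (scale A k f c)
 then show ?case using J.scale[OF scale.IH, of c] by (simp add: algebra_simps)
next
 case (lin l A k f)
 have "(%y. l y - l (P y)) \<in> L x" using lin(1) P by (auto simp: L_def Lin_iff algebra_simps)
 then have "J {x} (Suc k) (%y. (l y - l (P y)) * f y)" using J.fac[of x "{}" _ k f] J_empty[OF lin(2)] by simp
 moreover have "(%y. l (P y)) \<in> Lin" using lin(1) P by (auto simp: Lin_iff)
 then have "J {x} (Suc k) (%y. l (P y) * (f y - f (P y)))" by (rule J.lin[OF _ lin.IH])
 ultimately show ?case using J.add by (fastforce simp: algebra_simps)
next
 case (fac x' A l k f)
 note l = L_Lin[OF fac(2)]
 have "(%y. l y - l (P y)) \<in> L x" using l P by (auto simp: L_def Lin_iff algebra_simps)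
 then have "J {x} (Suc k) (%y. (l y - l (P y)) * f y)" using J.fac[of x "{}" _ k f] J_empty[OF fac(3)] by simp
 moreover have "(%y. l (P y)) \<in> Lin" using l P by (auto simp: Lin_iff)
 then have "J {x} (Suc k) (%y. l (P y) * (f y - f (P y)))" by (rule J.lin[OF _ fac.IH])
 ultimately show ?case using J.add by (fastforce simp: algebra_simps)
qed (auto intro: J.zero)

end

section \<open>Weight multiplicities of products of linear ideals\<close>

text \<open>\<open>\<eta>\<close> is the action of the diagonal matrix on points, and it scales the
  coordinate \<open>\<zeta> c\<close> by the prime with number \<open>w c\<close>. The coordinates
  determine a linear form only on \<open>Y\<close>, the actual space inside the larger type.\<close>

locale weighted_forms = forms sY X Z for sY :: "'k::field_char_0 => 'a::ab_group_add => 'a" and X :: "'x set" and Z +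
 fixes \<eta> :: "'a => 'a" and C :: "'c set" and \<zeta> :: "'c => 'a => 'k" and w :: "'c => nat" and Y :: "'a set"
 assumes eta_linear: "\<eta> (y + y') = \<eta> y + \<eta> y'" "\<eta> (sY a y) = sY a (\<eta> y)"
  and eta_Z: "x \<in> X ==> y \<in> Z x ==> \<eta> y \<in> Z x"
  and finC: "finite C" and zeta: "c \<in> C ==> \<zeta> c \<in> Lin"
  and zeta_eta: "c \<in> C ==> y \<in> Y ==> \<zeta> c (\<eta> y) = of_nat (nprime (w c)) * \<zeta> c y"
  and zeta_span: "l \<in> Lin ==> \<exists>a. \<forall>y\<in>Y. l y = (\<Sum>c\<in>C. a c * \<zeta> c y)"
begin

text \<open>Invariance is required in both directions so that restriction to \<open>S\<close>,
  extended by 0, commutes with the action on functions.\<close>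

definition good :: "'a set => bool" where
 "good S \<longleftrightarrow> S \<subseteq> Y & (\<exists>B. finite B & S = span B) & (\<forall>y. \<eta> y \<in> S \<longleftrightarrow> y \<in> S)"

definition rs :: "'a set => ('a => 'k) => 'a => 'k" where "rs S f = (%y. if y \<in> S then f y else 0)"
definition H :: "('a => 'k) => 'a => 'k" where "H f = (%y. f (\<eta> y))"
definition N :: "'a set => 'x set => nat => ('a => 'k) set" where "N S A k = rs S ` {f. J A k f}"
text \<open>The size of the weight is the degree, so no separate index for the grading is
  kept.\<close>

definition ch :: "'a set => 'x set => nat multiset => nat" where
 "ch S A M = fs.dim (eig H (N S A (size M)) (theta M))"
definition wset :: "nat => nat multiset set" where
 "wset k = (%cs. mset (map w cs)) ` {cs. set cs \<subseteq> C & length cs = k}"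
definition mon :: "'c list => 'a => 'k" where "mon cs y = prod_list (map (%c. \<zeta> c y) cs)"

lemma flinear_rs: "flinear (rs S)" by (rule flinearI) (auto simp: rs_def fs_simps)
lemma flinear_H: "flinear H" by (rule flinearI) (auto simp: H_def fs_simps)
lemma goodD: "good S ==> S \<subseteq> Y" "good S ==> subspace S" "good S ==> \<eta> y \<in> S \<longleftrightarrow> y \<in> S"
 by (auto simp: good_def)

lemma N_subspace: "fs.subspace (N S A k)"
proof -
 have "fs.subspace {f. J A k f}" unfolding fs.subspace_def
  by (auto simp: plus_fun_def zero_fun_def fscale_def intro: J.zero J.add J.scale)
 then show ?thesis unfolding N_def by (rule fsp.linear_subspace_image[OF flinear_rs])
qed

lemma H_rs: "good S ==> H (rs S f) = rs S (H f)"
 by (auto simp: H_def rs_def goodD)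

lemma N_stable: assumes "good S" "A \<subseteq> X" "u \<in> N S A k" shows "H u \<in> N S A k"
proof -
 obtain f where f: "J A k f" "u = rs S f" using assms(3) by (auto simp: N_def)
 have "J A k (H f)" using J_compose[where \<eta>=\<eta>, OF eta_linear(1) eta_linear(2) eta_Z f(1) assms(2)] by (simp add: H_def)
 then show ?thesis using f(2) H_rs[OF assms(1)] by (auto simp: N_def)
qed

lemma on_N: "f \<in> N S A k ==> on S A k f" by (auto simp: N_def on_def rs_def)

lemma N_supp: "u \<in> N S A k ==> y \<notin> S ==> u y = 0" by (auto simp: N_def rs_def)
lemma N_rs: "u \<in> N S A k ==> rs S u = u" by (auto simp: N_def rs_def)
lemma N_remove: "N S A k \<subseteq> N S (A - {x}) k" using J_remove by (auto simp: N_def)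

lemma finite_monos: "finite {cs. set cs \<subseteq> C & length cs = k}"
 by (rule finite_lists_length_eq[OF finC])

lemma finite_wset: "finite (wset k)" unfolding wset_def by (rule finite_imageI[OF finite_monos])

lemma size_wset: "M \<in> wset k ==> size M = k" by (auto simp: wset_def)

lemma J_mono_span:
 assumes S: "S \<subseteq> Y" and f: "J A k f" shows "rs S f \<in> fs.span ((%cs. rs S (mon cs)) ` {cs. set cs \<subseteq> C & length cs = k})"
proof -
 let ?D = "%k. (%cs. rs S (mon cs)) ` {cs. set cs \<subseteq> C & length cs = k}"
 have m: "rs S (%y. l y * f y) \<in> fs.span (?D (Suc k))" if l: "l \<in> Lin" and f: "rs S f \<in> fs.span (?D k)" for l k f
 proof -
  obtain a where a: "\<forall>y\<in>Y. l y = (\<Sum>c\<in>C. a c * \<zeta> c y)" using zeta_span[OF l] by blast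
  have eq: "rs S (%y. l y * f y) = (\<Sum>c\<in>C. fscale (a c) (%y. \<zeta> c y * rs S f y))"
   using a S by (auto simp: rs_def fs_simps sum_distrib_right mult.assoc)
  have "(%y. \<zeta> c y * rs S f y) \<in> fs.span (?D (Suc k))" if c: "c \<in> C" for c
  proof -
   let ?m = "%(f :: 'a => 'k) y. \<zeta> c y * f y"
   have lm: "flinear ?m" by (rule flinearI) (auto simp: fs_simps algebra_simps)
   have "?m ` ?D k \<subseteq> ?D (Suc k)"
   proof clarify
    fix cs assume "set cs \<subseteq> C" "k = length cs"
    then show "?m (rs S (mon cs)) \<in> ?D (Suc (length cs))"
     using c by (intro image_eqI[of _ _ "c # cs"]) (auto simp: rs_def mon_def fun_eq_iff)
   qed
   then have "?m ` fs.span (?D k) \<subseteq> fs.span (?D (Suc k))"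
    unfolding fsp.linear_span_image[OF lm, symmetric] by (rule fs.span_mono)
   then show ?thesis using f by blast
  qed
  then show ?thesis unfolding eq by (intro fs.span_sum fs.span_scale)
 qed
 show ?thesis using f
 proof (induction rule: J.induct)
  case one
  have "rs S (%y. 1) = rs S (mon [])" by (simp add: mon_def rs_def fun_eq_iff)
  then show ?case by (intro fs.span_base) auto
 next
  case (zero A k)
  have "rs S (%y. 0) = 0" by (simp add: rs_def zero_fun_def)
  then show ?case by (simp only: fs.span_zero)
 next
  case (add A k f g)
  have "rs S (%y. f y + g y) = rs S f + rs S g" by (auto simp: rs_def)
  then show ?case using fs.span_add[OF add.IH] by (simp only:)
 next
  case (scale A k f c)
  have "rs S (%y. c * f y) = fscale c (rs S f)" by (auto simp: rs_def fscale_def)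
  then show ?case using fs.span_scale[OF scale.IH] by (simp only:)
 next
  case (lin l A k f)
  show ?case by (rule m[OF lin(1) lin.IH])
 next
  case (fac x A l k f)
  show ?case by (rule m[OF L_Lin[OF fac(2)] fac.IH])
 qed
qed

lemma N_findim: "good S ==> findim (N S A k)"
 by (rule findim_mono[OF findim_span[OF finite_imageI[OF finite_monos[of k]]]])
  (use J_mono_span[OF goodD(1)] in \<open>auto simp: N_def\<close>)

lemma H_mono:
 assumes S: "good S" and cs: "set cs \<subseteq> C"
 shows "H (rs S (mon cs)) = fscale (theta (mset (map w cs))) (rs S (mon cs))"
proof -
 have "mon cs (\<eta> y) = theta (mset (map w cs)) * mon cs y" if y: "y \<in> Y" for y
  using cs by (induction cs) (auto simp: mon_def theta_add_mset zeta_eta[OF _ y] theta_def[of "{#}"])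
 then show ?thesis using goodD(1,3)[OF S] by (auto simp: H_def rs_def fs_simps)
qed

lemma components:
 assumes S: "good S" and A: "A \<subseteq> X" and u: "u \<in> N S A k"
 obtains c where "!!M. M \<in> wset k ==> c M \<in> eig H (N S A k) (theta M)" "u = (\<Sum>M\<in>wset k. c M)"
proof -
 let ?L = "{cs. set cs \<subseteq> C & length cs = k}"
 let ?m = "%cs. rs S (mon cs)" and ?w = "%cs. mset (map w cs)"
 have "u \<in> fs.span (?m ` ?L)" using J_mono_span[OF goodD(1)[OF S]] u by (auto simp: N_def)
 then obtain a where a: "u = (\<Sum>v\<in>?m ` ?L. fscale (a v) v)"
  using fs.span_finite[OF finite_imageI[OF finite_monos[of k]], of ?m] by auto
 define g where "g v = (SOME cs. cs \<in> ?L & ?m cs = v)" for v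
 have g: "g v \<in> ?L & ?m (g v) = v" if "v \<in> ?m ` ?L" for v
  using that someI_ex[of "%cs. cs \<in> ?L & ?m cs = v"] unfolding g_def by blast
 define c where "c M = (\<Sum>v\<in>{v\<in>?m ` ?L. ?w (g v) = M}. fscale (a v) v)" for M
 have uc: "u = (\<Sum>M\<in>wset k. c M)" unfolding a c_def
 proof (rule sum.group[symmetric])
  show "finite (?m ` ?L)" by (rule finite_imageI[OF finite_monos])
  show "finite (wset k)" by (rule finite_wset)
  show "(%v. ?w (g v)) ` ?m ` ?L \<subseteq> wset k" using g unfolding wset_def by blast
 qed
 have Hc: "H (c M) = fscale (theta M) (c M)" for M
 proof -
  have "H v = fscale (theta M) v" if "v \<in> ?m ` ?L" "?w (g v) = M" for v
   using H_mono[OF S, of "g v"] g[OF that(1)] that(2) by simp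
  then show ?thesis unfolding c_def fsp.linear_sum[OF flinear_H] fs.scale_sum_right fsp.linear_scale[OF flinear_H]
   by (intro sum.cong refl) (simp only: mem_Collect_eq fs.scale_left_commute)
 qed
 have "c M \<in> N S A k" if "M \<in> wset k" for M
  by (rule fs.eigen_components_in_subspace[where \<theta>=theta, OF flinear_H N_subspace N_stable[OF S A] finite_wset _ Hc _ that])
   (use u uc theta_inj in \<open>auto simp: inj_on_def\<close>)
 then show ?thesis using that uc Hc by (auto simp: eig_def)
qed

lemma eigenvector_weight:
 assumes S: "good S" and A: "A \<subseteq> X" and u: "u \<in> N S A k" "H u = fscale \<theta>0 u" "u ~= 0"
 shows "\<exists>M. size M = k & \<theta>0 = theta M"
proof (rule ccontr)
 assume n: "\<not> ?thesis"
 obtain c where c: "!!M. M \<in> wset k ==> c M \<in> eig H (N S A k) (theta M)" "u = (\<Sum>M\<in>wset k. c M)"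
  using components[OF S A u(1)] by blast
 have "u = (\<Sum>M\<in>{M\<in>wset k. theta M = \<theta>0}. c M)"
  by (rule eigen_sum[OF flinear_H finite_wset _ _ c(2) u(2)]) (use c(1) theta_inj in \<open>auto simp: inj_on_def eig_def\<close>)
 moreover have "{M\<in>wset k. theta M = \<theta>0} = {}" using n size_wset by auto
 ultimately show False using u(3) by simp
qed

lemma eig_sum_component:
 assumes "!!M. M \<in> wset k ==> H (c M) = fscale (theta M) (c M)" "u = (\<Sum>M\<in>wset k. c M)" "H u = fscale (theta M) u"
 shows "u = (if M \<in> wset k then c M else 0)"
proof -
 have "u = (\<Sum>M'\<in>{M'\<in>wset k. theta M' = (theta M :: 'k)}. c M')"
  by (rule eigen_sum[OF flinear_H finite_wset _ assms]) (auto simp: inj_on_def theta_inj)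
 also have "{M'\<in>wset k. theta M' = (theta M :: 'k)} = (if M \<in> wset k then {M} else {})" by (auto simp: theta_inj)
 finally show ?thesis by (simp add: zero_fun_def split: if_splits)
qed

text \<open>Restriction is onto in each degree and commutes with the torus, so a preimage may be
  replaced by its component of weight \<open>M\<close>.\<close>

lemma restrict_eig:
 assumes S: "good S" "good S'" "S' \<subseteq> S" and A: "A \<subseteq> X"
 shows "rs S' ` eig H (N S A k) (theta M) = eig H (N S' A k) (theta M)"
proof
 have rr: "rs S' (rs S f) = rs S' f" for f using S(3) by (auto simp: rs_def fun_eq_iff)
 have sub: "rs S' u \<in> eig H (N S' A k) (theta M)" if "u \<in> eig H (N S A k) (theta M)" for u M
 proof -
  have u: "u \<in> N S A k" "H u = fscale (theta M) u" using that by (auto simp: eig_def)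
  have "rs S' u \<in> N S' A k" using u(1) rr by (auto simp: N_def)
  moreover have "H (rs S' u) = fscale (theta M) (rs S' u)"
   by (simp only: H_rs[OF S(2)] u(2) fsp.linear_scale[OF flinear_rs])
  ultimately show ?thesis by (simp add: eig_def)
 qed
 then show "rs S' ` eig H (N S A k) (theta M) \<subseteq> eig H (N S' A k) (theta M)" by blast
 show "eig H (N S' A k) (theta M) \<subseteq> rs S' ` eig H (N S A k) (theta M)"
 proof
  fix v assume v: "v \<in> eig H (N S' A k) (theta M)"
  then obtain f where f: "J A k f" "v = rs S' f" by (auto simp: eig_def N_def)
  obtain c where c: "!!M. M \<in> wset k ==> c M \<in> eig H (N S A k) (theta M)" "rs S f = (\<Sum>M\<in>wset k. c M)"
   using components[OF S(1) A, of "rs S f" k] f(1) by (auto simp: N_def)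
  have "v = (\<Sum>M\<in>wset k. rs S' (c M))" using arg_cong[OF c(2), of "rs S'"] by (simp only: f(2) rr fsp.linear_sum[OF flinear_rs])
  then have "v = (if M \<in> wset k then rs S' (c M) else 0)"
   by (rule eig_sum_component[rotated]) (use v sub[OF c(1)] in \<open>auto simp: eig_def\<close>)
  moreover have "0 = rs S' 0" using fsp.linear_0[OF flinear_rs] by simp
  moreover have "0 \<in> eig H (N S A k) (theta M)" by (rule fs.subspace_0[OF subspace_eig[OF flinear_H N_subspace]])
  ultimately show "v \<in> rs S' ` eig H (N S A k) (theta M)" using c(1)[of M] by (cases "M \<in> wset k") auto
 qed
qed

lemma good_slice:
 assumes S: "good S" and c: "c \<in> C" and e: "e \<in> S" "\<zeta> c e ~= 0" shows "good {y \<in> S. \<zeta> c y = 0}"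
proof -
 obtain B where B: "finite B" "S = span B" using S by (auto simp: good_def)
 obtain B' where B': "finite B'" "card B' < card B" "span B' = {y \<in> span B. \<zeta> c y = 0}"
  by (rule span_slice[OF B(1) zeta[OF c] e(1)[unfolded B(2)] e(2)])
 have nz: "of_nat (nprime (w c)) ~= (0 :: 'k)" using prime_nprime[of "w c"] by (auto dest: prime_gt_0_nat)
 show ?thesis unfolding good_def
 proof (intro conjI allI)
  show "{y \<in> S. \<zeta> c y = 0} \<subseteq> Y" using goodD(1)[OF S] by blast
  show "\<exists>B. finite B & {y \<in> S. \<zeta> c y = 0} = span B" using B'(1) unfolding B(2) B'(3)[symmetric] by blast
  show "(\<eta> y \<in> {y \<in> S. \<zeta> c y = 0}) = (y \<in> {y \<in> S. \<zeta> c y = 0})" for y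
   using goodD(1,3)[OF S] zeta_eta[OF c, of y] nz by auto
 qed
qed

text \<open>Rank-nullity for restriction to the hyperplane where \<open>\<zeta> c\<close> vanishes.
  As \<open>e\<close> lies in every \<open>Z x\<close> with \<open>x \<in> A\<close>, the kernel is
  \<open>\<zeta> c\<close> times the ideal in one degree less, and this multiplication adds the
  index \<open>w c\<close> to a weight. In generating series the hyperplane contributes the factor 1
  minus the variable with index \<open>w c\<close>.\<close>

lemma ch_slice:
 assumes S: "good S" and A: "A \<subseteq> X" and c: "c \<in> C" and e: "e \<in> S" "\<zeta> c e ~= 0" "!!x. x \<in> A ==> e \<in> Z x"
 shows "ch S A M = ch {y \<in> S. \<zeta> c y = 0} A M + (if w c \<in># M then ch S A (M - {#w c#}) else 0)"
proof -
 let ?S' = "{y \<in> S. \<zeta> c y = 0}" and ?k = "size M"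
 let ?T = "eig H (N S A ?k) (theta M)"
 have nz: "of_nat (nprime (w c)) ~= (0 :: 'k)" using prime_nprime[of "w c"] by (auto dest: prime_gt_0_nat)
 have S': "good ?S'" by (rule good_slice[OF S c e(1,2)])
 have subT: "fs.subspace ?T" by (rule subspace_eig[OF flinear_H N_subspace])
 have finT: "findim (eig H (N S A k) \<theta>)" for k \<theta> by (rule findim_mono[OF N_findim[OF S] eig_subset])
 define \<mu> where "\<mu> f = (%y. \<zeta> c y * f y)" for f :: "'a => 'k"
 have lm: "flinear \<mu>" unfolding \<mu>_def by (rule flinearI) (auto simp: fs_simps algebra_simps)
 have inj: "u = 0" if u: "u \<in> N S A k" "\<mu> u = 0" for u k
 proof -
  obtain f where f: "J A k f" "u = rs S f" using u(1) by (auto simp: N_def)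
  have "f y = 0" if "y \<in> S" for y
  proof (rule cancel[OF zeta[OF c] goodD(2)[OF S] e(1,2) f(1) _ that])
   show "\<zeta> c v * f v = 0" if "v \<in> S" for v using fun_cong[OF u(2), of v] that by (simp add: \<mu>_def f(2) rs_def)
  qed
  then show "u = 0" by (auto simp: f(2) rs_def)
 qed
 have H\<mu>: "H (\<mu> u) = fscale (of_nat (nprime (w c))) (\<mu> (H u))" if "u \<in> N S A k" for u k
 proof
  fix y
  show "H (\<mu> u) y = fscale (of_nat (nprime (w c))) (\<mu> (H u)) y"
   using N_supp[OF that, of "\<eta> y"] goodD(1,3)[OF S] zeta_eta[OF c, of y]
   by (cases "y \<in> S") (auto simp: H_def \<mu>_def fscale_def)
 qed
 have kernel: "{u \<in> ?T. rs ?S' u = 0} = (if w c \<in># M then \<mu> ` eig H (N S A (size (M - {#w c#}))) (theta (M - {#w c#})) else {0})"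
 proof -
  have ker: "\<exists>v. u = \<mu> v & (case ?k of 0 => v = 0 | Suc k' => v \<in> N S A k' & fscale (of_nat (nprime (w c))) (H v) = fscale (theta M) v)"
   if u: "u \<in> ?T" "rs ?S' u = 0" for u
  proof -
   obtain f where f: "J A ?k f" "u = rs S f" using u(1) by (auto simp: eig_def N_def)
   have f0: "f y = 0" if "y \<in> S" "\<zeta> c y = 0" for y using fun_cong[OF u(2), of y] that by (simp add: f(2) rs_def)
   obtain f' where f': "!!y. y \<in> S ==> f y = \<zeta> c y * f' y" "case ?k of 0 => f' = (%y. 0) | Suc k' => J A k' f'"
    by (rule J_divide_on[OF goodD(2)[OF S] zeta[OF c] e A f(1) f0]) blast+
   have uv: "u = \<mu> (rs S f')" using f'(1) by (auto simp: f(2) rs_def \<mu>_def)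
   show ?thesis
   proof (cases ?k)
    case 0
    then have "rs S f' = 0" using f'(2) by (auto simp: rs_def zero_fun_def)
    then show ?thesis using uv 0 by auto
   next
    case (Suc k')
    then have v: "rs S f' \<in> N S A k'" using f'(2) by (auto simp: N_def)
    let ?d = "fscale (of_nat (nprime (w c))) (H (rs S f')) - fscale (theta M) (rs S f')"
    have "\<mu> ?d = H u - fscale (theta M) u"
     by (simp only: fsp.linear_diff[OF lm] fsp.linear_scale[OF lm] H\<mu>[OF v] uv)
    then have "\<mu> ?d = 0" using u(1) by (simp add: eig_def)
    moreover have "?d \<in> N S A k'"
     by (intro fs.subspace_diff[OF N_subspace] fs.subspace_scale[OF N_subspace] N_stable[OF S A] v)
    ultimately have "?d = 0" by (rule inj[rotated])
    then show ?thesis using uv v Suc by (intro exI[of _ "rs S f'"]) simp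
   qed
  qed
  show ?thesis
  proof (cases "w c \<in># M")
   case True
   let ?M = "M - {#w c#}"
   have M: "M = add_mset (w c) ?M" and sz: "?k = Suc (size ?M)" using True by (simp_all add: size_Suc_Diff1)
   have th: "theta M = of_nat (nprime (w c)) * (theta ?M :: 'k)" by (subst M) (rule theta_add_mset)
   have "{u \<in> ?T. rs ?S' u = 0} = \<mu> ` eig H (N S A (size ?M)) (theta ?M)"
   proof
    show "{u \<in> ?T. rs ?S' u = 0} \<subseteq> \<mu> ` eig H (N S A (size ?M)) (theta ?M)"
    proof clarify
     fix u assume "u \<in> ?T" "rs ?S' u = 0"
     then obtain v where v: "u = \<mu> v" "v \<in> N S A (size ?M)" "fscale (of_nat (nprime (w c))) (H v) = fscale (theta M) v"
      using ker[of u] sz by auto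
     have "fscale (of_nat (nprime (w c))) (H v) = fscale (of_nat (nprime (w c))) (fscale (theta ?M) v)"
      using v(3) unfolding th by (simp only: fs.scale_scale)
     then have "H v = fscale (theta ?M) v" using nz fs.scale_cancel_left[of "of_nat (nprime (w c)) :: 'k" "H v"] by blast
     then show "u \<in> \<mu> ` eig H (N S A (size ?M)) (theta ?M)" using v by (auto simp: eig_def)
    qed
    show "\<mu> ` eig H (N S A (size ?M)) (theta ?M) \<subseteq> {u \<in> ?T. rs ?S' u = 0}"
    proof clarify
     fix v assume "v \<in> eig H (N S A (size ?M)) (theta ?M)"
     then have v: "v \<in> N S A (size ?M)" "H v = fscale (theta ?M) v" by (auto simp: eig_def)
     obtain f where f: "J A (size ?M) f" "v = rs S f" using v(1) by (auto simp: N_def)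
     have "\<mu> v = rs S (%y. \<zeta> c y * f y)" by (auto simp: \<mu>_def f(2) rs_def)
     then have "\<mu> v \<in> N S A ?k" unfolding sz using J.lin[OF zeta[OF c] f(1)] by (auto simp: N_def)
     moreover have "H (\<mu> v) = fscale (theta M) (\<mu> v)"
      by (simp only: H\<mu>[OF v(1)] v(2) th fsp.linear_scale[OF lm] fs.scale_scale)
     moreover have "rs ?S' (\<mu> v) = 0" by (auto simp: rs_def \<mu>_def)
     ultimately show "\<mu> v \<in> ?T & rs ?S' (\<mu> v) = 0" by (simp add: eig_def)
    qed
   qed
   then show ?thesis using True by simp
  next
   case False
   \<comment> \<open>A nonzero element of the kernel would be \<open>\<zeta> c\<close> times an
     eigenvector of some weight, and then \<open>M\<close> would contain \<open>w c\<close>.\<close>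
   have "u = 0" if u: "u \<in> ?T" "rs ?S' u = 0" for u
   proof (rule ccontr)
    assume "u ~= 0"
    obtain v where v: "u = \<mu> v" "case ?k of 0 => v = 0 | Suc k' => v \<in> N S A k' & fscale (of_nat (nprime (w c))) (H v) = fscale (theta M) v"
     using ker[OF u] by blast
    have "v ~= 0" using v(1) \<open>u ~= 0\<close> fsp.linear_0[OF lm] by auto
    then obtain k' where k': "v \<in> N S A k'" "fscale (of_nat (nprime (w c))) (H v) = fscale (theta M) v"
     using v(2) by (cases ?k) auto
    have "H v = fscale (theta M / of_nat (nprime (w c))) v"
     using arg_cong[OF k'(2), of "fscale (1 / of_nat (nprime (w c)))"] nz by (simp add: fs.scale_scale)
    then obtain M' where "theta M / of_nat (nprime (w c)) = (theta M' :: 'k)"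
     using eigenvector_weight[OF S A k'(1) _ \<open>v ~= 0\<close>] by blast
    then have "theta M = (theta (add_mset (w c) M') :: 'k)" using nz by (simp add: theta_add_mset field_simps)
    then show False using False by (simp add: theta_inj)
   qed
   moreover have "0 \<in> ?T" "rs ?S' 0 = 0" using fs.subspace_0[OF subT] fsp.linear_0[OF flinear_rs] by auto
   ultimately have "{u \<in> ?T. rs ?S' u = 0} = {0}" by blast
   then show ?thesis using False by simp
  qed
 qed
 have "fs.dim (\<mu> ` eig H (N S A k) \<theta>) = fs.dim (eig H (N S A k) \<theta>)" for k \<theta>
 proof (rule fs_dim_eq_partial_iso[OF subspace_eig[OF flinear_H N_subspace] finT])
  show "inj_on \<mu> (eig H (N S A k) \<theta>)"
  proof (rule inj_onI)
   fix u v assume uv: "u \<in> eig H (N S A k) \<theta>" "v \<in> eig H (N S A k) \<theta>" "\<mu> u = \<mu> v"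
   have "u - v = 0"
    by (rule inj[of _ k]) (use uv fs.subspace_diff[OF N_subspace] fsp.linear_diff[OF lm] in \<open>auto simp: eig_def\<close>)
   then show "u = v" by simp
  qed
 qed (simp_all only: fsp.linear_add[OF lm] fsp.linear_scale[OF lm])
 then have "fs.dim {u \<in> ?T. rs ?S' u = 0} = (if w c \<in># M then ch S A (M - {#w c#}) else 0)"
  unfolding kernel by (simp add: ch_def)
 moreover have "rs ?S' ` ?T = eig H (N ?S' A ?k) (theta M)" by (rule restrict_eig[OF S S' _ A]) blast
 ultimately show ?thesis using rank_nullity[OF flinear_rs[of ?S'] subT finT] by (simp add: ch_def)
qed

lemma ch_zero: assumes g: "good {0}" shows "ch {0} {} M = (if M = {#} then 1 else 0)"
proof (cases "M = {#}")
 case True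
 let ?u = "rs {0} (%y. 1)"
 have "eig H (N {0} {} 0) 1 = fs.span {?u}"
 proof
  show "eig H (N {0} {} 0) 1 \<subseteq> fs.span {?u}"
  proof
   fix v assume "v \<in> eig H (N {0} {} 0) 1"
   then obtain f where "v = rs {0} f" by (auto simp: eig_def N_def)
   then have "v = fscale (f 0) ?u" by (simp add: rs_def fs_simps)
   then show "v \<in> fs.span {?u}" using fs.span_scale[OF fs.span_base[of ?u "{?u}"], of "f 0"] by simp
  qed
  have "?u \<in> N {0} {} 0" using J.one by (auto simp: N_def)
  moreover have "H ?u = fscale 1 ?u" using H_rs[OF g, of "%y. 1"] by (simp add: H_def)
  ultimately have "?u \<in> eig H (N {0} {} 0) 1" by (simp add: eig_def)
  then show "fs.span {?u} \<subseteq> eig H (N {0} {} 0) 1"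
   by (intro fs.span_minimal[OF _ subspace_eig[OF flinear_H N_subspace]]) simp
 qed
 moreover have "?u ~= 0" by (auto simp: rs_def fun_eq_iff)
 ultimately have "fs.dim (eig H (N {0} {} 0) 1) = 1"
  using fs.dim_span_eq_card_independent[of "{?u}"] by simp
 then show ?thesis using True by (simp add: ch_def theta_def)
next
 case False
 have "rs {0} f = 0" if "J {} (size M) f" for f
  using J_at_0[OF that] False by (auto simp: rs_def zero_fun_def nonempty_has_size)
 then have "eig H (N {0} {} (size M)) (theta M) \<subseteq> {0}" by (auto simp: eig_def N_def)
 then have "eig H (N {0} {} (size M)) (theta M) = {0}"
  using fs.subspace_0[OF subspace_eig[OF flinear_H N_subspace]] by blast
 then have "ch {0} {} M = 0" by (simp only: ch_def fs_dim_zero)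
 then show ?thesis using False by simp
qed

section \<open>The Euler characteristic in a fixed weight\<close>

definition par :: "bool => 'x set set" where "par p = {A \<in> Pow X. even (card A) = p}"

lemma par_insert: "A \<in> par p ==> x \<in> X - A ==> insert x A \<in> par (\<not> p)"
 using finX finite_subset[of A X] by (auto simp: par_def)

definition bdf :: "('x set \<times> 'a => 'k) => 'x set \<times> 'a => 'k" where
 "bdf c = (%(A, y). if A \<subseteq> X then bd (%A. c (A, y)) A else 0)"

lemma flinear_bdf: "flinear bdf"
 by (rule flinearI) (auto simp: bdf_def fs_simps bd_linear)

lemma slice_bdf: "A \<subseteq> X ==> slice A (bdf c) = (\<Sum>x\<in>X - A. fscale (sg x A) (slice (insert x A) c))"
 by (auto simp: slice_def bdf_def bd_def fs_simps)

text \<open>Exactness is known degree by degree, not weight by weight. A bounding chain is cut down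
  to its component of weight \<open>M\<close>, which still bounds because the differential commutes
  with the torus. Folded by the parity of |A|, the complex in weight \<open>M\<close> is an exact
  pair.\<close>

lemma euler:
 assumes S: "good S" and K: "!!y. y \<in> S ==> \<forall>x\<in>X. y \<in> Z x ==> y = 0" and ne: "X ~= {}" and k: "card X \<le> size M"
 shows "(\<Sum>A\<in>Pow X. (-1) ^ card A * int (ch S A M)) = 0"
proof -
 let ?k = "size M"
 let ?E = "%A. eig H (N S A ?k) (theta M)"
 let ?T = "%p. fprod (par p) ?E"
 have subE: "fs.subspace (?E A)" for A by (rule subspace_eig[OF flinear_H N_subspace])
 have finE: "findim (?E A)" for A by (rule findim_mono[OF N_findim[OF S] eig_subset])
 have finP: "finite (par p)" for p using finX by (simp add: par_def)
 obtain B where B: "finite B" "S = span B" using S by (auto simp: good_def)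
 have Er: "?E (insert x A) \<subseteq> ?E A" if "x \<notin> A" for x A
  using N_remove[of S "insert x A" ?k x] that by (auto simp: eig_def)
 have img: "bdf c \<in> ?T p" if c: "c \<in> ?T (\<not> p)" for c p
  unfolding fprod_def
 proof (intro CollectI conjI ballI allI impI)
  fix A assume A: "A \<in> par p"
  then have "A \<subseteq> X" by (simp add: par_def)
  show "slice A (bdf c) \<in> ?E A" unfolding slice_bdf[OF \<open>A \<subseteq> X\<close>]
  proof (intro fs.subspace_sum[OF subE] fs.subspace_scale[OF subE])
   fix x assume x: "x \<in> X - A"
   then have "slice (insert x A) c \<in> ?E (insert x A)" using c par_insert[OF A x] by (auto simp: fprod_def)
   then show "slice (insert x A) c \<in> ?E A" using Er[of x A] x by blast
  qed
 next
  fix A assume A: "A \<notin> par p"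
  show "slice A (bdf c) = 0"
  proof (cases "A \<subseteq> X")
   case True
   then have "A \<in> par (\<not> p)" using A by (simp add: par_def)
   then have "slice (insert x A) c = 0" if "x \<in> X - A" for x
    using par_insert[OF _ that] c by (auto simp: fprod_def par_def)
   then show ?thesis unfolding slice_bdf[OF True] by (intro sum.neutral ballI) (simp add: fs.scale_zero_right)
  next
   case False
   then show ?thesis by (auto simp: slice_def bdf_def)
  qed
 qed
 have ex: "bdf ` ?T (\<not> p) = {t \<in> ?T p. bdf t = 0}" for p
 proof
  have "bdf (bdf c) = 0" for c
  proof
   fix q :: "'x set \<times> 'a"
   obtain A y where q: "q = (A, y)" by (cases q)
   show "bdf (bdf c) q = 0 q"
   proof (cases "A \<subseteq> X")
    case True
    have "bd (%A. bdf c (A, y)) A = bd (bd (%A. c (A, y))) A" using True by (intro bd_cong) (auto simp: bdf_def)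
    then show ?thesis using True bd_bd[OF True] by (simp add: q bdf_def)
   qed (simp add: q bdf_def)
  qed
  then show "bdf ` ?T (\<not> p) \<subseteq> {t \<in> ?T p. bdf t = 0}" using img by blast
  show "{t \<in> ?T p. bdf t = 0} \<subseteq> bdf ` ?T (\<not> p)"
  proof clarify
   fix t assume t: "t \<in> ?T p" "bdf t = 0"
   have tA: "slice A t \<in> ?E A" if "A \<subseteq> X" for A
    using t(1) that fs.subspace_0[OF subE[of A]] by (cases "A \<in> par p") (auto simp: fprod_def)
   have onA: "on (span B) A ?k (slice A t)" if "A \<subseteq> X" for A
    using tA[OF that] on_N[of "slice A t" S A ?k] B(2) by (simp add: eig_def)
   have bt0: "bd (%A. slice A t y) A = 0" if "A \<subseteq> X" for A y
    using fun_cong[OF t(2), of "(A, y)"] that by (simp add: bdf_def slice_def)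
   have "\<exists>d. (\<forall>A\<subseteq>X. J A ?k (d A)) & (\<forall>A\<subseteq>X. \<forall>y\<in>span B. slice A t y = bd (%A. d A y) A)"
    by (rule exactness[OF ne k B(1)]) (use K onA bt0 in \<open>auto simp: B(2)\<close>)
   then obtain d where d0: "(\<forall>A\<subseteq>X. J A ?k (d A)) & (\<forall>A\<subseteq>X. \<forall>y\<in>span B. slice A t y = bd (%A. d A y) A)" by (rule exE)
   have d: "!!A. A \<subseteq> X ==> J A ?k (d A)" "!!A y. A \<subseteq> X ==> y \<in> S ==> slice A t y = bd (%A. d A y) A"
    using d0 unfolding B(2) by simp_all
   have "\<forall>A\<in>Pow X. \<exists>c. (\<forall>M\<in>wset ?k. c M \<in> eig H (N S A ?k) (theta M)) & rs S (d A) = (\<Sum>M\<in>wset ?k. c M)"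
   proof
    fix A assume A: "A \<in> Pow X"
    then have dA: "rs S (d A) \<in> N S A ?k" using d(1) by (auto simp: N_def)
    have "A \<subseteq> X" using A by simp
    obtain c where c: "!!M. M \<in> wset ?k ==> c M \<in> eig H (N S A ?k) (theta M)"
     "rs S (d A) = (\<Sum>M\<in>wset ?k. c M)" by (rule components[OF S \<open>A \<subseteq> X\<close> dA]) blast
    show "\<exists>c. (\<forall>M\<in>wset ?k. c M \<in> eig H (N S A ?k) (theta M)) & rs S (d A) = (\<Sum>M\<in>wset ?k. c M)"
     by (intro exI[of _ c] conjI ballI c)
   qed
   then obtain c where "\<forall>A\<in>Pow X. (\<forall>M\<in>wset ?k. c A M \<in> eig H (N S A ?k) (theta M)) & rs S (d A) = (\<Sum>M\<in>wset ?k. c A M)"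
    by (rule bchoice[THEN exE])
   then have c: "!!A M. A \<subseteq> X ==> M \<in> wset ?k ==> c A M \<in> eig H (N S A ?k) (theta M)"
    "!!A. A \<subseteq> X ==> rs S (d A) = (\<Sum>M\<in>wset ?k. c A M)" by simp_all
   \<comment> \<open>The component of weight \<open>M\<close> of the bounding chain, kept only at
     the sets whose parity is opposite to that of \<open>t\<close>.\<close>
   define v where "v = (%(A, y). if A \<in> par (\<not> p) & M \<in> wset ?k then c A M y else 0)"
   have sv: "slice A v = (if A \<in> par (\<not> p) & M \<in> wset ?k then c A M else 0)" for A
    by (auto simp: slice_def v_def)
   have "v \<in> ?T (\<not> p)" unfolding fprod_def mem_Collect_eq sv
    using c(1) fs.subspace_0[OF subE] by (auto simp: par_def)
   moreover have "bdf v = t"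
   proof -
    have "slice A (bdf v) = slice A t" for A
    proof (cases "A \<in> par p")
     case True
     then have A: "A \<subseteq> X" by (simp add: par_def)
     define u where "u M' = (\<Sum>x\<in>X - A. fscale (sg x A) (c (insert x A) M'))" for M'
     have "slice A t = rs S (slice A t)" using tA[OF A] N_rs[of "slice A t" S A ?k] by (simp add: eig_def)
     also have "... = (\<Sum>x\<in>X - A. fscale (sg x A) (rs S (d (insert x A))))"
      using d(2)[OF A] by (auto simp: rs_def bd_def fs_simps)
     also have "... = (\<Sum>x\<in>X - A. \<Sum>M'\<in>wset ?k. fscale (sg x A) (c (insert x A) M'))"
      by (rule sum.cong[OF refl]) (use A c(2) in \<open>auto simp: fs.scale_sum_right\<close>)
     also have "... = (\<Sum>M'\<in>wset ?k. u M')" unfolding u_def by (rule sum.swap)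
     finally have tu: "slice A t = (\<Sum>M'\<in>wset ?k. u M')" .
     have "H (u M') = fscale (theta M') (u M')" if "M' \<in> wset ?k" for M'
     proof -
      have "H (c (insert x A) M') = fscale (theta M') (c (insert x A) M')" if "x \<in> X - A" for x
       using c(1)[of "insert x A" M'] that A \<open>M' \<in> wset ?k\<close> by (auto simp: eig_def)
      then show ?thesis unfolding u_def fsp.linear_sum[OF flinear_H] fs.scale_sum_right fsp.linear_scale[OF flinear_H]
       by (intro sum.cong refl) (simp only: fs.scale_left_commute)
     qed
     moreover have "H (slice A t) = fscale (theta M) (slice A t)" using tA[OF A] unfolding eig_def by blast
     ultimately have "slice A t = (if M \<in> wset ?k then u M else 0)" by (rule eig_sum_component[OF _ tu])
     also have "... = slice A (bdf v)"
      unfolding slice_bdf[OF A] u_def sv using par_insert[OF True] by (auto simp: fs.scale_zero_right)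
     finally show ?thesis by simp
    next
     case False
     then show ?thesis using img[OF \<open>v \<in> ?T (\<not> p)\<close>] t(1) by (auto simp: fprod_def)
    qed
    then show ?thesis by (auto simp: slice_def fun_eq_iff)
   qed
   ultimately show "t \<in> bdf ` ?T (\<not> p)" by blast
  qed
 qed
 have "fs.dim (?T True) = fs.dim (?T False)"
  by (rule dim_eq_of_exact_pair[OF flinear_bdf flinear_bdf])
   (use ex[of True] ex[of False] in \<open>auto intro!: subspace_fprod findim_fprod subE finE finP\<close>)
 then have eq: "(\<Sum>A\<in>par True. ch S A M) = (\<Sum>A\<in>par False. ch S A M)"
  using dim_fprod[OF finP subE finE] by (simp add: ch_def)
 have "(\<Sum>A\<in>Pow X. (-1) ^ card A * int (ch S A M)) = (\<Sum>A\<in>par True. (-1) ^ card A * int (ch S A M)) + (\<Sum>A\<in>par False. (-1) ^ card A * int (ch S A M))"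
  by (subst sum.union_disjoint[symmetric]) (auto simp: par_def finX intro: sum.cong)
 also have "(\<Sum>A\<in>par True. (-1) ^ card A * int (ch S A M)) = int (\<Sum>A\<in>par True. ch S A M)"
  unfolding of_nat_sum by (rule sum.cong[OF refl]) (simp add: par_def)
 also have "(\<Sum>A\<in>par False. (-1) ^ card A * int (ch S A M)) = - int (\<Sum>A\<in>par False. ch S A M)"
  unfolding of_nat_sum sum_negf[symmetric] by (rule sum.cong[OF refl]) (simp add: par_def)
 finally show ?thesis using eq by simp
qed

end

section \<open>Power series in finitely many variables\<close>

definition res :: "nat => xps => xps" where
 "res m f = Abs_xps (%M. if set_mset M \<subseteq> {..<m} then xcoeff f M else 0)"

definition xvar :: "nat => xps" where "xvar j = Abs_xps (%M. if M = {#j#} then 1 else 0)"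

definition omega :: "nat => xps" where "omega m = (\<Prod>j<m. 1 - xvar j)"

lemma xcoeff_Abs [simp]: "xcoeff (Abs_xps f) M = f M" by (simp add: Abs_xps_inverse)

lemma xcoeff_res [simp]: "xcoeff (res m f) M = (if set_mset M \<subseteq> {..<m} then xcoeff f M else 0)"
 by (simp add: res_def)

lemma xcoeff_sum: "xcoeff (\<Sum>i\<in>F. f i) M = (\<Sum>i\<in>F. xcoeff (f i) M)"
 by (induction F rule: infinite_finite_induct) (auto simp: zero_xps.rep_eq plus_xps.rep_eq)

lemma xcoeff_sign: "xcoeff ((-1) ^ k * f) M = (-1) ^ k * xcoeff f M"
 by (induction k) (auto simp: uminus_xps.rep_eq)

lemma res_hom: "res m 1 = 1" "res m (f + g) = res m f + res m g" "res m (- f) = - res m f" "res m (f * g) = res m f * res m g"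
proof -
 show "res m (f * g) = res m f * res m g"
 proof (rule xps_eqI)
  fix M
  show "xcoeff (res m (f * g)) M = xcoeff (res m f * res m g) M"
  proof (cases "set_mset M \<subseteq> {..<m}")
   case True
   then show ?thesis unfolding times_xps.rep_eq xcoeff_res by (auto simp: times_xps.rep_eq intro!: sum.cong)
  next
   case False
   have "(\<Sum>(A, B)\<in>{(A, B). A + B = M}. xcoeff (res m f) A * xcoeff (res m g) B) = 0"
    using False by (intro sum.neutral) auto
   then show ?thesis using False by (simp add: times_xps.rep_eq)
  qed
 qed
qed (auto intro!: xps_eqI simp: one_xps.rep_eq plus_xps.rep_eq uminus_xps.rep_eq)

lemma res_sum: "res m (\<Sum>i\<in>F. f i) = (\<Sum>i\<in>F. res m (f i))"
 by (rule xps_eqI) (simp add: xcoeff_sum)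

lemma res_power: "res m (f ^ k) = res m f ^ k" by (induction k) (simp_all add: res_hom)

lemma res_trunc: "res m (trunc k f) = trunc k (res m f)"
 by (rule xps_eqI) (simp add: trunc_def)

lemma xcoeff_xvar_mult: "xcoeff (xvar j * f) M = (if j \<in># M then xcoeff f (M - {#j#}) else 0)"
proof -
 have "xcoeff (xvar j * f) M = (\<Sum>(A, B)\<in>(if j \<in># M then {({#j#}, M - {#j#})} else {}). xcoeff (xvar j) A * xcoeff f B)"
  unfolding times_xps.rep_eq
 proof (rule sum.mono_neutral_right[OF finite_mset_splits])
  show "(if j \<in># M then {({#j#}, M - {#j#})} else {}) \<subseteq> {(A, B). A + B = M}" by auto
  show "\<forall>i\<in>{(A, B). A + B = M} - (if j \<in># M then {({#j#}, M - {#j#})} else {}). (case i of (A, B) => xcoeff (xvar j) A * xcoeff f B) = 0"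
   by (auto simp: xvar_def split: if_splits)
 qed
 then show ?thesis by (simp add: xvar_def)
qed

lemma xcoeff_one_minus_xvar: "xcoeff ((1 - xvar j) * f) M = xcoeff f M - (if j \<in># M then xcoeff f (M - {#j#}) else 0)"
 by (simp only: left_diff_distrib mult_1_left minus_xps.rep_eq xcoeff_xvar_mult)

text \<open>Multiplication by 1 - x_l subtracts a shifted copy of the series and so removes exactly
  the monomials divisible by x_l.\<close>

lemma xcoeff_sigma_omega: "xcoeff (sigma * omega l) M = (if set_mset M Int {..<l} = {} then 1 else 0)"
proof (induction l arbitrary: M)
 case 0
 then show ?case by (simp add: omega_def xcoeff_sigma)
next
 case (Suc l)
 have "sigma * omega (Suc l) = (1 - xvar l) * (sigma * omega l)" by (simp add: omega_def mult_ac)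
 moreover have "set_mset (M - {#l#}) Int {..<l} = set_mset M Int {..<l}"
  by (auto simp: in_diff_count split: if_splits)
 moreover have "set_mset M Int {..<Suc l} = {} \<longleftrightarrow> set_mset M Int {..<l} = {} & l \<notin># M"
  by (auto simp: less_Suc_eq)
 ultimately show ?case using Suc by (simp add: xcoeff_one_minus_xvar)
qed

lemma res_sigma_omega: "res m sigma * res m (omega m) = 1"
proof -
 have "res m (sigma * omega m) = 1"
  by (rule xps_eqI) (auto simp: xcoeff_sigma_omega one_xps.rep_eq Int_absorb2)
 then show ?thesis by (simp add: res_hom)
qed

section \<open>Moebius inversion and solution of the recursion\<close>

lemma alternating_interval_sum:
 assumes "finite B" "C \<subseteq> B"
 shows "(\<Sum>A\<in>{A\<in>Pow B. C \<subseteq> A}. (-1) ^ card A) = (if C = B then (-1) ^ card C else 0 :: 'r::comm_ring_1)"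
proof -
 have fC: "finite C" using assms finite_subset by blast
 have "(\<Sum>A\<in>{A\<in>Pow B. C \<subseteq> A}. (-1) ^ card A) = (\<Sum>D\<in>Pow (B - C). (-1) ^ card C * (-1) ^ card D :: 'r)"
 proof (rule sum.reindex_bij_witness[of _ "%D. C Un D" "%A. A - C"])
  fix A assume A: "A \<in> {A\<in>Pow B. C \<subseteq> A}"
  have "finite A" using A assms(1) finite_subset by auto
  then have "card A = card C + card (A - C)" using A card_Un_disjoint[of C "A - C"] fC by (auto simp: Un_absorb1)
  then show "(-1) ^ card C * (-1) ^ card (A - C) = ((-1) ^ card A :: 'r)" by (simp add: power_add)
 qed (use assms in auto)
 also have "... = (-1) ^ card C * (if B - C = {} then 1 else 0)"
  unfolding sum_distrib_left[symmetric] using sum_alternating_Pow[of "B - C", where 'k='r] assms(1) by simp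
 also have "... = (if C = B then (-1) ^ card C else 0)" using assms(2) by auto
 finally show ?thesis .
qed

lemma moebius_Pow:
 fixes c :: "'x set => 'r::comm_ring_1"
 assumes B: "finite B" shows "(\<Sum>A\<in>Pow B. (-1) ^ card A * (\<Sum>C\<in>Pow A. (-1) ^ card C * c C)) = c B"
proof -
 have "(\<Sum>A\<in>Pow B. (-1) ^ card A * (\<Sum>C\<in>Pow A. (-1) ^ card C * c C))
   = (\<Sum>A\<in>Pow B. \<Sum>C\<in>{C\<in>Pow B. C \<subseteq> A}. (-1) ^ card A * ((-1) ^ card C * c C))"
  unfolding sum_distrib_left by (intro sum.cong) auto
 also have "... = (\<Sum>C\<in>Pow B. \<Sum>A\<in>{A\<in>Pow B. C \<subseteq> A}. (-1) ^ card A * ((-1) ^ card C * c C))"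
  by (rule sum.swap_restrict) (simp_all add: B)
 also have "... = (\<Sum>C\<in>Pow B. if C = B then c B else 0)"
 proof (rule sum.cong[OF refl])
  fix C assume C: "C \<in> Pow B"
  have "(\<Sum>A\<in>{A\<in>Pow B. C \<subseteq> A}. (-1) ^ card A * ((-1) ^ card C * c C)) = (if C = B then (-1) ^ card C else 0) * ((-1) ^ card C * c C)"
   unfolding sum_distrib_right[symmetric] using alternating_interval_sum[OF B, of C, where 'r='r] C by simp
  also have "... = (if C = B then c B else 0)"
   by (simp add: mult.assoc[symmetric] power_mult_distrib[symmetric])
  finally show "(\<Sum>A\<in>{A\<in>Pow B. C \<subseteq> A}. (-1) ^ card A * ((-1) ^ card C * c C)) = (if C = B then c B else 0)" .
 qed
 finally show ?thesis using B by simp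
qed

lemma polymatroidD:
 assumes "polymatroid X rk" shows "finite X" "rk {} = 0" "A \<subseteq> B ==> B \<subseteq> X ==> rk A \<le> rk B"
 using assms by (auto simp: polymatroid_def)

text \<open>The recursion is solved for an abstract family: \<open>c B\<close> stands for the
  character of the ideal for \<open>B\<close> in m variables, \<open>\<Omega>\<close> for the
  inverse of \<sigma> there, and n - rk(B) for the dimension of the intersection of the subspaces in
  \<open>B\<close>. After multiplication by this power of \<open>\<Omega>\<close>,
  \<open>c B\<close> starts in degree |B|, while for nonempty \<open>B\<close> the alternating sum
  over subsets stops before degree |B|.\<close>

context
 fixes X :: "'x set" and rk :: "'x set => nat" and n m :: nat and c :: "'x set => xps" and \<Omega> :: xps
 assumes pm: "polymatroid X rk" and rkn: "!!B. B \<subseteq> X ==> rk B \<le> n" and \<Omega>: "res m sigma * \<Omega> = 1"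
  and base: "\<Omega> ^ n * c {} = 1"
  and low: "!!B M. B \<subseteq> X ==> size M < card B ==> xcoeff (\<Omega> ^ (n - rk B) * c B) M = 0"
  and eul: "!!B M. B \<subseteq> X ==> B ~= {} ==> card B \<le> size M ==>
   xcoeff (\<Omega> ^ (n - rk B) * (\<Sum>A\<in>Pow B. (-1) ^ card A * c A)) M = 0"
begin

definition alt :: "'x set => xps" where "alt B = (\<Sum>A\<in>Pow B. (-1) ^ card A * c A)"

lemma sigma_omega_power: "i \<le> j ==> \<Omega> ^ j * res m sigma ^ i = \<Omega> ^ (j - i)"
proof -
 assume "i \<le> j"
 then have "\<Omega> ^ j = \<Omega> ^ (j - i) * \<Omega> ^ i" by (simp add: power_add[symmetric])
 then have "\<Omega> ^ j * res m sigma ^ i = \<Omega> ^ (j - i) * (res m sigma * \<Omega>) ^ i" by (simp add: power_mult_distrib mult_ac)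
 then show ?thesis by (simp add: \<Omega>)
qed

text \<open>By Moebius inversion the sum over proper subsets becomes a combination of
  \<open>alt B\<close> and \<open>c B\<close>. After multiplication by the power of
  \<open>\<Omega>\<close> these live in complementary degrees, below |B| and from |B| on, so the
  truncation keeps exactly the \<open>alt B\<close> term.\<close>

lemma res_polyP: "B \<subseteq> X ==> res m (polyP B rk) = \<Omega> ^ (n - rk B) * alt B"
proof (induction "card B" arbitrary: B rule: less_induct)
 case less
 have finB: "finite B" using less.prems polymatroidD(1)[OF pm] finite_subset by blast
 show ?case
 proof (cases "B = {}")
  case True
  then show ?thesis using base polymatroidD(2)[OF pm] by (simp add: polyP.simps[of "{}"] res_hom alt_def)
 next
  case False
  let ?W = "\<Omega> ^ (n - rk B)"
  \<comment> \<open>The power of \<sigma> in the recursion converts the exponent n - rk(A) from the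
    induction hypothesis into n - rk(B), which is the same for all summands.\<close>
  have summand: "res m (polyP A rk * sigma ^ (rk B - rk A) * (-1) ^ (card B - card A)) = (-1) ^ card B * (?W * ((-1) ^ card A * alt A))" if A: "A \<subset> B" for A
  proof -
   have AX: "A \<subseteq> X" and r: "rk A \<le> rk B" "rk B \<le> n" using A less.prems polymatroidD(3)[OF pm, of A B] rkn by auto
   have "res m (polyP A rk) = \<Omega> ^ (n - rk A) * alt A" using less.hyps[of A] psubset_card_mono[OF finB A] AX by simp
   moreover have "\<Omega> ^ (n - rk A) * res m sigma ^ (rk B - rk A) = ?W"
    using sigma_omega_power[of "rk B - rk A" "n - rk A"] r by simp
   moreover have "(-1) ^ (card B - card A) = ((-1) ^ card B * (-1) ^ card A :: xps)"
    using card_mono[OF finB, of A] A by (auto simp: power_add[symmetric] minus_one_power_iff even_diff_nat)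
   ultimately show ?thesis by (simp add: res_hom res_power mult_ac)
  qed
  let ?f = "- (\<Sum>A | A \<subset> B. polyP A rk * sigma ^ (rk B - rk A) * (-1) ^ (card B - card A))"
  have Pow: "Pow B = insert B {A. A \<subset> B}" by auto
  have finP: "finite {A. A \<subset> B}" using finB by (intro finite_subset[of "{A. A \<subset> B}" "Pow B"]) auto
  have "c B = (-1) ^ card B * alt B + (\<Sum>A | A \<subset> B. (-1) ^ card A * alt A)"
   using moebius_Pow[OF finB, of c] unfolding alt_def[symmetric] Pow using finP by simp
  then have mob: "(\<Sum>A | A \<subset> B. (-1) ^ card A * alt A) = c B - (-1) ^ card B * alt B" by simp
  have sq: "(-1) ^ card B * ((-1) ^ card B * x) = (x :: xps)" for x by (simp add: mult.assoc[symmetric] power_mult_distrib[symmetric])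
  have "res m ?f = - (\<Sum>A | A \<subset> B. (-1) ^ card B * (?W * ((-1) ^ card A * alt A)))"
   unfolding res_hom(3) res_sum by (intro arg_cong[where f=uminus] sum.cong refl summand) simp
  also have "... = - ((-1) ^ card B * (?W * (c B - (-1) ^ card B * alt B)))"
   unfolding sum_distrib_left[symmetric] mob ..
  also have "... = ?W * alt B - (-1) ^ card B * (?W * c B)"
   by (simp add: right_diff_distrib mult.left_commute[of ?W] sq)
  finally have f: "res m ?f = ?W * alt B - (-1) ^ card B * (?W * c B)" .
  have "xcoeff (trunc (card B) (res m ?f)) M = xcoeff (?W * alt B) M" for M
   unfolding f using low[OF less.prems, of M] eul[OF less.prems False, of M]
   by (auto simp: trunc_def minus_xps.rep_eq xcoeff_sign alt_def)
  then have "trunc (card B) (res m ?f) = ?W * alt B" by (rule xps_eqI)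
  then show ?thesis using False finB by (simp add: polyP.simps[of B] res_trunc)
 qed
qed

lemma res_first: "res m (sigma ^ (n - rk X) * polyP X rk) = (\<Sum>A\<in>Pow X. (-1) ^ card A * c A)"
proof -
 have "res m (sigma ^ (n - rk X) * polyP X rk) = \<Omega> ^ (n - rk X) * res m sigma ^ (n - rk X) * alt X"
  using res_polyP[OF subset_refl] by (simp add: res_hom res_power mult_ac)
 then show ?thesis using sigma_omega_power[of "n - rk X" "n - rk X"] by (simp add: alt_def)
qed

text \<open>Substituting the inverse of \<sigma> for q cancels the powers depending on the rank and
  leaves an alternating sum of the \<open>alt A\<close>, which Moebius inversion turns into
  \<open>c X\<close>.\<close>

lemma res_second: "res m (sigma ^ n * polyH X rk sigma_inv (-1)) = c X"
proof -
 have inv: "res m sigma * res m sigma_inv = 1" unfolding res_hom(4)[symmetric] sigma_sigma_inv res_hom(1) ..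
 have \<Omega>i: "res m sigma_inv = \<Omega>"
 proof -
  have "\<Omega> = \<Omega> * (res m sigma * res m sigma_inv)" by (simp add: inv)
  also have "... = res m sigma_inv * (res m sigma * \<Omega>)" by (simp only: mult_ac)
  finally show ?thesis by (simp add: \<Omega>)
 qed
 have "res m (sigma ^ n * (polyP A rk * sigma_inv ^ rk A * (-1) ^ card A)) = (-1) ^ card A * alt A" if A: "A \<in> Pow X" for A
 proof -
  have "\<Omega> ^ (n - rk A) * \<Omega> ^ rk A = \<Omega> ^ n" using rkn[of A] A by (simp add: power_add[symmetric])
  moreover have "res m sigma ^ n * \<Omega> ^ n = 1" by (simp add: power_mult_distrib[symmetric] \<Omega>)
  moreover have "res m (sigma ^ n * (polyP A rk * sigma_inv ^ rk A * (-1) ^ card A))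
    = res m sigma ^ n * (\<Omega> ^ (n - rk A) * \<Omega> ^ rk A) * ((-1) ^ card A * alt A)"
   using res_polyP[of A] A by (simp add: res_hom res_power \<Omega>i mult_ac)
  ultimately show ?thesis by simp
 qed
 then have "res m (sigma ^ n * polyH X rk sigma_inv (-1)) = (\<Sum>A\<in>Pow X. (-1) ^ card A * alt A)"
  unfolding polyH_def sum_distrib_left res_sum by (intro sum.cong) auto
 then show ?thesis using moebius_Pow[OF polymatroidD(1)[OF pm], of c] by (simp add: alt_def)
qed

end

lemma sigma_Sym_bar: "sigma \<in> Sym_bar" by (simp add: Sym_bar_def xcoeff_sigma)

lemma sigma_inv_Sym_bar: "sigma_inv \<in> Sym_bar"
proof -
 let ?u = "Abs_xps (%M. if \<forall>x. count M x \<le> 1 then (-1) ^ size M else 0)"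
 have "sigma_inv = sigma_inv * (sigma * ?u)" by (simp only: sigma_times_alternating_elementary mult_1_right)
 also have "... = (sigma * sigma_inv) * ?u" by (simp only: mult_ac)
 finally have eq: "sigma_inv = ?u" by (simp only: sigma_sigma_inv mult_1_left)
 have "(\<forall>x. count (image_mset \<pi> M) x \<le> 1) \<longleftrightarrow> (\<forall>x. count M x \<le> 1)" if "bij \<pi>" for \<pi> and M :: "nat multiset"
 proof -
  have "count (image_mset \<pi> M) (\<pi> x) = count M x" for x
  proof -
   have "\<pi> -` {\<pi> x} = {x}" using bij_is_inj[OF that] by (auto simp: inj_eq)
   then show ?thesis unfolding count_image_mset by (cases "x \<in># M") (auto simp: count_eq_zero_iff)
  qed
  moreover have "surj \<pi>" using that by (rule bij_is_surj)
  ultimately show ?thesis by (metis surjD)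
 qed
 then show ?thesis unfolding eq Sym_bar_def by auto
qed

lemma theorem_series_Sym_bar:
 "sigma ^ k * polyP X rk \<in> Sym_bar" "sigma ^ k * polyH X rk sigma_inv (-1) \<in> Sym_bar"
proof -
 have P: "polyP A rk \<in> Sym_bar" for A using polyP_in_Sym[of A rk] by (simp add: Sym_def)
 have "- 1 \<in> Sym_bar" by (intro Sym_bar_minus Sym_bar_one)
 then show "sigma ^ k * polyP X rk \<in> Sym_bar" "sigma ^ k * polyH X rk sigma_inv (-1) \<in> Sym_bar"
  unfolding polyH_def
  by (intro Sym_bar_mult Sym_bar_power Sym_bar_sum sigma_Sym_bar sigma_inv_Sym_bar P; assumption?)+
qed

section \<open>Ideals of subspace arrangements\<close>

locale realized = wspace sW BW b m + vs: finite_dimensional_vector_space sV BV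
 for sW :: "'k::field_char_0 => 'w::ab_group_add => 'w" and BW b m
  and sV :: "'k => 'v::ab_group_add => 'v" and BV +
 fixes X :: "'x set" and V :: "'x => 'v set"
 assumes finX: "finite X" and Vsub: "x \<in> X ==> vs.subspace (V x)"
begin

abbreviation sY :: "'k => ('w => 'v) => 'w => 'v" where "sY \<equiv> %c \<phi> w. sV c (\<phi> w)"
abbreviation "td \<equiv> tensor_dual sV sW"
abbreviation "Y \<equiv> td UNIV"
abbreviation "Z \<equiv> %x. td (V x)"

lemma vector_space_sY: "vector_space sY"
 by unfold_locales (auto simp: fun_eq_iff vs.scale_right_distrib vs.scale_left_distrib)

sublocale ys: vector_space sY by (rule vector_space_sY)

definition vlin :: "('w => 'v) => bool" where
 "vlin \<phi> \<longleftrightarrow> (\<forall>u v. \<phi> (u + v) = \<phi> u + \<phi> v) & (\<forall>c u. \<phi> (sW c u) = sV c (\<phi> u))"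

lemma vlin_expand: assumes "vlin \<phi>" shows "\<phi> = (\<Sum>j<m. (%w. sV (crd j w) (\<phi> (b j))))"
proof
 fix w
 have z: "\<phi> 0 = 0" using assms unfolding vlin_def by (metis add_cancel_right_left)
 have s: "\<phi> (\<Sum>j\<in>F. f j) = (\<Sum>j\<in>F. \<phi> (f j))" for F :: "nat set" and f
  by (induction F rule: infinite_finite_induct) (use assms z in \<open>auto simp: vlin_def\<close>)
 have "\<phi> w = \<phi> (\<Sum>j<m. sW (crd j w) (b j))" by (rule arg_cong[OF crd_expand])
 also have "... = (\<Sum>j<m. sV (crd j w) (\<phi> (b j)))" unfolding s using assms by (simp add: vlin_def)
 finally show "\<phi> w = (\<Sum>j<m. (%w. sV (crd j w) (\<phi> (b j)))) w" by (simp add: sum_fun_apply)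
qed

text \<open>Expanding the argument in the basis of W writes a linear map as a finite sum of rank one
  maps, each a coordinate form times a value in \<open>S\<close>.\<close>

lemma td_iff: assumes S: "vs.subspace S" shows "\<phi> \<in> td S \<longleftrightarrow> vlin \<phi> & (\<forall>w. \<phi> w \<in> S)"
proof
 let ?G = "{(%w. sV (\<eta> w) v) | v \<eta>. v \<in> S & \<eta> \<in> dual}"
 have "ys.subspace {\<phi>. vlin \<phi> & (\<forall>w. \<phi> w \<in> S)}"
  unfolding ys.subspace_def
  using vs.subspace_0[OF S] vs.subspace_add[OF S] vs.subspace_scale[OF S]
  by (auto simp: vlin_def vs.scale_right_distrib vs.scale_left_commute)
 moreover have "?G \<subseteq> {\<phi>. vlin \<phi> & (\<forall>w. \<phi> w \<in> S)}"
  using vs.subspace_scale[OF S] by (auto simp: vlin_def dualD vs.scale_left_distrib)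
 ultimately have "td S \<subseteq> {\<phi>. vlin \<phi> & (\<forall>w. \<phi> w \<in> S)}" unfolding tensor_dual_def by (intro ys.span_minimal)
 then show "\<phi> \<in> td S ==> vlin \<phi> & (\<forall>w. \<phi> w \<in> S)" by blast
 assume \<phi>: "vlin \<phi> & (\<forall>w. \<phi> w \<in> S)"
 have "(%w. sV (crd j w) (\<phi> (b j))) \<in> ?G" for j using \<phi> crd_dual by blast
 then have "(\<Sum>j<m. (%w. sV (crd j w) (\<phi> (b j)))) \<in> td S"
  unfolding tensor_dual_def by (intro ys.span_sum ys.span_base)
 then show "\<phi> \<in> td S" by (rule subst[where P="%\<psi>. \<psi> \<in> td S", OF vlin_expand[OF \<phi>[THEN conjunct1], symmetric]])
qed

lemma Y_iff: "\<phi> \<in> Y \<longleftrightarrow> vlin \<phi>" using td_iff[OF vs.subspace_UNIV] by simp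

lemma Z_iff: "x \<in> X ==> \<phi> \<in> Z x \<longleftrightarrow> vlin \<phi> & (\<forall>w. \<phi> w \<in> V x)" using td_iff[OF Vsub] .

lemma vlin_comp: assumes g: "g \<in> GL sW" shows "vlin (\<phi> o g) \<longleftrightarrow> vlin \<phi>"
proof
 have c: "vlin (\<psi> o h)" if "vlin \<psi>" "h \<in> GL sW" for \<psi> h using that linD[OF GL_lin[OF that(2)]] by (simp add: vlin_def)
 show "vlin \<phi> ==> vlin (\<phi> o g)" using c g by blast
 assume "vlin (\<phi> o g)"
 then have "vlin (\<phi> o g o inv g)" by (rule c[OF _ GL_inv(1)[OF g]])
 then show "vlin \<phi>" by (simp only: comp_assoc GL_inv(2)[OF g] comp_id)
qed

definition Jact :: "('w => 'w) => (('w => 'v) => 'k) => ('w => 'v) => 'k" where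
 "Jact g f = (%\<phi>. f (\<phi> o g))"

definition eta :: "('w => 'v) => 'w => 'v" where "eta \<phi> = \<phi> o hW"

lemma J_module_fmod: "J_module sV sW V A = fmod Jact (prod_ideal sV sW V A)"
 by (simp add: J_module_def fmod_def Jact_def[abs_def])

lemma flinear_Jact: "flinear (Jact g)" by (rule flinearI) (auto simp: Jact_def fs_simps)

text \<open>A basis of \<open>S\<close> is extended to V and numbered so that the vectors from
  \<open>S\<close> come first; the coordinates with later numbers then vanish on
  \<open>S\<close>.\<close>

lemma adapted_basis:
 assumes S: "vs.subspace S"
 obtains v \<xi> where "!!i. i < vs.dim S ==> v i \<in> S" "!!i. \<xi> i \<in> dual_space sV"
  "!!i j. i < vs.dim UNIV ==> j < vs.dim UNIV ==> \<xi> i (v j) = (if i = j then 1 else 0)"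
  "!!u. u = (\<Sum>i<vs.dim UNIV. sV (\<xi> i u) (v i))"
  "!!u i. u \<in> S ==> vs.dim S \<le> i ==> i < vs.dim UNIV ==> \<xi> i u = 0" "vs.dim S \<le> vs.dim UNIV"
proof -
 let ?r = "vs.dim S" and ?n = "vs.dim UNIV"
 obtain B0 where B0: "B0 \<subseteq> S" "vs.independent B0" "S \<subseteq> vs.span B0" "card B0 = ?r" by (rule vs.basis_exists)
 define B1 where "B1 = vs.extend_basis B0"
 have B1: "B0 \<subseteq> B1" "vs.independent B1" "vs.span B1 = UNIV"
  using vs.extend_basis_superset[OF B0(2)] vs.independent_extend_basis[OF B0(2)] vs.span_extend_basis[OF B0(2)] by (auto simp: B1_def)
 have fin: "finite B1" "finite B0" using vs.finiteI_independent B1(2) B0(2) by blast+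
 have card1: "card B1 = ?n" using vs.dim_span_eq_card_independent[OF B1(2)] B1(3) by simp
 have rn: "?r \<le> ?n" using card_mono[OF fin(1) B1(1)] B0(4) card1 by simp
 obtain f0 where f0: "bij_betw f0 {..<?r} B0" using finite_same_card_bij[of "{..<?r}" B0] fin B0(4) by auto
 have "card {?r..<?n} = card (B1 - B0)" using card_Diff_subset[OF fin(2) B1(1)] B0(4) card1 by simp
 then obtain f1 where f1: "bij_betw f1 {?r..<?n} (B1 - B0)" using finite_same_card_bij[of "{?r..<?n}" "B1 - B0"] fin by auto
 define v where "v i = (if i < ?r then f0 i else f1 i)" for i
 have b0: "bij_betw v {..<?r} B0" using f0 by (subst bij_betw_cong[of _ _ f0]) (auto simp: v_def)
 have "bij_betw v {?r..<?n} (B1 - B0)" using f1 by (subst bij_betw_cong[of _ _ f1]) (auto simp: v_def)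
 then have "bij_betw v ({..<?r} Un {?r..<?n}) (B0 Un (B1 - B0))" by (rule bij_betw_combine[OF b0]) auto
 moreover have "{..<?r} Un {?r..<?n} = {..<?n}" "B0 Un (B1 - B0) = B1" using rn B1(1) by auto
 ultimately have v: "bij_betw v {..<?n} B1" by simp
 define \<xi> where "\<xi> i u = vs.representation B1 u (v i)" for i u
 have in1: "v i \<in> B1" if "i < ?n" for i using v that by (auto simp: bij_betw_def)
 show ?thesis
 proof (rule that[of v \<xi>])
  show "v i \<in> S" if "i < ?r" for i using b0 B0(1) that by (auto simp: bij_betw_def)
  have "vector_space ((*) :: 'k => 'k => 'k)" by (rule vector_space_mult)
  then show "\<xi> i \<in> dual_space sV" for i unfolding dual_space_def mem_Collect_eq Vector_Spaces.linear_iff \<xi>_def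
   using vs.vector_space_axioms B1(3) by (auto simp: vs.representation_add[OF B1(2)] vs.representation_scale[OF B1(2)])
  show "\<xi> i (v j) = (if i = j then 1 else 0)" if "i < ?n" "j < ?n" for i j
  proof -
   have "v i = v j \<longleftrightarrow> i = j" using v that by (auto simp: bij_betw_def inj_on_def)
   then show ?thesis by (auto simp: \<xi>_def vs.representation_basis[OF B1(2) in1[OF that(2)]])
  qed
  show "u = (\<Sum>i<?n. sV (\<xi> i u) (v i))" for u
  proof -
   have "u = (\<Sum>x\<in>B1. sV (vs.representation B1 u x) x)"
    using vs.sum_representation_eq[OF B1(2) _ fin(1) subset_refl, of u] B1(3) by simp
   also have "... = (\<Sum>i<?n. sV (\<xi> i u) (v i))" unfolding \<xi>_def by (rule sum.reindex_bij_betw[OF v, symmetric])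
   finally show ?thesis .
  qed
  show "\<xi> i u = 0" if u: "u \<in> S" and i: "?r \<le> i" "i < ?n" for u i
  proof -
   have "u \<in> vs.span B0" using u B0(3) by blast
   then have "vs.representation B1 u = vs.representation B0 u" by (rule vs.representation_extend[OF B1(2) _ B1(1)])
   moreover have "v i \<notin> B0"
   proof
    assume "v i \<in> B0"
    then obtain i' where i': "i' < ?r" "v i = v i'" using b0 by (auto simp: bij_betw_def)
    have "i' \<in> {..<?n}" "i \<in> {..<?n}" using i' i rn by simp_all
    then have "i = i'" using inj_onD[OF bij_betw_imp_inj_on[OF v] i'(2)] by blast
    then show False using i' i by simp
   qed
   ultimately show ?thesis unfolding \<xi>_def using vs.representation_ne_zero[of B0 u "v i"] by auto
  qed
 qed (rule rn)
qed

end

text \<open>One instance for each subset \<open>B\<close>, with r the dimension of the intersection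
  of the \<open>V x\<close> over \<open>B\<close> and the first r basis vectors inside it. The
  ideals do not depend on the basis, which is what links the instances for different
  subsets.\<close>

locale adapted = realized sW BW b m sV BV X V
 for sW :: "'k::field_char_0 => 'w::ab_group_add => 'w" and BW b m
  and sV :: "'k => 'v::ab_group_add => 'v" and BV and X :: "'x set" and V +
 fixes B :: "'x set" and v :: "nat => 'v" and \<xi> :: "nat => 'v => 'k" and n r :: nat
 assumes BX: "B \<subseteq> X" and v_in: "i < r ==> x \<in> B ==> v i \<in> V x" and xi_dual: "\<xi> i \<in> dual_space sV"
  and xi_v: "i < n ==> j < n ==> \<xi> i (v j) = (if i = j then 1 else 0)"
  and v_expand: "u = (\<Sum>i<n. sV (\<xi> i u) (v i))"
  and xi_zero: "(!!x. x \<in> B ==> u \<in> V x) ==> r \<le> i ==> i < n ==> \<xi> i u = 0" and rn: "r \<le> n"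
begin

text \<open>The entry in row \<open>fst c\<close> and column \<open>snd c\<close> of the matrix of a
  linear map from W to V. The diagonal matrix on W scales column j by the prime with number j, so
  the weight of a coordinate is its column.\<close>

definition \<zeta> :: "nat \<times> nat => ('w => 'v) => 'k" where "\<zeta> c \<phi> = \<xi> (fst c) (\<phi> (b (snd c)))"
definition ev :: "nat \<times> nat => 'w => 'v" where "ev c = (%w. sV (crd (snd c) w) (v (fst c)))"
abbreviation "C \<equiv> {..<n} \<times> {..<m}"

lemma xi_linear: "\<xi> i (u + u') = \<xi> i u + \<xi> i u'" "\<xi> i (sV a u) = a * \<xi> i u"
proof -
 have "Vector_Spaces.linear sV (*) (\<xi> i)" using xi_dual by (simp add: dual_space_def)
 then show "\<xi> i (u + u') = \<xi> i u + \<xi> i u'" "\<xi> i (sV a u) = a * \<xi> i u"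
  by (simp_all add: Vector_Spaces.linear_iff)
qed

lemma ev_Y: "ev c \<in> Y"
 unfolding Y_iff vlin_def ev_def by (simp add: dualD[OF crd_dual] vs.scale_left_distrib)

lemma zeta_ev: "c \<in> C ==> c' \<in> C ==> \<zeta> c (ev c') = (if c = c' then 1 else 0)"
 by (cases c; cases c') (auto simp: \<zeta>_def ev_def xi_linear xi_v crd_b)

lemma Y_expand: assumes "\<phi> \<in> Y" shows "\<phi> = (\<Sum>c\<in>C. sY (\<zeta> c \<phi>) (ev c))"
proof
 fix w
 have "\<phi> w = (\<Sum>j<m. sV (crd j w) (\<phi> (b j)))" using fun_cong[OF vlin_expand[OF assms[unfolded Y_iff]], of w] unfolding sum_fun_apply .
 also have "... = (\<Sum>j<m. sV (crd j w) (\<Sum>i<n. sV (\<xi> i (\<phi> (b j))) (v i)))" unfolding v_expand[symmetric] ..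
 also have "... = (\<Sum>i<n. \<Sum>j<m. sV (\<xi> i (\<phi> (b j))) (sV (crd j w) (v i)))"
  unfolding vs.scale_sum_right by (subst sum.swap) (simp add: mult.commute)
 also have "... = (\<Sum>c\<in>C. sV (\<zeta> c \<phi>) (ev c w))" by (simp add: sum.cartesian_product case_prod_unfold \<zeta>_def ev_def)
 finally show "\<phi> w = (\<Sum>c\<in>C. sY (\<zeta> c \<phi>) (ev c)) w" by (simp add: sum_fun_apply)
qed

lemma dual_sum: assumes "l \<in> dual_space sY" shows "l (\<Sum>c\<in>F. sY (a c) (f c)) = (\<Sum>c\<in>F. a c * l (f c))"
proof -
 have l: "l (y + y') = l y + l y'" "l (sY c y) = c * l y" for y y' c
  using assms by (simp_all add: dual_space_def Vector_Spaces.linear_iff)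
 have l0: "l 0 = 0" using l(1)[of 0 0] by simp
 show ?thesis
 proof (induction F rule: infinite_finite_induct)
  case (infinite F)
  show ?case by (simp only: sum.infinite[OF infinite] l0)
 next
  case (insert c F)
  show ?case unfolding sum.insert[OF insert.hyps] l insert.IH ..
 qed (simp only: sum.empty l0)
qed

sublocale wf: weighted_forms sY B Z eta C \<zeta> snd Y
proof unfold_locales
 show "finite B" using BX finX finite_subset by blast
 show "ys.subspace (Z x)" for x unfolding tensor_dual_def by (rule ys.subspace_span)
 show "eta (\<phi> + \<psi>) = eta \<phi> + eta \<psi>" for \<phi> \<psi> :: "'w => 'v" by (auto simp: eta_def fun_eq_iff)
 show "eta (sY a \<phi>) = sY a (eta \<phi>)" for a \<phi> by (simp add: eta_def fun_eq_iff)
 show "eta \<phi> \<in> Z x" if "x \<in> B" "\<phi> \<in> Z x" for x \<phi>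
  using that BX Z_iff[of x] vlin_comp[OF hW_GL] unfolding eta_def by auto
 show "finite C" by simp
 show "\<zeta> c \<in> dual_space sY" if "c \<in> C" for c
  using vector_space_sY vector_space_mult by (simp add: dual_space_def Vector_Spaces.linear_iff \<zeta>_def xi_linear)
 show "\<zeta> c (eta \<phi>) = of_nat (nprime (snd c)) * \<zeta> c \<phi>" if "c \<in> C" "\<phi> \<in> Y" for c \<phi>
  using that by (auto simp: eta_def \<zeta>_def hW_b Y_iff vlin_def xi_linear)
 show "\<exists>a. \<forall>\<phi>\<in>Y. l \<phi> = (\<Sum>c\<in>C. a c * \<zeta> c \<phi>)" if l: "l \<in> dual_space sY" for l
 proof (intro exI ballI)
  fix \<phi> assume "\<phi> \<in> Y"
  have "l \<phi> = l (\<Sum>c\<in>C. sY (\<zeta> c \<phi>) (ev c))" by (rule arg_cong[OF Y_expand[OF \<open>\<phi> \<in> Y\<close>]])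
  also have "... = (\<Sum>c\<in>C. l (ev c) * \<zeta> c \<phi>)" unfolding dual_sum[OF l] by (simp add: mult.commute)
  finally show "l \<phi> = (\<Sum>c\<in>C. l (ev c) * \<zeta> c \<phi>)" .
 qed
qed

definition Sl :: "(nat \<times> nat) set => ('w => 'v) set" where "Sl F = {\<phi> \<in> Y. \<forall>c\<in>F. \<zeta> c \<phi> = 0}"

lemma Sl_insert: "Sl (insert c F) = {\<phi> \<in> Sl F. \<zeta> c \<phi> = 0}" by (auto simp: Sl_def)
lemma ev_Sl: "F \<subseteq> C ==> c \<in> C ==> c \<notin> F ==> ev c \<in> Sl F" using zeta_ev ev_Y by (auto simp: Sl_def)

lemma good_Y: "wf.good Y"
proof -
 have "Y = ys.span (ev ` C)"
 proof
  show "ys.span (ev ` C) \<subseteq> Y" using ev_Y ys.subspace_span by (intro ys.span_minimal) (auto simp: tensor_dual_def)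
  show "Y \<subseteq> ys.span (ev ` C)"
  proof
   fix \<phi> assume \<phi>: "\<phi> \<in> Y"
   have "(\<Sum>c\<in>C. sY (\<zeta> c \<phi>) (ev c)) \<in> ys.span (ev ` C)" by (intro ys.span_sum ys.span_scale ys.span_base imageI)
   then show "\<phi> \<in> ys.span (ev ` C)" by (rule subst[where P="%\<psi>. \<psi> \<in> ys.span (ev ` C)", OF Y_expand[OF \<phi>, symmetric]])
  qed
 qed
 moreover have "eta \<phi> \<in> Y \<longleftrightarrow> \<phi> \<in> Y" for \<phi> unfolding eta_def Y_iff by (rule vlin_comp[OF hW_GL])
 ultimately show ?thesis unfolding wf.good_def
  by (intro conjI subset_refl exI[of _ "ev ` C"] allI) (assumption | simp)+
qed

lemma good_Sl: "F \<subseteq> C ==> wf.good (Sl F)"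
proof -
 assume "F \<subseteq> C"
 then have "finite F" by (rule finite_subset) simp
 then show ?thesis using \<open>F \<subseteq> C\<close>
 proof (induction F)
  case empty
  then show ?case using good_Y by (simp add: Sl_def)
 next
  case (insert c F)
  then show ?case unfolding Sl_insert using ev_Sl zeta_ev[of c c]
   by (intro wf.good_slice[where e="ev c"]) auto
 qed
qed

definition chx :: "('w => 'v) set => 'x set => xps" where
 "chx S A = Abs_xps (%M. if set_mset M \<subseteq> {..<m} then int (wf.ch S A M) else 0)"

lemma res_chx: "res m (chx S A) = chx S A" by (rule xps_eqI) (simp add: chx_def)

text \<open>A coordinate with row below r has its dual vector \<open>ev c\<close> in every
  \<open>Z x\<close> with \<open>x \<in> A\<close>, so requiring it to vanish multiplies the series
  by one factor. The dual vectors of the remaining coordinates stay in the slice, which allows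
  iteration.\<close>

lemma chx_Sl:
 assumes A: "A \<subseteq> B" and F: "F \<subseteq> {..<r} \<times> {..<m}"
 shows "chx (Sl F) A = (\<Prod>c\<in>F. 1 - xvar (snd c)) * chx Y A"
proof -
 have "finite F" using F by (rule finite_subset) simp
 then show ?thesis using F
 proof (induction F)
  case empty
  have "Sl {} = Y" by (simp add: Sl_def)
  then show ?case by simp
 next
  case (insert c F)
  have cC: "c \<in> C" "F \<subseteq> C" "fst c < r" "snd c < m" using insert.prems rn by auto
  have e: "ev c \<in> Sl F" "\<zeta> c (ev c) ~= 0" using ev_Sl[OF cC(2,1)] insert.hyps zeta_ev[OF cC(1,1)] by auto
  have eZ: "ev c \<in> Z x" if "x \<in> A" for x
  proof -
   have x: "x \<in> X" "x \<in> B" using that A BX by auto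
   show ?thesis using ev_Y[of c] v_in[OF cC(3) x(2)] vs.subspace_scale[OF Vsub[OF x(1)]]
    unfolding Z_iff[OF x(1)] Y_iff by (simp add: ev_def)
  qed
  have "chx (Sl (insert c F)) A = (1 - xvar (snd c)) * chx (Sl F) A"
  proof (rule xps_eqI)
   fix M
   have "set_mset (M - {#snd c#}) \<subseteq> {..<m} \<longleftrightarrow> set_mset M \<subseteq> {..<m}" if "snd c \<in># M"
   proof -
    have "set_mset M = insert (snd c) (set_mset (M - {#snd c#}))"
     using arg_cong[OF insert_DiffM[OF that], of set_mset] by simp
    then show ?thesis using cC(4) by auto
   qed
   then show "xcoeff (chx (Sl (insert c F)) A) M = xcoeff ((1 - xvar (snd c)) * chx (Sl F) A) M"
    using wf.ch_slice[OF good_Sl[OF cC(2)] A cC(1) e eZ, of M] unfolding xcoeff_one_minus_xvar Sl_insert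
    by (auto simp: chx_def)
  qed
  then show ?case using insert by (simp add: mult.assoc)
 qed
qed

abbreviation "S0 \<equiv> Sl ({..<r} \<times> {..<m})"

lemma chx_S0: assumes "A \<subseteq> B" shows "chx S0 A = res m (omega m) ^ r * chx Y A"
proof -
 have "(\<Prod>c\<in>{..<r} \<times> {..<m}. 1 - xvar (snd c)) = omega m ^ r"
  using prod.cartesian_product[of "%i j. 1 - xvar j" "{..<m}" "{..<r}"] by (simp add: omega_def case_prod_unfold)
 then have "chx S0 A = omega m ^ r * chx Y A" using chx_Sl[OF assms subset_refl] by simp
 from arg_cong[OF this, of "res m"] show ?thesis unfolding res_chx res_hom(4) res_power .
qed

lemma S0_good: "wf.good S0" using rn by (intro good_Sl) auto

text \<open>On \<open>S0\<close> the first r rows vanish, and a map with values in the intersection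
  has all its later rows 0. This is the arrangement with zero intersection to which exactness
  applies.\<close>

lemma S0_Z: assumes \<phi>: "\<phi> \<in> S0" "\<forall>x\<in>B. \<phi> \<in> Z x" shows "\<phi> = 0"
proof -
 have Y: "\<phi> \<in> Y" using \<phi>(1) by (simp add: Sl_def)
 have V: "\<phi> w \<in> V x" if "x \<in> B" for x w using \<phi>(2) that BX Z_iff[of x \<phi>] by auto
 have "\<zeta> c \<phi> = 0" if c: "c \<in> C" for c
 proof (cases "fst c < r")
  case True
  then show ?thesis using \<phi>(1) c by (auto simp: Sl_def)
 next
  case False
  then show ?thesis using xi_zero[OF V] c by (auto simp: \<zeta>_def)
 qed
 then have "(\<Sum>c\<in>C. sY (\<zeta> c \<phi>) (ev c)) = 0" by (intro sum.neutral ballI) (simp add: zero_fun_def)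
 then show ?thesis by (rule trans[OF Y_expand[OF Y]])
qed

lemma chx_euler:
 assumes "B ~= {}" "card B \<le> size M"
 shows "xcoeff (res m (omega m) ^ r * (\<Sum>A\<in>Pow B. (-1) ^ card A * chx Y A)) M = 0"
proof -
 have "res m (omega m) ^ r * (\<Sum>A\<in>Pow B. (-1) ^ card A * chx Y A) = (\<Sum>A\<in>Pow B. (-1) ^ card A * chx S0 A)"
  unfolding sum_distrib_left using chx_S0 by (intro sum.cong) (auto simp: mult.left_commute)
 moreover have "(\<Sum>A\<in>Pow B. (-1) ^ card A * int (wf.ch S0 A M)) = 0" by (rule wf.euler[OF S0_good S0_Z assms])
 ultimately show ?thesis by (cases "set_mset M \<subseteq> {..<m}") (simp_all add: xcoeff_sum xcoeff_sign chx_def)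
qed

lemma chx_low: assumes "size M < card B" shows "xcoeff (res m (omega m) ^ r * chx Y B) M = 0"
proof -
 have "f y = 0" if "wf.J B (size M) f" for f y by (rule wf.J_small[OF that _ assms]) (use BX finX finite_subset in blast)
 then have "wf.N S0 B (size M) \<subseteq> {0}" by (auto simp: wf.N_def wf.rs_def zero_fun_def)
 then have "eig wf.H (wf.N S0 B (size M)) (theta M) \<subseteq> {0}" using eig_subset by blast
 then have "eig wf.H (wf.N S0 B (size M)) (theta M) = {0}"
  using fs.subspace_0[OF subspace_eig[OF wf.flinear_H wf.N_subspace]] by blast
 then have "wf.ch S0 B M = 0" by (simp only: wf.ch_def fs_dim_zero)
 then show ?thesis unfolding chx_S0[OF subset_refl, symmetric] by (simp add: chx_def)
qed

lemma chx_base: assumes "B = {}" "r = n" shows "res m (omega m) ^ n * chx Y {} = 1"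
proof -
 have "0 \<in> S0" by (rule ys.subspace_0[OF wf.goodD(2)[OF S0_good]])
 then have "S0 = {0}" using S0_Z assms(1) by auto
 then have "xcoeff (chx S0 {}) M = xcoeff 1 M" for M using wf.ch_zero S0_good by (simp add: chx_def one_xps.rep_eq)
 then have "chx S0 {} = 1" by (rule xps_eqI)
 then show ?thesis using chx_S0[of "{}"] assms(2) by simp
qed

end

section \<open>Product ideals as graded polynomial modules\<close>

context adapted
begin

definition I :: "'x set => (('w => 'v) => 'k) set" where "I A = fs.span (\<Union>k. wf.N Y A k)"

lemma N_I: "wf.N Y A k \<subseteq> I A" unfolding I_def using fs.span_superset by blast

lemma I_linear_image:
 assumes "flinear h" "!!k u. u \<in> wf.N Y A k ==> h u \<in> T" "fs.subspace T" "u \<in> I A" shows "h u \<in> T"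
proof -
 have "h ` I A = fs.span (h ` (\<Union>k. wf.N Y A k))" unfolding I_def by (rule fsp.linear_span_image[OF assms(1), symmetric])
 also have "... \<subseteq> T" by (rule fs.span_minimal[OF _ assms(3)]) (use assms(2) in blast)
 finally show ?thesis using assms(4) by blast
qed

lemma I_subspace: "fs.subspace (I A)" by (simp add: I_def)

lemma N_mult:
 assumes "u \<in> wf.N Y A k" "u' \<in> wf.N Y A' l" "A Int A' = {}" shows "u * u' \<in> I (A Un A')"
proof -
 obtain f f' where f: "wf.J A k f" "u = wf.rs Y f" "wf.J A' l f'" "u' = wf.rs Y f'" using assms by (auto simp: wf.N_def)
 have "u * u' = wf.rs Y (%y. f y * f' y)" by (auto simp: f wf.rs_def)
 then have "u * u' \<in> wf.N Y (A Un A') (k + l)" using wf.J_mult[OF f(1) assms(3) f(3)] by (auto simp: wf.N_def)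
 then show ?thesis using N_I by blast
qed

lemma I_mult: assumes "u \<in> I A" "u' \<in> I A'" "A Int A' = {}" shows "u * u' \<in> I (A Un A')"
proof -
 have 1: "flinear (%u. u * u')" for u' :: "('w => 'v) => 'k" by (rule flinearI) (auto simp: fs_simps algebra_simps)
 have 2: "flinear (%u'. u * u')" for u :: "('w => 'v) => 'k" by (rule flinearI) (auto simp: fs_simps algebra_simps)
 have "u * u' \<in> I (A Un A')" if "u' \<in> wf.N Y A' l" for u' l
  by (rule I_linear_image[OF 1 _ I_subspace assms(1)]) (rule N_mult[OF _ that assms(3)])
 then show ?thesis by (rule I_linear_image[OF 2 _ I_subspace assms(2)])
qed

lemma poly_supp: "f \<in> poly_fun sV sW ==> \<phi> \<notin> Y ==> f \<phi> = 0"
 by (induction rule: poly_fun.induct) auto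

lemma poly_scale: assumes "f \<in> poly_fun sV sW" shows "fscale c f \<in> poly_fun sV sW"
proof -
 have "fscale c f = (%\<phi>. if \<phi> \<in> Y then c else 0) * f" using poly_supp[OF assms] by (auto simp: fscale_def)
 then show ?thesis using poly_fun.mult[OF poly_fun.const assms] by simp
qed

lemma poly_zero: "0 \<in> poly_fun sV sW" using poly_fun.const[where c=0 and sV=sV and sW=sW] by (simp add: zero_fun_def)

lemma poly_sum: "(!!i. i \<in> F ==> f i \<in> poly_fun sV sW) ==> (\<Sum>i\<in>F. f i) \<in> poly_fun sV sW"
 by (induction F rule: infinite_finite_induct) (auto intro: poly_zero poly_fun.add)

lemma Lin_poly: assumes l: "l \<in> wf.Lin" shows "wf.rs Y l \<in> poly_fun sV sW"
proof -
 obtain a where a: "\<forall>\<phi>\<in>Y. l \<phi> = (\<Sum>c\<in>C. a c * \<zeta> c \<phi>)" using wf.zeta_span[OF l] by blast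
 have "wf.rs Y l = (\<Sum>c\<in>C. fscale (a c) (%\<phi>. if \<phi> \<in> Y then \<xi> (fst c) (\<phi> (b (snd c))) else 0))"
  using a by (auto simp: wf.rs_def fs_simps \<zeta>_def)
 also have "... \<in> poly_fun sV sW" by (intro poly_sum poly_scale poly_fun.coord xi_dual)
 finally show ?thesis .
qed

lemma poly_in_I: "f \<in> poly_fun sV sW ==> f \<in> I {}"
proof (induction rule: poly_fun.induct)
 case (const c)
 have "(%\<phi>. if \<phi> \<in> Y then c else 0) = wf.rs Y (%y. c * 1)" by (simp add: wf.rs_def)
 also have "... \<in> wf.N Y {} 0" using wf.J.scale[OF wf.J.one] unfolding wf.N_def by blast
 finally show ?case using N_I by blast
next
 case (coord \<xi>' w)
 have "(%\<phi>. \<xi>' (\<phi> w)) \<in> wf.Lin" using coord vector_space_sY vector_space_mult by (simp add: dual_space_def Vector_Spaces.linear_iff)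
 then have "wf.J {} (Suc 0) (%\<phi>. \<xi>' (\<phi> w) * 1)" by (rule wf.J.lin[OF _ wf.J.one])
 moreover have "(%\<phi>. if \<phi> \<in> Y then \<xi>' (\<phi> w) else 0) = wf.rs Y (%\<phi>. \<xi>' (\<phi> w) * 1)" by (simp add: wf.rs_def)
 ultimately have "(%\<phi>. if \<phi> \<in> Y then \<xi>' (\<phi> w) else 0) \<in> wf.N Y {} (Suc 0)" unfolding wf.N_def by blast
 then show ?case using N_I by blast
next
 case (add f f')
 show ?case by (rule fs.subspace_add[OF I_subspace add.IH])
next
 case (mult f f')
 show ?case using I_mult[OF mult.IH Int_empty_left] by (simp only: Un_empty_left)
qed

text \<open>Subtracting the composition with a projection of V to \<open>V x\<close> carries all
  polynomial functions into the ideal generated by linear forms, and it fixes a function that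
  vanishes on maps into \<open>V x\<close>.\<close>

lemma vanishing_in_I: assumes x: "x \<in> B" and f: "f \<in> vanishing_ideal sV sW (V x)" shows "f \<in> I {x}"
proof -
 have xX: "x \<in> X" using x BX by blast
 interpret vv: vector_space_pair sV sV by unfold_locales
 have "\<exists>p. range p \<subseteq> V x & Vector_Spaces.linear sV sV p & (\<forall>u\<in>V x. p (id u) = u)"
  by (rule vv.linear_exists_left_inverse_on[OF vs.linear_id Vsub[OF xX]]) simp
 then obtain p where p: "range p \<subseteq> V x" "Vector_Spaces.linear sV sV p" "!!u. u \<in> V x ==> p u = u" by auto
 have plin: "p (u + u') = p u + p u'" "p (sV a u) = sV a (p u)" for u u' a
  using vv.linear_add[OF p(2)] vv.linear_scale[OF p(2)] by auto
 define D where "D f = wf.rs Y (%\<phi>. f \<phi> - f (p o \<phi>))" for f :: "('w => 'v) => 'k"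
 have PY: "p o \<phi> \<in> Z x" if "\<phi> \<in> Y" for \<phi> using that p(1) plin unfolding Y_iff Z_iff[OF xX] vlin_def by auto
 have ZY: "Z x \<subseteq> Y" using Z_iff[OF xX] Y_iff by blast
 have lD: "flinear D" by (rule flinearI) (auto simp: D_def wf.rs_def fs_simps algebra_simps)
 have "D u \<in> I {x}" if u: "u \<in> wf.N Y {} k" for u k
 proof -
  obtain g where g: "wf.J {} k g" "u = wf.rs Y g" using u by (auto simp: wf.N_def)
  have "wf.J {x} k (%\<phi>. g \<phi> - g (p o \<phi>))"
  proof (rule wf.J_minus_projection[OF _ _ _ g(1)])
   show "p o (\<phi> + \<psi>) = (p o \<phi>) + (p o \<psi>)" for \<phi> \<psi> :: "'w => 'v" by (simp add: fun_eq_iff plin)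
   show "p o sY a \<phi> = sY a (p o \<phi>)" for a \<phi> by (simp add: fun_eq_iff plin)
   show "p o \<phi> = \<phi>" if "\<phi> \<in> Z x" for \<phi> using that p(3) Z_iff[OF xX] by (auto simp: fun_eq_iff)
  qed
  moreover have "D u = wf.rs Y (%\<phi>. g \<phi> - g (p o \<phi>))" using PY ZY by (auto simp: D_def g(2) wf.rs_def fun_eq_iff)
  ultimately have "D u \<in> wf.N Y {x} k" unfolding wf.N_def by blast
  then show ?thesis using N_I by blast
 qed
 moreover have "f \<in> I {}" using f poly_in_I by (auto simp: vanishing_ideal_def)
 ultimately have "D f \<in> I {x}" by (rule I_linear_image[OF lD _ I_subspace])
 moreover have "D f = f" using f PY poly_supp by (auto simp: D_def wf.rs_def vanishing_ideal_def fun_eq_iff)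
 ultimately show ?thesis by (simp only:)
qed

lemma finB: "A \<subseteq> B ==> finite A" by (rule finite_subset[OF subset_trans[OF _ BX] finX])

abbreviation "PI \<equiv> prod_ideal sV sW V"

lemma prod_in_I:
 assumes A: "A \<subseteq> B" and f: "!!x. x \<in> A ==> f x \<in> vanishing_ideal sV sW (V x)" and q: "q \<in> poly_fun sV sW"
 shows "q * (\<Prod>x\<in>A. f x) \<in> I A"
 using finB[OF A] A f
proof (induction A)
 case empty
 then show ?case using poly_in_I[OF q] by simp
next
 case (insert x A)
 have v: "f x \<in> I {x}" by (rule vanishing_in_I) (use insert.prems in auto)
 have IH: "q * (\<Prod>x\<in>A. f x) \<in> I A" by (rule insert.IH) (use insert.prems in auto)
 have "q * (\<Prod>x\<in>insert x A. f x) = f x * (q * (\<Prod>x\<in>A. f x))" by (simp only: prod.insert[OF insert.hyps] mult.left_commute)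
 moreover have "{x} Int A = {}" using insert.hyps by simp
 ultimately show ?case using I_mult[OF v IH] by (simp only: insert_is_Un[symmetric])
qed

lemma PI_subspace: "fs.subspace (PI A)" by (simp add: prod_ideal_def)

lemma PI_linear_image:
 assumes "flinear h" "!!r f. r \<in> poly_fun sV sW ==> \<forall>x\<in>A. f x \<in> vanishing_ideal sV sW (V x) ==> h (r * (\<Prod>x\<in>A. f x)) \<in> PI A'"
  "u \<in> PI A"
 shows "h u \<in> PI A'"
proof -
 let ?G = "{r * (\<Prod>x\<in>A. f x) | r f. r \<in> poly_fun sV sW & (\<forall>x\<in>A. f x \<in> vanishing_ideal sV sW (V x))}"
 have "h ` PI A = fs.span (h ` ?G)" unfolding prod_ideal_def by (rule fsp.linear_span_image[OF assms(1), symmetric])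
 also have "... \<subseteq> PI A'" by (rule fs.span_minimal[OF _ PI_subspace]) (use assms(2) in blast)
 finally show ?thesis using assms(3) by blast
qed

lemma PI_gen: "q \<in> poly_fun sV sW ==> \<forall>x\<in>A. f x \<in> vanishing_ideal sV sW (V x) ==> q * (\<Prod>x\<in>A. f x) \<in> PI A"
 unfolding prod_ideal_def by (rule fs.span_base) blast

lemma flinear_times: "flinear (%u. q * u)" for q :: "('w => 'v) => 'k"
 by (rule flinearI) (auto simp: fs_simps algebra_simps)

lemma J_in_PI: "wf.J A k f ==> A \<subseteq> B ==> wf.rs Y f \<in> PI A"
proof (induction rule: wf.J.induct)
 case one
 have "wf.rs Y (%y. 1) \<in> poly_fun sV sW" unfolding wf.rs_def by (rule poly_fun.const)
 from PI_gen[OF this, of "{}" "%_. 0"] show ?case by (simp only: ball_empty prod.empty mult_1_right simp_thms)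
next
 case (zero A k)
 have "wf.rs Y (%y. 0) = 0" by (simp add: wf.rs_def zero_fun_def)
 then show ?case using fs.subspace_0[OF PI_subspace] by (simp only:)
next
 case (add A k f g)
 have "wf.rs Y (%y. f y + g y) = wf.rs Y f + wf.rs Y g" by (auto simp: wf.rs_def)
 then show ?case using fs.subspace_add[OF PI_subspace add.IH(1)[OF add.prems] add.IH(2)[OF add.prems]] by (simp only:)
next
 case (scale A k f c)
 have "wf.rs Y (%y. c * f y) = fscale c (wf.rs Y f)" by (auto simp: wf.rs_def fscale_def)
 then show ?case using fs.subspace_scale[OF PI_subspace scale.IH[OF scale.prems]] by (simp only:)
next
 case (lin l A k f)
 have "wf.rs Y l * wf.rs Y f \<in> PI A"
 proof (rule PI_linear_image[OF flinear_times _ lin.IH[OF lin.prems]])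
  fix r f assume "r \<in> poly_fun sV sW" "\<forall>x\<in>A. f x \<in> vanishing_ideal sV sW (V x)"
  then show "wf.rs Y l * (r * (\<Prod>x\<in>A. f x)) \<in> PI A"
   unfolding mult.assoc[symmetric] by (intro PI_gen poly_fun.mult Lin_poly lin.hyps)
 qed
 moreover have "wf.rs Y l * wf.rs Y f = wf.rs Y (%y. l y * f y)" by (auto simp: wf.rs_def)
 ultimately show ?case by (simp only:)
next
 case (fac x A l k f)
 have A: "A \<subseteq> B" "x \<in> X" "finite A" using fac.prems BX finB by auto
 have ZY: "Z x \<subseteq> Y" using Z_iff[OF A(2)] Y_iff by blast
 have lv: "wf.rs Y l \<in> vanishing_ideal sV sW (V x)"
  using Lin_poly[OF wf.L_Lin[OF fac(2)]] fac(2) ZY by (auto simp: vanishing_ideal_def wf.rs_def wf.L_def)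
 have "wf.rs Y l * wf.rs Y f \<in> PI (insert x A)"
 proof (rule PI_linear_image[OF flinear_times _ fac.IH[OF A(1)]])
  fix r g assume g: "r \<in> poly_fun sV sW" "\<forall>x\<in>A. g x \<in> vanishing_ideal sV sW (V x)"
  have "(\<Prod>v\<in>A. (g(x := wf.rs Y l)) v) = (\<Prod>v\<in>A. g v)" using fac(1) by (intro prod.cong) auto
  then have "wf.rs Y l * (r * (\<Prod>v\<in>A. g v)) = r * (\<Prod>v\<in>insert x A. (g(x := wf.rs Y l)) v)"
   using fac(1) A(3) by (simp add: mult.left_commute)
  also have "... \<in> PI (insert x A)" by (rule PI_gen[OF g(1)]) (use g(2) lv in auto)
  finally show "wf.rs Y l * (r * (\<Prod>v\<in>A. g v)) \<in> PI (insert x A)" .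
 qed
 moreover have "wf.rs Y l * wf.rs Y f = wf.rs Y (%y. l y * f y)" by (auto simp: wf.rs_def)
 ultimately show ?case by (simp only:)
qed

text \<open>This frees the graded description from the chosen basis, so that instances for different
  subsets speak about the same ideals.\<close>

lemma PI_eq_I: assumes A: "A \<subseteq> B" shows "PI A = I A"
proof
 show "PI A \<subseteq> I A" unfolding prod_ideal_def
  by (rule fs.span_minimal[OF _ I_subspace]) (use prod_in_I[OF A] in blast)
 show "I A \<subseteq> PI A" unfolding I_def
  by (rule fs.span_minimal[OF _ PI_subspace]) (use J_in_PI[OF _ A] in \<open>auto simp: wf.N_def\<close>)
qed

lemma H_Jact: "wf.H = Jact hW" by (intro ext) (simp add: wf.H_def Jact_def eta_def)

text \<open>A weight determines its degree, so an eigenvector in the sum of all degrees has a single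
  homogeneous component.\<close>

lemma eig_I: assumes A: "A \<subseteq> B" shows "eig wf.H (I A) (theta M) = eig wf.H (wf.N Y A (size M)) (theta M)"
proof
 show "eig wf.H (wf.N Y A (size M)) (theta M) \<subseteq> eig wf.H (I A) (theta M)" using N_I by (auto simp: eig_def)
 show "eig wf.H (I A) (theta M) \<subseteq> eig wf.H (wf.N Y A (size M)) (theta M)"
 proof
  fix u assume "u \<in> eig wf.H (I A) (theta M)"
  then have u: "u \<in> I A" "wf.H u = fscale (theta M) u" by (auto simp: eig_def)
  let ?E = "%M. eig wf.H (wf.N Y A (size M)) (theta M)"
  have sE: "fs.subspace (?E M)" for M by (rule subspace_eig[OF wf.flinear_H wf.N_subspace])
  have "I A \<subseteq> fs.span (\<Union>(range ?E))" unfolding I_def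
  proof (rule fs.span_minimal[OF _ fs.subspace_span], clarify)
   fix k v assume "v \<in> wf.N Y A k"
   then obtain c where c: "!!M. M \<in> wf.wset k ==> c M \<in> eig wf.H (wf.N Y A k) (theta M)" "v = (\<Sum>M\<in>wf.wset k. c M)"
    using wf.components[OF good_Y A] by blast
   have "c M \<in> fs.span (\<Union>(range ?E))" if "M \<in> wf.wset k" for M
    using c(1)[OF that] wf.size_wset[OF that] by (intro fs.span_base) auto
   then show "v \<in> fs.span (\<Union>(range ?E))" unfolding c(2) by (rule fs.span_sum)
  qed
  then have "u \<in> fs.span (\<Union>(range ?E))" using u(1) by blast
  then obtain \<T> where T: "finite \<T>" "\<T> \<subseteq> range ?E" "u \<in> fs.span (\<Union>\<T>)" by (rule in_span_Union_finite)
  obtain F where F: "finite F" "\<T> = ?E ` F" using finite_subset_image[OF T(1,2)] by blast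
  have "u \<in> {\<Sum>M\<in>F. c M |c. \<forall>M\<in>F. c M \<in> ?E M}"
   using T(3) unfolding F(2) span_UN_eq_sums[OF F(1) sE] .
  then obtain c where c: "u = (\<Sum>M\<in>F. c M)" "\<forall>M\<in>F. c M \<in> ?E M" by blast
  have "u = (\<Sum>M'\<in>{M'\<in>F. theta M' = (theta M :: 'k)}. c M')"
   by (rule eigen_sum[OF wf.flinear_H F(1) _ _ c(1) u(2)]) (use c(2) in \<open>auto simp: inj_on_def theta_inj eig_def\<close>)
  also have "{M'\<in>F. theta M' = (theta M :: 'k)} = (if M \<in> F then {M} else {})" by (auto simp: theta_inj)
  finally have ueq: "u = (\<Sum>M'\<in>(if M \<in> F then {M} else {}). c M')" .
  show "u \<in> ?E M"
  proof (cases "M \<in> F")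
   case True
   then show ?thesis using ueq c(2) by simp
  next
   case False
   then have "u = 0" using ueq by (simp only: if_False sum.empty)
   then show ?thesis using fs.subspace_0[OF sE] by (simp only:)
  qed
 qed
qed

lemma dim_eig_PI: "A \<subseteq> B ==> fs.dim (eig (Jact hW) (PI A) (theta M)) = wf.ch Y A M"
 unfolding PI_eq_I H_Jact[symmetric] eig_I wf.ch_def ..

text \<open>A list of row numbers turns tensors into polynomial functions: the tensor slot
  \<open>l\<close> is contracted with row \<open>il ! l\<close> of the linear map. Monomials in the
  coordinates are images of pure tensors, so these maps reach the whole coordinate ring.\<close>

definition hmap :: "nat list => ((nat => 'w => 'k) => 'k) => ('w => 'v) => 'k" where
 "hmap il t = (%\<phi>. if \<phi> \<in> Y then t (%l. \<xi> (il ! l) o \<phi>) else 0)"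

lemma PI_poly_module: assumes A: "A \<subseteq> B" shows "poly_module Jact (PI A) {(length il, hmap il) |il. True}"
proof -
 let ?\<H> = "{(length il, hmap il) |il. True}"
 have lin: "flinear (hmap il)" for il by (rule flinearI) (auto simp: hmap_def fs_simps)
 have Yg: "\<phi> o g \<in> Y \<longleftrightarrow> \<phi> \<in> Y" if "g \<in> GL sW" for g \<phi> unfolding Y_iff by (rule vlin_comp[OF that])
 have eqv: "equivariant_on (GL sW) tact Jact (E {..<k}) (hmap il)" for k il
  unfolding equivariant_on_def using fsp.linear_add[OF lin] fsp.linear_scale[OF lin] Yg
  by (auto simp: hmap_def tact_def Jact_def comp_assoc fun_eq_iff)
 have stab: "Jact g u \<in> I A" if g: "g \<in> GL sW" and u: "u \<in> I A" for g u
 proof (rule I_linear_image[OF flinear_Jact _ I_subspace u])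
  fix k u assume "u \<in> wf.N Y A k"
  then obtain f where f: "wf.J A k f" "u = wf.rs Y f" by (auto simp: wf.N_def)
  have "wf.J A k (%\<phi>. f (\<phi> o g))"
  proof (rule wf.J_compose[OF _ _ _ f(1) A])
   show "\<phi> + \<psi> o g = (\<phi> o g) + (\<psi> o g)" for \<phi> \<psi> :: "'w => 'v" by (auto simp: fun_eq_iff)
   show "sY a \<phi> o g = sY a (\<phi> o g)" for a \<phi> by (simp add: fun_eq_iff)
   show "\<phi> o g \<in> Z x" if "x \<in> B" "\<phi> \<in> Z x" for x \<phi> using that BX Z_iff[of x] vlin_comp[OF g] by auto
  qed
  moreover have "Jact g u = wf.rs Y (%\<phi>. f (\<phi> o g))" using Yg[OF g] by (auto simp: f(2) Jact_def wf.rs_def)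
  ultimately have "Jact g u \<in> wf.N Y A k" unfolding wf.N_def by blast
  then show "Jact g u \<in> I A" using N_I by blast
 qed
 have mono: "wf.rs Y (wf.mon cs) \<in> fs.span (\<Union>(k, h)\<in>?\<H>. h ` E {..<k})" for cs
 proof -
  let ?il = "map fst cs" and ?w = "%l. b (snd (cs ! l))"
  have "wf.rs Y (wf.mon cs) = hmap ?il (pt {..<length ?il} ?w)"
  proof
   fix \<phi>
   have "\<xi> i o \<phi> \<in> dual" if "\<phi> \<in> Y" for i using that unfolding Y_iff vlin_def dual_iff by (simp add: xi_linear)
   moreover have "wf.mon cs \<phi> = (\<Prod>l<length cs. \<xi> (map fst cs ! l) (\<phi> (?w l)))"
    unfolding wf.mon_def by (subst prod.list_conv_set_nth) (auto simp: \<zeta>_def lessThan_atLeast0 intro!: prod.cong)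
   ultimately show "wf.rs Y (wf.mon cs) \<phi> = hmap ?il (pt {..<length ?il} ?w) \<phi>"
    by (auto simp: wf.rs_def hmap_def pt_apply dfam_def)
  qed
  moreover have "hmap ?il (pt {..<length ?il} ?w) \<in> (\<Union>(k, h)\<in>?\<H>. h ` E {..<k})" using pt_in_E by blast
  ultimately show ?thesis by (simp add: fs.span_base)
 qed
 have "I A \<subseteq> fs.span (\<Union>(k, h)\<in>?\<H>. h ` E {..<k})" unfolding I_def
 proof (rule fs.span_minimal[OF _ fs.subspace_span], clarify)
  fix u k assume "u \<in> wf.N Y A k"
  then have "u \<in> fs.span ((%cs. wf.rs Y (wf.mon cs)) ` {cs. set cs \<subseteq> C & length cs = k})"
   using wf.J_mono_span[OF subset_refl] by (auto simp: wf.N_def)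
  moreover have "fs.span ((%cs. wf.rs Y (wf.mon cs)) ` {cs. set cs \<subseteq> C & length cs = k}) \<subseteq> fs.span (\<Union>(k, h)\<in>?\<H>. h ` E {..<k})"
   by (rule fs.span_minimal[OF _ fs.subspace_span]) (use mono in blast)
  ultimately show "u \<in> fs.span (\<Union>(k, h)\<in>?\<H>. h ` E {..<k})" by blast
 qed
 moreover have "findim (eig (Jact hW) (I A) (theta M))" for M
  unfolding H_Jact[symmetric] eig_I[OF A] by (rule findim_mono[OF wf.N_findim[OF good_Y] eig_subset])
 ultimately show ?thesis unfolding poly_module_def PI_eq_I[OF A]
  using flinear_Jact stab I_subspace eqv by (auto simp: stable_def Jact_def comp_assoc)
qed

end

section \<open>The main theorem\<close>

context wspace
begin

text \<open>If \<open>U\<close> is not of polynomial type, both sides vanish. Otherwise all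
  multiplicities are those of one class in some degree \<open>k\<close>, and independence of
  characters reduces the claim to an identity of weight multiplicities. There the Schur expansion of
  \<open>f\<close> meets the characters of the Schur functors.\<close>

lemma sym_star_eq:
 fixes act :: "('w => 'w) => ('a => 'k) => 'a => 'k" and U :: "('k, 'w, 'u::ab_group_add) glmod"
 assumes f: "f \<in> Sym_bar" and F: "finite F" and pm: "!!i. i \<in> F ==> poly_module act (N i) \<H>"
  and co: "!!M. set_mset M \<subseteq> {..<m} ==> xcoeff f M = (\<Sum>i\<in>F. s i * int (fs.dim (eig (act hW) (N i) (theta M))))"
 shows "sym_star sW f U = (\<Sum>i\<in>F. s i * int (gl_mult sW (fmod act (N i)) U))"
proof -
 let ?S = "%lam. young_symmetrizer lam ` E (cells lam)"
 have "\<forall>lam. \<exists>h. poly_module tact (?S lam) {(sum_list lam, h)}" using schur_functor_poly_module by blast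
 then obtain hh where hh: "\<forall>lam. poly_module tact (?S lam) {(sum_list lam, hh lam)}" by (rule choice[THEN exE])
 show ?thesis
 proof (cases "\<exists>k. \<exists>T\<in>simples k. iso_mod (fmod tact T) U")
  case False
  then have no: "\<not> iso_mod (fmod tact T) U" if "T \<in> simples k" for k T using that by blast
  have "gl_mult sW (schur_functor sW lam) U = 0" for lam
   unfolding schur_functor_fmod by (rule gl_mult_zero[OF hh[rule_format] no])
  moreover have "gl_mult sW (fmod act (N i)) U = 0" if "i \<in> F" for i by (rule gl_mult_zero[OF pm[OF that] no])
  ultimately show ?thesis by (simp add: sym_star_def)
 next
  case True
  then obtain k T where T: "T \<in> simples k" "iso_mod (fmod tact T) U" by blast
  define \<kappa> where "\<kappa> = cls k T"
  have \<kappa>: "\<kappa> \<in> classes k" "T \<in> \<kappa>" using T(1) cls_self[OF T(1)] by (auto simp: \<kappa>_def classes_def)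
  let ?m = "%lam. mlt TYPE(nat \<times> nat => 'w => 'k) tact (?S lam)" and ?n = "%i. mlt TYPE('a) act (N i)"
  have gS: "gl_mult sW (schur_functor sW lam) U = ?m lam \<kappa>" for lam
   unfolding schur_functor_fmod by (rule gl_mult_mlt[OF hh[rule_format] \<kappa> T(2)])
  have gN: "gl_mult sW (fmod act (N i)) U = ?n i \<kappa>" if "i \<in> F" for i by (rule gl_mult_mlt[OF pm[OF that] \<kappa> T(2)])
  have dimS: "int (fs.dim (eig (tact hW) (?S lam) (theta M))) = xcoeff (schur lam) M" if "is_partition lam" "set_mset M \<subseteq> {..<m}" for lam M
   using dim_eig_schur_functor[OF that] by (simp add: xcoeff_schur)
  \<comment> \<open>\<open>sym_star\<close> sums over partitions of all sizes. A Schur functor of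
    another degree has no weight of size \<open>k\<close>, so the class of \<open>U\<close> cannot
    occur in it.\<close>
  have off: "?m lam \<kappa> = 0" if lam: "is_partition lam" "sum_list lam ~= k" for lam
  proof -
   have "int (?m lam \<kappa>) = 0"
   proof (rule characters_independent[OF _ \<kappa>(1)])
    fix M assume M: "M \<in> weights k"
    have "xcoeff (schur lam) M = 0"
    proof -
     have "ssyt_content lam M = {}" using M lam(2) by (auto simp: ssyt_content_def weights_def card_cells)
     then show ?thesis by (simp add: xcoeff_schur)
    qed
    then have "fs.dim (eig (tact hW) (?S lam) (theta M)) = 0" using dimS[OF lam(1), of M] M by (simp add: weights_def)
    then have "(\<Sum>\<kappa>\<in>classes k. ?m lam \<kappa> * chi \<kappa> M) = 0" using mlt_character[OF hh[rule_format] M] by simp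
    then show "(\<Sum>\<kappa>\<in>classes k. int (?m lam \<kappa>) * int (chi \<kappa> M)) = 0"
     by (metis (no_types, lifting) of_nat_0 of_nat_mult of_nat_sum sum.cong)
   qed
   then show ?thesis by simp
  qed
  have "sym_star sW f U = (\<Sum>lam\<in>parts k. schur_coeff f lam * int (?m lam \<kappa>))"
   unfolding sym_star_def gS
  proof (rule sum.mono_neutral_left[OF finite_parts])
   show "{lam. is_partition lam & ?m lam \<kappa> ~= 0} \<subseteq> parts k"
   proof
    fix lam assume "lam \<in> {lam. is_partition lam & ?m lam \<kappa> ~= 0}"
    then have lam: "is_partition lam" "?m lam \<kappa> ~= 0" by blast+
    have "sum_list lam = k"
    proof (rule ccontr)
     assume "sum_list lam ~= k"
     then show False using off[OF lam(1)] lam(2) by simp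
    qed
    then show "lam \<in> parts k" using lam(1) by (simp add: parts_def)
   qed
  qed (auto simp: parts_def)
  also have "... - (\<Sum>i\<in>F. s i * int (?n i \<kappa>)) = 0"
  proof (rule characters_independent[where a="%\<kappa>. (\<Sum>lam\<in>parts k. schur_coeff f lam * int (?m lam \<kappa>)) - (\<Sum>i\<in>F. s i * int (?n i \<kappa>))", OF _ \<kappa>(1)])
   fix M assume M: "M \<in> weights k"
   then have M': "size M = k" "set_mset M \<subseteq> {..<m}" by (auto simp: weights_def)
   have "(\<Sum>\<kappa>\<in>classes k. (\<Sum>lam\<in>parts k. schur_coeff f lam * int (?m lam \<kappa>)) * int (chi \<kappa> M))
     = (\<Sum>lam\<in>parts k. schur_coeff f lam * int (\<Sum>\<kappa>\<in>classes k. ?m lam \<kappa> * chi \<kappa> M))"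
    unfolding sum_distrib_right of_nat_sum sum_distrib_left of_nat_mult by (subst sum.swap) (simp add: mult.assoc)
   also have "... = (\<Sum>lam\<in>parts k. schur_coeff f lam * xcoeff (schur lam) M)"
    unfolding mlt_character[OF hh[rule_format] M, symmetric]
    by (rule sum.cong[OF refl]) (use dimS M'(2) in \<open>auto simp: parts_def\<close>)
   also have "... = xcoeff f M" using xcoeff_schur_sum[of "schur_coeff f" M] schur_sum_schur_coeff[OF f] M'(1) by simp
   finally have 1: "(\<Sum>\<kappa>\<in>classes k. (\<Sum>lam\<in>parts k. schur_coeff f lam * int (?m lam \<kappa>)) * int (chi \<kappa> M)) = xcoeff f M" .
   have "(\<Sum>\<kappa>\<in>classes k. (\<Sum>i\<in>F. s i * int (?n i \<kappa>)) * int (chi \<kappa> M)) = (\<Sum>i\<in>F. s i * int (\<Sum>\<kappa>\<in>classes k. ?n i \<kappa> * chi \<kappa> M))"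
    unfolding sum_distrib_right of_nat_sum sum_distrib_left of_nat_mult by (subst sum.swap) (simp add: mult.assoc)
   also have "... = (\<Sum>i\<in>F. s i * int (fs.dim (eig (act hW) (N i) (theta M))))"
    by (rule sum.cong[OF refl]) (simp only: mlt_character[OF pm M])
   finally show "(\<Sum>\<kappa>\<in>classes k. ((\<Sum>lam\<in>parts k. schur_coeff f lam * int (?m lam \<kappa>)) - (\<Sum>i\<in>F. s i * int (?n i \<kappa>))) * int (chi \<kappa> M)) = 0"
    unfolding left_diff_distrib sum_subtractf 1 co[OF M'(2)] by simp
  qed
  finally have "sym_star sW f U = (\<Sum>i\<in>F. s i * int (?n i \<kappa>))" by simp
  then show ?thesis using gN by simp
 qed
qed

end

context realized
begin

lemma adapted_exists:
 assumes B: "B \<subseteq> X"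
 obtains v \<xi> where "adapted sW BW b m sV BV X V B v \<xi> (vs.dim UNIV) (vs.dim (\<Inter>x\<in>B. V x))"
proof -
 have S: "vs.subspace (\<Inter>x\<in>B. V x)" using Vsub B by (intro vs.subspace_Inter) auto
 obtain v \<xi> where *: "!!i. i < vs.dim (\<Inter>x\<in>B. V x) ==> v i \<in> (\<Inter>x\<in>B. V x)" "!!i. \<xi> i \<in> dual_space sV"
  "!!i j. i < vs.dim UNIV ==> j < vs.dim UNIV ==> \<xi> i (v j) = (if i = j then 1 else 0)"
  "!!u. u = (\<Sum>i<vs.dim UNIV. sV (\<xi> i u) (v i))"
  "!!u i. u \<in> (\<Inter>x\<in>B. V x) ==> vs.dim (\<Inter>x\<in>B. V x) \<le> i ==> i < vs.dim UNIV ==> \<xi> i u = 0"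
  "vs.dim (\<Inter>x\<in>B. V x) \<le> vs.dim UNIV"
  by (rule adapted_basis[OF S]) blast
 have "adapted sW BW b m sV BV X V B v \<xi> (vs.dim UNIV) (vs.dim (\<Inter>x\<in>B. V x))"
  by unfold_locales (use * B in auto)
 then show ?thesis by (rule that)
qed

definition cJ :: "'x set => xps" where
 "cJ A = Abs_xps (%M. if set_mset M \<subseteq> {..<m} then int (fs.dim (eig (Jact hW) (prod_ideal sV sW V A) (theta M))) else 0)"

end

lemma (in adapted) chx_cJ: assumes "A \<subseteq> B" shows "chx Y A = cJ A"
 unfolding chx_def cJ_def dim_eig_PI[OF assms] ..

context realized
begin

text \<open>Each property required of the family \<open>cJ\<close> at a subset \<open>B\<close> is
  proved in a basis adapted to \<open>B\<close>, where r = n - rk(B), and is then translated into a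
  statement free of the basis.\<close>

lemma theorem_series:
 assumes pm: "polymatroid X rk" and re: "realization sV V X rk"
 shows "res m (sigma ^ (vs.dim UNIV - rk X) * polyP X rk) = (\<Sum>A\<in>Pow X. (-1) ^ card A * cJ A)"
  "res m (sigma ^ vs.dim UNIV * polyH X rk sigma_inv (-1)) = cJ X"
proof -
 let ?n = "vs.dim UNIV" and ?O = "res m (omega m)"
 \<comment> \<open>The realization condition is an equation between integers, so it also bounds the
   rank by n; the truncated subtraction of natural numbers is exact from here on.\<close>
 have dim: "rk B \<le> ?n & vs.dim (\<Inter>x\<in>B. V x) = ?n - rk B" if "B \<subseteq> X" for B
 proof -
  have "int (rk B) = int ?n - int (vs.dim (\<Inter>x\<in>B. V x))" using re that by (simp add: realization_def)
  then show ?thesis by linarith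
 qed
 have rkn: "rk B \<le> ?n" if "B \<subseteq> X" for B using dim[OF that] by simp
 have ad: "\<exists>v \<xi>. adapted sW BW b m sV BV X V B v \<xi> ?n (?n - rk B)" if B: "B \<subseteq> X" for B
 proof -
  obtain v \<xi> where "adapted sW BW b m sV BV X V B v \<xi> ?n (vs.dim (\<Inter>x\<in>B. V x))" by (rule adapted_exists[OF B])
  then show ?thesis unfolding dim[OF B, THEN conjunct2] by (intro exI)
 qed
 have base: "?O ^ ?n * cJ {} = 1"
 proof -
  obtain v \<xi> where a: "adapted sW BW b m sV BV X V {} v \<xi> ?n (?n - rk {})" using ad[OF empty_subsetI] by (elim exE)
  have "?n - rk {} = ?n" by (simp only: polymatroidD(2)[OF pm] diff_zero)
  then show ?thesis by (rule adapted.chx_base[OF a refl, unfolded adapted.chx_cJ[OF a subset_refl]])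
 qed
 have low: "xcoeff (?O ^ (?n - rk B) * cJ B) M = 0" if B: "B \<subseteq> X" and M: "size M < card B" for B M
 proof -
  obtain v \<xi> where a: "adapted sW BW b m sV BV X V B v \<xi> ?n (?n - rk B)" using ad[OF B] by (elim exE)
  show ?thesis using adapted.chx_low[OF a M] unfolding adapted.chx_cJ[OF a subset_refl] .
 qed
 have eul: "xcoeff (?O ^ (?n - rk B) * (\<Sum>A\<in>Pow B. (-1) ^ card A * cJ A)) M = 0"
  if B: "B \<subseteq> X" "B ~= {}" and M: "card B \<le> size M" for B M
 proof -
  obtain v \<xi> where a: "adapted sW BW b m sV BV X V B v \<xi> ?n (?n - rk B)" using ad[OF B(1)] by (elim exE)
  have "(\<Sum>A\<in>Pow B. (-1) ^ card A * adapted.chx sW BW b m sV V Y A) = (\<Sum>A\<in>Pow B. (-1) ^ card A * cJ A)"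
   by (rule sum.cong[OF refl]) (simp only: adapted.chx_cJ[OF a] Pow_iff)
  then show ?thesis using adapted.chx_euler[OF a B(2) M] by (simp only:)
 qed
 note hyps = pm rkn res_sigma_omega base low eul
 show "res m (sigma ^ (?n - rk X) * polyP X rk) = (\<Sum>A\<in>Pow X. (-1) ^ card A * cJ A)"
  by (rule res_first[where c=cJ and X=X and rk=rk and n="vs.dim UNIV" and m=m and \<Omega>="res m (omega m)", OF hyps])
 show "res m (sigma ^ ?n * polyH X rk sigma_inv (-1)) = cJ X"
  by (rule res_second[where c=cJ and X=X and rk=rk and n="vs.dim UNIV" and m=m and \<Omega>="res m (omega m)", OF hyps])
qed

lemma star_ideals:
 fixes U :: "('k, 'w, 'u::ab_group_add) glmod"
 assumes pm: "polymatroid X rk" and re: "realization sV V X rk" and n: "vs.dim UNIV = n"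
 shows "sym_star sW (sigma ^ (n - rk X) * polyP X rk) U
   = (\<Sum>A\<in>Pow X. (-1) ^ card A * int (gl_mult sW (J_module sV sW V A) U))"
  "sym_star sW (sigma ^ n * polyH X rk sigma_inv (-1)) U = int (gl_mult sW (J_module sV sW V X) U)"
proof -
 \<comment> \<open>The instance for the full set \<open>X\<close> supplies the module structure of
   the ideals for all subsets at once.\<close>
 obtain v \<xi> where a: "adapted sW BW b m sV BV X V X v \<xi> (vs.dim UNIV) (vs.dim (\<Inter>x\<in>X. V x))" by (rule adapted_exists[OF subset_refl])
 note ser = theorem_series[OF pm re, unfolded n]
 note pmod = adapted.PI_poly_module[OF a PowD]
 have co1: "xcoeff (sigma ^ (n - rk X) * polyP X rk) M
   = (\<Sum>A\<in>Pow X. (-1) ^ card A * int (fs.dim (eig (Jact hW) (prod_ideal sV sW V A) (theta M))))"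
  if "set_mset M \<subseteq> {..<m}" for M
  using arg_cong[OF ser(1), of "%f. xcoeff f M"] that by (simp add: xcoeff_sum xcoeff_sign cJ_def)
 have co2: "xcoeff (sigma ^ n * polyH X rk sigma_inv (-1)) M
   = (\<Sum>A\<in>{X}. 1 * int (fs.dim (eig (Jact hW) (prod_ideal sV sW V A) (theta M))))"
  if "set_mset M \<subseteq> {..<m}" for M
  using arg_cong[OF ser(2), of "%f. xcoeff f M"] that by (simp add: cJ_def)
 have finP: "finite (Pow X)" using finX by simp
 show "sym_star sW (sigma ^ (n - rk X) * polyP X rk) U
   = (\<Sum>A\<in>Pow X. (-1) ^ card A * int (gl_mult sW (J_module sV sW V A) U))"
  unfolding J_module_fmod by (rule sym_star_eq[OF theorem_series_Sym_bar(1) finP pmod co1])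
 have "sym_star sW (sigma ^ n * polyH X rk sigma_inv (-1)) U
   = (\<Sum>A\<in>{X}. 1 * int (gl_mult sW (fmod Jact (prod_ideal sV sW V A)) U))"
  by (rule sym_star_eq[OF theorem_series_Sym_bar(2) _ pmod co2]) simp_all
 then show "sym_star sW (sigma ^ n * polyH X rk sigma_inv (-1)) U = int (gl_mult sW (J_module sV sW V X) U)"
  unfolding J_module_fmod by simp
qed

end

theorem theorem5p2:
  fixes X :: "'x set" and rk :: "'x set \<Rightarrow> nat" and d n :: nat
    and sV :: "'k::field_char_0 \<Rightarrow> 'v::ab_group_add \<Rightarrow> 'v" and BV :: "'v set"
    and V :: "'x \<Rightarrow> 'v set"
    and sW :: "'k \<Rightarrow> 'w::ab_group_add \<Rightarrow> 'w" and BW :: "'w set"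
    and U :: "('k, 'w, 'u::ab_group_add) glmod"
  assumes "polymatroid X rk" and "card X = d"
    and "finite_dimensional_vector_space sV BV" and "vector_space.dim sV UNIV = n"
    and "realization sV V X rk"
    and "finite_dimensional_vector_space sW BW"
    and "rational_module sW U" and "irreducible_module sW U"
  shows "sym_star sW (sigma ^ (n - rk X) * polyP X rk) U
           = (\<Sum>A\<in>Pow X. (-1) ^ card A * int (gl_mult sW (J_module sV sW V A) U))
         \<and> sym_star sW (sigma ^ n * polyH X rk sigma_inv (-1)) U
           = int (gl_mult sW (J_module sV sW V X) U)"
proof -
 interpret fW: finite_dimensional_vector_space sW BW by fact
 obtain b where b: "bij_betw b {..<card BW} BW"
  using finite_same_card_bij[of "{..<card BW}" BW] fW.finite_Basis by auto
 have "realized sW BW b (card BW) sV BV X V"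
 proof (intro realized.intro wspace.intro wspace_axioms.intro realized_axioms.intro assms(3,6) b polymatroidD(1)[OF assms(1)])
  show "module.subspace sV (V x)" if "x \<in> X" for x using assms(5) that unfolding realization_def by blast
 qed
 from realized.star_ideals[OF this assms(1,5,4)] show ?thesis by (rule conjI)
qed

end
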